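(* Let $\theta,\gamma\in\mathbb{R}$ with $\theta>0$, and let $(X,\mathcal{B},\mu,T)$ be an ergodic measure preserving system whose discrete spectrum $\sigma(T)$ satisfies $\sigma(T)\cap\langle\theta^{-1}\rangle=\{0\}$. Then for any $k\in\mathbb{N}$ and any $f_1,\ldots,f_k\in L^\infty(X)$, $$\lim_{N-M\to\infty}\frac{1}{N-M}\sum_{n=M}^N\prod_{j=1}^kT^{j\lfloor\theta n+\gamma\rfloor}f_j=\lim_{N\to\infty}\frac1N\sum_{n=1}^N\prod_{j=1}^kT^{jn}f_j,\qquad(\ast)$$ where convergence takes place in $L^2(X)$. In particular, for any fixed ergodic measure preserving system $(X,\mathcal{B},\mu,T)$ and for (Lebesgue-)almost all $\theta>0$, equation $(\ast)$ holds for all $\gamma\in\mathbb{R}$ (and all $k\in\mathbb{N}$, $f_1,\dots,f_k\in L^\infty(X)$).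
   Context: A measure preserving system $(X,\mathcal{B},\mu,T)$ is a probability space $(X,\mathcal{B},\mu)$ with a measure preserving transformation $T:X\to X$; $T^nf:=f\circ T^n$. Let $\mathbb{T}=\mathbb{R}/\mathbb{Z}$ and $e(\theta)=e^{2\pi i\theta}$. The discrete spectrum $\sigma(T)$ is the set of $\theta\in\mathbb{T}$ for which there is a non-zero $f\in L^2(X)$ with $f\circ T=e(\theta)f$. For $I\subset\mathbb{T}$, $\langle I\rangle$ is the subgroup of $\mathbb{T}$ generated by $I$; subsets (and elements) of $\mathbb{R}$ are identified with their projections mod $1$ to $\mathbb{T}$, so $\langle\theta^{-1}\rangle=\{m/\theta\bmod 1:m\in\mathbb{Z}\}$. In $\lim_{N-M\to\infty}$, $M\le N$ are natural numbers. The only finitely many $n\in\mathbb{N}$ with $\lfloor\theta n+\gamma\rfloor<0$ do not influence the limit; for these, the corresponding term is read with the inverse of $T$ if $T$ is invertible, and is omitted otherwise.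
   Formalization: The "in particular" part is proved for systems with separable L²(X); for arbitrary probability spaces it is false (the rotation on the Bohr compactification of the integers is ergodic with σ(T) all of 𝕋, and (∗) fails for every irrational θ). *)

theory Defs
  imports "HOL-Probability.Probability" "HOL-Algebra.Generated_Groups"
begin

section \<open>Measure preserving systems\<close>

locale measure_preserving_system = prob_space M for M :: "'a measure" +
  fixes T :: "'a \<Rightarrow> 'a"
  assumes measurable_T: "T \<in> measurable M M"
    and preserves: "distr M M T = M"

locale ergodic_system = measure_preserving_system +
  assumes ergodic:
    "\<And>A. A \<in> sets M \<Longrightarrow> T -` A \<inter> space M = A \<Longrightarrow> measure M A = 0 \<or> measure M A = 1"

definition invertible_system :: "'a measure \<Rightarrow> ('a \<Rightarrow> 'a) \<Rightarrow> bool" where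
  "invertible_system M T \<longleftrightarrow>
     bij_betw T (space M) (space M) \<and> the_inv_into (space M) T \<in> measurable M M"

text \<open>Integer powers of a transformation; for negative exponents only meaningful if the
  system is invertible.\<close>

definition iterate :: "'a measure \<Rightarrow> ('a \<Rightarrow> 'a) \<Rightarrow> int \<Rightarrow> 'a \<Rightarrow> 'a" where
  "iterate M T m =
     (if m \<ge> 0 then T ^^ nat m else the_inv_into (space M) T ^^ nat (- m))"

section \<open>Complex-valued functions in \<open>L\<^sup>2\<close> and \<open>L\<^sup>\<infinity>\<close>\<close>

text \<open>Elements are representatives, so equality of classes is equality almost everywhere.\<close>

definition L2_space :: "'a measure \<Rightarrow> ('a \<Rightarrow> complex) set" where
  "L2_space M = {f \<in> borel_measurable M. integrable M (\<lambda>x. (cmod (f x))\<^sup>2)}"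

definition Linf_space :: "'a measure \<Rightarrow> ('a \<Rightarrow> complex) set" where
  "Linf_space M = {f \<in> borel_measurable M. \<exists>C::real. AE x in M. cmod (f x) \<le> C}"

definition L2_dist :: "'a measure \<Rightarrow> ('a \<Rightarrow> complex) \<Rightarrow> ('a \<Rightarrow> complex) \<Rightarrow> real" where
  "L2_dist M f g = sqrt (\<integral>x. (cmod (f x - g x))\<^sup>2 \<partial>M)"

text \<open>Membership in \<open>L\<^sup>2\<close> is demanded explicitly because the Bochner integral of a
  non-integrable function is \<open>0\<close>.\<close>

definition L2_tendsto ::
  "'a measure \<Rightarrow> ('i \<Rightarrow> 'a \<Rightarrow> complex) \<Rightarrow> ('a \<Rightarrow> complex) \<Rightarrow> 'i filter \<Rightarrow> bool" where
  "L2_tendsto M u g F \<longleftrightarrow>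
     g \<in> L2_space M \<and> (\<forall>i. u i \<in> L2_space M) \<and> ((\<lambda>i. L2_dist M (u i) g) \<longlongrightarrow> 0) F"

text \<open>Only needed for statements about almost every parameter: in a separable \<open>L\<^sup>2\<close> the
  spectrum of a measure preserving transformation is countable, while the rotation of the Bohr
  compactification of \<open>\<int>\<close> is ergodic and has the whole circle as its discrete spectrum.\<close>

definition L2_separable :: "'a measure \<Rightarrow> bool" where
  "L2_separable M \<longleftrightarrow>
     (\<exists>D. countable D \<and> D \<subseteq> L2_space M \<and>
          (\<forall>f\<in>L2_space M. \<forall>\<epsilon>>0. \<exists>d\<in>D. L2_dist M f d < \<epsilon>))"

section \<open>The circle group and the discrete spectrum\<close>

text \<open>\<open>\<real>/\<int>\<close> is represented by the fundamental domain \<open>[0,1)\<close>, the projection from \<open>\<real>\<close> being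
  \<^const>\<open>frac\<close>; the group operation is addition modulo 1.\<close>

definition circle_group :: "real monoid" where
  "circle_group = \<lparr>carrier = {0..<1}, mult = (\<lambda>x y. frac (x + y)), one = 0\<rparr>"

definition circle_span :: "real set \<Rightarrow> real set" where
  "circle_span I = generate circle_group (frac ` I)"

definition discrete_spectrum :: "'a measure \<Rightarrow> ('a \<Rightarrow> 'a) \<Rightarrow> real set" where
  "discrete_spectrum M T =
     {t \<in> carrier circle_group. \<exists>f\<in>L2_space M. \<not> (AE x in M. f x = 0) \<and>
        (AE x in M. f (T x) = cis (2 * pi * t) * f x)}"

lemma comm_group_circle_group: "comm_group circle_group"
proof (rule comm_groupI)
  fix x assume "x \<in> carrier circle_group"
  then show "\<exists>y\<in>carrier circle_group. y \<otimes>\<^bsub>circle_group\<^esub> x = \<one>\<^bsub>circle_group\<^esub>"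
    by (intro bexI[of _ "frac (- x)"]) (auto simp: circle_group_def frac_lt_1)
qed (auto simp: circle_group_def frac_lt_1 add_ac frac_eq)

lemma circle_group_inv:
  assumes "x \<in> carrier circle_group"
  shows "inv\<^bsub>circle_group\<^esub> x = frac (- x)"
proof -
  interpret comm_group circle_group by (rule comm_group_circle_group)
  show ?thesis
    using assms by (intro inv_equality) (auto simp: circle_group_def frac_lt_1)
qed

lemma circle_span_singleton: "circle_span {a} = {frac (of_int m * a) | m :: int. True}"
proof -
  interpret comm_group circle_group by (rule comm_group_circle_group)
  have fa: "frac a \<in> carrier circle_group"
    by (simp add: circle_group_def frac_lt_1)
  have inv: "inv\<^bsub>circle_group\<^esub> (frac a) = frac (- a)"
    using circle_group_inv[OF fa] by (simp add: frac_neg_frac)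
  have mult: "x \<otimes>\<^bsub>circle_group\<^esub> y = frac (x + y)" for x y
    by (simp add: circle_group_def)
  have nat: "frac (of_nat n * a) \<in> circle_span {a} \<and> frac (- (of_nat n * a)) \<in> circle_span {a}"
    for n :: nat
  proof (induction n)
    case 0
    then show ?case
      using generate.one[of circle_group "frac ` {a}"]
      by (simp add: circle_span_def circle_group_def)
  next
    case (Suc n)
    have "frac a \<in> circle_span {a}" "frac (- a) \<in> circle_span {a}"
      using generate.incl[of "frac a" "frac ` {a}" circle_group]
        generate.inv[of "frac a" "frac ` {a}" circle_group]
      by (auto simp: circle_span_def inv)
    with Suc have "frac (frac (of_nat n * a) + frac a) \<in> circle_span {a}"
      "frac (frac (- (of_nat n * a)) + frac (- a)) \<in> circle_span {a}"
      by (auto simp: circle_span_def generate.eng simp flip: mult)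
    then have "frac (of_nat n * a + a) \<in> circle_span {a}"
      "frac (- (of_nat n * a) + - a) \<in> circle_span {a}"
      by (simp_all only: frac_add_simps)
    then show ?case
      by (simp add: algebra_simps)
  qed
  show ?thesis
  proof (intro equalityI subsetI)
    fix x assume "x \<in> circle_span {a}"
    then have "x \<in> generate circle_group (frac ` {a})"
      by (simp add: circle_span_def)
    then show "x \<in> {frac (of_int m * a) | m :: int. True}"
    proof induction
      case one
      show ?case by (auto simp: circle_group_def intro!: exI[of _ 0])
    next
      case (incl h)
      then show ?case by (auto intro!: exI[of _ 1])
    next
      case (inv h)
      then show ?case using \<open>inv\<^bsub>circle_group\<^esub> (frac a) = frac (- a)\<close>
        by (auto intro!: exI[of _ "-1"])
    next
      case (eng h1 h2)
      then obtain m1 m2 :: int where "h1 = frac (of_int m1 * a)" "h2 = frac (of_int m2 * a)"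
        by auto
      then have "h1 \<otimes>\<^bsub>circle_group\<^esub> h2 = frac (of_int (m1 + m2) * a)"
        by (simp add: mult algebra_simps)
      then show ?case by blast
    qed
  next
    fix x assume "x \<in> {frac (of_int m * a) | m :: int. True}"
    then obtain m :: int where "x = frac (of_int m * a)" by auto
    then show "x \<in> circle_span {a}"
      using nat by (cases m rule: int_cases2) auto
  qed
qed

section \<open>Multiple ergodic averages\<close>

text \<open>The filter on pairs \<open>(M, N)\<close> for the limit \<open>N - M \<rightarrow> \<infinity>\<close>.\<close>

definition window_filter :: "(nat \<times> nat) filter" where
  "window_filter = filtercomap (\<lambda>(m, n). real n - real m) at_top"

text \<open>The product of the functions \<open>T\<^bsup>j r\<^esup> f\<^sub>j\<close> for \<open>j = 1, \<dots>, k\<close>; it is omitted, that is,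
  replaced by \<open>0\<close>, if \<open>r < 0\<close> and \<open>T\<close> is not invertible.\<close>

definition product_term ::
  "'a measure \<Rightarrow> ('a \<Rightarrow> 'a) \<Rightarrow> nat \<Rightarrow> (nat \<Rightarrow> 'a \<Rightarrow> complex) \<Rightarrow> int \<Rightarrow> 'a \<Rightarrow> complex" where
  "product_term M T k f r x =
     (if r \<ge> 0 \<or> invertible_system M T
      then \<Prod>j=1..k. f j (iterate M T (int j * r) x) else 0)"

definition beatty_average ::
  "'a measure \<Rightarrow> ('a \<Rightarrow> 'a) \<Rightarrow> real \<Rightarrow> real \<Rightarrow> nat \<Rightarrow> (nat \<Rightarrow> 'a \<Rightarrow> complex) \<Rightarrow>
     nat \<times> nat \<Rightarrow> 'a \<Rightarrow> complex" where
  "beatty_average M T \<theta> \<gamma> k f = (\<lambda>(m, N) x.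
     (\<Sum>n=m..N. product_term M T k f \<lfloor>\<theta> * real n + \<gamma>\<rfloor> x) / of_real (real N - real m))"

definition multiple_average ::
  "'a measure \<Rightarrow> ('a \<Rightarrow> 'a) \<Rightarrow> nat \<Rightarrow> (nat \<Rightarrow> 'a \<Rightarrow> complex) \<Rightarrow> nat \<Rightarrow> 'a \<Rightarrow> complex" where
  "multiple_average M T k f = (\<lambda>N x.
     (\<Sum>n=1..N. \<Prod>j=1..k. f j ((T ^^ (j * n)) x)) / of_nat N)"

text \<open>Both limits exist in \<open>L\<^sup>2\<close> and are equal.\<close>

definition beatty_limit_equation ::
  "'a measure \<Rightarrow> ('a \<Rightarrow> 'a) \<Rightarrow> real \<Rightarrow> real \<Rightarrow> nat \<Rightarrow> (nat \<Rightarrow> 'a \<Rightarrow> complex) \<Rightarrow> bool" where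
  "beatty_limit_equation M T \<theta> \<gamma> k f \<longleftrightarrow>
     (\<exists>g. L2_tendsto M (beatty_average M T \<theta> \<gamma> k f) g window_filter \<and>
          L2_tendsto M (multiple_average M T k f) g sequentially)"

end

theory Submission
  imports Defs "HOL-Computational_Algebra.Polynomial" "HOL-Real_Asymp.Real_Asymp"
begin

text \<open>
  Grouping the \<open>n\<close> by the value \<open>r = \<lfloor>\<theta> n + \<gamma>\<rfloor>\<close> turns the average along the Beatty sequence into an
  average of \<open>c(r) T\<^sup>rf\<^sub>1 \<cdots> T\<^bsup>kr\<^esup>f\<^sub>k\<close>, where the number \<open>c(r)\<close> of such \<open>n\<close> is
  \<open>1/\<theta> + frac ((\<gamma> - r - 1)/\<theta>) - frac ((\<gamma> - r)/\<theta>)\<close>. Approximating the fractional part by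
  trigonometric polynomials reduces the theorem to two facts about multiple averages over long
  windows: the plain ones converge, and those twisted by \<open>e(h r/\<theta>)\<close> with \<open>h/\<theta> \<notin> \<int>\<close> tend to \<open>0\<close>.

  Convergence is a soft form of Walsh's argument. In an ultraproduct of the system along almost
  invariant lists, one of the functions is approximated by dual functions, up to a remainder almost
  orthogonal to all of them. The remainder does not contribute, and for a dual function the product
  can be rewritten with one function fewer over the extended system.

  For the twisted averages, iterating van der Corput's inequality bounds the twisted form by the
  Gowers-Host-Kra functional of one of the functions. If the limit did not vanish it would therefore
  correlate with a cube average of itself; changing variables in that cube average produces a twisted
  form with one function fewer, which is zero by induction. The case of one function says that
  \<open>h/\<theta>\<close> is not in the discrete spectrum.

  In a separable \<open>L\<^sup>2\<close> the spectrum is countable by orthogonality of eigenfunctions, and each of its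
  non-zero elements lies in the span of \<open>1/\<theta>\<close> for countably many \<open>\<theta>\<close> only.
\<close>

text \<open>The space need not be standard and \<open>T\<close> need not be invertible, so neither
  factors nor disintegrations are used: every system is a function algebra with a positive trace,
  and a new system arises by naming an algebra and a trace. Convergence is proved over an arbitrary
  countable abelian group, although only windows of integers matter in the end, for the sake of the
  second half. Means in several variables do not commute in general; but once averages converge
  along almost invariant lists, every invariant mean takes the same value on a correlation, and
  nested means may be reordered and sheared. Applied to \<open>int poly\<close>, this yields cube
  functionals of all dimensions and justifies the change of variables in them. Bounds by these
  functionals are kept in the linear form \<open>\<eta> + C * U\<close>, because a root would not
  pass through the next mean. Frequencies with \<open>h / \<theta>\<close> an integer are not
  excluded by the spectral hypothesis; they cancel, since the weight contains only a difference of
  consecutive fractional parts.\<close>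

section \<open>Ultrafilter limits\<close>

text \<open>Zorn's lemma for non-trivial filters below \<open>sequentially\<close>, ordered by
  refinement. A chain has a non-trivial infimum because \<open>False\<close> would already hold
  eventually in one of its members. A minimal filter decides every \<open>P\<close>: if it does not
  contain the complement, intersecting it with the set where \<open>P\<close> holds cannot refine
  it.\<close>

lemma ex_free_ultrafilter:
  "\<exists>U :: nat filter. U \<noteq> bot \<and> U \<le> sequentially \<and>
     (\<forall>P. eventually P U \<or> eventually (\<lambda>n. \<not> P n) U)"
proof -
  define A where "A = {F :: nat filter. F \<noteq> bot \<and> F \<le> sequentially}"
  have "\<exists>m\<in>A. \<forall>a\<in>A. m \<ge> a \<longrightarrow> a = m"
  proof (rule predicate_Zorn)
    show "partial_order_on A (relation_of (\<ge>) A)"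
      by (rule partial_order_on_relation_ofI) auto
  next
    show "\<exists>u\<in>A. \<forall>a\<in>C. u \<le> a" if C: "C \<in> Chains (relation_of (\<ge>) A)" for C
    proof (cases "C = {}")
      case True
      have "sequentially \<in> A" by (simp add: A_def)
      then show ?thesis using True by blast
    next
      case False
      have CA: "C \<subseteq> A" and ch: "\<And>x y. x \<in> C \<Longrightarrow> y \<in> C \<Longrightarrow> x \<le> y \<or> y \<le> x"
        using C by (auto simp: Chains_def relation_of_def)
      have "Inf C \<noteq> bot"
      proof
        assume "Inf C = bot"
        then have "eventually (\<lambda>_. False) (Inf C)" by simp
        moreover have "\<exists>x\<in>C. x \<le> inf F G" if "F \<in> C" "G \<in> C" for F G
          using ch[OF that] that by (metis inf.orderE inf.commute order_refl)
        ultimately have "\<exists>b\<in>C. eventually (\<lambda>_. False) b"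
          using False by (subst (asm) eventually_Inf_base) auto
        then show False using CA by (auto simp: A_def trivial_limit_def)
      qed
      moreover have "Inf C \<le> sequentially"
        using False CA by (auto simp: A_def intro: Inf_lower2)
      ultimately show ?thesis by (auto simp: A_def intro: Inf_lower)
    qed
  qed
  then obtain U where U: "U \<noteq> bot" "U \<le> sequentially"
    and max: "\<And>F. F \<noteq> bot \<Longrightarrow> F \<le> sequentially \<Longrightarrow> F \<le> U \<Longrightarrow> F = U"
    unfolding A_def by blast
  have "eventually P U \<or> eventually (\<lambda>n. \<not> P n) U" for P
  proof (rule disjCI)
    assume n: "\<not> eventually (\<lambda>n. \<not> P n) U"
    have "inf U (principal {n. P n}) = U"
      using n U(2) by (intro max) (auto simp: trivial_limit_def eventually_inf_principal le_infI1)
    moreover have "eventually P (inf U (principal {n. P n}))"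
      by (simp add: eventually_inf_principal)
    ultimately show "eventually P U" by simp
  qed
  with U show ?thesis by blast
qed

definition ultra :: "nat filter" where
  "ultra = (SOME U. U \<noteq> bot \<and> U \<le> sequentially \<and>
     (\<forall>P. eventually P U \<or> eventually (\<lambda>n. \<not> P n) U))"

lemma ultra_neq_bot [simp]: "ultra \<noteq> bot"
  and ultra_le: "ultra \<le> sequentially"
  and ultra_cases: "eventually P ultra \<or> eventually (\<lambda>n. \<not> P n) ultra"
  using someI_ex[OF ex_free_ultrafilter] unfolding ultra_def[symmetric] by auto

lemma eventually_ultra_ge: "eventually (\<lambda>n. k \<le> n) ultra"
  using ultra_le eventually_ge_at_top[of k] by (rule filter_leD)

definition Ulim :: "(nat \<Rightarrow> 'a::t2_space) \<Rightarrow> 'a" where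
  "Ulim f = Lim ultra f"

lemma Ulim_eqI: "(f \<longlongrightarrow> l) ultra \<Longrightarrow> Ulim f = l"
  unfolding Ulim_def by (rule tendsto_Lim) auto

text \<open>The values lie in a compact ball, so the image filter has a cluster point; as
  \<open>ultra\<close> decides every predicate, a cluster point is a limit.\<close>

lemma tendsto_Ulim:
  fixes f :: "nat \<Rightarrow> 'a::{real_normed_vector, heine_borel}"
  assumes "\<And>n. norm (f n) \<le> C"
  shows "(f \<longlongrightarrow> Ulim f) ultra"
proof -
  have "compact (cball (0::'a) C)" by simp
  moreover have "filtermap f ultra \<noteq> bot" by (simp add: filtermap_bot_iff)
  moreover have "eventually (\<lambda>x. x \<in> cball 0 C) (filtermap f ultra)"
    using assms by (simp add: eventually_filtermap)
  ultimately obtain l where l: "inf (nhds l) (filtermap f ultra) \<noteq> bot"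
    unfolding compact_filter by blast
  have "(f \<longlongrightarrow> l) ultra"
  proof (rule topological_tendstoI)
    fix S assume S: "open S" "l \<in> S"
    show "eventually (\<lambda>n. f n \<in> S) ultra"
    proof (rule ccontr)
      assume "\<not> eventually (\<lambda>n. f n \<in> S) ultra"
      then have "eventually (\<lambda>n. f n \<notin> S) ultra" using ultra_cases by blast
      then have "eventually (\<lambda>x. x \<notin> S) (filtermap f ultra)" by (simp add: eventually_filtermap)
      moreover have "eventually (\<lambda>x. x \<in> S) (nhds l)" using S by (auto simp: eventually_nhds)
      ultimately have "eventually (\<lambda>x. False) (inf (nhds l) (filtermap f ultra))"
        unfolding eventually_inf by (metis (mono_tags))
      with l show False by (simp add: trivial_limit_def)
    qed
  qed
  then show ?thesis using Ulim_eqI by metis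
qed

lemma Ulim_const [simp]: "Ulim (\<lambda>n. c) = c"
  by (intro Ulim_eqI tendsto_const)

lemma norm_Ulim_le:
  fixes f :: "nat \<Rightarrow> 'a::{real_normed_vector, heine_borel}"
  assumes "\<And>n. norm (f n) \<le> C"
  shows "norm (Ulim f) \<le> C"
  using Lim_norm_ubound[OF ultra_neq_bot tendsto_Ulim[OF assms]] assms by simp

section \<open>Averages over lists\<close>

text \<open>Lists rather than finite sets, so that images and convolutions keep multiplicities and
  \<open>avg_map\<close> needs no injectivity. The average over \<open>[]\<close> is
  \<open>0\<close> by division by zero.\<close>

definition avg :: "'b list \<Rightarrow> ('b \<Rightarrow> 'c::real_normed_field) \<Rightarrow> 'c" where
  "avg W f = (\<Sum>w\<leftarrow>W. f w) / of_nat (length W)"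

lemma avg_add: "avg W (\<lambda>w. f w + g w) = avg W f + avg W g"
  by (simp add: avg_def sum_list_addf add_divide_distrib)

lemma avg_diff: "avg W (\<lambda>w. f w - g w) = avg W f - avg W g"
  by (simp add: avg_def sum_list_subtractf diff_divide_distrib)

lemma avg_cmult: "avg W (\<lambda>w. c * f w) = c * avg W f"
  by (simp add: avg_def sum_list_const_mult)

lemma avg_multc: "avg W (\<lambda>w. f w * c) = avg W f * c"
  by (simp add: avg_def sum_list_mult_const)

lemma avg_const [simp]: "W \<noteq> [] \<Longrightarrow> avg W (\<lambda>w. c) = c"
  by (simp add: avg_def sum_list_triv)

lemma avg_cnj: "cnj (avg W f) = avg W (\<lambda>w. cnj (f w))"
  unfolding avg_def by (induction W) (auto simp: add_divide_distrib)

lemma Re_avg: "Re (avg W f) = avg W (\<lambda>w. Re (f w))"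
  unfolding avg_def by (induction W) (auto simp: add_divide_distrib Re_divide_of_nat)

lemma avg_of_real: "avg W (\<lambda>w. complex_of_real (f w)) = of_real (avg W f)"
  unfolding avg_def by (induction W) (auto simp: add_divide_distrib)

lemma avg_map: "avg (map h W) f = avg W (\<lambda>w. f (h w))"
  by (simp add: avg_def o_def)

lemma avg_singleton [simp]: "avg [w] f = f w"
  by (simp add: avg_def)

lemma avg_mono:
  fixes f :: "'b \<Rightarrow> real"
  assumes "\<And>w. w \<in> set W \<Longrightarrow> f w \<le> g w"
  shows "avg W f \<le> avg W g"
  unfolding avg_def by (intro divide_right_mono sum_list_mono) (auto intro: assms)

lemma avg_cong: "(\<And>w. w \<in> set W \<Longrightarrow> f w = g w) \<Longrightarrow> avg W f = avg W g"
  unfolding avg_def by (metis map_eq_conv)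

lemma norm_avg_le_avg: "norm (avg W f) \<le> avg W (\<lambda>w. norm (f w))"
proof -
  have "norm (\<Sum>w\<leftarrow>W. f w) \<le> (\<Sum>w\<leftarrow>W. norm (f w))"
    by (induction W) (auto intro: norm_triangle_le)
  then show ?thesis by (simp add: avg_def norm_divide divide_right_mono)
qed

lemma norm_avg_le:
  assumes "W \<noteq> []" "\<And>w. w \<in> set W \<Longrightarrow> norm (f w) \<le> C"
  shows "norm (avg W f) \<le> C"
proof -
  have "avg W (\<lambda>w. norm (f w)) \<le> avg W (\<lambda>w. C)" using assms by (intro avg_mono)
  with norm_avg_le_avg[of W f] assms(1) show ?thesis by simp
qed

lemma avg_swap: "avg W (\<lambda>w. avg V (\<lambda>v. f w v)) = avg V (\<lambda>v. avg W (\<lambda>w. f w v))"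
proof -
  have "(\<Sum>w\<leftarrow>W. \<Sum>v\<leftarrow>V. f w v) = (\<Sum>v\<leftarrow>V. \<Sum>w\<leftarrow>W. f w v)"
    by (induction W) (auto simp: sum_list_addf)
  moreover have "avg W (\<lambda>w. avg V (\<lambda>v. f w v)) = avg W (\<lambda>w. \<Sum>v\<leftarrow>V. f w v) * inverse (of_nat (length V))"
    by (simp add: avg_multc avg_def[of V] divide_inverse del: sum_list_mult_const)
  moreover have "avg V (\<lambda>v. avg W (\<lambda>w. f w v)) = avg V (\<lambda>v. \<Sum>w\<leftarrow>W. f w v) * inverse (of_nat (length W))"
    by (simp add: avg_multc avg_def[of W] divide_inverse del: sum_list_mult_const)
  moreover have "avg W (\<lambda>w. \<Sum>v\<leftarrow>V. f w v) = (\<Sum>w\<leftarrow>W. \<Sum>v\<leftarrow>V. f w v) * inverse (of_nat (length W))"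
    "avg V (\<lambda>v. \<Sum>w\<leftarrow>W. f w v) = (\<Sum>v\<leftarrow>V. \<Sum>w\<leftarrow>W. f w v) * inverse (of_nat (length V))"
    by (simp_all add: avg_def divide_inverse)
  ultimately show ?thesis by (simp add: mult_ac)
qed

text \<open>The variance of \<open>norm (f w)\<close> is non-negative.\<close>

lemma norm_avg_power2_le: "(norm (avg W f))\<^sup>2 \<le> avg W (\<lambda>w. (norm (f w))\<^sup>2)"
proof (cases "W = []")
  case True
  then show ?thesis by (simp add: avg_def)
next
  case False
  let ?a = "avg W (\<lambda>w. norm (f w))"
  have "0 \<le> avg W (\<lambda>w. (norm (f w) - ?a)\<^sup>2)"
    using avg_mono[of W "\<lambda>_. 0" "\<lambda>w. (norm (f w) - ?a)\<^sup>2"] False by simp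
  also have "\<dots> = avg W (\<lambda>w. (norm (f w))\<^sup>2 - (2 * ?a) * norm (f w) + ?a\<^sup>2)"
    by (intro avg_cong) (simp add: power2_diff algebra_simps)
  also have "\<dots> = avg W (\<lambda>w. (norm (f w))\<^sup>2) - ?a\<^sup>2"
    using False by (simp add: avg_add avg_diff avg_cmult power2_eq_square)
  finally have "?a\<^sup>2 \<le> avg W (\<lambda>w. (norm (f w))\<^sup>2)" by simp
  moreover have "(norm (avg W f))\<^sup>2 \<le> ?a\<^sup>2"
    by (intro power_mono norm_avg_le_avg) simp
  ultimately show ?thesis by simp
qed

section \<open>Traced algebras\<close>

text \<open>Points are triples \<open>(l, k, x)\<close>: \<open>x\<close> is a point of the system, \<open>k\<close> a formal time on which
  the shift acts, and the list \<open>l\<close> holds the indices introduced by the successive ultraproducts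
  below. So all extensions of a system live over one type, and an induction may range over them.\<close>

definition sh :: "int \<Rightarrow> ('l \<times> int \<times> 'a \<Rightarrow> complex) \<Rightarrow> 'l \<times> int \<times> 'a \<Rightarrow> complex" where
  "sh n f = (\<lambda>(l, k, x). f (l, k + n, x))"

lemma sh_zero [simp]: "sh 0 f = f"
  by (auto simp: sh_def)

lemma sh_sh [simp]: "sh m (sh n f) = sh (m + n) f"
  by (auto simp: sh_def algebra_simps)

lemma sh_mult: "sh n (\<lambda>y. f y * g y) = (\<lambda>y. sh n f y * sh n g y)"
  and sh_add: "sh n (\<lambda>y. f y + g y) = (\<lambda>y. sh n f y + sh n g y)"
  and sh_cnj: "sh n (\<lambda>y. cnj (f y)) = (\<lambda>y. cnj (sh n f y))"
  and sh_const: "sh n (\<lambda>y. c) = (\<lambda>y. c)"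
  and sh_avg: "sh n (\<lambda>y. avg W (\<lambda>w. F w y)) = (\<lambda>y. avg W (\<lambda>w. sh n (F w) y))"
  by (auto simp: sh_def)

lemma norm_sh_le: "(\<And>y. cmod (f y) \<le> C) \<Longrightarrow> cmod (sh n f y) \<le> C"
  by (auto simp: sh_def split: prod.splits)

text \<open>A measure preserving action in algebraic form. Elements are functions bounded
  everywhere, not classes, so \<open>nrm\<close> is only a seminorm. Positivity of \<open>tr\<close>
  on pointwise non-negative functions yields Cauchy-Schwarz and the comparison of \<open>nrm\<close>
  with sup bounds.\<close>

locale traced_algebra =
  fixes A :: "('l \<times> int \<times> 'a \<Rightarrow> complex) set" and tr :: "('l \<times> int \<times> 'a \<Rightarrow> complex) \<Rightarrow> complex"
  assumes A_const: "(\<lambda>_. c) \<in> A"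
    and A_add: "f \<in> A \<Longrightarrow> g \<in> A \<Longrightarrow> (\<lambda>y. f y + g y) \<in> A"
    and A_mult: "f \<in> A \<Longrightarrow> g \<in> A \<Longrightarrow> (\<lambda>y. f y * g y) \<in> A"
    and A_cnj: "f \<in> A \<Longrightarrow> (\<lambda>y. cnj (f y)) \<in> A"
    and A_sh: "f \<in> A \<Longrightarrow> sh n f \<in> A"
    and A_bdd: "f \<in> A \<Longrightarrow> \<exists>C. \<forall>y. cmod (f y) \<le> C"
    and tr_add: "f \<in> A \<Longrightarrow> g \<in> A \<Longrightarrow> tr (\<lambda>y. f y + g y) = tr f + tr g"
    and tr_cmult: "f \<in> A \<Longrightarrow> tr (\<lambda>y. c * f y) = c * tr f"
    and tr_cnj: "f \<in> A \<Longrightarrow> tr (\<lambda>y. cnj (f y)) = cnj (tr f)"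
    and tr_sh: "f \<in> A \<Longrightarrow> tr (sh n f) = tr f"
    and tr_pos: "f \<in> A \<Longrightarrow> (\<And>y. Im (f y) = 0 \<and> Re (f y) \<ge> 0) \<Longrightarrow> Re (tr f) \<ge> 0"
    and tr_one: "tr (\<lambda>_. 1) = 1"
begin

lemma A_cmult: "f \<in> A \<Longrightarrow> (\<lambda>y. c * f y) \<in> A"
  using A_mult[OF A_const] .

lemma A_diff: "f \<in> A \<Longrightarrow> g \<in> A \<Longrightarrow> (\<lambda>y. f y - g y) \<in> A"
  using A_add[OF _ A_cmult[of g "-1"]] by simp

lemma A_sum_list: "(\<And>w. w \<in> set W \<Longrightarrow> F w \<in> A) \<Longrightarrow> (\<lambda>y. \<Sum>w\<leftarrow>W. F w y) \<in> A"
  by (induction W) (auto intro: A_const A_add)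

lemma A_avg: "(\<And>w. w \<in> set W \<Longrightarrow> F w \<in> A) \<Longrightarrow> (\<lambda>y. avg W (\<lambda>w. F w y)) \<in> A"
  unfolding avg_def divide_inverse using A_mult[OF A_sum_list A_const] by blast

lemma A_prod: "(\<And>i. i \<in> I \<Longrightarrow> F i \<in> A) \<Longrightarrow> (\<lambda>y. \<Prod>i\<in>I. F i y) \<in> A"
  by (induction I rule: infinite_finite_induct) (auto intro: A_const A_mult)

lemma tr_diff: "f \<in> A \<Longrightarrow> g \<in> A \<Longrightarrow> tr (\<lambda>y. f y - g y) = tr f - tr g"
  using tr_add[OF _ A_cmult[of g "-1"]] tr_cmult[of g "-1"] by simp

lemma tr_const [simp]: "tr (\<lambda>_. c) = c"
  using tr_cmult[OF A_const[of 1], of c] tr_one by simp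

lemma tr_sum_list: "(\<And>w. w \<in> set W \<Longrightarrow> F w \<in> A) \<Longrightarrow> tr (\<lambda>y. \<Sum>w\<leftarrow>W. F w y) = (\<Sum>w\<leftarrow>W. tr (F w))"
  by (induction W) (auto simp: tr_add A_sum_list)

lemma tr_avg:
  assumes "\<And>w. w \<in> set W \<Longrightarrow> F w \<in> A"
  shows "tr (\<lambda>y. avg W (\<lambda>w. F w y)) = avg W (\<lambda>w. tr (F w))"
  using tr_cmult[OF A_sum_list[of W F, OF assms], where c = "inverse (of_nat (length W))"] tr_sum_list[of W F, OF assms]
  by (simp add: avg_def divide_inverse mult.commute)

definition ip :: "('l \<times> int \<times> 'a \<Rightarrow> complex) \<Rightarrow> ('l \<times> int \<times> 'a \<Rightarrow> complex) \<Rightarrow> complex" where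
  "ip f g = tr (\<lambda>y. f y * cnj (g y))"

definition nrm :: "('l \<times> int \<times> 'a \<Rightarrow> complex) \<Rightarrow> real" where
  "nrm f = sqrt (Re (ip f f))"

lemma A_ip: "f \<in> A \<Longrightarrow> g \<in> A \<Longrightarrow> (\<lambda>y. f y * cnj (g y)) \<in> A"
  by (intro A_mult A_cnj)

lemma ip_commute: "f \<in> A \<Longrightarrow> g \<in> A \<Longrightarrow> ip g f = cnj (ip f g)"
  unfolding ip_def by (subst tr_cnj[symmetric]) (auto intro: A_ip simp: mult.commute)

lemma Re_ip_nonneg: "f \<in> A \<Longrightarrow> Re (ip f f) \<ge> 0"
  unfolding ip_def by (intro tr_pos A_ip) auto

lemma nrm_nonneg [simp]: "f \<in> A \<Longrightarrow> nrm f \<ge> 0"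
  unfolding nrm_def using Re_ip_nonneg by simp

lemma nrm_power2: "f \<in> A \<Longrightarrow> (nrm f)\<^sup>2 = Re (ip f f)"
  unfolding nrm_def using Re_ip_nonneg by simp

lemma ip_diff_cmult_self:
  assumes "f \<in> A" "g \<in> A"
  shows "Re (ip (\<lambda>y. f y - t * g y) (\<lambda>y. f y - t * g y)) =
    Re (ip f f) - 2 * Re (cnj t * ip f g) + (cmod t)\<^sup>2 * Re (ip g g)"
proof -
  have e: "(\<lambda>y. (f y - t * g y) * cnj (f y - t * g y)) =
    (\<lambda>y. (f y * cnj (f y) - cnj t * (f y * cnj (g y))) - (t * (g y * cnj (f y)) - (t * cnj t) * (g y * cnj (g y))))"
    by (auto simp: algebra_simps)
  have "ip (\<lambda>y. f y - t * g y) (\<lambda>y. f y - t * g y) =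
    (ip f f - cnj t * ip f g) - (t * ip g f - t * cnj t * ip g g)"
    unfolding ip_def e using assms
    by (simp add: tr_diff tr_cmult A_diff A_cmult A_ip)
  also have "ip g f = cnj (ip f g)" using assms by (rule ip_commute)
  finally have "Re (ip (\<lambda>y. f y - t * g y) (\<lambda>y. f y - t * g y)) =
      Re (ip f f) - 2 * Re (cnj t * ip f g) + Re (t * cnj t * ip g g)"
    by simp
  also have "Re (t * cnj t * ip g g) = (cmod t)\<^sup>2 * Re (ip g g)"
    by (subst complex_norm_square[symmetric]) simp
  finally show ?thesis .
qed

lemma Cauchy_Schwarz: 
  assumes "f \<in> A" "g \<in> A"
  shows "cmod (ip f g) \<le> nrm f * nrm g"
proof -
  define b where "b = (cmod (ip f g))\<^sup>2"
  have *: "0 \<le> (nrm f)\<^sup>2 - 2 * s * b + s\<^sup>2 * b * (nrm g)\<^sup>2" for s :: real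
  proof -
    \<comment> \<open>This multiple makes the cross term real and leaves a real quadratic in
      \<open>s\<close>.\<close>
    let ?t = "of_real s * ip f g"
    have "cnj ?t * ip f g = of_real (s * b)"
      using complex_norm_square[of "ip f g"] by (simp add: b_def mult_ac)
    then have "Re (cnj ?t * ip f g) = s * b" by (metis Re_complex_of_real)
    moreover have "(cmod ?t)\<^sup>2 = s\<^sup>2 * b" by (simp add: norm_mult power_mult_distrib b_def)
    moreover have "0 \<le> Re (ip (\<lambda>y. f y - ?t * g y) (\<lambda>y. f y - ?t * g y))"
      using assms by (intro Re_ip_nonneg A_diff A_cmult)
    ultimately show ?thesis
      using ip_diff_cmult_self[OF assms, of ?t] nrm_power2[OF assms(1)] nrm_power2[OF assms(2)]
      by (simp only:)
  qed
  have b0: "b \<ge> 0" by (simp add: b_def)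
  have "b \<le> (nrm f)\<^sup>2 * (nrm g)\<^sup>2"
  proof (cases "nrm g = 0")
    case True
    then have "0 \<le> (nrm f)\<^sup>2 - 2 * s * b" for s using *[of s] by simp
    \<comment> \<open>The bound is now affine in \<open>s\<close>; for \<open>b > 0\<close> this
      value of \<open>s\<close> would make it \<open>-1\<close>.\<close>
    from this[of "((nrm f)\<^sup>2 + 1) / (2 * b)"] b0 have "b = 0"
      by (cases "b = 0") auto
    then show ?thesis by simp
  next
    case False
    have "0 \<le> ((nrm f)\<^sup>2 - 2 * (1 / (nrm g)\<^sup>2) * b + (1 / (nrm g)\<^sup>2)\<^sup>2 * b * (nrm g)\<^sup>2) * (nrm g)\<^sup>2"
      using *[of "1 / (nrm g)\<^sup>2"] by (intro mult_nonneg_nonneg) auto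
    also have "\<dots> = (nrm f)\<^sup>2 * (nrm g)\<^sup>2 - b"
      using False by (simp add: field_simps power2_eq_square)
    finally show ?thesis by simp
  qed
  then have "(cmod (ip f g))\<^sup>2 \<le> (nrm f * nrm g)\<^sup>2" by (simp add: b_def power_mult_distrib)
  from power2_le_imp_le[OF this] show ?thesis using assms by simp
qed

lemma nrm_cmult: "f \<in> A \<Longrightarrow> nrm (\<lambda>y. c * f y) = cmod c * nrm f"
proof -
  assume f: "f \<in> A"
  have "ip (\<lambda>y. c * f y) (\<lambda>y. c * f y) = tr (\<lambda>y. (c * cnj c) * (f y * cnj (f y)))"
    by (simp add: ip_def mult_ac)
  also have "\<dots> = of_real ((cmod c)\<^sup>2) * ip f f"
    unfolding ip_def complex_norm_square using tr_cmult[OF A_ip[OF f f]] .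
  finally show ?thesis by (simp add: nrm_def real_sqrt_mult)
qed

lemma nrm_triangle: 
  assumes "f \<in> A" "g \<in> A"
  shows "nrm (\<lambda>y. f y + g y) \<le> nrm f + nrm g"
proof -
  have "(nrm (\<lambda>y. f y + g y))\<^sup>2 = (nrm f)\<^sup>2 + 2 * Re (ip f g) + (nrm g)\<^sup>2"
    using ip_diff_cmult_self[OF assms, of "-1"] assms by (simp add: nrm_power2 A_add)
  also have "\<dots> \<le> (nrm f)\<^sup>2 + 2 * (nrm f * nrm g) + (nrm g)\<^sup>2"
    using Cauchy_Schwarz[OF assms] complex_Re_le_cmod[of "ip f g"] by simp
  also have "\<dots> = (nrm f + nrm g)\<^sup>2" by (simp add: power2_sum)
  finally show ?thesis by (rule power2_le_imp_le) (use assms in simp)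
qed

lemma nrm_minus_commute: "f \<in> A \<Longrightarrow> g \<in> A \<Longrightarrow> nrm (\<lambda>y. f y - g y) = nrm (\<lambda>y. g y - f y)"
  using nrm_cmult[of "\<lambda>y. f y - g y" "-1"] by (simp add: A_diff)

lemma nrm_triangle_diff: 
  assumes "f \<in> A" "g \<in> A" "h \<in> A"
  shows "nrm (\<lambda>y. f y - h y) \<le> nrm (\<lambda>y. f y - g y) + nrm (\<lambda>y. g y - h y)"
  using nrm_triangle[OF A_diff[OF assms(1,2)] A_diff[OF assms(2,3)]] by simp

lemma nrm_mono:
  assumes "f \<in> A" "g \<in> A" "\<And>y. cmod (f y) \<le> cmod (g y)"
  shows "nrm f \<le> nrm g"
proof -
  have "0 \<le> Re (tr (\<lambda>y. g y * cnj (g y) - f y * cnj (f y)))"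
  proof (intro tr_pos A_diff A_ip assms)
    fix y
    have "(cmod (f y))\<^sup>2 \<le> (cmod (g y))\<^sup>2" by (rule power_mono[OF assms(3)]) simp
    then show "Im (g y * cnj (g y) - f y * cnj (f y)) = 0 \<and> 0 \<le> Re (g y * cnj (g y) - f y * cnj (f y))"
      by (simp only: complex_norm_square[symmetric] of_real_diff[symmetric] Im_complex_of_real Re_complex_of_real) simp
  qed
  then show ?thesis using assms by (simp add: nrm_def ip_def tr_diff A_ip)
qed

lemma nrm_mult_le:
  assumes "f \<in> A" "g \<in> A" "\<And>y. cmod (g y) \<le> C"
  shows "nrm (\<lambda>y. g y * f y) \<le> C * nrm f"
proof -
  have C: "C \<ge> 0" using assms(3) norm_ge_zero order_trans by blast
  have "nrm (\<lambda>y. g y * f y) \<le> nrm (\<lambda>y. of_real C * f y)"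
    using C assms(3) by (intro nrm_mono A_mult A_const assms) (auto simp: norm_mult intro: mult_right_mono)
  also have "\<dots> = C * nrm f" using nrm_cmult[OF assms(1), of "of_real C"] C by simp
  finally show ?thesis .
qed

lemma nrm_le_const:
  assumes "f \<in> A" "\<And>y. cmod (f y) \<le> C"
  shows "nrm f \<le> C"
  using nrm_mult_le[OF A_const[of 1] assms] by (simp add: nrm_def ip_def tr_one)

lemma cmod_tr_mult_le:
  assumes "f \<in> A" "g \<in> A"
  shows "cmod (tr (\<lambda>y. f y * g y)) \<le> nrm f * nrm g"
proof -
  have "nrm (\<lambda>y. cnj (g y)) \<le> nrm g" using assms by (intro nrm_mono A_cnj) auto
  then have "nrm f * nrm (\<lambda>y. cnj (g y)) \<le> nrm f * nrm g" using assms by (intro mult_left_mono) auto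
  with Cauchy_Schwarz[OF assms(1) A_cnj[OF assms(2)]] show ?thesis by (simp add: ip_def)
qed

lemma cmod_tr_le:
  assumes "f \<in> A" "\<And>y. cmod (f y) \<le> C"
  shows "cmod (tr f) \<le> C"
  using cmod_tr_mult_le[OF assms(1) A_const[of 1]] nrm_le_const[OF assms] nrm_le_const[OF A_const[of 1], of 1]
    mult_left_mono[OF nrm_le_const[OF A_const[of 1], of 1] nrm_nonneg[OF assms(1)]] by auto

lemma nrm_sh: "f \<in> A \<Longrightarrow> nrm (sh n f) = nrm f"
  using tr_sh[OF A_ip, of f f n] by (simp add: nrm_def ip_def sh_mult sh_cnj)

lemma nrm_avg_le:
  assumes "W \<noteq> []" "\<And>w. w \<in> set W \<Longrightarrow> F w \<in> A" "\<And>w. w \<in> set W \<Longrightarrow> nrm (F w) \<le> C"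
  shows "nrm (\<lambda>y. avg W (\<lambda>w. F w y)) \<le> C"
proof -
  have "nrm (\<lambda>y. \<Sum>w\<leftarrow>W. F w y) \<le> of_nat (length W) * C"
    using assms(2,3)
  proof (induction W)
    case Nil
    then show ?case by (simp add: nrm_def ip_def)
  next
    case (Cons w W)
    have "nrm (\<lambda>y. F w y + (\<Sum>w\<leftarrow>W. F w y)) \<le> nrm (F w) + nrm (\<lambda>y. \<Sum>w\<leftarrow>W. F w y)"
      using Cons.prems by (intro nrm_triangle A_sum_list) auto
    also have "\<dots> \<le> C + of_nat (length W) * C"
      using Cons by (intro add_mono) auto
    finally show ?case by (simp add: algebra_simps)
  qed
  moreover have "nrm (\<lambda>y. avg W (\<lambda>w. F w y)) = inverse (of_nat (length W)) * nrm (\<lambda>y. \<Sum>w\<leftarrow>W. F w y)"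
    using nrm_cmult[OF A_sum_list[of W F, OF assms(2)], where c = "inverse (of_nat (length W))"]
    by (simp add: avg_def divide_inverse mult.commute norm_inverse)
  ultimately have "nrm (\<lambda>y. avg W (\<lambda>w. F w y)) \<le> inverse (of_nat (length W)) * (of_nat (length W) * C)"
    by (simp add: mult_left_mono del: mult_le_cancel_left)
  then show ?thesis using assms(1) by (simp add: mult.assoc[symmetric])
qed

text \<open>The pointwise inequality \<open>norm_avg_power2_le\<close>, integrated by
  \<open>tr\<close>.\<close>

lemma nrm_avg_power2_le:
  assumes "\<And>w. w \<in> set W \<Longrightarrow> F w \<in> A"
  shows "(nrm (\<lambda>y. avg W (\<lambda>w. F w y)))\<^sup>2 \<le> avg W (\<lambda>w. (nrm (F w))\<^sup>2)"
proof -
  have "0 \<le> Re (tr (\<lambda>y. avg W (\<lambda>w. F w y * cnj (F w y)) - avg W (\<lambda>w. F w y) * cnj (avg W (\<lambda>w. F w y))))"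
  proof (intro tr_pos A_diff A_ip A_avg assms)
    fix y
    show "Im (avg W (\<lambda>w. F w y * cnj (F w y)) - avg W (\<lambda>w. F w y) * cnj (avg W (\<lambda>w. F w y))) = 0 \<and>
      0 \<le> Re (avg W (\<lambda>w. F w y * cnj (F w y)) - avg W (\<lambda>w. F w y) * cnj (avg W (\<lambda>w. F w y)))"
      using norm_avg_power2_le[of W "\<lambda>w. F w y"]
      by (simp only: complex_norm_square[symmetric] avg_of_real of_real_diff[symmetric] Im_complex_of_real Re_complex_of_real) simp
  qed
  then show ?thesis using assms
    by (simp add: nrm_power2 A_avg ip_def tr_diff A_ip tr_avg Re_avg cong: avg_cong)
qed

end

lemma avg_avg:
  "avg W (\<lambda>w. avg V (\<lambda>v. f w v)) = (\<Sum>w\<leftarrow>W. \<Sum>v\<leftarrow>V. f w v) / (of_nat (length W) * of_nat (length V))"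
proof -
  have "avg W (\<lambda>w. avg V (\<lambda>v. f w v)) = avg W (\<lambda>w. \<Sum>v\<leftarrow>V. f w v) * inverse (of_nat (length V))"
    by (simp add: avg_multc avg_def[of V] divide_inverse del: sum_list_mult_const)
  then show ?thesis by (simp add: avg_def divide_inverse)
qed

section \<open>Approximately invariant lists\<close>

text \<open>\<open>from_nat\<close> enumerates the group, so one index \<open>n\<close> controls
  both the finite set of translations and the error. Testing against all functions bounded by
  \<open>1\<close> measures the \<open>l1\<close> distance between the uniform distribution on
  \<open>W\<close> and its translates.\<close>

definition folner :: "nat \<Rightarrow> 'g::{countable, ab_group_add} list \<Rightarrow> bool" where
  "folner n W \<longleftrightarrow> W \<noteq> [] \<and> (\<forall>i\<le>n. \<forall>f :: 'g \<Rightarrow> complex. (\<forall>w. cmod (f w) \<le> 1) \<longrightarrow>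
     cmod (avg W (\<lambda>w. f (w + from_nat i)) - avg W f) \<le> 1 / (real n + 1))"

lemma folner_not_Nil: "folner n W \<Longrightarrow> W \<noteq> []"
  by (simp add: folner_def)

lemma folnerD:
  "folner n W \<Longrightarrow> i \<le> n \<Longrightarrow> (\<And>w. cmod (f w) \<le> 1) \<Longrightarrow>
    cmod (avg W (\<lambda>w. f (w + from_nat i)) - avg W f) \<le> 1 / (real n + 1)"
  by (simp add: folner_def)

lemma folner_mono:
  assumes "folner n W" "m \<le> n"
  shows "folner m W"
proof -
  have "1 / (real n + 1) \<le> 1 / (real m + 1)" using assms(2) by (simp add: frac_le)
  then show ?thesis
    using folner_not_Nil[OF assms(1)] folnerD[OF assms(1)] assms(2)
    unfolding folner_def by (meson order_trans)
qed

lemma folner_bound: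
  assumes "folner n W" "to_nat g \<le> n" "\<And>w. cmod (f w) \<le> C"
  shows "cmod (avg W (\<lambda>w. f (w + g)) - avg W f) \<le> C / (real n + 1)"
proof (cases "C = 0")
  case True
  then have "f = (\<lambda>_. 0)" using assms(3) by auto
  then show ?thesis using True by simp
next
  case False
  then have C: "C > 0" using assms(3)[of 0] norm_ge_zero[of "f 0"] by linarith
  let ?f = "\<lambda>w. of_real (1 / C) * f w"
  have "cmod (?f w) \<le> 1" for w
    using assms(3)[of w] C by (simp add: norm_mult norm_divide field_simps)
  then have "cmod (avg W (\<lambda>w. ?f (w + from_nat (to_nat g))) - avg W ?f) \<le> 1 / (real n + 1)"
    by (rule folnerD[OF assms(1,2)])
  then have "cmod (of_real (1 / C) * (avg W (\<lambda>w. f (w + g)) - avg W f)) \<le> 1 / (real n + 1)"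
    by (simp only: from_nat_to_nat avg_cmult right_diff_distrib)
  then have "cmod (avg W (\<lambda>w. f (w + g)) - avg W f) / C \<le> 1 / (real n + 1)"
    using C by (simp add: norm_mult norm_divide)
  then show ?thesis using C by (simp add: field_simps)
qed

text \<open>Hence a statement about all pairs of \<open>folner n\<close> lists is uniform over the
  translates of one list; \<open>ex_translation_stable\<close> uses it in this form.\<close>

lemma folner_translate:
  assumes "folner n W"
  shows "folner n (map ((+) g) W)"
  unfolding folner_def
proof (intro conjI allI impI)
  show "map ((+) g) W \<noteq> []" using assms by (simp add: folner_def)
  fix i and f :: "'a \<Rightarrow> complex"
  assume "i \<le> n" "\<forall>w. cmod (f w) \<le> 1"
  then have "cmod (avg W (\<lambda>w. f (g + (w + from_nat i))) - avg W (\<lambda>w. f (g + w))) \<le> 1 / (real n + 1)"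
    using folnerD[OF assms, of i "\<lambda>w. f (g + w)"] by simp
  then show "cmod (avg (map ((+) g) W) (\<lambda>w. f (w + from_nat i)) - avg (map ((+) g) W) f) \<le> 1 / (real n + 1)"
    by (simp add: avg_map add.assoc)
qed

primrec nmul :: "nat \<Rightarrow> 'g::ab_group_add \<Rightarrow> 'g" where
  "nmul 0 g = 0"
| "nmul (Suc n) g = nmul n g + g"

text \<open>The convolution of the uniform distributions on long progressions in the directions
  \<open>g\<^sub>0, \<dots>, g\<^sub>n\<close> is almost invariant under each \<open>g\<^sub>i\<close>.\<close>

lemma ex_folner: "\<exists>W :: 'g::{countable, ab_group_add} list. folner n W"
proof -
  have "\<exists>W :: 'g list. W \<noteq> [] \<and> (\<forall>i<m. \<forall>f :: 'g \<Rightarrow> complex. (\<forall>w. cmod (f w) \<le> 1) \<longrightarrow>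
     cmod (avg W (\<lambda>w. f (w + from_nat i)) - avg W f) \<le> 1 / (real n + 1))" for m
  proof (induction m)
    case 0
    show ?case by (intro exI[of _ "[0]"]) auto
  next
    case (Suc m)
    then obtain W :: "'g list" where W: "W \<noteq> []" and inv: "\<And>i f. i < m \<Longrightarrow> (\<forall>w. cmod (f w) \<le> 1) \<Longrightarrow>
       cmod (avg W (\<lambda>w. f (w + from_nat i)) - avg W f) \<le> 1 / (real n + 1)" by blast
    let ?g = "from_nat m :: 'g"
    \<comment> \<open>Translating the progression by one step leaves two end terms of norm at most
      \<open>1\<close>, so the error is \<open>2 / N = 1 / (n + 1)\<close>.\<close>
    define N where "N = 2 * (n + 1)"
    define V where "V = [w + nmul k ?g. w \<leftarrow> W, k \<leftarrow> [0..<N]]"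
    have N: "N > 0" by (simp add: N_def)
    have sum_concat: "(\<Sum>v\<leftarrow>[w + nmul k ?g. w \<leftarrow> W', k \<leftarrow> [0..<N]]. f v) = (\<Sum>w\<leftarrow>W'. \<Sum>k\<leftarrow>[0..<N]. f (w + nmul k ?g))"
      for f :: "'g \<Rightarrow> complex" and W'
      by (induction W') (auto simp: o_def)
    have "length V = length W * N" unfolding V_def by (induction W) auto
    then have avgV: "avg V f = avg W (\<lambda>w. avg [0..<N] (\<lambda>k. f (w + nmul k ?g)))" for f :: "'g \<Rightarrow> complex"
      unfolding avg_avg unfolding avg_def \<open>length V = _\<close> sum_concat[of f W, folded V_def] by simp
    have "V \<noteq> []" using \<open>length V = _\<close> W N by auto
    moreover have "cmod (avg V (\<lambda>w. f (w + from_nat i)) - avg V f) \<le> 1 / (real n + 1)"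
      if i: "i < Suc m" and f: "\<forall>w. cmod (f w) \<le> 1" for i and f :: "'g \<Rightarrow> complex"
    proof (cases "i = m")
      case False
      \<comment> \<open>Invariance under the earlier directions survives the convolution: it is
        merely averaged over the translates by \<open>nmul k ?g\<close>.\<close>
      have "avg V (\<lambda>w. f (w + from_nat i)) - avg V f =
         avg [0..<N] (\<lambda>k. avg W (\<lambda>w. f (w + from_nat i + nmul k ?g)) - avg W (\<lambda>w. f (w + nmul k ?g)))"
        unfolding avgV avg_swap[of W] avg_diff by (simp add: add_ac)
      also have "cmod \<dots> \<le> 1 / (real n + 1)"
      proof (rule norm_avg_le)
        fix k
        show "cmod (avg W (\<lambda>w. f (w + from_nat i + nmul k ?g)) - avg W (\<lambda>w. f (w + nmul k ?g))) \<le> 1 / (real n + 1)"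
          using inv[of i "\<lambda>w. f (w + nmul k ?g)"] f i False by auto
      qed (use N in auto)
      finally show ?thesis .
    next
      case True
      have tel: "(\<Sum>k<K. f (w + ?g + nmul k ?g)) - (\<Sum>k<K. f (w + nmul k ?g)) = f (w + nmul K ?g) - f w" for w K
        by (induction K) (auto simp: algebra_simps)
      have "avg [0..<N] (\<lambda>k. f (w + ?g + nmul k ?g)) - avg [0..<N] (\<lambda>k. f (w + nmul k ?g)) =
        (f (w + nmul N ?g) - f w) / of_nat N" for w
        unfolding avg_def diff_divide_distrib[symmetric]
        using tel[of w N] by (simp add: interv_sum_list_conv_sum_set_nat lessThan_atLeast0)
      then have "avg V (\<lambda>w. f (w + from_nat i)) - avg V f =
         avg W (\<lambda>w. (f (w + nmul N ?g) - f w) / of_nat N)"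
        unfolding avgV avg_diff[symmetric] True by (simp add: add_ac)
      also have "cmod \<dots> \<le> 2 / real N"
      proof (rule norm_avg_le)
        fix w
        have "cmod (f (w + nmul N ?g) - f w) \<le> 1 + 1"
          using f by (intro order_trans[OF norm_triangle_ineq4] add_mono) auto
        then show "cmod ((f (w + nmul N ?g) - f w) / of_nat N) \<le> 2 / real N"
          using N by (simp add: norm_divide divide_right_mono)
      qed (use W in auto)
      also have "\<dots> = 1 / (real n + 1)" by (simp add: N_def field_simps)
      finally show ?thesis .
    qed
    ultimately show ?case by blast
  qed
  from this[of "Suc n"] show ?thesis unfolding folner_def less_Suc_eq_le .
qed

section \<open>Ultraproducts\<close>

type_synonym ('g, 'a) pt = "(nat \<times> 'g) list \<times> int \<times> 'a"

text \<open>A function on the extension is a family of functions of \<open>A\<close>, indexed by the head \<open>(N, w)\<close> of the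
  list. The index \<open>N\<close> is that of the ultraproduct, \<open>w\<close> ranges over the list \<open>\<W> N\<close> of group elements.\<close>

definition slice :: "(('g, 'a) pt \<Rightarrow> complex) \<Rightarrow> nat \<times> 'g \<Rightarrow> ('g, 'a) pt \<Rightarrow> complex" where
  "slice F p = (\<lambda>(l, y). F (p # l, y))"

definition glue :: "(nat \<times> 'g \<Rightarrow> ('g, 'a) pt \<Rightarrow> complex) \<Rightarrow> ('g, 'a) pt \<Rightarrow> complex" where
  "glue G = (\<lambda>(l, y). case l of [] \<Rightarrow> 0 | p # l' \<Rightarrow> G p (l', y))"

definition ext :: "(('g, 'a) pt \<Rightarrow> complex) set \<Rightarrow> (('g, 'a) pt \<Rightarrow> complex) set" where
  "ext A = {F. (\<exists>C. \<forall>y. cmod (F y) \<le> C) \<and> (\<forall>p. slice F p \<in> A)}"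

text \<open>\<open>ext A\<close> does not mention \<open>\<W>\<close>; only the trace does. The same
  family of functions can therefore be measured by several traces, as
  \<open>dual_in_Cauchy_space\<close> does with the singleton lists \<open>[0]\<close> and with
  almost invariant lists.\<close>

definition trext :: "(nat \<Rightarrow> 'g list) \<Rightarrow> ((('g, 'a) pt \<Rightarrow> complex) \<Rightarrow> complex) \<Rightarrow> (('g, 'a) pt \<Rightarrow> complex) \<Rightarrow> complex" where
  "trext \<W> tr F = Ulim (\<lambda>N. avg (\<W> N) (\<lambda>w. tr (slice F (N, w))))"

lemma slice_glue [simp]: "slice (glue G) p = G p"
  by (auto simp: slice_def glue_def)

lemma slice_mult: "slice (\<lambda>y. f y * g y) p = (\<lambda>y. slice f p y * slice g p y)"
  and slice_add: "slice (\<lambda>y. f y + g y) p = (\<lambda>y. slice f p y + slice g p y)"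
  and slice_diff: "slice (\<lambda>y. f y - g y) p = (\<lambda>y. slice f p y - slice g p y)"
  and slice_cnj: "slice (\<lambda>y. cnj (f y)) p = (\<lambda>y. cnj (slice f p y))"
  and slice_const: "slice (\<lambda>y. c) p = (\<lambda>y. c)"
  and slice_avg: "slice (\<lambda>y. avg W (\<lambda>w. F w y)) p = (\<lambda>y. avg W (\<lambda>w. slice (F w) p y))"
  and slice_sh: "slice (sh n f) p = sh n (slice f p)"
  by (auto simp: slice_def sh_def)

lemma norm_slice_le: "(\<And>y. cmod (f y) \<le> C) \<Longrightarrow> cmod (slice f p y) \<le> C"
  by (auto simp: slice_def split: prod.splits)

lemma glue_in_ext:
  assumes "\<And>p. G p \<in> B" "\<And>p y. cmod (G p y) \<le> C"
  shows "glue G \<in> ext B"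
proof -
  have "cmod (glue G y) \<le> max C 0" for y
    using assms(2) by (auto simp: glue_def le_max_iff_disj split: prod.splits list.splits)
  then show ?thesis using assms(1) by (auto simp: ext_def)
qed

text \<open>Every trace axiom is an identity or inequality between bounded sequences and passes to
  the limit along \<open>ultra\<close>.\<close>

lemma traced_algebra_ext:
  fixes A :: "(('g, 'b) pt \<Rightarrow> complex) set"
  assumes "traced_algebra A tr" "\<And>N. \<W> N \<noteq> []"
  shows "traced_algebra (ext A) (trext \<W> tr)"
proof -
  interpret traced_algebra A tr by fact
  have sl: "slice F p \<in> A" if "F \<in> ext A" for F p using that unfolding ext_def by blast
  have bd: "\<exists>C. \<forall>y. cmod (F y) \<le> C" if "F \<in> ext A" for F using that unfolding ext_def by blast
  have conv: "((\<lambda>N. avg (\<W> N) (\<lambda>w. tr (slice F (N, w)))) \<longlongrightarrow> trext \<W> tr F) ultra" if F: "F \<in> ext A" for F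
  proof -
    obtain C where C: "\<And>y. cmod (F y) \<le> C" using bd[OF F] by blast
    have "cmod (avg (\<W> N) (\<lambda>w. tr (slice F (N, w)))) \<le> C" for N
      using assms(2) sl[OF F] C by (intro norm_avg_le cmod_tr_le norm_slice_le)
    then show ?thesis unfolding trext_def by (rule tendsto_Ulim)
  qed
  note eq = Ulim_eqI[of "\<lambda>N. avg (\<W> N) (\<lambda>w. tr (slice F (N, w)))" for F, folded trext_def]
  show ?thesis
  proof
    show "(\<lambda>_. c) \<in> ext A" for c
      by (auto simp: ext_def slice_const A_const)
    show add: "(\<lambda>y. f y + g y) \<in> ext A" if fg: "f \<in> ext A" "g \<in> ext A" for f g
    proof -
      obtain C D where "\<And>y. cmod (f y) \<le> C" "\<And>y. cmod (g y) \<le> D" using fg[THEN bd] by blast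
      then have "cmod (f y + g y) \<le> C + D" for y by (intro norm_triangle_le add_mono)
      then show ?thesis using fg by (auto simp: ext_def slice_add A_add)
    qed
    show mult: "(\<lambda>y. f y * g y) \<in> ext A" if fg: "f \<in> ext A" "g \<in> ext A" for f g
    proof -
      obtain C D where CD: "\<And>y. cmod (f y) \<le> C" "\<And>y. cmod (g y) \<le> D" using fg[THEN bd] by blast
      have "0 \<le> C" using CD(1) norm_ge_zero order_trans by blast
      then have "cmod (f y * g y) \<le> C * D" for y unfolding norm_mult using CD by (intro mult_mono) auto
      then show ?thesis using fg by (auto simp: ext_def slice_mult A_mult)
    qed
    show cnj: "(\<lambda>y. cnj (f y)) \<in> ext A" if "f \<in> ext A" for f
      using that by (auto simp: ext_def slice_cnj A_cnj)
    show shf: "sh n f \<in> ext A" if "f \<in> ext A" for n f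
    proof -
      obtain C where "\<And>y. cmod (f y) \<le> C" using bd \<open>f \<in> ext A\<close> by blast
      then have "cmod (sh n f y) \<le> C" for y by (rule norm_sh_le)
      then show ?thesis using that by (auto simp: ext_def slice_sh A_sh)
    qed
    show "\<exists>C. \<forall>y. cmod (f y) \<le> C" if "f \<in> ext A" for f using bd[OF that] .
    show "trext \<W> tr (\<lambda>y. f y + g y) = trext \<W> tr f + trext \<W> tr g" if fg: "f \<in> ext A" "g \<in> ext A" for f g
      using tendsto_add[OF conv[OF fg(1)] conv[OF fg(2)]] sl fg
      by (intro eq) (simp add: slice_add tr_add avg_add)
    show "trext \<W> tr (\<lambda>y. c * f y) = c * trext \<W> tr f" if f: "f \<in> ext A" for c f
      using tendsto_mult[OF tendsto_const[of c] conv[OF f]] sl f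
      by (intro eq) (simp add: slice_mult slice_const tr_cmult avg_cmult)
    show "trext \<W> tr (\<lambda>y. cnj (f y)) = cnj (trext \<W> tr f)" if f: "f \<in> ext A" for f
      using tendsto_cnj[OF conv[OF f]] sl f
      by (intro eq) (simp add: slice_cnj tr_cnj avg_cnj)
    show "trext \<W> tr (sh n f) = trext \<W> tr f" if f: "f \<in> ext A" for n f
      using conv[OF f] sl f by (intro eq) (simp add: slice_sh tr_sh)
    show "Re (trext \<W> tr f) \<ge> 0" if f: "f \<in> ext A" and pos: "\<And>y. Im (f y) = 0 \<and> Re (f y) \<ge> 0" for f
    proof (rule tendsto_lowerbound[OF tendsto_Re[OF conv[OF f]]])
      have "0 \<le> Re (tr (slice f p))" for p
        using pos by (intro tr_pos sl f) (auto simp: slice_def split: prod.splits)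
      then have "0 \<le> Re (avg (\<W> N) (\<lambda>w. tr (slice f (N, w))))" for N
        using avg_mono[of "\<W> N" "\<lambda>_. 0" "\<lambda>w. Re (tr (slice f (N, w)))"] assms(2) by (simp add: Re_avg)
      then show "eventually (\<lambda>N. 0 \<le> Re (avg (\<W> N) (\<lambda>w. tr (slice f (N, w))))) ultra" by simp
    qed auto
    show "trext \<W> tr (\<lambda>_. 1) = 1"
      using assms(2) by (intro eq) (simp add: slice_const)
  qed
qed

context traced_algebra
begin

lemma almost_projection:
  assumes E: "E \<subseteq> A" "(\<lambda>_. 0) \<in> E" "\<And>f g. f \<in> E \<Longrightarrow> g \<in> E \<Longrightarrow> (\<lambda>y. f y + g y) \<in> E"
    "\<And>c f. f \<in> E \<Longrightarrow> (\<lambda>y. c * f y) \<in> E"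
    and f: "f \<in> A" and \<delta>: "\<delta> > 0"
  shows "\<exists>e\<in>E. nrm (\<lambda>y. f y - e y) \<le> nrm f + \<delta> \<and> (\<forall>s\<in>E. cmod (ip (\<lambda>y. f y - e y) s) \<le> \<delta> * nrm s)"
proof -
  define D where "D = (\<lambda>e. (nrm (\<lambda>y. f y - e y))\<^sup>2) ` E"
  have bdd: "bdd_below D" by (auto simp: D_def intro!: bdd_belowI[of _ 0])
  have ne: "D \<noteq> {}" using E(2) by (auto simp: D_def)
  obtain e where e: "e \<in> E" and lt: "(nrm (\<lambda>y. f y - e y))\<^sup>2 < Inf D + \<delta>\<^sup>2"
    using cInf_lessD[OF ne, of "Inf D + \<delta>\<^sup>2"] \<delta> by (auto simp: D_def)
  define u where "u = (\<lambda>y. f y - e y)"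
  have uA: "u \<in> A" unfolding u_def using e E(1) f by (intro A_diff) auto
  have "Inf D \<le> (nrm (\<lambda>y. f y - 0))\<^sup>2"
    using bdd E(2) unfolding D_def by (intro cInf_lower) (auto intro: image_eqI[of _ _ "\<lambda>_. 0"])
  then have "(nrm u)\<^sup>2 \<le> (nrm f)\<^sup>2 + \<delta>\<^sup>2" using lt by (simp add: u_def)
  also have "\<dots> \<le> (nrm f + \<delta>)\<^sup>2" using \<delta> f by (simp add: power2_sum)
  finally have "nrm u \<le> nrm f + \<delta>" by (rule power2_le_imp_le) (use \<delta> f in simp)
  moreover have "cmod (ip u s) \<le> \<delta> * nrm s" if s: "s \<in> E" for s
  proof (cases "nrm s = 0")
    case True
    then show ?thesis using Cauchy_Schwarz[OF uA, of s] s E(1) by auto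
  next
    case False
    have sA: "s \<in> A" using s E(1) by auto
    define c where "c = (nrm s)\<^sup>2"
    have c: "c > 0" using False by (simp add: c_def)
    define t where "t = of_real (1 / c) * ip u s"
    have "Inf D \<le> (nrm (\<lambda>y. f y - (e y + t * s y)))\<^sup>2"
      using bdd E(3)[OF e E(4)[OF s, of t]] unfolding D_def
      by (intro cInf_lower) (auto intro: image_eqI[of _ _ "\<lambda>y. e y + t * s y"])
    also have "\<dots> = (nrm (\<lambda>y. u y - t * s y))\<^sup>2" by (simp add: u_def algebra_simps)
    also have "\<dots> = Re (ip u u) - 2 * Re (cnj t * ip u s) + (cmod t)\<^sup>2 * Re (ip s s)"
      using uA sA by (simp add: nrm_power2 A_diff A_cmult ip_diff_cmult_self)
    also have "cnj t * ip u s = of_real ((cmod (ip u s))\<^sup>2 / c)"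
      using complex_norm_square[of "ip u s"] by (simp add: t_def mult_ac)
    also have "(cmod t)\<^sup>2 * Re (ip s s) = (cmod (ip u s))\<^sup>2 / c"
      using c sA by (simp add: t_def norm_mult norm_divide power2_eq_square c_def nrm_power2[symmetric] field_simps)
    finally have "Inf D \<le> (nrm u)\<^sup>2 - (cmod (ip u s))\<^sup>2 / c" using uA by (simp add: nrm_power2)
    then have "(cmod (ip u s))\<^sup>2 / c \<le> \<delta>\<^sup>2" using lt by (simp add: u_def)
    then have "(cmod (ip u s))\<^sup>2 \<le> (\<delta> * nrm s)\<^sup>2" using c by (simp add: field_simps c_def)
    then show ?thesis by (rule power2_le_imp_le) (use \<delta> sA in simp)
  qed
  ultimately show ?thesis using e unfolding u_def by blast
qed

end

section \<open>Norm convergence of multilinear averages\<close>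

definition character :: "('g::ab_group_add \<Rightarrow> complex) \<Rightarrow> bool" where
  "character \<xi> \<longleftrightarrow> (\<forall>g h. \<xi> (g + h) = \<xi> g * \<xi> h) \<and> (\<forall>g. cmod (\<xi> g) = 1)"

lemma character_add: "character \<xi> \<Longrightarrow> \<xi> (g + h) = \<xi> g * \<xi> h"
  and norm_character: "character \<xi> \<Longrightarrow> cmod (\<xi> g) = 1"
  by (auto simp: character_def)

lemma character_mult_cnj: "character \<xi> \<Longrightarrow> \<xi> g * cnj (\<xi> g) = 1"
  using complex_norm_square[of "\<xi> g"] by (simp add: norm_character)

definition lp :: "(('g \<Rightarrow> int) \<times> (('g, 'a) pt \<Rightarrow> complex)) list \<Rightarrow> 'g \<Rightarrow> ('g, 'a) pt \<Rightarrow> complex" where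
  "lp fs w y = (\<Prod>(\<phi>, f)\<leftarrow>fs. sh (\<phi> w) f y)"

definition valid :: "(('g::ab_group_add, 'a) pt \<Rightarrow> complex) set \<Rightarrow> (('g \<Rightarrow> int) \<times> (('g, 'a) pt \<Rightarrow> complex)) list \<Rightarrow> bool" where
  "valid A fs \<longleftrightarrow> (\<forall>(\<phi>, f)\<in>set fs. Modules.additive \<phi> \<and> f \<in> A)"

definition mav :: "('g \<Rightarrow> complex) \<Rightarrow> (('g \<Rightarrow> int) \<times> (('g, 'a) pt \<Rightarrow> complex)) list \<Rightarrow> 'g list \<Rightarrow> ('g, 'a) pt \<Rightarrow> complex" where
  "mav \<xi> fs W y = avg W (\<lambda>w. \<xi> w * lp fs w y)"

lemma lp_Nil [simp]: "lp [] w y = 1"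
  and lp_Cons [simp]: "lp ((\<phi>, f) # fs) w y = sh (\<phi> w) f y * lp fs w y"
  by (auto simp: lp_def)

lemma lp_append: "lp (fs @ gs) w y = lp fs w y * lp gs w y"
  by (induction fs) auto

lemma valid_Nil [simp]: "valid A []"
  and valid_Cons [simp]: "valid A ((\<phi>, f) # fs) \<longleftrightarrow> Modules.additive \<phi> \<and> f \<in> A \<and> valid A fs"
  by (auto simp: valid_def)

context traced_algebra
begin

lemma norm_bound_pos: "f \<in> A \<Longrightarrow> \<exists>C>0. \<forall>y. cmod (f y) \<le> C"
  using A_bdd[of f] by (meson less_le_trans linorder_le_less_linear order_trans zero_less_one less_imp_le)

end

lemma lp_in_A:
  fixes A :: "(('g::ab_group_add, 'b) pt \<Rightarrow> complex) set"
  assumes "traced_algebra A tr" "valid A fs"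
  shows "lp fs w \<in> A"
proof -
  interpret traced_algebra A tr by fact
  have Nil: "lp [] w = (\<lambda>_. 1)" for w :: 'g by (intro ext) simp
  have Cons: "lp ((\<phi>, f) # fs) w = (\<lambda>y. sh (\<phi> w) f y * lp fs w y)"
    for \<phi> :: "'g \<Rightarrow> int" and f :: "('g, 'b) pt \<Rightarrow> complex" and fs w
    by (intro ext) simp
  show ?thesis using assms(2)
    by (induction fs) (auto simp: Nil Cons intro!: A_const A_mult A_sh)
qed

lemma lp_bound:
  assumes "traced_algebra A tr" "valid A fs"
  shows "\<exists>C>0. \<forall>w y. cmod (lp fs w y) \<le> C"
  using assms(2)
proof (induction fs)
  case Nil
  show ?case by (intro exI[of _ 1]) auto
next
  case (Cons p fs)
  interpret traced_algebra A tr by fact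
  obtain \<phi> f where p: "p = (\<phi>, f)" by (cases p)
  obtain C where C: "C > 0" "\<And>w y. cmod (lp fs w y) \<le> C" using Cons p by auto
  obtain D where D: "D > 0" "\<And>y. cmod (f y) \<le> D" using norm_bound_pos[of f] Cons.prems p by auto
  have "cmod (lp (p # fs) w y) \<le> D * C" for w y
    unfolding p lp_Cons norm_mult
    by (intro mult_mono norm_sh_le C(2) D(2) norm_ge_zero less_imp_le[OF D(1)])
  then show ?case using C D by (intro exI[of _ "D * C"]) auto
qed

lemma ext_bound_slice: "F \<in> ext A \<Longrightarrow> \<exists>K. \<forall>p y. cmod (slice F p y) \<le> K"
  unfolding ext_def using norm_slice_le by blast

lemma ext_slice: "F \<in> ext A \<Longrightarrow> slice F p \<in> A"
  unfolding ext_def by blast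

lemma tendsto_ip_ext:
  fixes \<W> :: "nat \<Rightarrow> 'g list" and A' :: "(('g, 'b) pt \<Rightarrow> complex) set"
  assumes "traced_algebra A' tr'" "\<And>N. \<W> N \<noteq> []" "F \<in> ext A'" "G \<in> ext A'"
  shows "((\<lambda>N. avg (\<W> N) (\<lambda>w. traced_algebra.ip tr' (slice F (N, w)) (slice G (N, w)))) \<longlongrightarrow>
    traced_algebra.ip (trext \<W> tr') F G) ultra"
proof -
  interpret A: traced_algebra A' tr' by fact
  interpret B: traced_algebra "ext A'" "trext \<W> tr'" by (rule traced_algebra_ext[OF assms(1,2)])
  have FG: "(\<lambda>y. F y * cnj (G y)) \<in> ext A'" using assms by (intro B.A_ip)
  obtain K where K: "\<And>p y. cmod (slice (\<lambda>y. F y * cnj (G y)) p y) \<le> K"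
    using ext_bound_slice[OF FG] by blast
  have "cmod (avg (\<W> N) (\<lambda>w. tr' (slice (\<lambda>y. F y * cnj (G y)) (N, w)))) \<le> K" for N
    using assms(2) K FG by (intro norm_avg_le A.cmod_tr_le ext_slice)
  then have "((\<lambda>N. avg (\<W> N) (\<lambda>w. tr' (slice (\<lambda>y. F y * cnj (G y)) (N, w)))) \<longlongrightarrow>
      trext \<W> tr' (\<lambda>y. F y * cnj (G y))) ultra"
    unfolding trext_def by (rule tendsto_Ulim)
  then show ?thesis by (simp add: A.ip_def B.ip_def slice_mult slice_cnj)
qed

lemma ex_div_Suc_le:
  assumes "\<epsilon> > 0"
  shows "\<exists>n\<ge>k. C / (real n + 1) \<le> \<epsilon>"
proof -
  obtain n where n: "real n \<ge> C / \<epsilon>" using real_arch_simple by blast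
  have "C / \<epsilon> \<le> real (max n k) + 1" using n by (simp add: of_nat_max)
  then have "C / (real (max n k) + 1) \<le> \<epsilon>"
    using assms by (simp add: field_simps)
  then show ?thesis by (intro exI[of _ "max n k"]) auto
qed

text \<open>The function shifted along \<open>\<phi>\<close> is left out of the locale: it is the
  argument \<open>u\<close> of \<open>aw\<close> and varies over a whole space, while
  \<open>fs\<close> holds the functions that stay fixed. \<open>T\<close> below is the plain
  ultraproduct, with singleton lists.\<close>

locale reduction_step = traced_algebra A tr
  for A :: "(('g::{countable, ab_group_add}, 'b) pt \<Rightarrow> complex) set" and tr +
  fixes \<xi> :: "'g \<Rightarrow> complex" and \<phi> :: "'g \<Rightarrow> int"
    and fs :: "(('g \<Rightarrow> int) \<times> (('g, 'b) pt \<Rightarrow> complex)) list"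
  assumes \<xi>: "character \<xi>" and \<phi>: "Modules.additive \<phi>" and fs: "valid A fs"
begin

interpretation T: traced_algebra "ext A" "trext (\<lambda>_. [0]) tr"
  by (intro traced_algebra_ext traced_algebra_axioms) auto

definition aw :: "'g list \<Rightarrow> (('g, 'b) pt \<Rightarrow> complex) \<Rightarrow> ('g, 'b) pt \<Rightarrow> complex" where
  "aw W u = (\<lambda>y. avg W (\<lambda>w. \<xi> w * (sh (\<phi> w) u y * lp fs w y)))"

text \<open>The dual functions: \<open>ip (aw W u) c = ip u (dw W c)\<close>.\<close>

definition dw :: "'g list \<Rightarrow> (('g, 'b) pt \<Rightarrow> complex) \<Rightarrow> ('g, 'b) pt \<Rightarrow> complex" where
  "dw W c = (\<lambda>y. avg W (\<lambda>w. cnj (\<xi> w) * sh (- \<phi> w) (\<lambda>y. cnj (lp fs w y) * c y) y))"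

definition ax :: "'g list \<Rightarrow> (('g, 'b) pt \<Rightarrow> complex) \<Rightarrow> ('g, 'b) pt \<Rightarrow> complex" where
  "ax W F = (\<lambda>y. avg W (\<lambda>w. \<xi> w * (sh (\<phi> w) F y * glue (\<lambda>_. lp fs w) y)))"

definition bd :: real where
  "bd = (SOME C. C > 0 \<and> (\<forall>w y. cmod (lp fs w y) \<le> C))"

lemma bd: "bd > 0" "cmod (lp fs w y) \<le> bd"
  using someI_ex[OF lp_bound[OF traced_algebra_axioms fs]] unfolding bd_def[symmetric] by blast+

lemma lp_A: "lp fs w \<in> A"
  by (rule lp_in_A[OF traced_algebra_axioms fs])

lemma aw_A: "u \<in> A \<Longrightarrow> aw W u \<in> A"
  unfolding aw_def by (intro A_avg A_mult A_const A_sh lp_A)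

lemma dw_A: "c \<in> A \<Longrightarrow> dw W c \<in> A"
  unfolding dw_def by (intro A_avg A_mult A_const A_sh A_cnj lp_A)

lemma norm_aw_le:
  assumes "W \<noteq> []" "\<And>y. cmod (u y) \<le> K"
  shows "cmod (aw W u y) \<le> K * bd"
proof -
  have "0 \<le> K" using assms(2) norm_ge_zero order_trans by blast
  then show ?thesis unfolding aw_def
    by (intro norm_avg_le assms(1))
      (simp add: norm_mult norm_character[OF \<xi>] mult_mono norm_sh_le[OF assms(2)] bd)
qed

lemma norm_dw_le:
  assumes "W \<noteq> []" "\<And>y. cmod (u y) \<le> K"
  shows "cmod (dw W u y) \<le> bd * K"
proof -
  have "cmod (cnj (lp fs w y) * u y) \<le> bd * K" for w y
    unfolding norm_mult complex_mod_cnj by (intro mult_mono bd assms(2)) (use bd in auto)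
  then have "cmod (sh (- \<phi> w) (\<lambda>y. cnj (lp fs w y) * u y) y) \<le> bd * K" for w y
    by (rule norm_sh_le)
  then show ?thesis unfolding dw_def
    by (intro norm_avg_le assms(1)) (simp add: norm_mult norm_character[OF \<xi>])
qed

lemma nrm_aw_le:
  assumes "W \<noteq> []" "u \<in> A"
  shows "nrm (aw W u) \<le> bd * nrm u"
  unfolding aw_def
proof (rule nrm_avg_le)
  fix w
  have "nrm (\<lambda>y. (\<xi> w * lp fs w y) * sh (\<phi> w) u y) \<le> bd * nrm (sh (\<phi> w) u)"
    by (intro nrm_mult_le A_mult A_const A_sh lp_A assms) (simp add: norm_mult norm_character[OF \<xi>] bd)
  then show "nrm (\<lambda>y. \<xi> w * (sh (\<phi> w) u y * lp fs w y)) \<le> bd * nrm u"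
    using assms by (simp add: nrm_sh mult_ac)
qed (intro assms A_mult A_const A_sh lp_A)+

lemma nrm_dw_le:
  assumes "W \<noteq> []" "u \<in> A"
  shows "nrm (dw W u) \<le> bd * nrm u"
  unfolding dw_def
proof (rule nrm_avg_le)
  fix w
  have "nrm (\<lambda>y. cnj (\<xi> w) * sh (- \<phi> w) (\<lambda>y. cnj (lp fs w y) * u y) y) =
      nrm (\<lambda>y. cnj (lp fs w y) * u y)"
    by (simp add: nrm_cmult nrm_sh A_sh A_mult A_cnj lp_A assms norm_character[OF \<xi>])
  also have "\<dots> \<le> bd * nrm u"
    by (intro nrm_mult_le A_cnj lp_A assms) (simp add: bd)
  finally show "nrm (\<lambda>y. cnj (\<xi> w) * sh (- \<phi> w) (\<lambda>y. cnj (lp fs w y) * u y) y) \<le> bd * nrm u" .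
qed (intro assms A_mult A_const A_sh A_cnj lp_A)+

text \<open>Each summand is shifted by \<open>- \<phi> w\<close> inside the trace, which frees
  \<open>u\<close> of its shift.\<close>

lemma adjoint:
  assumes "u \<in> A" "c \<in> A"
  shows "ip (aw W u) c = ip u (dw W c)"
proof -
  have "ip (aw W u) c = tr (\<lambda>y. avg W (\<lambda>w. (\<xi> w * (sh (\<phi> w) u y * lp fs w y)) * cnj (c y)))"
    unfolding ip_def aw_def avg_multc ..
  also have "\<dots> = avg W (\<lambda>w. tr (\<lambda>y. (\<xi> w * (sh (\<phi> w) u y * lp fs w y)) * cnj (c y)))"
    by (intro tr_avg A_mult A_const A_sh lp_A A_cnj assms)
  also have "\<dots> = avg W (\<lambda>w. tr (\<lambda>y. u y * cnj (cnj (\<xi> w) * sh (- \<phi> w) (\<lambda>y. cnj (lp fs w y) * c y) y)))"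
  proof (rule avg_cong)
    fix w
    let ?h = "\<lambda>y. (\<xi> w * (sh (\<phi> w) u y * lp fs w y)) * cnj (c y)"
    have "tr ?h = tr (sh (- \<phi> w) ?h)"
      by (intro tr_sh[symmetric] A_mult A_const A_sh lp_A A_cnj assms)
    also have "sh (- \<phi> w) ?h = (\<lambda>y. u y * cnj (cnj (\<xi> w) * sh (- \<phi> w) (\<lambda>y. cnj (lp fs w y) * c y) y))"
      by (simp add: sh_mult sh_const sh_cnj mult_ac)
    finally show "tr ?h = tr (\<lambda>y. u y * cnj (cnj (\<xi> w) * sh (- \<phi> w) (\<lambda>y. cnj (lp fs w y) * c y) y))" .
  qed
  also have "\<dots> = tr (\<lambda>y. avg W (\<lambda>w. u y * cnj (cnj (\<xi> w) * sh (- \<phi> w) (\<lambda>y. cnj (lp fs w y) * c y) y)))"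
    by (intro tr_avg[symmetric] A_mult A_const A_sh lp_A A_cnj assms)
  also have "\<dots> = ip u (dw W c)"
    unfolding ip_def dw_def avg_cnj avg_cmult ..
  finally show ?thesis .
qed

lemma glue_lp_ext: "glue (\<lambda>_. lp fs w) \<in> ext A"
  by (rule glue_in_ext[of _ _ bd]) (auto intro: lp_A bd)

lemma ax_ext: "F \<in> ext A \<Longrightarrow> ax W F \<in> ext A"
  unfolding ax_def by (intro T.A_avg T.A_mult T.A_const T.A_sh glue_lp_ext)

lemma slice_ax: "slice (ax W F) p = aw W (slice F p)"
  unfolding ax_def aw_def by (simp add: slice_avg slice_mult slice_const slice_sh)

lemma ax_add: "ax W (\<lambda>y. f y + g y) = (\<lambda>y. ax W f y + ax W g y)"
  unfolding ax_def avg_add[symmetric] by (simp add: sh_add algebra_simps)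

lemma ax_cmult: "ax W (\<lambda>y. c * f y) = (\<lambda>y. c * ax W f y)"
  unfolding ax_def avg_cmult[symmetric] by (simp add: sh_mult sh_const algebra_simps)

lemma tendsto_nrm_slice:
  assumes "F \<in> ext A"
  shows "((\<lambda>N. nrm (slice F (N, 0))) \<longlongrightarrow> T.nrm F) ultra"
  unfolding nrm_def T.nrm_def
  using tendsto_real_sqrt[OF tendsto_Re[OF tendsto_ip_ext[OF traced_algebra_axioms _ assms assms, of "\<lambda>_. [0]"]]]
  by simp

text \<open>The subspace on which the averages are known to converge; it contains the families of
  dual functions, and the function under study is approximated from it.\<close>

definition Cauchy_space :: "(('g, 'b) pt \<Rightarrow> complex) set" where
  "Cauchy_space = {e \<in> ext A. \<forall>\<epsilon>>0. \<exists>n. \<forall>W W'. folner n W \<longrightarrow> folner n W' \<longrightarrow>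
     T.nrm (\<lambda>y. ax W e y - ax W' e y) \<le> \<epsilon>}"

lemma Cauchy_space_add:
  assumes "f \<in> Cauchy_space" "g \<in> Cauchy_space"
  shows "(\<lambda>y. f y + g y) \<in> Cauchy_space"
  unfolding Cauchy_space_def
proof (safe)
  have fg: "f \<in> ext A" "g \<in> ext A" using assms by (auto simp: Cauchy_space_def)
  then show "(\<lambda>y. f y + g y) \<in> ext A" by (rule T.A_add)
  fix \<epsilon> :: real assume "\<epsilon> > 0"
  then have e: "\<epsilon> / 2 > 0" by simp
  obtain n m where n: "\<And>W W'. folner n W \<Longrightarrow> folner n W' \<Longrightarrow> T.nrm (\<lambda>y. ax W f y - ax W' f y) \<le> \<epsilon> / 2"
    and m: "\<And>W W'. folner m W \<Longrightarrow> folner m W' \<Longrightarrow> T.nrm (\<lambda>y. ax W g y - ax W' g y) \<le> \<epsilon> / 2"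
    using assms e unfolding Cauchy_space_def by blast
  have "T.nrm (\<lambda>y. ax W (\<lambda>y. f y + g y) y - ax W' (\<lambda>y. f y + g y) y) \<le> \<epsilon>"
    if "folner (max n m) W" "folner (max n m) W'" for W W'
  proof -
    have W: "folner n W" "folner m W" "folner n W'" "folner m W'"
      using that by (auto intro: folner_mono)
    have "T.nrm (\<lambda>y. ax W (\<lambda>y. f y + g y) y - ax W' (\<lambda>y. f y + g y) y) =
      T.nrm (\<lambda>y. (ax W f y - ax W' f y) + (ax W g y - ax W' g y))"
      by (simp add: ax_add algebra_simps)
    also have "\<dots> \<le> T.nrm (\<lambda>y. ax W f y - ax W' f y) + T.nrm (\<lambda>y. ax W g y - ax W' g y)"
      by (intro T.nrm_triangle T.A_diff ax_ext fg)
    also have "\<dots> \<le> \<epsilon> / 2 + \<epsilon> / 2" by (intro add_mono n m W)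
    finally show ?thesis by simp
  qed
  then show "\<exists>n. \<forall>W W'. folner n W \<longrightarrow> folner n W' \<longrightarrow>
     T.nrm (\<lambda>y. ax W (\<lambda>y. f y + g y) y - ax W' (\<lambda>y. f y + g y) y) \<le> \<epsilon>" by blast
qed

lemma Cauchy_space_cmult:
  assumes "f \<in> Cauchy_space"
  shows "(\<lambda>y. c * f y) \<in> Cauchy_space"
  unfolding Cauchy_space_def
proof (safe)
  have f: "f \<in> ext A" using assms by (auto simp: Cauchy_space_def)
  then show "(\<lambda>y. c * f y) \<in> ext A" by (rule T.A_cmult)
  fix \<epsilon> :: real assume "\<epsilon> > 0"
  then have e: "\<epsilon> / (cmod c + 1) > 0" by (simp add: add_nonneg_pos)
  obtain n where n: "\<And>W W'. folner n W \<Longrightarrow> folner n W' \<Longrightarrow> T.nrm (\<lambda>y. ax W f y - ax W' f y) \<le> \<epsilon> / (cmod c + 1)"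
    using assms e unfolding Cauchy_space_def by blast
  have "T.nrm (\<lambda>y. ax W (\<lambda>y. c * f y) y - ax W' (\<lambda>y. c * f y) y) \<le> \<epsilon>"
    if "folner n W" "folner n W'" for W W'
  proof -
    have "T.nrm (\<lambda>y. ax W (\<lambda>y. c * f y) y - ax W' (\<lambda>y. c * f y) y) = cmod c * T.nrm (\<lambda>y. ax W f y - ax W' f y)"
      unfolding ax_cmult right_diff_distrib[symmetric] by (intro T.nrm_cmult T.A_diff ax_ext f)
    also have "\<dots> \<le> (cmod c + 1) * (\<epsilon> / (cmod c + 1))"
      using that f by (intro mult_mono n T.nrm_nonneg T.A_diff ax_ext) auto
    also have "\<dots> = \<epsilon>" using norm_ge_zero[of c] by (simp add: field_simps add_nonneg_eq_0_iff)
    finally show ?thesis .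
  qed
  then show "\<exists>n. \<forall>W W'. folner n W \<longrightarrow> folner n W' \<longrightarrow>
     T.nrm (\<lambda>y. ax W (\<lambda>y. c * f y) y - ax W' (\<lambda>y. c * f y) y) \<le> \<epsilon>" by blast
qed

lemma Cauchy_space_zero: "(\<lambda>_. 0) \<in> Cauchy_space"
proof -
  have "ax W (\<lambda>_. 0) = (\<lambda>_. 0)" for W
    by (simp add: ax_def sh_const avg_def)
  then show ?thesis
    by (simp add: Cauchy_space_def T.A_const T.nrm_def T.ip_def)
qed

text \<open>If the averages of \<open>u\<close> stayed large on ever more invariant lists, a
  diagonal choice of such lists would give a family \<open>s\<close> of dual functions in
  \<open>Cauchy_space\<close> for which \<open>T.ip u s\<close> is at least
  \<open>\<epsilon>\<^sup>2\<close>, against the near orthogonality of \<open>u\<close>.\<close>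

lemma small_part:
  assumes u: "u \<in> ext A" and \<delta>: "\<delta> \<ge> 0" and \<epsilon>: "\<epsilon> > 0"
    and orth: "\<And>s. s \<in> Cauchy_space \<Longrightarrow> cmod (T.ip u s) \<le> \<delta> * T.nrm s"
    and lt: "\<delta> * (bd * (bd * T.nrm u)) < \<epsilon>\<^sup>2"
    and dual: "\<And>\<W> c K. (\<And>N. \<W> N \<noteq> []) \<Longrightarrow> (\<And>n. eventually (\<lambda>N. folner n (\<W> N)) ultra) \<Longrightarrow>
      (\<And>N. c N \<in> A) \<Longrightarrow> (\<And>N y. cmod (c N y) \<le> K) \<Longrightarrow> glue (\<lambda>(N, w). dw (\<W> N) (c N)) \<in> Cauchy_space"
  shows "\<exists>n. \<forall>W. folner n W \<longrightarrow> T.nrm (ax W u) \<le> \<epsilon>"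
proof (rule ccontr)
  assume "\<nexists>n. \<forall>W. folner n W \<longrightarrow> T.nrm (ax W u) \<le> \<epsilon>"
  then have "\<forall>n. \<exists>W. folner n W \<and> T.nrm (ax W u) > \<epsilon>" by (meson not_le)
  then obtain V where V: "\<And>n. folner n (V n)" "\<And>n. T.nrm (ax (V n) u) > \<epsilon>" by metis
  define us where "us = (\<lambda>N. slice u (N, 0))"
  have usA: "us N \<in> A" for N unfolding us_def by (rule ext_slice[OF u])
  obtain K where K: "\<And>N y. cmod (us N y) \<le> K"
    using ext_bound_slice[OF u] unfolding us_def by blast
  define B where "B = (\<lambda>n N. \<epsilon> < nrm (aw (V n) (us N)))"
  have B: "eventually (B n) ultra" for n
    using order_tendstoD(1)[OF tendsto_nrm_slice[OF ax_ext[OF u]] V(2)]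
    unfolding B_def us_def slice_ax .
  \<comment> \<open>The largest index up to \<open>N\<close> for which the average is still large in
    slice \<open>N\<close>; it tends to infinity along \<open>ultra\<close>. The inserted
    \<open>0\<close> keeps the set non-empty, and \<open>B 0 N\<close> below makes that default a
    valid index too.\<close>
  define sel where "sel = (\<lambda>N. Max (insert 0 {n. n \<le> N \<and> B n N}))"
  have fin: "finite (insert 0 {n. n \<le> N \<and> B n N})" for N by simp
  have sel_ge: "eventually (\<lambda>N. n \<le> sel N \<and> B (sel N) N) ultra" for n
  proof -
    have "eventually (\<lambda>N. B n N \<and> B 0 N \<and> n \<le> N) ultra"
      by (intro eventually_conj B eventually_ultra_ge)
    then show ?thesis
    proof (rule eventually_mono)
      fix N assume N: "B n N \<and> B 0 N \<and> n \<le> N"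
      then have "n \<le> sel N" unfolding sel_def by (intro Max_ge fin) auto
      moreover have "sel N \<in> insert 0 {n. n \<le> N \<and> B n N}" unfolding sel_def by (intro Max_in fin) auto
      ultimately show "n \<le> sel N \<and> B (sel N) N" using N by auto
    qed
  qed
  define \<W> where "\<W> = (\<lambda>N. V (sel N))"
  have ne: "\<W> N \<noteq> []" for N unfolding \<W>_def using V(1) folner_not_Nil by blast
  have fo: "eventually (\<lambda>N. folner n (\<W> N)) ultra" for n
    using sel_ge[of n] unfolding \<W>_def by (rule eventually_mono) (use V(1) folner_mono in blast)
  define c where "c = (\<lambda>N. aw (\<W> N) (us N))"
  have cA: "c N \<in> A" for N unfolding c_def by (rule aw_A[OF usA])
  define s where "s = glue (\<lambda>(N, w :: 'g). dw (\<W> N) (c N))"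
  have s: "s \<in> Cauchy_space" unfolding s_def
    using norm_aw_le[OF ne K] by (intro dual[OF ne fo cA]) (auto simp: c_def)
  then have sX: "s \<in> ext A" by (simp add: Cauchy_space_def)
  have slice_s: "slice s (N, w) = dw (\<W> N) (c N)" for N w by (simp add: s_def)
  have "((\<lambda>N. ip (us N) (dw (\<W> N) (c N))) \<longlongrightarrow> T.ip u s) ultra"
    using tendsto_ip_ext[OF traced_algebra_axioms _ u sX, of "\<lambda>_. [0]"] by (simp add: slice_s us_def)
  \<comment> \<open>Pairing \<open>u\<close> with the dual function made from its own average gives
    the squared norm of the average.\<close>
  moreover have "ip (us N) (dw (\<W> N) (c N)) = ip (c N) (c N)" for N
    using adjoint[OF usA cA, of "\<W> N"] by (simp add: c_def)
  ultimately have "((\<lambda>N. ip (c N) (c N)) \<longlongrightarrow> T.ip u s) ultra"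
    by simp
  then have "((\<lambda>N. (nrm (c N))\<^sup>2) \<longlongrightarrow> Re (T.ip u s)) ultra"
    using nrm_power2[OF cA] by (auto dest: tendsto_Re)
  moreover have "eventually (\<lambda>N. \<epsilon>\<^sup>2 \<le> (nrm (c N))\<^sup>2) ultra"
    using sel_ge[of 0]
    by (rule eventually_mono) (use \<epsilon> in \<open>auto simp: B_def c_def \<W>_def intro!: power_mono\<close>)
  ultimately have "\<epsilon>\<^sup>2 \<le> Re (T.ip u s)" by (rule tendsto_lowerbound) simp
  also have "\<dots> \<le> \<delta> * T.nrm s" using orth[OF s] complex_Re_le_cmod[of "T.ip u s"] by linarith
  also have "T.nrm s \<le> bd * (bd * T.nrm u)"
  proof (rule tendsto_le[OF _ _ tendsto_nrm_slice[OF sX]])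
    show "((\<lambda>N. bd * (bd * nrm (us N))) \<longlongrightarrow> bd * (bd * T.nrm u)) ultra"
      unfolding us_def by (intro tendsto_mult tendsto_const tendsto_nrm_slice u)
    have "nrm (slice s (N, 0)) \<le> bd * (bd * nrm (us N))" for N
    proof -
      have "nrm (dw (\<W> N) (c N)) \<le> bd * nrm (c N)" by (rule nrm_dw_le[OF ne cA])
      also have "\<dots> \<le> bd * (bd * nrm (us N))"
        unfolding c_def using bd(1) by (intro mult_left_mono nrm_aw_le[OF ne usA]) auto
      finally show ?thesis by (simp add: slice_s)
    qed
    then show "eventually (\<lambda>N. nrm (slice s (N, 0)) \<le> bd * (bd * nrm (us N))) ultra" by simp
  qed simp
  finally show False using lt \<delta> by (simp add: mult_left_mono)
qed

text \<open>Translating the summation variable of a dual function in \<open>T\<^bsup>\<phi> w'\<^esup> \<sigma>\<close> by \<open>w'\<close> removes the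
  shift by \<open>\<phi> w'\<close>, so that only \<open>length fs\<close> functions depend on \<open>w'\<close>.\<close>

definition red_fs :: "(('g \<Rightarrow> int) \<times> (('g, 'b) pt \<Rightarrow> complex)) list" where
  "red_fs = map (\<lambda>(\<psi>, f). (\<psi>, glue (\<lambda>(N, w) y. f y * sh (\<psi> w - \<phi> w) (\<lambda>y. cnj (f y)) y))) fs"

lemma valid_red_fs: "valid (ext A) red_fs"
  unfolding valid_def red_fs_def
proof (clarsimp)
  fix \<psi> and f :: "('g, 'b) pt \<Rightarrow> complex"
  assume "(\<psi>, f) \<in> set fs"
  then have \<psi>: "Modules.additive \<psi>" and f: "f \<in> A" using fs by (auto simp: valid_def)
  obtain C where C: "C > 0" "\<And>y. cmod (f y) \<le> C" using norm_bound_pos[OF f] by blast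
  have "cmod (sh (\<psi> w - \<phi> w) (\<lambda>y. cnj (f y)) y) \<le> C" for w y
    by (rule norm_sh_le) (simp add: C)
  then have "cmod (f y * sh (\<psi> w - \<phi> w) (\<lambda>y. cnj (f y)) y) \<le> C * C" for w y
    unfolding norm_mult using C by (intro mult_mono) auto
  moreover have "(\<lambda>y. f y * sh (\<psi> w - \<phi> w) (\<lambda>y. cnj (f y)) y) \<in> A" for w
    by (intro A_mult A_sh A_cnj f)
  ultimately have "glue (\<lambda>(N, w) y. f y * sh (\<psi> w - \<phi> w) (\<lambda>y. cnj (f y)) y) \<in> ext A"
    by (intro glue_in_ext[of _ _ "C * C"]) (auto simp only: split: prod.splits)
  with \<psi> show "Modules.additive \<psi> \<and> glue (\<lambda>(N, w) y. f y * sh (\<psi> w - \<phi> w) (\<lambda>y. cnj (f y)) y) \<in> ext A" ..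
qed

text \<open>Additivity of \<open>\<psi>\<close> turns the shift by
  \<open>\<psi> w' + \<psi> w - \<phi> w\<close> into one by
  \<open>\<psi> (w + w') - \<phi> w\<close>.\<close>

lemma slice_lp_red_fs:
  "slice (lp red_fs w') (N, w) y = lp fs w' y * sh (- \<phi> w) (\<lambda>y. cnj (lp fs (w + w') y)) y"
  using fs unfolding red_fs_def
proof (induction fs)
  case Nil
  then show ?case by (simp add: slice_def sh_def split: prod.splits)
next
  case (Cons p gs)
  obtain \<psi> f where p: "p = (\<psi>, f)" by (cases p)
  have \<psi>: "\<psi> (w + w') = \<psi> w + \<psi> w'" using Cons.prems p by (simp add: additive.add)
  have IH: "slice (lp (map (\<lambda>(\<psi>, f). (\<psi>, glue (\<lambda>(N, w) y. f y * sh (\<psi> w - \<phi> w) (\<lambda>y. cnj (f y)) y))) gs) w') (N, w) y =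
    lp gs w' y * sh (- \<phi> w) (\<lambda>y. cnj (lp gs (w + w') y)) y" using Cons p by simp
  have "slice (lp (map (\<lambda>(\<psi>, f). (\<psi>, glue (\<lambda>(N, w) y. f y * sh (\<psi> w - \<phi> w) (\<lambda>y. cnj (f y)) y))) (p # gs)) w') (N, w) y =
    sh (\<psi> w') (\<lambda>y. f y * sh (\<psi> w - \<phi> w) (\<lambda>y. cnj (f y)) y) y * (lp gs w' y * sh (- \<phi> w) (\<lambda>y. cnj (lp gs (w + w') y)) y)"
    unfolding IH[symmetric] p
    by (simp add: slice_def glue_def sh_def split: prod.splits)
  also have "\<dots> = lp (p # gs) w' y * sh (- \<phi> w) (\<lambda>y. cnj (lp (p # gs) (w + w') y)) y"
    by (simp add: p sh_mult sh_cnj \<psi> algebra_simps)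
  finally show ?case .
qed

text \<open>Replacing the averaging variable \<open>w\<close> of the dual function by
  \<open>w + w'\<close> costs one use of almost invariance. The factor \<open>\<xi> w'\<close> then
  cancels against \<open>cnj (\<xi> (w + w'))\<close>, which is why the induction hypothesis is
  needed for the trivial character only.\<close>

lemma dual_shift:
  assumes W: "folner n W" and w': "to_nat w' \<le> n" and c: "\<And>y. cmod (c y) \<le> K"
  shows "cmod (\<xi> w' * (sh (\<phi> w') (dw W c) y * lp fs w' y) -
     avg W (\<lambda>w. (cnj (\<xi> w) * sh (- \<phi> w) c y) * slice (lp red_fs w') (N, w) y)) \<le> bd * K * bd / (real n + 1)"
proof -
  have K: "0 \<le> K" using c norm_ge_zero order_trans by blast
  define v where "v = (\<lambda>w. cnj (\<xi> w) * sh (\<phi> w' - \<phi> w) (\<lambda>y. cnj (lp fs w y) * c y) y)"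
  have "cmod (cnj (lp fs w y) * c y) \<le> bd * K" for w y
    unfolding norm_mult complex_mod_cnj by (intro mult_mono bd c) (use bd in auto)
  then have "cmod (sh (\<phi> w' - \<phi> w) (\<lambda>y. cnj (lp fs w y) * c y) y) \<le> bd * K" for w
    by (rule norm_sh_le)
  then have "cmod (v w) \<le> bd * K" for w by (simp add: v_def norm_mult norm_character[OF \<xi>])
  then have 1: "cmod (avg W (\<lambda>w. v (w + w')) - avg W v) \<le> bd * K / (real n + 1)"
    by (rule folner_bound[OF W w'])
  have "sh (\<phi> w') (dw W c) y = avg W v"
    by (simp add: dw_def v_def sh_avg sh_mult sh_const)
  moreover have "(cnj (\<xi> w) * sh (- \<phi> w) c y) * slice (lp red_fs w') (N, w) y = (\<xi> w' * lp fs w' y) * v (w + w')" for w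
  proof -
    have "v (w + w') = cnj (\<xi> w) * cnj (\<xi> w') * (sh (- \<phi> w) (\<lambda>y. cnj (lp fs (w + w') y)) y * sh (- \<phi> w) c y)"
      by (simp add: v_def character_add[OF \<xi>] additive.add[OF \<phi>] sh_mult)
    then show ?thesis unfolding slice_lp_red_fs using character_mult_cnj[OF \<xi>, of w']
      by (simp add: mult_ac)
  qed
  ultimately have "\<xi> w' * (sh (\<phi> w') (dw W c) y * lp fs w' y) -
     avg W (\<lambda>w. (cnj (\<xi> w) * sh (- \<phi> w) c y) * slice (lp red_fs w') (N, w) y) =
     (\<xi> w' * lp fs w' y) * (avg W v - avg W (\<lambda>w. v (w + w')))"
    by (simp only: avg_cmult) (simp add: algebra_simps)
  also have "cmod \<dots> = cmod (lp fs w' y) * cmod (avg W (\<lambda>w. v (w + w')) - avg W v)"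
    by (simp add: norm_mult norm_character[OF \<xi>] norm_minus_commute)
  also have "\<dots> \<le> bd * (bd * K / (real n + 1))"
    by (intro mult_mono 1 bd) (use bd in auto)
  finally show ?thesis by (simp add: mult_ac)
qed

text \<open>By \<open>dual_shift\<close> the difference of two averages of \<open>s\<close> is, up
  to a small error, an average over \<open>\<W> N\<close> of bounded functions times slices of
  \<open>d\<close>, the difference of two averages of \<open>red_fs\<close>. Its norm is at most
  \<open>K\<close> times the root mean square of the norms of these slices, which tends to the norm
  of \<open>d\<close> for the trace built from \<open>\<W>\<close>; there the induction hypothesis
  applies.\<close>

lemma dual_in_Cauchy_space:
  assumes IH: "\<And>tr' gs \<epsilon>. traced_algebra (ext A) tr' \<Longrightarrow> valid (ext A) gs \<Longrightarrow> length gs = length fs \<Longrightarrow> \<epsilon> > 0 \<Longrightarrow>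
      \<exists>n. \<forall>W W'. folner n W \<longrightarrow> folner n W' \<longrightarrow>
        traced_algebra.nrm tr' (\<lambda>y. mav (\<lambda>_. 1) gs W y - mav (\<lambda>_. 1) gs W' y) \<le> \<epsilon>"
    and ne: "\<And>N. \<W> N \<noteq> []" and fo: "\<And>n. eventually (\<lambda>N. folner n (\<W> N)) ultra"
    and cA: "\<And>N. c N \<in> A" and K: "\<And>N y. cmod (c N y) \<le> K"
  shows "glue (\<lambda>(N, w). dw (\<W> N) (c N)) \<in> Cauchy_space"
proof -
  define s where "s = glue (\<lambda>(N, w :: 'g). dw (\<W> N) (c N))"
  have K0: "0 \<le> K" using K norm_ge_zero order_trans by blast
  have slice_s: "slice s (N, w) = dw (\<W> N) (c N)" for N w by (simp add: s_def)
  have sX: "s \<in> ext A" unfolding s_def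
  proof (rule glue_in_ext)
    fix p and y :: "('g, 'b) pt"
    show "(case p of (N, w) \<Rightarrow> dw (\<W> N) (c N)) \<in> A" by (simp add: dw_A cA split: prod.split)
    show "cmod ((case p of (N, w) \<Rightarrow> dw (\<W> N) (c N)) y) \<le> bd * K"
      using norm_dw_le[OF ne K] by (simp split: prod.split del: split_paired_All)
  qed
  interpret T2: traced_algebra "ext A" "trext \<W> tr"
    by (rule traced_algebra_ext[OF traced_algebra_axioms ne])
  have "\<exists>n. \<forall>W W'. folner n W \<longrightarrow> folner n W' \<longrightarrow> T.nrm (\<lambda>y. ax W s y - ax W' s y) \<le> \<epsilon>"
    if \<epsilon>: "\<epsilon> > 0" for \<epsilon>
  proof -
    define \<eta> where "\<eta> = \<epsilon> / (2 * (K + 1))"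
    have \<eta>: "\<eta> > 0" "K * \<eta> \<le> \<epsilon> / 2" using \<epsilon> K0 by (auto simp: \<eta>_def field_simps)
    obtain n where n: "\<And>W W'. folner n W \<Longrightarrow> folner n W' \<Longrightarrow>
        T2.nrm (\<lambda>y. mav (\<lambda>_. 1) red_fs W y - mav (\<lambda>_. 1) red_fs W' y) \<le> \<eta>"
      using IH[OF T2.traced_algebra_axioms valid_red_fs _ \<eta>(1)] by (auto simp: red_fs_def)
    have "T.nrm (\<lambda>y. ax W s y - ax W' s y) \<le> \<epsilon>" if W: "folner n W" "folner n W'" for W W'
    proof -
      have lpX: "lp red_fs w \<in> ext A" for w
        by (rule lp_in_A[OF T.traced_algebra_axioms valid_red_fs])
      have mavX: "mav (\<lambda>_. 1) red_fs V \<in> ext A" for V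
      proof -
        have "(\<lambda>y. avg V (\<lambda>w. 1 * lp red_fs w y)) \<in> ext A"
          by (intro T.A_avg T.A_mult T.A_const lpX)
        then show ?thesis by (simp add: mav_def[abs_def])
      qed
      define d where "d = (\<lambda>y. mav (\<lambda>_. 1) red_fs W y - mav (\<lambda>_. 1) red_fs W' y)"
      have dX: "d \<in> ext A" unfolding d_def by (intro T.A_diff mavX)
      \<comment> \<open>\<open>W\<close> and \<open>W'\<close> are finite and already fixed, so
        \<open>m\<close> may exceed the indices of all their elements; \<open>\<W> N\<close> is
        \<open>folner m\<close> for \<open>ultra\<close>-almost all \<open>N\<close>.\<close>
      obtain m where m: "m \<ge> Max (to_nat ` (set W \<union> set W'))"
        and r: "2 * (bd * K * bd) / (real m + 1) \<le> \<epsilon> / 2"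
        using ex_div_Suc_le[of "\<epsilon> / 2"] \<epsilon> by (metis half_gt_zero)
      have m: "to_nat w \<le> m" if "w \<in> set W \<union> set W'" for w
        using m that by (meson Max_ge List.finite_set finite_UnI finite_imageI imageI order_trans)
      define R where "R = (\<lambda>N. avg (\<W> N) (\<lambda>w. (nrm (slice d (N, w)))\<^sup>2))"
      have R: "(R \<longlongrightarrow> (T2.nrm d)\<^sup>2) ultra"
      proof -
        have "((\<lambda>N. Re (avg (\<W> N) (\<lambda>w. ip (slice d (N, w)) (slice d (N, w))))) \<longlongrightarrow> Re (T2.ip d d)) ultra"
          by (intro tendsto_Re tendsto_ip_ext[OF traced_algebra_axioms ne] dX)
        then show ?thesis by (simp add: R_def Re_avg nrm_power2 ext_slice[OF dX] T2.nrm_power2[OF dX])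
      qed
      have main: "nrm (slice (\<lambda>y. ax W s y - ax W' s y) (N, 0)) \<le> 2 * (bd * K * bd) / (real m + 1) + K * sqrt (R N)"
        if N: "folner m (\<W> N)" for N
      proof -
        define g where "g = (\<lambda>w y. cnj (\<xi> w) * sh (- \<phi> w) (c N) y)"
        have gA: "g w \<in> A" for w unfolding g_def by (intro A_mult A_const A_sh cA)
        have g: "cmod (g w y) \<le> K" for w y
          by (simp add: g_def norm_mult norm_character[OF \<xi>] norm_sh_le K)
        have app: "cmod (slice (ax V s) (N, 0) y - avg (\<W> N) (\<lambda>w. g w y * slice (mav (\<lambda>_. 1) red_fs V) (N, w) y))
            \<le> bd * K * bd / (real m + 1)" if V: "V \<noteq> []" "\<And>v. v \<in> set V \<Longrightarrow> to_nat v \<le> m" for V y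
        proof -
          have mav_slice: "slice (mav (\<lambda>_. 1) red_fs V) p y = avg V (\<lambda>w'. slice (lp red_fs w') p y)" for p
            by (simp add: mav_def slice_def split: prod.splits)
          have "slice (ax V s) (N, 0) y = avg V (\<lambda>w'. \<xi> w' * (sh (\<phi> w') (dw (\<W> N) (c N)) y * lp fs w' y))"
            by (simp add: slice_ax slice_s aw_def)
          moreover have "avg (\<W> N) (\<lambda>w. g w y * slice (mav (\<lambda>_. 1) red_fs V) (N, w) y) =
              avg V (\<lambda>w'. avg (\<W> N) (\<lambda>w. g w y * slice (lp red_fs w') (N, w) y))"
            unfolding mav_slice avg_cmult[symmetric] by (rule avg_swap)
          ultimately show ?thesis
            unfolding g_def by (simp only: avg_diff[symmetric]) (intro norm_avg_le dual_shift N K V)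
        qed
        define L where "L = slice (\<lambda>y. ax W s y - ax W' s y) (N, 0)"
        define G where "G = (\<lambda>y. avg (\<W> N) (\<lambda>w. g w y * slice d (N, w) y))"
        have LA: "L \<in> A" unfolding L_def by (intro ext_slice T.A_diff ax_ext sX)
        have GA: "G \<in> A" unfolding G_def by (intro A_avg A_mult gA ext_slice[OF dX])
        have "cmod (L y - G y) \<le> 2 * (bd * K * bd) / (real m + 1)" for y
        proof -
          let ?A = "\<lambda>V. slice (ax V s) (N, 0) y" and ?B = "\<lambda>V. avg (\<W> N) (\<lambda>w. g w y * slice (mav (\<lambda>_. 1) red_fs V) (N, w) y)"
          have eq: "L y - G y = (?A W - ?B W) - (?A W' - ?B W')"
            unfolding L_def G_def d_def slice_diff right_diff_distrib avg_diff by simp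
          have "cmod (L y - G y) \<le> cmod (?A W - ?B W) + cmod (?A W' - ?B W')"
            unfolding eq by (rule norm_triangle_ineq4)
          also have "\<dots> \<le> bd * K * bd / (real m + 1) + bd * K * bd / (real m + 1)"
          proof (rule add_mono)
            show "cmod (?A W - ?B W) \<le> bd * K * bd / (real m + 1)"
              by (rule app[OF folner_not_Nil[OF W(1)]]) (rule m, simp)
            show "cmod (?A W' - ?B W') \<le> bd * K * bd / (real m + 1)"
              by (rule app[OF folner_not_Nil[OF W(2)]]) (rule m, simp)
          qed
          also have "\<dots> = 2 * (bd * K * bd) / (real m + 1)" by (simp add: mult_ac)
          finally show ?thesis .
        qed
        then have 1: "nrm (\<lambda>y. L y - G y) \<le> 2 * (bd * K * bd) / (real m + 1)"
          by (intro nrm_le_const A_diff LA GA)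
        have "(nrm G)\<^sup>2 \<le> avg (\<W> N) (\<lambda>w. (nrm (\<lambda>y. g w y * slice d (N, w) y))\<^sup>2)"
          unfolding G_def by (intro nrm_avg_power2_le A_mult gA ext_slice[OF dX])
        also have "\<dots> \<le> avg (\<W> N) (\<lambda>w. K\<^sup>2 * (nrm (slice d (N, w)))\<^sup>2)"
          unfolding power_mult_distrib[symmetric]
          by (intro avg_mono power_mono nrm_mult_le gA g ext_slice[OF dX] nrm_nonneg A_mult)
        also have "\<dots> = K\<^sup>2 * R N" by (simp add: avg_cmult R_def)
        finally have "nrm G \<le> K * sqrt (R N)"
          using real_le_rsqrt K0 by (fastforce simp: real_sqrt_mult)
        moreover have "nrm L \<le> nrm (\<lambda>y. L y - G y) + nrm G"
          using nrm_triangle[OF A_diff[OF LA GA] GA] by simp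
        ultimately show ?thesis using 1 unfolding L_def by linarith
      qed
      have "T.nrm (\<lambda>y. ax W s y - ax W' s y) \<le> 2 * (bd * K * bd) / (real m + 1) + K * sqrt ((T2.nrm d)\<^sup>2)"
      proof (rule tendsto_le[OF _ _ tendsto_nrm_slice])
        show "((\<lambda>N. 2 * (bd * K * bd) / (real m + 1) + K * sqrt (R N)) \<longlongrightarrow>
            2 * (bd * K * bd) / (real m + 1) + K * sqrt ((T2.nrm d)\<^sup>2)) ultra"
          by (intro tendsto_intros R)
        show "eventually (\<lambda>N. nrm (slice (\<lambda>y. ax W s y - ax W' s y) (N, 0)) \<le>
            2 * (bd * K * bd) / (real m + 1) + K * sqrt (R N)) ultra"
          using fo[of m] by (rule eventually_mono) (rule main)
      qed (auto intro: T.A_diff ax_ext sX)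
      also have "\<dots> \<le> \<epsilon> / 2 + K * \<eta>"
        using r n[OF W] K0 T2.nrm_nonneg[OF dX] by (intro add_mono mult_left_mono) (auto simp: d_def)
      also have "\<dots> \<le> \<epsilon>" using \<eta> by simp
      finally show ?thesis .
    qed
    then show ?thesis by blast
  qed
  then show ?thesis using sX unfolding Cauchy_space_def s_def by blast
qed

lemma mav_Cauchy_step:
  assumes IH: "\<And>tr' gs \<epsilon>. traced_algebra (ext A) tr' \<Longrightarrow> valid (ext A) gs \<Longrightarrow> length gs = length fs \<Longrightarrow> \<epsilon> > 0 \<Longrightarrow>
      \<exists>n. \<forall>W W'. folner n W \<longrightarrow> folner n W' \<longrightarrow>
        traced_algebra.nrm tr' (\<lambda>y. mav (\<lambda>_. 1) gs W y - mav (\<lambda>_. 1) gs W' y) \<le> \<epsilon>"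
    and f: "f \<in> A" and \<epsilon>: "\<epsilon> > 0"
  shows "\<exists>n. \<forall>W W'. folner n W \<longrightarrow> folner n W' \<longrightarrow>
      nrm (\<lambda>y. mav \<xi> ((\<phi>, f) # fs) W y - mav \<xi> ((\<phi>, f) # fs) W' y) \<le> \<epsilon>"
proof -
  define F where "F = glue (\<lambda>_ :: nat \<times> 'g. f)"
  obtain C where C: "\<And>y. cmod (f y) \<le> C" using A_bdd[OF f] by blast
  have FX: "F \<in> ext A" unfolding F_def by (rule glue_in_ext[of _ _ C]) (auto simp only: f C)
  \<comment> \<open>Bounds \<open>bd * (bd * T.nrm u)\<close> for the remainder \<open>u\<close>,
    because \<open>\<delta> \<le> 1\<close>; the factor \<open>2\<close> in \<open>\<delta>\<close>
    makes the inequality required by \<open>small_part\<close> strict.\<close>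
  define X where "X = bd * (bd * (T.nrm F + 1))"
  have X: "X > 0" using bd(1) T.nrm_nonneg[OF FX] by (simp add: X_def add_nonneg_pos)
  define \<delta> where "\<delta> = min 1 ((\<epsilon> / 3)\<^sup>2 / (2 * X))"
  have \<delta>: "\<delta> > 0" "\<delta> \<le> 1" using \<epsilon> X by (auto simp: \<delta>_def)
  have "\<delta> * X \<le> (\<epsilon> / 3)\<^sup>2 / (2 * X) * X" using X by (intro mult_right_mono) (auto simp: \<delta>_def)
  also have "\<dots> < (\<epsilon> / 3)\<^sup>2" using X \<epsilon> by simp
  finally have \<delta>X: "\<delta> * X < (\<epsilon> / 3)\<^sup>2" .
  have "Cauchy_space \<subseteq> ext A" by (auto simp: Cauchy_space_def)
  then obtain e where e: "e \<in> Cauchy_space" and un: "T.nrm (\<lambda>y. F y - e y) \<le> T.nrm F + \<delta>"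
    and orth: "\<And>s. s \<in> Cauchy_space \<Longrightarrow> cmod (T.ip (\<lambda>y. F y - e y) s) \<le> \<delta> * T.nrm s"
    using T.almost_projection[OF _ Cauchy_space_zero Cauchy_space_add Cauchy_space_cmult FX \<delta>(1)] by blast
  have eX: "e \<in> ext A" using e by (simp add: Cauchy_space_def)
  define u where "u = (\<lambda>y. F y - e y)"
  have uX: "u \<in> ext A" unfolding u_def by (intro T.A_diff FX eX)
  have "bd * (bd * T.nrm u) \<le> X"
    unfolding X_def using un \<delta>(2) bd(1) by (intro mult_left_mono) (auto simp: u_def)
  then have lt: "\<delta> * (bd * (bd * T.nrm u)) < (\<epsilon> / 3)\<^sup>2"
    using \<delta>X \<delta>(1) by (meson le_less_trans less_imp_le mult_left_mono)
  have "\<exists>n. \<forall>W. folner n W \<longrightarrow> T.nrm (ax W u) \<le> \<epsilon> / 3"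
    using \<epsilon> \<delta>(1) orth by (intro small_part[OF uX _ _ _ lt] dual_in_Cauchy_space[OF IH]) (auto simp: u_def)
  then obtain n1 where n1: "\<And>W. folner n1 W \<Longrightarrow> T.nrm (ax W u) \<le> \<epsilon> / 3" by blast
  have "\<epsilon> / 3 > 0" using \<epsilon> by simp
  then obtain n2 where n2: "\<And>W W'. folner n2 W \<Longrightarrow> folner n2 W' \<Longrightarrow> T.nrm (\<lambda>y. ax W e y - ax W' e y) \<le> \<epsilon> / 3"
    using e unfolding Cauchy_space_def by blast
  have mav_aw: "mav \<xi> ((\<phi>, f) # fs) W = aw W f" for W
    by (simp add: mav_def[abs_def] aw_def)
  have "nrm (\<lambda>y. mav \<xi> ((\<phi>, f) # fs) W y - mav \<xi> ((\<phi>, f) # fs) W' y) \<le> \<epsilon>"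
    if W: "folner (max n1 n2) W" "folner (max n1 n2) W'" for W W'
  proof -
    have W: "folner n1 W" "folner n1 W'" "folner n2 W" "folner n2 W'" using W by (auto intro: folner_mono)
    have F: "F = (\<lambda>y. e y + u y)" by (simp add: u_def)
    have "slice (\<lambda>y. ax W F y - ax W' F y) p = (\<lambda>y. aw W f y - aw W' f y)" for p
      unfolding slice_diff slice_ax by (simp add: F_def)
    \<comment> \<open>All slices of a constant family coincide, so its norm in the ultraproduct is
      the original one.\<close>
    then have "((\<lambda>N. nrm (\<lambda>y. aw W f y - aw W' f y)) \<longlongrightarrow> T.nrm (\<lambda>y. ax W F y - ax W' F y)) ultra"
      using tendsto_nrm_slice[OF T.A_diff[OF ax_ext[OF FX, of W] ax_ext[OF FX, of W']]] by simp
    then have "nrm (\<lambda>y. aw W f y - aw W' f y) = T.nrm (\<lambda>y. ax W F y - ax W' F y)"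
      by (simp add: tendsto_const_iff)
    also have "\<dots> = T.nrm (\<lambda>y. (ax W e y - ax W' e y) + (ax W u y - ax W' u y))"
      unfolding F ax_add by (simp add: algebra_simps)
    also have "\<dots> \<le> T.nrm (\<lambda>y. ax W e y - ax W' e y) + T.nrm (\<lambda>y. ax W u y - ax W' u y)"
      by (intro T.nrm_triangle T.A_diff ax_ext eX uX)
    also have "T.nrm (\<lambda>y. ax W u y - ax W' u y) \<le> T.nrm (ax W u) + T.nrm (\<lambda>y. (- 1) * ax W' u y)"
      using T.nrm_triangle[OF ax_ext[OF uX] T.A_cmult[OF ax_ext[OF uX]], of W "-1" W'] by simp
    also have "T.nrm (\<lambda>y. (- 1) * ax W' u y) = T.nrm (ax W' u)"
      by (subst T.nrm_cmult[OF ax_ext[OF uX]]) simp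
    finally show ?thesis using n1[OF W(1)] n1[OF W(2)] n2[OF W(3,4)] unfolding mav_aw by linarith
  qed
  then show ?thesis by blast
qed

end

text \<open>A translation by \<open>g\<close> multiplies the average by \<open>\<xi> g\<close>; if
  \<open>\<xi> g \<noteq> 1\<close>, almost invariance forces the averages towards
  \<open>0\<close>.\<close>

lemma avg_character_Cauchy:
  fixes \<xi> :: "'g::{countable, ab_group_add} \<Rightarrow> complex"
  assumes \<xi>: "character \<xi>" and \<epsilon>: "\<epsilon> > 0"
  shows "\<exists>n. \<forall>W W'. folner n W \<longrightarrow> folner n W' \<longrightarrow> cmod (avg W \<xi> - avg W' \<xi>) \<le> \<epsilon>"
proof (cases "\<forall>g. \<xi> g = 1")
  case True
  then have "\<xi> = (\<lambda>_. 1)" by auto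
  then have "cmod (avg W \<xi> - avg W' \<xi>) \<le> \<epsilon>" if "folner 0 W" "folner 0 W'" for W W'
    using \<epsilon> folner_not_Nil[OF that(1)] folner_not_Nil[OF that(2)] by simp
  then show ?thesis by blast
next
  case False
  then obtain g where g: "\<xi> g \<noteq> 1" by blast
  have p: "\<epsilon> / 2 * cmod (\<xi> g - 1) > 0" using g \<epsilon> by simp
  obtain n where n: "to_nat g \<le> n" "1 / (real n + 1) \<le> \<epsilon> / 2 * cmod (\<xi> g - 1)"
    using ex_div_Suc_le[OF p, of "to_nat g" 1] by blast
  have "cmod (avg W \<xi>) \<le> \<epsilon> / 2" if "folner n W" for W
  proof -
    have "cmod (avg W (\<lambda>w. \<xi> (w + g)) - avg W \<xi>) \<le> 1 / (real n + 1)"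
      by (rule folner_bound[OF that n(1)]) (simp add: norm_character[OF \<xi>])
    moreover have "avg W (\<lambda>w. \<xi> (w + g)) - avg W \<xi> = avg W \<xi> * (\<xi> g - 1)"
      by (simp add: character_add[OF \<xi>] avg_multc algebra_simps)
    ultimately have "cmod (avg W \<xi>) * cmod (\<xi> g - 1) \<le> \<epsilon> / 2 * cmod (\<xi> g - 1)"
      using n(2) by (simp add: norm_mult)
    then show ?thesis using g by simp
  qed
  note half = this
  have "cmod (avg W \<xi> - avg W' \<xi>) \<le> \<epsilon>" if "folner n W" "folner n W'" for W W'
    using half[OF that(1)] half[OF that(2)] norm_triangle_ineq4[of "avg W \<xi>" "avg W' \<xi>"] by linarith
  then show ?thesis by blast
qed

text \<open>Algebra, trace and character vary in the induction: a step leads from \<open>A\<close>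
  to \<open>ext A\<close>, with a trace built from lists unknown beforehand.\<close>

theorem mav_Cauchy:
  fixes A :: "(('g::{countable, ab_group_add}, 'b) pt \<Rightarrow> complex) set"
  assumes "traced_algebra A tr" "character \<xi>" "valid A fs" "\<epsilon> > 0"
  shows "\<exists>n. \<forall>W W'. folner n W \<longrightarrow> folner n W' \<longrightarrow>
      traced_algebra.nrm tr (\<lambda>y. mav \<xi> fs W y - mav \<xi> fs W' y) \<le> \<epsilon>"
  using assms
proof (induction "length fs" arbitrary: A tr \<xi> fs \<epsilon>)
  case 0
  then interpret traced_algebra A tr by simp
  obtain n where n: "\<And>W W'. folner n W \<Longrightarrow> folner n W' \<Longrightarrow> cmod (avg W \<xi> - avg W' \<xi>) \<le> \<epsilon>"
    using avg_character_Cauchy[OF \<open>character \<xi>\<close> \<open>\<epsilon> > 0\<close>] by blast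
  have "nrm (\<lambda>y. mav \<xi> fs W y - mav \<xi> fs W' y) \<le> \<epsilon>" if "folner n W" "folner n W'" for W W'
    using nrm_le_const[OF A_const n[OF that]] 0 by (simp add: mav_def)
  then show ?case by blast
next
  case (Suc k)
  then obtain \<phi> f gs where fs_eq: "fs = (\<phi>, f) # gs" by (cases fs) auto
  have one: "character (\<lambda>_ :: 'g. 1)" by (simp add: character_def)
  interpret reduction_step A tr \<xi> \<phi> gs
    using Suc.prems by (intro reduction_step.intro reduction_step_axioms.intro) (auto simp: fs_eq)
  show ?case unfolding fs_eq
  proof (rule mav_Cauchy_step)
    fix tr' :: "(('g, 'b) pt \<Rightarrow> complex) \<Rightarrow> complex" and hs and \<epsilon> :: real
    assume "traced_algebra (ext A) tr'" "valid (ext A) hs" "length hs = length gs" "0 < \<epsilon>"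
    then show "\<exists>n. \<forall>W W'. folner n W \<longrightarrow> folner n W' \<longrightarrow>
        traced_algebra.nrm tr' (\<lambda>y. mav (\<lambda>_. 1) hs W y - mav (\<lambda>_. 1) hs W' y) \<le> \<epsilon>"
      using Suc.hyps fs_eq one by (intro Suc.hyps(1)) auto
  qed (use Suc.prems fs_eq in simp_all)
qed

section \<open>Invariant means\<close>

definition bdf :: "('b \<Rightarrow> complex) \<Rightarrow> bool" where
  "bdf f \<longleftrightarrow> (\<exists>C. \<forall>x. cmod (f x) \<le> C)"

lemma bdfI: "(\<And>x. cmod (f x) \<le> C) \<Longrightarrow> bdf f"
  by (auto simp: bdf_def)

lemma bdf_const [intro]: "bdf (\<lambda>_. c)"
  by (rule bdfI) auto

lemma bdf_comp: "bdf f \<Longrightarrow> bdf (\<lambda>x. f (g x))"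
  by (auto simp: bdf_def)

lemma bdf_add: "bdf f \<Longrightarrow> bdf g \<Longrightarrow> bdf (\<lambda>x. f x + g x)"
  unfolding bdf_def by (meson add_mono norm_triangle_le)

lemma bdf_mult: "bdf f \<Longrightarrow> bdf g \<Longrightarrow> bdf (\<lambda>x. f x * g x)"
  unfolding bdf_def norm_mult by (meson mult_mono norm_ge_zero order_trans)

lemma bdf_cmult: "bdf f \<Longrightarrow> bdf (\<lambda>x. c * f x)"
  by (intro bdf_mult bdf_const)

lemma bdf_diff: "bdf f \<Longrightarrow> bdf g \<Longrightarrow> bdf (\<lambda>x. f x - g x)"
  using bdf_add[of f "\<lambda>x. (-1) * g x"] bdf_cmult[of g "-1"] by simp

lemma bdf_cnj: "bdf f \<Longrightarrow> bdf (\<lambda>x. cnj (f x))"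
  by (auto simp: bdf_def)

lemma bdf_Re: "bdf f \<Longrightarrow> bdf (\<lambda>x. of_real (Re (f x)))"
  unfolding bdf_def by (auto intro: order_trans[OF abs_Re_le_cmod])

lemma bdf_avg:
  assumes "bdf f" shows "bdf (\<lambda>x. avg W (\<lambda>w. f (h w x)))"
proof (cases "W = []")
  case True
  then show ?thesis by (simp add: avg_def bdf_const)
next
  case False
  then show ?thesis using assms unfolding bdf_def by (meson norm_avg_le)
qed

locale inv_mean =
  fixes \<Phi> :: "('g::ab_group_add \<Rightarrow> complex) \<Rightarrow> complex"
  assumes add: "bdf f \<Longrightarrow> bdf g \<Longrightarrow> \<Phi> (\<lambda>x. f x + g x) = \<Phi> f + \<Phi> g"
    and cmult: "bdf f \<Longrightarrow> \<Phi> (\<lambda>x. c * f x) = c * \<Phi> f"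
    and one: "\<Phi> (\<lambda>_. 1) = 1"
    and bound: "(\<And>x. cmod (f x) \<le> C) \<Longrightarrow> cmod (\<Phi> f) \<le> C"
    and shift: "bdf f \<Longrightarrow> \<Phi> (\<lambda>x. f (x + h)) = \<Phi> f"
    and cnj: "bdf f \<Longrightarrow> \<Phi> (\<lambda>x. cnj (f x)) = cnj (\<Phi> f)"
begin

lemma const [simp]: "\<Phi> (\<lambda>_. c) = c"
  using cmult[of "\<lambda>_. 1" c] one by (simp add: bdf_const)

lemma diff: "bdf f \<Longrightarrow> bdf g \<Longrightarrow> \<Phi> (\<lambda>x. f x - g x) = \<Phi> f - \<Phi> g"
  using add[of f "\<lambda>x. (-1) * g x"] cmult[of g "-1"] bdf_cmult[of g "-1"] by simp

lemma bdf_bound: "bdf (\<lambda>x. \<Phi> (f x))" if b: "bdf (\<lambda>(x, y). f x y)"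
proof -
  obtain C where "\<And>x y. cmod (f x y) \<le> C" using b by (auto simp: bdf_def)
  then show ?thesis by (intro bdfI[of _ C] bound)
qed

lemma sum_list: "(\<And>w. w \<in> set W \<Longrightarrow> bdf (F w)) \<Longrightarrow> \<Phi> (\<lambda>x. \<Sum>w\<leftarrow>W. F w x) = (\<Sum>w\<leftarrow>W. \<Phi> (F w)) \<and> bdf (\<lambda>x. \<Sum>w\<leftarrow>W. F w x)"
  by (induction W) (auto simp: add bdf_add)

lemma avg_eq:
  assumes "\<And>w. w \<in> set W \<Longrightarrow> bdf (F w)"
  shows "\<Phi> (\<lambda>x. avg W (\<lambda>w. F w x)) = avg W (\<lambda>w. \<Phi> (F w))"
  using sum_list[of W F, OF assms] cmult[of "\<lambda>x. \<Sum>w\<leftarrow>W. F w x" "inverse (of_nat (length W))"]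
  by (simp add: avg_def divide_inverse mult.commute)

lemma avg_shift:
  assumes "bdf f" "W \<noteq> []"
  shows "\<Phi> (\<lambda>x. avg W (\<lambda>w. f (x + w))) = \<Phi> f"
  using avg_eq[of W "\<lambda>w x. f (x + w)", OF bdf_comp[OF assms(1)]] assms by (simp add: shift)

text \<open>A function with values in \<open>[0, C]\<close> is within \<open>C / 2\<close> of the constant \<open>C / 2\<close>, so positivity
  follows from the norm bound.\<close>

lemma nonneg_real:
  assumes "bdf f" "\<And>x. Im (f x) = 0 \<and> Re (f x) \<ge> 0"
  shows "Re (\<Phi> f) \<ge> 0"
proof -
  obtain C where C: "\<And>x. cmod (f x) \<le> C" using assms(1) by (auto simp: bdf_def)
  have "cmod (f x - of_real (C / 2)) \<le> C / 2" for x
  proof -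
    have "f x = of_real (Re (f x))" using assms(2) by (simp add: complex_eq_iff)
    then have eq: "f x - of_real (C / 2) = of_real (Re (f x) - C / 2)" by simp
    have "Re (f x) \<le> C" using C[of x] complex_Re_le_cmod order_trans by blast
    then show ?thesis unfolding eq norm_of_real using assms(2)[of x] by linarith
  qed
  then have "cmod (\<Phi> (\<lambda>x. f x - of_real (C / 2))) \<le> C / 2" by (rule bound)
  then have "cmod (\<Phi> f - of_real (C / 2)) \<le> C / 2" using assms(1) by (simp add: diff bdf_const)
  then show ?thesis using abs_Re_le_cmod[of "\<Phi> f - of_real (C / 2)"] by simp
qed

lemma Re_eq:
  assumes "bdf f"
  shows "\<Phi> (\<lambda>x. of_real (Re (f x))) = of_real (Re (\<Phi> f))"
proof -
  have "(\<lambda>x. complex_of_real (Re (f x))) = (\<lambda>x. (1/2) * (f x + cnj (f x)))"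
    by (intro HOL.ext complex_eqI) simp_all
  then show ?thesis
    using cmult[OF bdf_add[OF assms bdf_cnj[OF assms]], of "1/2"] assms
    by (simp add: add bdf_cnj cnj complex_eq_iff)
qed

lemma nonneg:
  assumes "bdf f" "\<And>x. Re (f x) \<ge> 0"
  shows "Re (\<Phi> f) \<ge> 0"
  using nonneg_real[OF bdf_Re[OF assms(1)]] assms by (simp add: Re_eq)

lemma mono:
  assumes "bdf f" "bdf g" "\<And>x. Re (f x) \<le> Re (g x)"
  shows "Re (\<Phi> f) \<le> Re (\<Phi> g)"
  using nonneg[of "\<lambda>x. g x - f x"] assms by (simp add: bdf_diff diff)

text \<open>Multiply by the phase \<open>t\<close> that makes \<open>\<Phi> f\<close> a non-negative
  real, then compare real parts.\<close>

lemma cmod_le: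
  assumes "bdf f" "bdf g" "\<And>x. cmod (f x) \<le> Re (g x)"
  shows "cmod (\<Phi> f) \<le> Re (\<Phi> g)"
proof (cases "\<Phi> f = 0")
  case True
  then show ?thesis
    using nonneg[OF assms(2)] assms(3) norm_ge_zero order_trans by (metis norm_zero)
next
  case False
  define t where "t = cnj (\<Phi> f) / of_real (cmod (\<Phi> f))"
  have t: "cmod t = 1" using False by (simp add: t_def norm_divide)
  have "t * \<Phi> f = of_real (cmod (\<Phi> f))"
    using False complex_norm_square[of "\<Phi> f"] by (simp add: t_def field_simps power2_eq_square)
  then have "Re (\<Phi> (\<lambda>x. t * f x)) = cmod (\<Phi> f)"
    by (simp add: cmult[OF assms(1)])
  moreover have "Re (\<Phi> (\<lambda>x. t * f x)) \<le> Re (\<Phi> g)"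
  proof (rule mono)
    fix x
    show "Re (t * f x) \<le> Re (g x)"
      using complex_Re_le_cmod[of "t * f x"] assms(3)[of x] t by (simp add: norm_mult)
  qed (intro bdf_cmult assms)+
  ultimately show ?thesis by simp
qed

lemma cmod_power2_le:
  assumes "bdf f"
  shows "(cmod (\<Phi> f))\<^sup>2 \<le> Re (\<Phi> (\<lambda>x. f x * cnj (f x)))"
proof -
  let ?c = "\<Phi> f"
  have b: "bdf (\<lambda>x. f x * cnj (f x))" "bdf (\<lambda>x. cnj ?c * f x)" "bdf (\<lambda>x. ?c * cnj (f x))"
    by (intro bdf_mult bdf_const bdf_cnj assms)+
  have "0 \<le> Re (\<Phi> (\<lambda>x. (f x * cnj (f x) - cnj ?c * f x) - (?c * cnj (f x) - ?c * cnj ?c)))"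
  proof (rule nonneg)
    fix x
    have "(f x * cnj (f x) - cnj ?c * f x) - (?c * cnj (f x) - ?c * cnj ?c) =
        (f x - ?c) * cnj (f x - ?c)" by (simp add: algebra_simps)
    also have "Re \<dots> \<ge> 0" by (simp only: complex_norm_square[symmetric]) simp
    finally show "0 \<le> Re ((f x * cnj (f x) - cnj ?c * f x) - (?c * cnj (f x) - ?c * cnj ?c))" .
  qed (intro bdf_diff b bdf_const)
  also have "\<Phi> (\<lambda>x. (f x * cnj (f x) - cnj ?c * f x) - (?c * cnj (f x) - ?c * cnj ?c)) =
     \<Phi> (\<lambda>x. f x * cnj (f x)) - ?c * cnj ?c"
    using b assms by (simp add: diff bdf_diff bdf_const cmult cnj bdf_cnj)
  also have "?c * cnj ?c = of_real ((cmod ?c)\<^sup>2)" by (simp only: complex_norm_square)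
  finally show ?thesis by simp
qed

lemma cong_dist:
  assumes "bdf f" "bdf g" "\<And>x. cmod (f x - g x) \<le> \<epsilon>"
  shows "cmod (\<Phi> f - \<Phi> g) \<le> \<epsilon>"
  using bound[of "\<lambda>x. f x - g x" \<epsilon>] assms by (simp add: diff)

text \<open>Only \<open>\<Phi>\<close>-independent averages of translates enter, so any two invariant means agree here.\<close>

lemma near_avg:
  assumes "bdf f" "W \<noteq> []" "\<And>g. cmod (avg W (\<lambda>w. f (g + w)) - z) \<le> \<epsilon>"
  shows "cmod (\<Phi> f - z) \<le> \<epsilon>"
  using cong_dist[OF bdf_avg[OF assms(1), of W "\<lambda>w x. x + w"] bdf_const assms(3)] avg_shift[OF assms(1,2)] by simp

end

lemma avg_product:
  "avg [h w v. w \<leftarrow> W, v \<leftarrow> V] f = avg W (\<lambda>w. avg V (\<lambda>v. f (h w v)))"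
proof -
  have "(\<Sum>x\<leftarrow>[h w v. w \<leftarrow> W, v \<leftarrow> V]. f x) = (\<Sum>w\<leftarrow>W. \<Sum>v\<leftarrow>V. f (h w v))"
    by (induction W) (auto simp: o_def)
  moreover have "length [h w v. w \<leftarrow> W, v \<leftarrow> V] = length W * length V" by (induction W) auto
  ultimately show ?thesis unfolding avg_avg unfolding avg_def by simp
qed

lemma norm_avg_shift_le:
  assumes "\<And>x. cmod (f x) \<le> C"
  shows "cmod (avg [0..<Suc N] (\<lambda>h. f (int h + a + 1)) - avg [0..<Suc N] (\<lambda>h. f (int h + a))) \<le> 2 * C / (real N + 1)"
proof -
  have "(\<Sum>h<K. f (int h + a + 1)) - (\<Sum>h<K. f (int h + a)) = f (int K + a) - f a" for K
    by (induction K) (auto simp: algebra_simps)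
  then have "(\<Sum>h<Suc N. f (int h + a + 1)) - (\<Sum>h<Suc N. f (int h + a)) = f (int (Suc N) + a) - f a" .
  moreover have "(\<Sum>h\<leftarrow>[0..<Suc N]. g h) = (\<Sum>h<Suc N. g h)" for g :: "nat \<Rightarrow> complex"
    by (simp only: interv_sum_list_conv_sum_set_nat lessThan_atLeast0 set_upt)
  ultimately have "avg [0..<Suc N] (\<lambda>h. f (int h + a + 1)) - avg [0..<Suc N] (\<lambda>h. f (int h + a)) =
     (f (int (Suc N) + a) - f a) / of_nat (Suc N)"
    unfolding avg_def diff_divide_distrib[symmetric] by (simp only: length_upt diff_zero)
  also have "cmod \<dots> \<le> (C + C) / real (Suc N)"
    unfolding norm_divide norm_of_nat
    by (intro divide_right_mono order_trans[OF norm_triangle_ineq4] add_mono assms) simp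
  finally show ?thesis by (simp add: add.commute)
qed

lemma inv_mean_Ulim:
  fixes L :: "nat \<Rightarrow> 'g::ab_group_add list"
  assumes ne: "\<And>N. L N \<noteq> []"
    and inv: "\<And>f h. bdf f \<Longrightarrow> ((\<lambda>N. avg (L N) (\<lambda>x. f (x + h)) - avg (L N) f) \<longlongrightarrow> 0) ultra"
  shows "inv_mean (\<lambda>f. Ulim (\<lambda>N. avg (L N) f))"
proof -
  have conv: "((\<lambda>N. avg (L N) f) \<longlongrightarrow> Ulim (\<lambda>N. avg (L N) f)) ultra" if f: "bdf f" for f
  proof -
    obtain C where "\<And>x. cmod (f x) \<le> C" using f by (auto simp: bdf_def)
    then show ?thesis using ne by (intro tendsto_Ulim[of _ C] norm_avg_le)
  qed
  show ?thesis
  proof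
    show "Ulim (\<lambda>N. avg (L N) (\<lambda>x. f x + g x)) = Ulim (\<lambda>N. avg (L N) f) + Ulim (\<lambda>N. avg (L N) g)"
      if "bdf f" "bdf g" for f g
      unfolding avg_add by (intro Ulim_eqI tendsto_add conv that)
    show "Ulim (\<lambda>N. avg (L N) (\<lambda>x. c * f x)) = c * Ulim (\<lambda>N. avg (L N) f)" if "bdf f" for f c
      unfolding avg_cmult by (intro Ulim_eqI tendsto_mult tendsto_const conv that)
    show "Ulim (\<lambda>N. avg (L N) (\<lambda>_. 1)) = (1 :: complex)" using ne by simp
    show "cmod (Ulim (\<lambda>N. avg (L N) f)) \<le> C" if "\<And>x. cmod (f x) \<le> C" for f C
      using ne that by (intro norm_Ulim_le norm_avg_le)
    show "Ulim (\<lambda>N. avg (L N) (\<lambda>x. f (x + h))) = Ulim (\<lambda>N. avg (L N) f)" if "bdf f" for f h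
      using tendsto_add[OF inv[OF that, of h] conv[OF that]] by (intro Ulim_eqI) simp
    show "Ulim (\<lambda>N. avg (L N) (\<lambda>x. cnj (f x))) = cnj (Ulim (\<lambda>N. avg (L N) f))" if "bdf f" for f
      unfolding avg_cnj[symmetric] by (intro Ulim_eqI tendsto_cnj conv that)
  qed
qed

definition MEAN :: "('g::{countable, ab_group_add} \<Rightarrow> complex) \<Rightarrow> complex" where
  "MEAN f = Ulim (\<lambda>N. avg (SOME W. folner N W) f)"

lemma inv_mean_MEAN: "inv_mean (MEAN :: ('g::{countable, ab_group_add} \<Rightarrow> complex) \<Rightarrow> complex)"
  unfolding MEAN_def[abs_def]
proof (rule inv_mean_Ulim)
  have W: "folner N (SOME W :: 'g list. folner N W)" for N by (rule someI_ex[OF ex_folner])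
  then show "(SOME W :: 'g list. folner N W) \<noteq> []" for N using folner_not_Nil by blast
  fix f :: "'g \<Rightarrow> complex" and h
  assume "bdf f"
  then obtain C where C: "\<And>x. cmod (f x) \<le> C" by (auto simp: bdf_def)
  have "((\<lambda>N. C / (real N + 1)) \<longlongrightarrow> 0) ultra"
    by (rule tendsto_mono[OF ultra_le]) real_asymp
  moreover have "eventually (\<lambda>N. cmod (avg (SOME W. folner N W) (\<lambda>x. f (x + h)) - avg (SOME W. folner N W) f) \<le> C / (real N + 1)) ultra"
    using eventually_ultra_ge[of "to_nat h"] by (rule eventually_mono) (rule folner_bound[OF W _ C])
  ultimately show "((\<lambda>N. avg (SOME W. folner N W) (\<lambda>x. f (x + h)) - avg (SOME W. folner N W) f) \<longlongrightarrow> 0) ultra"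
    by (rule Lim_null_comparison[rotated])
qed

text \<open>The double window average that van der Corput's inequality produces; each difference
  \<open>d\<close> is counted with the weight of the Fejer kernel.\<close>

definition fejer :: "(int \<Rightarrow> complex) \<Rightarrow> complex" where
  "fejer f = Ulim (\<lambda>N. avg [0..<Suc N] (\<lambda>h. avg [0..<Suc N] (\<lambda>h'. f (int h' - int h))))"

lemma int_invariant:
  fixes P :: "(int \<Rightarrow> complex) \<Rightarrow> complex"
  assumes "\<And>f. bdf f \<Longrightarrow> P (\<lambda>x. f (x + 1)) = P f" "bdf f"
  shows "P (\<lambda>x. f (x + h)) = P f"
proof -
  have "\<forall>f. bdf f \<longrightarrow> P (\<lambda>x. f (x + h)) = P f"
  proof (induction h rule: int_induct[of _ 0])
    case (step1 i)
    then show ?case using assms(1)[OF bdf_comp, of _ "\<lambda>x. x + i"] by (simp add: add_ac)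
  next
    case (step2 i)
    show ?case
    proof (intro allI impI)
      fix f :: "int \<Rightarrow> complex" assume f: "bdf f"
      have "P (\<lambda>x. f (x + (i - 1))) = P (\<lambda>x. f (x + 1 + (i - 1)))"
        by (rule assms(1)[symmetric, OF bdf_comp[OF f]])
      also have "\<dots> = P f" using step2 f by (simp add: add_ac)
      finally show "P (\<lambda>x. f (x + (i - 1))) = P f" .
    qed
  qed simp
  then show ?thesis using assms(2) by blast
qed

lemma inv_mean_fejer: "inv_mean fejer"
proof -
  define L where "L = (\<lambda>N. [int h' - int h. h \<leftarrow> [0..<Suc N], h' \<leftarrow> [0..<Suc N]])"
  have avgL: "avg (L N) f = avg [0..<Suc N] (\<lambda>h. avg [0..<Suc N] (\<lambda>h'. f (int h' - int h)))" for N and f :: "int \<Rightarrow> complex"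
    unfolding L_def by (rule avg_product)
  have "inv_mean (\<lambda>f. Ulim (\<lambda>N. avg (L N) f))"
  proof (rule inv_mean_Ulim)
    show "L N \<noteq> []" for N by (auto simp: L_def)
    fix f :: "int \<Rightarrow> complex" and h
    assume f: "bdf f"
    have one: "((\<lambda>N. avg (L N) (\<lambda>x. f (x + 1)) - avg (L N) f) \<longlongrightarrow> 0) ultra" if f: "bdf f" for f
    proof -
      obtain C where C: "\<And>x. cmod (f x) \<le> C" using f by (auto simp: bdf_def)
      have lim: "((\<lambda>N. 2 * C / (real N + 1)) \<longlongrightarrow> 0) ultra"
        by (rule tendsto_mono[OF ultra_le]) real_asymp
      have "cmod (avg (L N) (\<lambda>x. f (x + 1)) - avg (L N) f) \<le> 2 * C / (real N + 1)" for N
        unfolding avgL avg_diff[symmetric]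
      proof (rule norm_avg_le)
        fix h
        show "cmod (avg [0..<Suc N] (\<lambda>h'. f (int h' - int h + 1) - f (int h' - int h))) \<le> 2 * C / (real N + 1)"
          using norm_avg_shift_le[of f C N "- int h"] C by (simp add: avg_diff)
      qed simp
      then show ?thesis by (intro Lim_null_comparison[OF _ lim]) simp
    qed
    have "\<forall>f. bdf f \<longrightarrow> ((\<lambda>N. avg (L N) (\<lambda>x. f (x + h)) - avg (L N) f) \<longlongrightarrow> 0) ultra"
    proof (induction h rule: int_induct[of _ 0])
      case (step1 i)
      show ?case
      proof (intro allI impI)
        fix f :: "int \<Rightarrow> complex" assume f: "bdf f"
        have "((\<lambda>N. avg (L N) (\<lambda>x. f (x + 1 + i)) - avg (L N) (\<lambda>x. f (x + i))) \<longlongrightarrow> 0) ultra"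
          by (rule one[OF bdf_comp[OF f]])
        from tendsto_add[OF this step1(2)[rule_format, OF f]]
        show "((\<lambda>N. avg (L N) (\<lambda>x. f (x + (i + 1))) - avg (L N) f) \<longlongrightarrow> 0) ultra" by (simp add: add_ac)
      qed
    next
      case (step2 i)
      show ?case
      proof (intro allI impI)
        fix f :: "int \<Rightarrow> complex" assume f: "bdf f"
        have "((\<lambda>N. avg (L N) (\<lambda>x. f (x + 1 + (i - 1))) - avg (L N) (\<lambda>x. f (x + (i - 1)))) \<longlongrightarrow> 0) ultra"
          by (rule one[OF bdf_comp[OF f]])
        from tendsto_diff[OF step2(2)[rule_format, OF f] this]
        show "((\<lambda>N. avg (L N) (\<lambda>x. f (x + (i - 1))) - avg (L N) f) \<longlongrightarrow> 0) ultra" by (simp add: add_ac)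
      qed
    qed simp
    then show "((\<lambda>N. avg (L N) (\<lambda>x. f (x + h)) - avg (L N) f) \<longlongrightarrow> 0) ultra" using f by blast
  qed
  then show ?thesis unfolding avgL fejer_def[abs_def] .
qed

text \<open>Iterated means along a surjective homomorphism \<open>F\<close> from the product group.
  Keeping \<open>F\<close> general allows the same pair of means to be read in sheared
  coordinates.\<close>

lemma inv_mean_comp:
  fixes F :: "'a::ab_group_add \<Rightarrow> 'b::ab_group_add \<Rightarrow> 'g::ab_group_add"
  assumes "inv_mean \<Phi>" "inv_mean \<Psi>"
    and F: "\<And>a a' b b'. F (a + a') (b + b') = F a b + F a' b'" "\<And>g. \<exists>a b. F a b = g"
  shows "inv_mean (\<lambda>c. \<Phi> (\<lambda>a. \<Psi> (\<lambda>b. c (F a b))))"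
proof -
  interpret P: inv_mean \<Phi> by fact
  interpret Q: inv_mean \<Psi> by fact
  have b: "bdf (\<lambda>b. c (F a b))" if "bdf c" for c a using that by (rule bdf_comp)
  have bb: "bdf (\<lambda>a. \<Psi> (\<lambda>b. c (F a b)))" if "bdf c" for c
    using that by (intro Q.bdf_bound) (auto simp: bdf_def)
  show ?thesis
  proof
    show "\<Phi> (\<lambda>a. \<Psi> (\<lambda>b. c (F a b) + d (F a b))) = \<Phi> (\<lambda>a. \<Psi> (\<lambda>b. c (F a b))) + \<Phi> (\<lambda>a. \<Psi> (\<lambda>b. d (F a b)))"
      if "bdf c" "bdf d" for c d
      using that by (simp add: Q.add b P.add bb)
    show "\<Phi> (\<lambda>a. \<Psi> (\<lambda>b. z * c (F a b))) = z * \<Phi> (\<lambda>a. \<Psi> (\<lambda>b. c (F a b)))" if "bdf c" for c z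
      using that by (simp add: Q.cmult b P.cmult bb)
    show "\<Phi> (\<lambda>a. \<Psi> (\<lambda>b. 1)) = 1" by simp
    show "cmod (\<Phi> (\<lambda>a. \<Psi> (\<lambda>b. c (F a b)))) \<le> C" if "\<And>x. cmod (c x) \<le> C" for c C
      by (intro P.bound Q.bound that)
    show "\<Phi> (\<lambda>a. \<Psi> (\<lambda>b. c (F a b + g))) = \<Phi> (\<lambda>a. \<Psi> (\<lambda>b. c (F a b)))" if "bdf c" for c g
    proof -
      obtain a' b' where g: "g = F a' b'" using F(2)[of g] by blast
      have "\<Phi> (\<lambda>a. \<Psi> (\<lambda>b. c (F a b + g))) = \<Phi> (\<lambda>a. \<Psi> (\<lambda>b. c (F (a + a') (b + b'))))"
        by (simp add: g F(1))
      also have "\<dots> = \<Phi> (\<lambda>a. \<Psi> (\<lambda>b. c (F (a + a') b)))"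
        using Q.shift[OF b[OF that]] by simp
      also have "\<dots> = \<Phi> (\<lambda>a. \<Psi> (\<lambda>b. c (F a b)))"
        by (rule P.shift[OF bb[OF that]])
      finally show ?thesis .
    qed
    show "\<Phi> (\<lambda>a. \<Psi> (\<lambda>b. cnj (c (F a b)))) = cnj (\<Phi> (\<lambda>a. \<Psi> (\<lambda>b. c (F a b))))" if "bdf c" for c
      using that by (simp add: Q.cnj b P.cnj bb)
  qed
qed

text \<open>The mean of a non-negative function over the multiples of \<open>k\<close> is at most \<open>k\<close> times its mean:
  take the summand \<open>r = 0\<close>.\<close>

lemma inv_mean_residues:
  assumes "inv_mean \<Phi>" "k > 0"
  shows "inv_mean (\<lambda>a. avg [0..<k] (\<lambda>r. \<Phi> (\<lambda>h. a (- (int k * h) + int r))))"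
proof -
  interpret P: inv_mean \<Phi> by fact
  have ne: "[0..<k] \<noteq> []" using assms(2) by simp
  have b: "bdf (\<lambda>h. a (- (int k * h) + int r))" if "bdf a" for a :: "int \<Rightarrow> complex" and r using that by (rule bdf_comp)
  have one: "avg [0..<k] (\<lambda>r. \<Phi> (\<lambda>h. a (- (int k * h) + int r + 1))) = avg [0..<k] (\<lambda>r. \<Phi> (\<lambda>h. a (- (int k * h) + int r)))"
    if a: "bdf a" for a
  proof -
    let ?g = "\<lambda>r. \<Phi> (\<lambda>h. a (- (int k * h) + int r))"
    \<comment> \<open>Residue \<open>k\<close> is residue \<open>0\<close> after a translation of
      \<open>h\<close>, so a shift by \<open>1\<close> only permutes the residues
      cyclically.\<close>
    have "?g k = \<Phi> (\<lambda>h. a (- (int k * (h + (- 1)))))" by (simp add: algebra_simps)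
    also have "\<dots> = ?g 0" using P.shift[OF b[OF a, of 0], of "-1"] by simp
    finally have *: "?g k = ?g 0" .
    have "(\<Sum>r<K. ?g (Suc r)) + ?g 0 = (\<Sum>r<K. ?g r) + ?g K" for K
      by (induction K) (auto simp: algebra_simps)
    from this[of k] have "(\<Sum>r<k. ?g (Suc r)) = (\<Sum>r<k. ?g r)" using * by simp
    then show ?thesis
      by (simp add: avg_def interv_sum_list_conv_sum_set_nat lessThan_atLeast0 algebra_simps)
  qed
  show ?thesis
  proof
    fix f :: "int \<Rightarrow> complex" and h :: int assume "bdf f"
    from int_invariant[of "\<lambda>a. avg [0..<k] (\<lambda>r. \<Phi> (\<lambda>h. a (- (int k * h) + int r)))", OF one this]
    show "avg [0..<k] (\<lambda>r. \<Phi> (\<lambda>x. f (- (int k * x) + int r + h))) = avg [0..<k] (\<lambda>r. \<Phi> (\<lambda>h. f (- (int k * h) + int r)))" .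
  qed (use ne b in \<open>auto simp: P.add avg_add P.cmult avg_cmult P.cnj avg_cnj intro!: norm_avg_le P.bound\<close>)
qed

section \<open>Integer polynomials as a countable group, and their additive maps\<close>

instance poly :: ("{countable, zero}") countable
  by standard (rule exI[of _ "\<lambda>p. to_nat (coeffs p)"], auto intro!: injI simp: coeffs_eq_iff)

lemma additive_coeff: "Modules.additive (\<lambda>p :: int poly. coeff p i)"
  by unfold_locales simp

lemma character_int_poly: "character \<zeta> \<Longrightarrow> character (\<lambda>p :: int poly. \<zeta> (coeff p i))"
  by (simp add: character_def)

lemma additive_cmult_int: "Modules.additive \<psi> \<Longrightarrow> Modules.additive (\<lambda>p. c * \<psi> p :: int)"
  by (simp add: Modules.additive_def algebra_simps)

lemma additive_add_fun: "Modules.additive \<phi> \<Longrightarrow> Modules.additive \<psi> \<Longrightarrow> Modules.additive (\<lambda>p. \<phi> p + \<psi> p :: int)"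
  by (simp add: Modules.additive_def algebra_simps)

lemma lp_sh: "sh (\<psi> w) (lp gs w) = lp (map (\<lambda>(\<phi>, f). (\<lambda>p. \<psi> p + \<phi> p, f)) gs) w"
proof (induction gs)
  case Nil
  then show ?case by (intro HOL.ext) (simp add: sh_def split: prod.splits)
next
  case (Cons a gs)
  obtain \<phi> f where a: "a = (\<phi>, f)" by (cases a)
  have "lp (a # gs) w = (\<lambda>y. sh (\<phi> w) f y * lp gs w y)" by (intro HOL.ext) (simp add: a)
  then show ?case by (intro HOL.ext) (simp add: a sh_mult Cons)
qed

lemma lp_cnj: "cnj (lp gs w y) = lp (map (\<lambda>(\<phi>, f). (\<phi>, \<lambda>y. cnj (f y))) gs) w y"
  by (induction gs) (auto simp: sh_cnj)

section \<open>Van der Corput's inequality for invariant means\<close>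

context traced_algebra
begin

text \<open>Averaging the correlation over windows of length \<open>Suc N\<close> does not change
  its mean. Cauchy-Schwarz removes \<open>f\<close>, and expanding the square bounds the left side
  by the double window average for every \<open>N\<close>; \<open>fejer\<close> is the limit of
  these.\<close>

lemma van_der_Corput:
  assumes "inv_mean \<Phi>" and u: "\<And>m :: int. u m \<in> A" "\<And>m y. cmod (u m y) \<le> K"
    and f: "f \<in> A" "nrm f \<le> 1"
  shows "(cmod (\<Phi> (\<lambda>m. tr (\<lambda>y. f y * u m y))))\<^sup>2 \<le> Re (fejer (\<lambda>d. \<Phi> (\<lambda>m. ip (u m) (u (m + d)))))"
proof -
  interpret P: inv_mean \<Phi> by fact
  let ?c = "\<lambda>m. tr (\<lambda>y. f y * u m y)"
  let ?\<gamma> = "\<lambda>d. \<Phi> (\<lambda>m. ip (u m) (u (m + d)))"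
  obtain F where F: "\<And>y. cmod (f y) \<le> F" using A_bdd[OF f(1)] by blast
  have F0: "0 \<le> F" "0 \<le> K" using F u(2) norm_ge_zero order_trans by blast+
  have "cmod (f y * u m y) \<le> F * K" for m y
    unfolding norm_mult using F u(2) F0 by (intro mult_mono) auto
  then have cb: "cmod (?c m) \<le> F * K" for m by (intro cmod_tr_le A_mult f u)
  have "cmod (u m y * cnj (u m' y)) \<le> K * K" for m m' y
    unfolding norm_mult complex_mod_cnj using u(2) F0 by (intro mult_mono) auto
  then have ipb: "cmod (ip (u m) (u m')) \<le> K * K" for m m'
    unfolding ip_def by (intro cmod_tr_le A_ip u)
  have \<gamma>b: "cmod (?\<gamma> d) \<le> K * K" for d by (intro P.bound ipb)
  have main: "(cmod (\<Phi> ?c))\<^sup>2 \<le> Re (avg [0..<Suc N] (\<lambda>h. avg [0..<Suc N] (\<lambda>h'. ?\<gamma> (int h' - int h))))" for N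
  proof -
    define W where "W = map int [0..<Suc N]"
    define a where "a = (\<lambda>m y. avg W (\<lambda>w. u (m + w) y))"
    have W: "W \<noteq> []" by (simp add: W_def)
    have aA: "a m \<in> A" for m unfolding a_def by (intro A_avg u)
    have ca: "avg W (\<lambda>w. ?c (m + w)) = tr (\<lambda>y. f y * a m y)" for m
      unfolding a_def avg_cmult[symmetric] by (subst tr_avg) (intro A_mult f u, rule refl)
    have expand: "ip (a m) (a m) = avg W (\<lambda>w. avg W (\<lambda>w'. ip (u (m + w)) (u (m + w'))))" for m
    proof -
      have "ip (a m) (a m) = tr (\<lambda>y. avg W (\<lambda>w. avg W (\<lambda>w'. u (m + w) y * cnj (u (m + w') y))))"
        by (simp add: ip_def a_def avg_cnj avg_multc avg_cmult)
      also have "\<dots> = avg W (\<lambda>w. avg W (\<lambda>w'. ip (u (m + w)) (u (m + w'))))"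
        unfolding ip_def by (subst tr_avg, intro A_avg A_ip u, intro avg_cong tr_avg A_ip u)
      finally show ?thesis .
    qed
    have "\<Phi> ?c = \<Phi> (\<lambda>m. tr (\<lambda>y. f y * a m y))"
      using P.avg_shift[of ?c W, OF bdfI[OF cb] W] unfolding ca by simp
    moreover have ba: "bdf (\<lambda>m. tr (\<lambda>y. f y * a m y))"
      unfolding ca[symmetric] by (intro bdf_avg bdfI[OF cb])
    ultimately have "(cmod (\<Phi> ?c))\<^sup>2 \<le> Re (\<Phi> (\<lambda>m. tr (\<lambda>y. f y * a m y) * cnj (tr (\<lambda>y. f y * a m y))))"
      using P.cmod_power2_le by simp
    also have "\<dots> \<le> Re (\<Phi> (\<lambda>m. ip (a m) (a m)))"
    proof (rule P.mono)
      show "bdf (\<lambda>m. ip (a m) (a m))"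
        unfolding expand by (intro bdfI[of _ "K * K"] norm_avg_le W ipb)
      show "bdf (\<lambda>m. tr (\<lambda>y. f y * a m y) * cnj (tr (\<lambda>y. f y * a m y)))"
        by (intro bdf_mult bdf_cnj ba)
      fix m
      have "cmod (tr (\<lambda>y. f y * a m y)) \<le> nrm f * nrm (a m)" by (intro cmod_tr_mult_le f aA)
      also have "\<dots> \<le> nrm (a m)" using f aA mult_right_mono[of "nrm f" 1 "nrm (a m)"] by simp
      finally have "(cmod (tr (\<lambda>y. f y * a m y)))\<^sup>2 \<le> (nrm (a m))\<^sup>2" by (intro power_mono) auto
      then show "Re (tr (\<lambda>y. f y * a m y) * cnj (tr (\<lambda>y. f y * a m y))) \<le> Re (ip (a m) (a m))"
        by (simp only: complex_norm_square[symmetric] Re_complex_of_real nrm_power2[OF aA])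
    qed
    also have "\<Phi> (\<lambda>m. ip (a m) (a m)) = avg W (\<lambda>w. avg W (\<lambda>w'. ?\<gamma> (w' - w)))"
    proof -
      have e: "\<Phi> (\<lambda>m. ip (a m) (a m)) = avg W (\<lambda>w. avg W (\<lambda>w'. \<Phi> (\<lambda>m. ip (u (m + w)) (u (m + w')))))"
      proof -
        have b1: "bdf (\<lambda>m. ip (u (m + w)) (u (m + w')))" for w w'
          by (rule bdfI[OF ipb])
        have b2: "bdf (\<lambda>m. avg W (\<lambda>w'. ip (u (m + w)) (u (m + w'))))" for w
          by (intro bdfI[of _ "K * K"] norm_avg_le W ipb)
        show ?thesis
          unfolding expand P.avg_eq[of W "\<lambda>w m. avg W (\<lambda>w'. ip (u (m + w)) (u (m + w')))", OF b2]
            P.avg_eq[of W "\<lambda>w' m. ip (u (m + w)) (u (m + w'))" for w, OF b1] ..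
      qed
      have "\<Phi> (\<lambda>m. ip (u (m + w)) (u (m + w'))) = ?\<gamma> (w' - w)" for w w'
        using P.shift[OF bdfI[of "\<lambda>m. ip (u m) (u (m + (w' - w)))", OF ipb], of w] by (simp add: algebra_simps)
      then show ?thesis using e by simp
    qed
    finally show ?thesis unfolding W_def avg_map .
  qed
  have "((\<lambda>N. avg [0..<Suc N] (\<lambda>h. avg [0..<Suc N] (\<lambda>h'. ?\<gamma> (int h' - int h)))) \<longlongrightarrow> fejer ?\<gamma>) ultra"
    unfolding fejer_def using \<gamma>b by (intro tendsto_Ulim[of _ "K * K"] norm_avg_le) auto
  then show ?thesis
    by (intro tendsto_lowerbound[OF tendsto_Re _ ultra_neq_bot]) (use main in auto)
qed

text \<open>Stable under products, conjugates and shifts, so the constants below can be uniform in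
  the functions.\<close>

definition ball :: "('l \<times> int \<times> 'a \<Rightarrow> complex) set" where
  "ball = {f \<in> A. \<forall>y. cmod (f y) \<le> 1}"

lemma ballD: "f \<in> ball \<Longrightarrow> f \<in> A" "f \<in> ball \<Longrightarrow> cmod (f y) \<le> 1"
  unfolding ball_def by blast+

lemma ballI: "f \<in> A \<Longrightarrow> (\<And>y. cmod (f y) \<le> 1) \<Longrightarrow> f \<in> ball"
  unfolding ball_def by blast

lemma ball_mult: "f \<in> ball \<Longrightarrow> g \<in> ball \<Longrightarrow> (\<lambda>y. f y * g y) \<in> ball"
  by (intro ballI A_mult) (auto simp: norm_mult intro: mult_le_one ballD)

lemma ball_cnj: "f \<in> ball \<Longrightarrow> (\<lambda>y. cnj (f y)) \<in> ball"
  by (intro ballI A_cnj) (auto intro: ballD)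

lemma ball_sh: "f \<in> ball \<Longrightarrow> sh n f \<in> ball"
  by (intro ballI A_sh norm_sh_le) (auto intro: ballD)

lemma ball_one: "(\<lambda>_. 1) \<in> ball"
  by (intro ballI A_const) auto

lemma ball_prod: "(\<And>i. i \<in> I \<Longrightarrow> F i \<in> ball) \<Longrightarrow> (\<lambda>y. \<Prod>i\<in>I. F i y) \<in> ball"
  by (induction I rule: infinite_finite_induct) (auto intro: ball_one ball_mult)

lemma cmod_tr_ball: "f \<in> ball \<Longrightarrow> cmod (tr f) \<le> 1"
  by (intro cmod_tr_le) (auto intro: ballD)

lemma nrm_ball: "f \<in> ball \<Longrightarrow> nrm f \<le> 1"
  by (intro nrm_le_const) (auto intro: ballD)

end

text \<open>Turns a bound on a square into one that is linear in \<open>b\<close>, with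
  \<open>t\<close> at free choice; linear bounds can be averaged again in the induction.\<close>

lemma le_add_square_div:
  fixes x t :: real
  assumes "t > 0" "x \<ge> 0" "x\<^sup>2 \<le> b"
  shows "x \<le> t + b / t"
proof (cases "x \<le> t")
  case True
  have "0 \<le> b / t" using assms by (intro divide_nonneg_pos) (auto intro: order_trans[of 0 "x\<^sup>2"])
  then show ?thesis using True by simp
next
  case False
  then have "x * t \<le> x\<^sup>2" using assms by (simp add: power2_eq_square)
  then have "x \<le> b / t" using assms by (simp add: field_simps)
  then show ?thesis using assms by simp
qed

text \<open>\<open>rest k s f\<close> collects all factors except \<open>f\<close> itself of the \<open>k\<close>-dimensional cube with sides
  \<open>s 0, \<dots>, s (k - 1)\<close>.\<close>

primrec rest :: "nat \<Rightarrow> (nat \<Rightarrow> int) \<Rightarrow> ('l \<times> int \<times> 'a \<Rightarrow> complex) \<Rightarrow> 'l \<times> int \<times> 'a \<Rightarrow> complex" where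
  "rest 0 s f = (\<lambda>_. 1)"
| "rest (Suc k) s f = (\<lambda>y. rest k s f y * cnj (sh (s k) (\<lambda>y. f y * rest k s f y) y))"

definition cube :: "nat \<Rightarrow> (nat \<Rightarrow> int) \<Rightarrow> ('l \<times> int \<times> 'a \<Rightarrow> complex) \<Rightarrow> 'l \<times> int \<times> 'a \<Rightarrow> complex" where
  "cube k s f = (\<lambda>y. f y * rest k s f y)"

lemma cube_0 [simp]: "cube 0 s f = f"
  by (simp add: cube_def)

lemma cube_Suc: "cube (Suc k) s f = (\<lambda>y. cube k s f y * cnj (sh (s k) (cube k s f) y))"
  by (simp add: cube_def mult_ac)

text \<open>Peels off the first side instead of the last, the recursion that matches
  \<open>pCons\<close>.\<close>

lemma cube_Suc_shift: "cube (Suc k) s f = cube k (\<lambda>i. s (Suc i)) (\<lambda>y. f y * cnj (sh (s 0) f y))"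
proof (induction k)
  case 0
  then show ?case by (simp add: cube_Suc)
next
  case (Suc k)
  have "cube (Suc (Suc k)) s f = (\<lambda>y. cube (Suc k) s f y * cnj (sh (s (Suc k)) (cube (Suc k) s f) y))"
    by (rule cube_Suc)
  also have "\<dots> = cube (Suc k) (\<lambda>i. s (Suc i)) (\<lambda>y. f y * cnj (sh (s 0) f y))"
    unfolding Suc.IH by (rule cube_Suc[symmetric])
  finally show ?case .
qed

text \<open>Additive maps of \<^typ>\<open>int poly\<close> into \<open>\<int>\<close> include infinitely many independent coordinates, so a
  single invariant mean on this group yields the cube averages of all dimensions.\<close>

locale poly_algebra = traced_algebra A tr
  for A :: "((int poly, 'b) pt \<Rightarrow> complex) set" and tr
begin

text \<open>The families whose correlations are covered by \<open>mav_Cauchy\<close>. The closure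
  rules below reduce membership of cubes and progressions to additivity of their shifts.\<close>

definition lprod :: "(int poly \<Rightarrow> (int poly, 'b) pt \<Rightarrow> complex) \<Rightarrow> bool" where
  "lprod u \<longleftrightarrow> (\<exists>gs. valid A gs \<and> (\<forall>w. u w = lp gs w))"

lemma lprod_const: "f \<in> A \<Longrightarrow> lprod (\<lambda>_. f)"
  unfolding lprod_def
  by (intro exI[of _ "[(\<lambda>_. 0, f)]"]) (auto simp: Modules.additive_def simp del: split_paired_All intro!: HOL.ext)

lemma lprod_mult:
  assumes "lprod u" "lprod v"
  shows "lprod (\<lambda>w y. u w y * v w y)"
proof -
  obtain gs hs where "valid A gs" "valid A hs" "\<And>w. u w = lp gs w" "\<And>w. v w = lp hs w"
    using assms unfolding lprod_def by blast
  then show ?thesis unfolding lprod_def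
    by (intro exI[of _ "gs @ hs"]) (auto simp: valid_def lp_append intro!: HOL.ext)
qed

lemma lprod_cnj:
  assumes "lprod u"
  shows "lprod (\<lambda>w y. cnj (u w y))"
proof -
  obtain gs where "valid A gs" "\<And>w. u w = lp gs w"
    using assms unfolding lprod_def by blast
  then show ?thesis unfolding lprod_def
    by (intro exI[of _ "map (\<lambda>(\<phi>, f). (\<phi>, \<lambda>y. cnj (f y))) gs"])
      (auto simp: valid_def lp_cnj A_cnj intro!: HOL.ext)
qed

lemma lprod_sh:
  assumes "lprod u" "Modules.additive \<psi>"
  shows "lprod (\<lambda>w. sh (\<psi> w) (u w))"
proof -
  obtain gs where "valid A gs" "\<And>w. u w = lp gs w"
    using assms unfolding lprod_def by blast
  then show ?thesis unfolding lprod_def using assms(2)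
    by (intro exI[of _ "map (\<lambda>(\<phi>, f). (\<lambda>p. \<psi> p + \<phi> p, f)) gs"])
      (auto simp: valid_def lp_sh intro!: additive_add_fun)
qed

lemma lprod_prod: "(\<And>i. i \<in> I \<Longrightarrow> lprod (u i)) \<Longrightarrow> lprod (\<lambda>w y. \<Prod>i\<in>I. u i w y)"
  by (induction I rule: infinite_finite_induct) (auto intro: lprod_const A_const lprod_mult)

lemma lprod_rest: "f \<in> A \<Longrightarrow> (\<And>i. Modules.additive (s i)) \<Longrightarrow> lprod (\<lambda>w. rest k (\<lambda>i. s i w) f)"
  by (induction k) (auto intro!: lprod_const A_const lprod_mult lprod_cnj lprod_sh)

lemma lprod_cube: "f \<in> A \<Longrightarrow> (\<And>i. Modules.additive (s i)) \<Longrightarrow> lprod (\<lambda>w. cube k (\<lambda>i. s i w) f)"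
  unfolding cube_def by (intro lprod_mult lprod_const lprod_rest)

lemma tr_mav:
  assumes "valid A gs" "R \<in> A"
  shows "tr (\<lambda>y. R y * mav \<xi> gs W y) = avg W (\<lambda>w. \<xi> w * tr (\<lambda>y. R y * lp gs w y))"
proof -
  have lp: "lp gs w \<in> A" for w by (rule lp_in_A[OF traced_algebra_axioms assms(1)])
  have "tr (\<lambda>y. R y * mav \<xi> gs W y) = tr (\<lambda>y. avg W (\<lambda>w. \<xi> w * (R y * lp gs w y)))"
    by (simp add: mav_def avg_cmult[symmetric] mult_ac)
  also have "\<dots> = avg W (\<lambda>w. tr (\<lambda>y. \<xi> w * (R y * lp gs w y)))"
    by (intro tr_avg A_mult A_const assms lp)
  also have "\<dots> = avg W (\<lambda>w. \<xi> w * tr (\<lambda>y. R y * lp gs w y))"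
    by (intro avg_cong tr_cmult A_mult assms lp)
  finally show ?thesis .
qed

lemma mav_A: "valid A gs \<Longrightarrow> mav \<xi> gs W \<in> A"
proof -
  assume v: "valid A gs"
  have "(\<lambda>y. avg W (\<lambda>w. \<xi> w * lp gs w y)) \<in> A"
    by (intro A_avg A_mult A_const lp_in_A[OF traced_algebra_axioms v])
  then show ?thesis by (simp add: mav_def[abs_def])
qed

text \<open>The mean is unchanged if the correlation is first averaged over \<open>W\<close>. The
  average at \<open>g\<close> is \<open>tr\<close> of \<open>R\<close> against the average
  translated by \<open>g\<close>, which \<open>near\<close> compares with the untranslated
  one.\<close>

lemma mean_near_mav:
  assumes "inv_mean \<Phi>" "character \<xi>" "valid A gs" "R \<in> A" "nrm R \<le> 1" "W \<noteq> []"
    and near: "\<And>g. nrm (\<lambda>y. mav \<xi> gs (map ((+) g) W) y - mav \<xi> gs W y) \<le> \<epsilon>"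
  shows "cmod (\<Phi> (\<lambda>w. \<xi> w * tr (\<lambda>y. R y * lp gs w y)) - tr (\<lambda>y. R y * mav \<xi> gs W y)) \<le> \<epsilon>"
proof -
  interpret P: inv_mean \<Phi> by fact
  obtain C where C: "C > 0" "\<And>w y. cmod (lp gs w y) \<le> C"
    using lp_bound[OF traced_algebra_axioms assms(3)] by blast
  have lpA: "lp gs w \<in> A" for w by (rule lp_in_A[OF traced_algebra_axioms assms(3)])
  have "cmod (\<xi> w * tr (\<lambda>y. R y * lp gs w y)) \<le> 1 * C" for w
  proof -
    have "cmod (tr (\<lambda>y. R y * lp gs w y)) \<le> nrm R * nrm (lp gs w)" by (intro cmod_tr_mult_le assms lpA)
    also have "\<dots> \<le> 1 * C" using C(1) by (intro mult_mono assms(5) nrm_le_const C(2) lpA nrm_nonneg) auto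
    finally show ?thesis by (simp add: norm_mult norm_character[OF assms(2)])
  qed
  then have b: "bdf (\<lambda>w. \<xi> w * tr (\<lambda>y. R y * lp gs w y))" by (rule bdfI)
  show ?thesis
  proof (rule P.near_avg[OF b assms(6)])
    fix g
    have "avg W (\<lambda>w. \<xi> (g + w) * tr (\<lambda>y. R y * lp gs (g + w) y)) = tr (\<lambda>y. R y * mav \<xi> gs (map ((+) g) W) y)"
      unfolding tr_mav[OF assms(3,4)] avg_map ..
    then have "avg W (\<lambda>w. \<xi> (g + w) * tr (\<lambda>y. R y * lp gs (g + w) y)) - tr (\<lambda>y. R y * mav \<xi> gs W y) =
       tr (\<lambda>y. R y * (mav \<xi> gs (map ((+) g) W) y - mav \<xi> gs W y))"
      using assms by (simp add: right_diff_distrib tr_diff A_mult mav_A)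
    also have "cmod \<dots> \<le> nrm R * nrm (\<lambda>y. mav \<xi> gs (map ((+) g) W) y - mav \<xi> gs W y)"
      using assms by (intro cmod_tr_mult_le A_diff mav_A)
    also have "\<dots> \<le> 1 * \<epsilon>" using assms by (intro mult_mono near) (auto intro: nrm_nonneg A_diff mav_A)
    finally show "cmod (avg W (\<lambda>w. \<xi> (g + w) * tr (\<lambda>y. R y * lp gs (g + w) y)) - tr (\<lambda>y. R y * mav \<xi> gs W y)) \<le> \<epsilon>"
      by simp
  qed
qed

lemma ex_translation_stable:
  assumes "character \<xi>" "valid A gs" "\<epsilon> > 0"
  shows "\<exists>W. W \<noteq> [] \<and> (\<forall>g. nrm (\<lambda>y. mav \<xi> gs (map ((+) g) W) y - mav \<xi> gs W y) \<le> \<epsilon>)"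
proof -
  obtain n where n: "\<And>W W'. folner n W \<Longrightarrow> folner n W' \<Longrightarrow> nrm (\<lambda>y. mav \<xi> gs W y - mav \<xi> gs W' y) \<le> \<epsilon>"
    using mav_Cauchy[OF traced_algebra_axioms assms] by blast
  obtain W :: "int poly list" where "folner n W" using ex_folner by blast
  then show ?thesis using n folner_translate folner_not_Nil by blast
qed

text \<open>Both means lie within \<open>e / 2\<close> of the trace of one and the same
  translation-stable average. This replaces Fubini's theorem and justifies all changes of variables
  below.\<close>

lemma mean_unique:
  assumes "inv_mean \<Phi>" "inv_mean \<Psi>" "character \<xi>" "lprod u"
  shows "\<Phi> (\<lambda>w. \<xi> w * tr (u w)) = \<Psi> (\<lambda>w. \<xi> w * tr (u w))"
proof -
  obtain gs where gs: "valid A gs" "\<And>w. u w = lp gs w" using assms(4) by (auto simp: lprod_def)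
  have "cmod (\<Phi> (\<lambda>w. \<xi> w * tr (u w)) - \<Psi> (\<lambda>w. \<xi> w * tr (u w))) \<le> 0 + e" if e: "e > 0" for e
  proof -
    obtain W where W: "W \<noteq> []" "\<And>g. nrm (\<lambda>y. mav \<xi> gs (map ((+) g) W) y - mav \<xi> gs W y) \<le> e / 2"
      using ex_translation_stable[OF assms(3) gs(1), of "e / 2"] e by auto
    note near = mean_near_mav[OF _ assms(3) gs(1) A_const[of 1] _ W]
    have n1: "nrm (\<lambda>_. 1) \<le> 1" by (intro nrm_le_const A_const) simp
    show ?thesis
      using near[OF assms(1) n1] near[OF assms(2) n1]
        norm_triangle_ineq4[of "\<Phi> (\<lambda>w. \<xi> w * tr (u w)) - tr (\<lambda>y. 1 * mav \<xi> gs W y)"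
          "\<Psi> (\<lambda>w. \<xi> w * tr (u w)) - tr (\<lambda>y. 1 * mav \<xi> gs W y)"]
      by (simp add: gs(2))
  qed
  then have "cmod (\<Phi> (\<lambda>w. \<xi> w * tr (u w)) - \<Psi> (\<lambda>w. \<xi> w * tr (u w))) \<le> 0" by (rule field_le_epsilon)
  then show ?thesis by simp
qed

text \<open>The Gowers-Host-Kra functional, that is, the \<open>2\<^sup>k\<close>-th power of the seminorm.\<close>

definition U :: "nat \<Rightarrow> ((int poly, 'b) pt \<Rightarrow> complex) \<Rightarrow> complex" where
  "U k f = MEAN (\<lambda>w :: int poly. tr (cube k (coeff w) f))"

text \<open>The side \<open>d\<close> is split off as coefficient \<open>0\<close> of
  \<open>pCons d w\<close>. By \<open>mean_unique\<close> it may be averaged with any invariant mean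
  \<open>\<Psi>\<close>, in particular with one adapted to residue classes.\<close>

lemma U_Suc:
  assumes "inv_mean \<Psi>" "f \<in> A"
  shows "U (Suc k) f = \<Psi> (\<lambda>d. U k (\<lambda>y. f y * cnj (sh d f y)))"
proof -
  interpret M: inv_mean "MEAN :: (int poly \<Rightarrow> complex) \<Rightarrow> complex" by (rule inv_mean_MEAN)
  have "inv_mean (\<lambda>c. \<Psi> (\<lambda>d. MEAN (\<lambda>w :: int poly. c (pCons d w))))"
    by (rule inv_mean_comp[OF assms(1) inv_mean_MEAN]) (simp, metis pCons_cases)
  then have "MEAN (\<lambda>w. 1 * tr (cube (Suc k) (\<lambda>i. coeff w i) f)) =
      \<Psi> (\<lambda>d. MEAN (\<lambda>w. 1 * tr (cube (Suc k) (\<lambda>i. coeff (pCons d w) i) f)))"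
    by (rule mean_unique[OF inv_mean_MEAN _ _ lprod_cube[OF assms(2)]])
      (auto simp: character_def intro: additive_coeff)
  then show ?thesis by (simp add: U_def cube_Suc_shift)
qed

lemma ball_rest: "f \<in> ball \<Longrightarrow> rest k s f \<in> ball"
  by (induction k) (auto intro!: ball_one ball_mult ball_cnj ball_sh)

lemma ball_cube: "f \<in> ball \<Longrightarrow> cube k s f \<in> ball"
  unfolding cube_def by (intro ball_mult ball_rest)

lemma U_bound: "f \<in> ball \<Longrightarrow> cmod (U k f) \<le> 1"
  unfolding U_def by (intro inv_mean.bound[OF inv_mean_MEAN] cmod_tr_ball ball_cube)

definition ell :: "(int \<Rightarrow> complex) \<Rightarrow> nat \<Rightarrow> (nat \<Rightarrow> (int poly, 'b) pt \<Rightarrow> complex) \<Rightarrow> complex" where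
  "ell \<zeta> k f = fejer (\<lambda>m. \<zeta> m * tr (\<lambda>y. \<Prod>j\<le>k. sh (int j * m) (f j) y))"

lemma U_0: "U 0 f = tr f"
  using inv_mean.const[OF inv_mean_MEAN] by (simp add: U_def)

lemma ball_multi: "(\<And>j. f j \<in> ball) \<Longrightarrow> (\<lambda>y. \<Prod>j\<in>J. sh (a j) (f j) y) \<in> ball"
  by (intro ball_prod ball_sh)

lemma sh_prod_eq: "sh n (\<lambda>y. \<Prod>j\<in>J. F j y) = (\<lambda>y. \<Prod>j\<in>J. sh n (F j) y)"
  by (auto simp: sh_def)

lemma bdf_tr_ball: "(\<And>x. F x \<in> ball) \<Longrightarrow> bdf (\<lambda>x. tr (F x))"
  by (rule bdfI[of _ 1]) (rule cmod_tr_ball)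

text \<open>Van der Corput yields shifts by \<open>- d\<close>, so \<open>U_Suc\<close> is used with
  the reflected Fejer mean, the case \<open>k = 1\<close> of
  \<open>inv_mean_residues\<close>.\<close>

lemma ell_bound_1:
  assumes f: "\<And>j. f j \<in> ball"
  shows "(cmod (ell (\<lambda>_. 1) 1 f))\<^sup>2 \<le> Re (U 1 (f 0))"
proof -
  interpret L: inv_mean fejer by (rule inv_mean_fejer)
  define u where "u = (\<lambda>m. sh (- m) (f 0))"
  have u: "u m \<in> ball" for m unfolding u_def by (intro ball_sh f)
  have "tr (\<lambda>y. \<Prod>j\<le>1. sh (int j * m) (f j) y) = tr (\<lambda>y. f 1 y * u m y)" for m
  proof -
    have "tr (\<lambda>y. \<Prod>j\<le>1. sh (int j * m) (f j) y) = tr (sh (- m) (\<lambda>y. \<Prod>j\<le>1. sh (int j * m) (f j) y))"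
      by (intro tr_sh[symmetric] ballD(1) ball_multi f)
    then show ?thesis by (simp add: sh_mult u_def mult.commute)
  qed
  then have eq: "ell (\<lambda>_. 1) 1 f = fejer (\<lambda>m. tr (\<lambda>y. f 1 y * u m y))" by (simp add: ell_def)
  have vdC: "(cmod (fejer (\<lambda>m. tr (\<lambda>y. f 1 y * u m y))))\<^sup>2 \<le> Re (fejer (\<lambda>d. fejer (\<lambda>m. ip (u m) (u (m + d)))))"
    using u f by (intro van_der_Corput[OF inv_mean_fejer, of _ 1] ballD nrm_ball)
  have ip: "ip (u m) (u (m + d)) = tr (\<lambda>y. f 0 y * cnj (sh (- d) (f 0) y))" for m d
  proof -
    have "ip (u m) (u (m + d)) = tr (sh (- m) (\<lambda>y. f 0 y * cnj (sh (- d) (f 0) y)))"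
      by (simp add: ip_def u_def sh_mult sh_cnj)
    also have "\<dots> = tr (\<lambda>y. f 0 y * cnj (sh (- d) (f 0) y))"
      by (intro tr_sh ballD(1) ball_mult ball_cnj ball_sh f)
    finally show ?thesis .
  qed
  have "inv_mean (\<lambda>a. fejer (\<lambda>h. a (- h)))"
    using inv_mean_residues[OF inv_mean_fejer, of 1] by simp
  from U_Suc[OF this ballD(1)[OF f], of 0 0] show ?thesis
    using vdC unfolding eq by (simp add: ip U_0)
qed

text \<open>After a shift by \<open>- n m\<close> the last function carries no shift and is removed
  by van der Corput; the character leaves only the factor \<open>cnj (\<zeta> d)\<close> of modulus
  \<open>1\<close>. The hypothesis bounds the remaining form in the functions \<open>g j\<close>. It
  produces sides \<open>- n d\<close>, and the mean over multiples of \<open>n\<close> is compared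
  with the full mean through residues.\<close>

lemma ell_bound_Suc:
  assumes f: "\<And>j. f j \<in> ball" and \<zeta>: "character \<zeta>" and C: "C \<ge> 0" and \<eta>: "\<eta> > 0"
    and IH: "\<And>g. (\<And>j. g j \<in> ball) \<Longrightarrow> cmod (ell (\<lambda>_. 1) k g) \<le> \<eta> + C * Re (U k (g 0))"
  shows "(cmod (ell \<zeta> (Suc k) f))\<^sup>2 \<le> real (Suc k) * (\<eta> + C * Re (U (Suc k) (f 0)))"
proof -
  interpret L: inv_mean fejer by (rule inv_mean_fejer)
  define n where "n = Suc k"
  define v where "v = (\<lambda>m y. \<Prod>j\<le>k. sh ((int j - int n) * m) (f j) y)"
  define u where "u = (\<lambda>m y. \<zeta> m * v m y)"
  have v: "v m \<in> ball" for m unfolding v_def by (intro ball_multi f)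
  have u: "u m \<in> ball" for m unfolding u_def
    by (rule ballI[OF A_mult[OF A_const ballD(1)[OF v]]]) (simp add: norm_mult norm_character[OF \<zeta>] ballD(2)[OF v])
  have "\<zeta> m * tr (\<lambda>y. \<Prod>j\<le>n. sh (int j * m) (f j) y) = tr (\<lambda>y. f n y * u m y)" for m
  proof -
    have "tr (\<lambda>y. \<Prod>j\<le>n. sh (int j * m) (f j) y) = tr (sh (- (int n * m)) (\<lambda>y. \<Prod>j\<le>n. sh (int j * m) (f j) y))"
      by (intro tr_sh[symmetric] ballD(1) ball_multi f)
    also have "sh (- (int n * m)) (\<lambda>y. \<Prod>j\<le>n. sh (int j * m) (f j) y) = (\<lambda>y. f n y * v m y)"
      unfolding sh_prod_eq by (simp add: n_def v_def algebra_simps)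
    also have "\<zeta> m * tr (\<lambda>y. f n y * v m y) = tr (\<lambda>y. \<zeta> m * (f n y * v m y))"
      by (intro tr_cmult[symmetric] A_mult ballD(1) f v)
    finally show ?thesis by (simp add: u_def mult_ac)
  qed
  then have "ell \<zeta> (Suc k) f = fejer (\<lambda>m. tr (\<lambda>y. f n y * u m y))" by (simp add: ell_def n_def)
  also have "(cmod \<dots>)\<^sup>2 \<le> Re (fejer (\<lambda>d. fejer (\<lambda>m. ip (u m) (u (m + d)))))"
    using u f by (intro van_der_Corput[OF inv_mean_fejer, of _ 1] ballD nrm_ball)
  also have "\<dots> \<le> cmod (fejer (\<lambda>d. fejer (\<lambda>m. ip (u m) (u (m + d)))))" by (rule complex_Re_le_cmod)
  also have "\<dots> \<le> Re (fejer (\<lambda>d. \<eta> + C * U k (\<lambda>y. f 0 y * cnj (sh (- (int n * d)) (f 0) y))))"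
  proof (rule L.cmod_le)
    have "cmod (ip (u m) (u m')) \<le> 1" for m m'
      unfolding ip_def by (intro cmod_tr_ball ball_mult ball_cnj u)
    then show "bdf (\<lambda>d. fejer (\<lambda>m. ip (u m) (u (m + d))))"
      by (intro bdfI[of _ 1] L.bound)
    show "bdf (\<lambda>d. \<eta> + C * U k (\<lambda>y. f 0 y * cnj (sh (- (int n * d)) (f 0) y)))"
      by (intro bdf_add bdf_const bdf_cmult bdfI[OF U_bound] ball_mult ball_cnj ball_sh f)
    fix d
    define g where "g = (\<lambda>j y. f j y * cnj (sh ((int j - int n) * d) (f j) y))"
    have g: "g j \<in> ball" for j unfolding g_def by (intro ball_mult ball_cnj ball_sh f)
    have "ip (u m) (u (m + d)) = cnj (\<zeta> d) * tr (\<lambda>y. \<Prod>j\<le>k. sh (int j * m) (g j) y)" for m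
    proof -
      let ?P = "\<lambda>y. \<Prod>j\<le>k. sh ((int j - int n) * m) (g j) y"
      have "(\<lambda>y. u m y * cnj (u (m + d) y)) = (\<lambda>y. (\<zeta> m * cnj (\<zeta> m)) * cnj (\<zeta> d) * ?P y)"
        by (simp add: u_def v_def character_add[OF \<zeta>] g_def sh_mult sh_cnj prod.distrib algebra_simps)
      then have "ip (u m) (u (m + d)) = tr (\<lambda>y. cnj (\<zeta> d) * ?P y)"
        by (simp add: ip_def character_mult_cnj[OF \<zeta>])
      also have "\<dots> = cnj (\<zeta> d) * tr ?P" by (intro tr_cmult ballD(1) ball_multi g)
      also have "tr ?P = tr (sh (int n * m) ?P)" by (intro tr_sh[symmetric] ballD(1) ball_multi g)
      also have "sh (int n * m) ?P = (\<lambda>y. \<Prod>j\<le>k. sh (int j * m) (g j) y)"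
        unfolding sh_prod_eq by (simp add: algebra_simps)
      finally show ?thesis .
    qed
    then have "fejer (\<lambda>m. ip (u m) (u (m + d))) = cnj (\<zeta> d) * ell (\<lambda>_. 1) k g"
      by (simp add: ell_def L.cmult bdf_tr_ball ball_multi g)
    then have "cmod (fejer (\<lambda>m. ip (u m) (u (m + d)))) = cmod (ell (\<lambda>_. 1) k g)"
      by (simp add: norm_mult norm_character[OF \<zeta>])
    also have "\<dots> \<le> \<eta> + C * Re (U k (g 0))" by (rule IH[OF g])
    finally show "cmod (fejer (\<lambda>m. ip (u m) (u (m + d)))) \<le>
        Re (\<eta> + C * U k (\<lambda>y. f 0 y * cnj (sh (- (int n * d)) (f 0) y)))"
      by (simp add: g_def)
  qed
  also have "\<dots> \<le> real n * (\<eta> + C * Re (U (Suc k) (f 0)))"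
  proof -
    define a where "a = (\<lambda>d. \<eta> + C * U k (\<lambda>y. f 0 y * cnj (sh d (f 0) y)))"
    have ab: "bdf a" unfolding a_def
      by (intro bdf_add bdf_const bdf_cmult bdfI[OF U_bound] ball_mult ball_cnj ball_sh f)
    \<comment> \<open>\<open>Re (a d)\<close> bounds a modulus, hence is non-negative; so one
      residue class is bounded by the sum over all of them.\<close>
    have a0: "0 \<le> Re (a d)" for d
    proof -
      have "0 \<le> \<eta> + C * Re (U k (\<lambda>y. f 0 y * cnj (sh d (f 0) y)))"
        using IH[of "\<lambda>_ y. f 0 y * cnj (sh d (f 0) y)"] norm_ge_zero order_trans
        by (intro order_trans[OF norm_ge_zero IH[of "\<lambda>_ y. f 0 y * cnj (sh d (f 0) y)"]] ball_mult ball_cnj ball_sh f)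
      then show ?thesis by (simp add: a_def)
    qed
    have n: "n > 0" by (simp add: n_def)
    define \<Psi> where "\<Psi> = (\<lambda>a. avg [0..<n] (\<lambda>r. fejer (\<lambda>h. a (- (int n * h) + int r))))"
    have \<Psi>: "inv_mean \<Psi>" unfolding \<Psi>_def by (rule inv_mean_residues[OF inv_mean_fejer n])
    interpret P: inv_mean \<Psi> by (rule \<Psi>)
    have bU: "bdf (\<lambda>d. U k (\<lambda>y. f 0 y * cnj (sh d (f 0) y)))"
      by (intro bdfI[OF U_bound] ball_mult ball_cnj ball_sh f)
    have "\<Psi> a = \<eta> + C * U (Suc k) (f 0)"
      unfolding a_def using U_Suc[OF \<Psi> ballD(1)[OF f], of k 0]
      by (simp add: P.add bdf_const bdf_cmult P.cmult bU)
    moreover have "Re (fejer (\<lambda>h. a (- (int n * h)))) \<le> real n * Re (\<Psi> a)"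
    proof -
      let ?t = "\<lambda>r. Re (fejer (\<lambda>h. a (- (int n * h) + int r)))"
      have "?t 0 \<le> (\<Sum>r<n. ?t r)"
        using n by (intro member_le_sum L.nonneg bdf_comp[OF ab] a0) auto
      also have "\<dots> = real n * Re (\<Psi> a)"
        using n by (simp add: \<Psi>_def Re_avg avg_def interv_sum_list_conv_sum_set_nat lessThan_atLeast0)
      finally show ?thesis by simp
    qed
    ultimately show ?thesis by (simp add: a_def)
  qed
  finally show ?thesis by (simp add: n_def)
qed

text \<open>From \<open>k = 2\<close> on \<open>\<zeta>\<close> is arbitrary because the step uses
  the hypothesis only for the trivial character. At \<open>k = 1\<close> the factor
  \<open>cnj (\<zeta> d)\<close> would stay inside the mean over \<open>d\<close>, and
  \<open>U 1\<close> does not see it.\<close>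

lemma ell_bound:
  assumes "k \<ge> 1" "character \<zeta>" "k = 1 \<Longrightarrow> \<zeta> = (\<lambda>_. 1)" "\<eta> > 0"
  shows "\<exists>C\<ge>0. \<forall>f. (\<forall>j. f j \<in> ball) \<longrightarrow> cmod (ell \<zeta> k f) \<le> \<eta> + C * Re (U k (f 0))"
  using assms
proof (induction k arbitrary: \<zeta> \<eta> rule: nat_induct_at_least)
  case base
  have "cmod (ell \<zeta> 1 f) \<le> \<eta> + 1 / \<eta> * Re (U 1 (f 0))" if "\<forall>j. f j \<in> ball" for f
    using le_add_square_div[OF \<open>\<eta> > 0\<close> norm_ge_zero ell_bound_1, of f] that base by simp
  then show ?case using base by (intro exI[of _ "1 / \<eta>"]) auto
next
  case (Suc k)
  \<comment> \<open>The bound on the square is converted with \<open>t = \<eta> / 2\<close>; then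
    \<open>\<eta>'\<close> contributes
    \<open>2 / \<eta> * (real (Suc k) * \<eta>') = \<eta> / 2\<close>.\<close>
  define \<eta>' where "\<eta>' = \<eta>\<^sup>2 / (4 * real (Suc k))"
  have \<eta>': "\<eta>' > 0" using Suc.prems by (simp add: \<eta>'_def)
  have "character (\<lambda>_. 1)" by (simp add: character_def)
  then obtain C where C: "C \<ge> 0" "\<And>g. (\<And>j. g j \<in> ball) \<Longrightarrow> cmod (ell (\<lambda>_. 1) k g) \<le> \<eta>' + C * Re (U k (g 0))"
    using Suc.IH[of "\<lambda>_. 1" \<eta>'] \<eta>' by blast
  define C' where "C' = 2 / \<eta> * real (Suc k) * C"
  have "cmod (ell \<zeta> (Suc k) f) \<le> \<eta> + C' * Re (U (Suc k) (f 0))" if "\<forall>j. f j \<in> ball" for f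
  proof -
    let ?r = "Re (U (Suc k) (f 0))"
    have "cmod (ell \<zeta> (Suc k) f) \<le> \<eta> / 2 + real (Suc k) * (\<eta>' + C * ?r) / (\<eta> / 2)"
      using that Suc.prems by (intro le_add_square_div ell_bound_Suc C \<eta>') auto
    also have "\<dots> = \<eta> / 2 + (2 / \<eta> * (real (Suc k) * \<eta>') + C' * ?r)"
      using Suc.prems by (simp add: C'_def field_simps)
    also have "2 / \<eta> * (real (Suc k) * \<eta>') = \<eta> / 2"
    proof -
      have eq: "real (Suc k) * \<eta>' = \<eta>\<^sup>2 / 4" by (simp add: \<eta>'_def del: of_nat_Suc)
      show ?thesis unfolding eq using Suc.prems by (simp add: power2_eq_square)
    qed
    finally show ?thesis by simp
  qed
  then show ?case using C(1) Suc.prems unfolding C'_def by (intro exI[of _ "2 / \<eta> * real (Suc k) * C"]) auto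
qed

end

lemma rest_cong: "(\<And>i. i < k \<Longrightarrow> s i = t i) \<Longrightarrow> rest k s f = rest k t f"
  by (induction k) auto

section \<open>Vanishing of the twisted correlations\<close>

context poly_algebra
begin

text \<open>Moving all sides of the cube by \<open>m\<close> shifts each vertex by a multiple \<open>j m\<close>, \<open>1 \<le> j \<le> k\<close>.\<close>

lemma rest_shift:
  assumes f: "f \<in> ball"
  shows "\<exists>F. (\<forall>j. F j \<in> ball) \<and>
    (\<forall>m. rest k (\<lambda>i. s i + m) f = (\<lambda>y. \<Prod>j\<in>{1..k}. sh (int j * m) (F j) y))"
proof (induction k)
  case 0
  show ?case using ball_one by (intro exI[of _ "\<lambda>_ _. 1"]) auto
next
  case (Suc k)
  then obtain F where F: "\<And>j. F j \<in> ball"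
    "\<And>m. rest k (\<lambda>i. s i + m) f = (\<lambda>y. \<Prod>j\<in>{1..k}. sh (int j * m) (F j) y)" by blast
  \<comment> \<open>The product of \<open>f\<close> and \<open>rest k\<close> has the factors
    \<open>H 0, ..., H k\<close> at the multiples \<open>0, ..., k\<close> of \<open>m\<close>; the
    new side moves each of them up by one multiple, which explains the index \<open>j - 1\<close> in
    \<open>G\<close>.\<close>
  define H where "H = (\<lambda>j. if j = 0 then f else F j)"
  define G where "G = (\<lambda>j y. (if j \<le> k then F j y else 1) * cnj (sh (s k) (H (j - 1)) y))"
  have G: "G j \<in> ball" for j
    unfolding G_def H_def by (cases "j \<le> k"; cases "j - 1 = 0") (auto intro!: ball_mult ball_cnj ball_sh ball_one F f)
  have "rest (Suc k) (\<lambda>i. s i + m) f = (\<lambda>y. \<Prod>j\<in>{1..Suc k}. sh (int j * m) (G j) y)" for m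
  proof
    fix y
    have "(\<Prod>j\<in>{1..Suc k}. sh (int j * m) (G j) y) =
       (\<Prod>j\<in>{1..Suc k}. if j \<le> k then sh (int j * m) (F j) y else 1) *
       (\<Prod>j\<in>{1..Suc k}. cnj (sh (int j * m + s k) (H (j - 1)) y))"
      unfolding prod.distrib[symmetric] G_def
      by (intro prod.cong) (auto simp: sh_mult sh_cnj sh_const)
    also have "(\<Prod>j\<in>{1..Suc k}. if j \<le> k then sh (int j * m) (F j) y else 1) =
        (\<Prod>j\<in>{1..k}. sh (int j * m) (F j) y)" by simp
    also have "(\<Prod>j\<in>{1..Suc k}. cnj (sh (int j * m + s k) (H (j - 1)) y)) =
        (\<Prod>j\<in>{0..k}. cnj (sh (int (Suc j) * m + s k) (H j) y))"
      unfolding One_nat_def prod.shift_bounds_cl_Suc_ivl by simp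
    also have "\<dots> = cnj (sh (m + s k) f y) * (\<Prod>j\<in>{Suc 0..k}. cnj (sh (int (Suc j) * m + s k) (H j) y))"
      by (subst prod.atLeast_Suc_atMost) (auto simp: H_def)
    also have "(\<Prod>j\<in>{Suc 0..k}. cnj (sh (int (Suc j) * m + s k) (H j) y)) =
        (\<Prod>j\<in>{1..k}. cnj (sh (s k + m) (sh (int j * m) (F j)) y))"
      by (intro prod.cong) (auto simp: H_def algebra_simps)
    also have "\<dots> = cnj (sh (s k + m) (\<lambda>y. \<Prod>j\<in>{1..k}. sh (int j * m) (F j) y) y)"
      unfolding sh_prod_eq by simp
    finally show "rest (Suc k) (\<lambda>i. s i + m) f y = (\<Prod>j\<in>{1..Suc k}. sh (int j * m) (G j) y)"
      by (simp only: rest.simps F(2) sh_mult) (simp add: add.commute mult_ac)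
  qed
  then show ?case using G by blast
qed

definition prog :: "nat \<Rightarrow> (nat \<Rightarrow> (int poly, 'b) pt \<Rightarrow> complex) \<Rightarrow> int \<Rightarrow> (int poly, 'b) pt \<Rightarrow> complex" where
  "prog k f m = (\<lambda>y. \<Prod>j\<in>{1..k}. sh (int j * m) (f j) y)"

text \<open>The progression read on \<open>int poly\<close>: only coefficient \<open>0\<close>
  shifts, so integer averages become averages over the group for which the means are known to
  agree.\<close>

definition prog_fs :: "nat \<Rightarrow> (nat \<Rightarrow> (int poly, 'b) pt \<Rightarrow> complex) \<Rightarrow> ((int poly \<Rightarrow> int) \<times> ((int poly, 'b) pt \<Rightarrow> complex)) list" where
  "prog_fs k f = map (\<lambda>j. (\<lambda>p. int j * coeff p 0, f j)) [1..<Suc k]"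

lemma lp_prog_fs: "lp (prog_fs k f) w = prog k f (coeff w 0)"
  by (intro HOL.ext) (simp add: lp_def prog_fs_def prog_def o_def prod.distinct_set_conv_list[symmetric]
      atLeastLessThanSuc_atLeastAtMost del: upt_Suc)

lemma valid_prog_fs: "(\<And>j. j \<in> {1..k} \<Longrightarrow> f j \<in> A) \<Longrightarrow> valid A (prog_fs k f)"
  by (auto simp: valid_def prog_fs_def intro!: additive_cmult_int additive_coeff)

lemma ball_prog: "(\<And>j. f j \<in> ball) \<Longrightarrow> prog k f m \<in> ball"
  unfolding prog_def by (rule ball_multi)

lemma ell_eq_prog: "ell \<zeta> k f = fejer (\<lambda>m. \<zeta> m * tr (\<lambda>y. f 0 y * prog k f m y))"
proof -
  have "(\<Prod>j\<le>k. sh (int j * m) (f j) y) = f 0 y * prog k f m y" for m y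
    by (simp add: prog_def prod.atLeast_Suc_atMost[of 0 k] flip: atLeast0AtMost)
  then show ?thesis by (simp add: ell_def)
qed

text \<open>The Fejer mean in coefficient \<open>0\<close>, combined with a mean in the others, is
  an invariant mean on \<open>int poly\<close>, so \<open>mean_near_mav\<close> applies.\<close>

lemma fejer_near_mav:
  assumes \<zeta>: "character \<zeta>" and f: "\<And>j. f j \<in> ball" and R: "R \<in> ball" and "W \<noteq> []"
    and near: "\<And>g. nrm (\<lambda>y. mav (\<lambda>p. \<zeta> (coeff p 0)) (prog_fs k f) (map ((+) g) W) y -
        mav (\<lambda>p. \<zeta> (coeff p 0)) (prog_fs k f) W y) \<le> \<epsilon>"
  shows "cmod (fejer (\<lambda>m. \<zeta> m * tr (\<lambda>y. R y * prog k f m y)) -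
      tr (\<lambda>y. R y * mav (\<lambda>p. \<zeta> (coeff p 0)) (prog_fs k f) W y)) \<le> \<epsilon>"
proof -
  interpret M: inv_mean "MEAN :: (int poly \<Rightarrow> complex) \<Rightarrow> complex" by (rule inv_mean_MEAN)
  have "inv_mean (\<lambda>c. fejer (\<lambda>d. MEAN (\<lambda>w :: int poly. c (pCons d w))))"
    by (rule inv_mean_comp[OF inv_mean_fejer inv_mean_MEAN]) (simp, metis pCons_cases)
  from mean_near_mav[OF this character_int_poly[OF \<zeta>] valid_prog_fs[of k f] ballD(1)[OF R] nrm_ball[OF R] assms(4) near]
  show ?thesis using f by (simp add: lp_prog_fs ballD(1))
qed

lemma norm_mav_prog_le:
  assumes "character \<zeta>" "\<And>j. f j \<in> ball" "W \<noteq> []"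
  shows "mav (\<lambda>p. \<zeta> (coeff p 0)) (prog_fs k f) W \<in> ball"
proof (rule ballI)
  show "mav (\<lambda>p. \<zeta> (coeff p 0)) (prog_fs k f) W \<in> A"
    by (intro mav_A valid_prog_fs ballD(1) assms)
  show "cmod (mav (\<lambda>p. \<zeta> (coeff p 0)) (prog_fs k f) W y) \<le> 1" for y
    unfolding mav_def
    by (intro norm_avg_le assms) (simp add: norm_mult norm_character[OF assms(1)] lp_prog_fs ballD(2) ball_prog assms)
qed

text \<open>Expand the one unshifted factor of the cube into the progression average that it stands
  for. Moving all sides by the variable \<open>m\<close> of the progression leaves, for fixed sides,
  a twisted form with functions at the multiples \<open>1, ..., Suc k\<close> of \<open>m\<close>; a
  shift by \<open>- m\<close> turns it into \<open>ell \<zeta> k\<close>.\<close>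

lemma U_small:
  assumes \<zeta>: "character \<zeta>" and f: "\<And>j. f j \<in> ball" and W: "W \<noteq> []"
    and near: "\<And>g. nrm (\<lambda>y. mav (\<lambda>p. \<zeta> (coeff p 0)) (prog_fs (Suc k) f) (map ((+) g) W) y -
        mav (\<lambda>p. \<zeta> (coeff p 0)) (prog_fs (Suc k) f) W y) \<le> \<epsilon>"
    and IH: "\<And>g. (\<And>j. g j \<in> ball) \<Longrightarrow> ell \<zeta> k g = 0"
  shows "cmod (U (Suc k) (\<lambda>y. cnj (mav (\<lambda>p. \<zeta> (coeff p 0)) (prog_fs (Suc k) f) W y))) \<le> \<epsilon>"
proof -
  interpret M: inv_mean "MEAN :: (int poly \<Rightarrow> complex) \<Rightarrow> complex" by (rule inv_mean_MEAN)
  interpret L: inv_mean fejer by (rule inv_mean_fejer)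
  define n where "n = Suc k"
  define a where "a = mav (\<lambda>p. \<zeta> (coeff p 0)) (prog_fs n f) W"
  define g where "g = (\<lambda>y. cnj (a y))"
  have a: "a \<in> ball" unfolding a_def by (rule norm_mav_prog_le[OF \<zeta> f W])
  have g: "g \<in> ball" unfolding g_def by (rule ball_cnj[OF a])
  define R where "R = (\<lambda>s y. cnj (rest n s g y))"
  have R: "R s \<in> ball" for s unfolding R_def by (intro ball_cnj ball_rest g)
  define D where "D = (\<lambda>s. fejer (\<lambda>m. \<zeta> m * tr (\<lambda>y. R s y * prog n f m y)))"
  have near_D: "cmod (tr (\<lambda>y. R s y * a y) - D s) \<le> \<epsilon>" for s
    using fejer_near_mav[OF \<zeta> f R W near[folded n_def]] by (simp add: D_def a_def norm_minus_commute)
  have Db: "bdf (\<lambda>h. D (s h))" for s :: "int poly \<Rightarrow> nat \<Rightarrow> int"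
    unfolding D_def
    by (intro bdfI[of _ 1] L.bound) (simp add: norm_mult norm_character[OF \<zeta>] cmod_tr_ball ball_mult R ball_prog f)
  have "cnj (U n g) = MEAN (\<lambda>h. tr (\<lambda>y. R (coeff h) y * a y))"
  proof -
    have "cnj (tr (cube n s g)) = tr (\<lambda>y. R s y * a y)" for s
      using tr_cnj[OF ballD(1)[OF ball_cube[OF g]], of n s] by (simp add: cube_def R_def g_def mult.commute)
    then show ?thesis unfolding U_def using M.cnj[OF bdf_tr_ball[of "\<lambda>w. cube n (coeff w) g", OF ball_cube[OF g]]] by simp
  qed
  then have "cmod (cnj (U n g) - MEAN (\<lambda>h. D (coeff h))) \<le> \<epsilon>"
    using M.cong_dist[OF bdf_tr_ball Db near_D, of coeff] by (simp add: ball_mult R a)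
  moreover have "MEAN (\<lambda>h :: int poly. D (coeff h)) = 0"
  proof -
    define u where "u = (\<lambda>w :: int poly. \<lambda>y. R (\<lambda>i. coeff w (Suc i)) y * prog n f (coeff w 0) y)"
    have u: "lprod u"
      unfolding u_def R_def prog_def
      by (intro lprod_mult lprod_cnj lprod_rest lprod_prod lprod_sh lprod_const additive_coeff
          additive_cmult_int ballD(1) g f)
    \<comment> \<open>Adding \<open>smult m e\<close> moves the first \<open>n\<close> sides by
      \<open>m\<close>, and these are the only sides that \<open>rest n\<close> reads.\<close>
    define e where "e = (\<Sum>i<n. monom (1 :: int) i)"
    have e: "coeff e i = (if i < n then 1 else 0)" for i
      by (simp add: e_def coeff_sum)
    \<comment> \<open>\<open>c1\<close> and \<open>c2\<close> are the same nested mean in plain and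
      in sheared coordinates; \<open>mean_unique\<close> equates them on \<open>u\<close>.\<close>
    have c1: "inv_mean (\<lambda>c. MEAN (\<lambda>h. fejer (\<lambda>m. c (pCons m h))))"
      by (rule inv_mean_comp[OF inv_mean_MEAN inv_mean_fejer]) (simp, metis pCons_cases)
    have c2: "inv_mean (\<lambda>c. MEAN (\<lambda>h. fejer (\<lambda>m. c (pCons m (h + smult m e)))))"
    proof (rule inv_mean_comp[OF inv_mean_MEAN inv_mean_fejer])
      fix p :: "int poly"
      obtain m h where "p = pCons m h" by (rule pCons_cases)
      then show "\<exists>h m. pCons m (h + smult m e) = p"
        by (intro exI[of _ "h - smult m e"] exI[of _ m]) simp
    qed (simp add: algebra_simps smult_add_left)
    have "MEAN (\<lambda>h :: int poly. D (coeff h)) =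
       MEAN (\<lambda>h. fejer (\<lambda>m. \<zeta> (coeff (pCons m h) 0) * tr (u (pCons m h))))"
      by (simp add: D_def u_def)
    also have "\<dots> = MEAN (\<lambda>h. fejer (\<lambda>m. \<zeta> (coeff (pCons m (h + smult m e)) 0) * tr (u (pCons m (h + smult m e)))))"
      by (rule mean_unique[OF c1 c2 character_int_poly[OF \<zeta>] u])
    also have "\<dots> = MEAN (\<lambda>h :: int poly. 0)"
    proof -
      have "fejer (\<lambda>m. \<zeta> (coeff (pCons m (h + smult m e)) 0) * tr (u (pCons m (h + smult m e)))) = 0" for h
      proof -
        obtain F where F: "\<And>j. F j \<in> ball"
          "\<And>m. rest n (\<lambda>i. coeff h i + m) g = (\<lambda>y. \<Prod>j\<in>{1..n}. sh (int j * m) (F j) y)"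
          using rest_shift[OF g, of n "coeff h"] by blast
        define G where "G = (\<lambda>j y. cnj (F (Suc j) y) * f (Suc j) y)"
        have G: "G j \<in> ball" for j unfolding G_def by (intro ball_mult ball_cnj F f)
        have "tr (u (pCons m (h + smult m e))) = tr (\<lambda>y. \<Prod>j\<le>k. sh (int j * m) (G j) y)" for m
        proof -
          have eq: "rest n (\<lambda>i. coeff (h + smult m e) i) g = rest n (\<lambda>i. coeff h i + m) g"
            by (rule rest_cong) (simp add: e)
          have "u (pCons m (h + smult m e)) = (\<lambda>y. \<Prod>j\<in>{1..n}. sh (int j * m) (\<lambda>y. cnj (F j y) * f j y) y)"
            unfolding u_def R_def prog_def coeff_pCons_Suc coeff_pCons_0 eq F(2)
            by (simp add: sh_mult sh_cnj prod.distrib)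
          also have "\<dots> = (\<lambda>y. \<Prod>j\<le>k. sh (int (Suc j) * m) (G j) y)"
            unfolding n_def One_nat_def prod.shift_bounds_cl_Suc_ivl atLeast0AtMost G_def ..
          finally have "tr (u (pCons m (h + smult m e))) = tr (\<lambda>y. \<Prod>j\<le>k. sh (int (Suc j) * m) (G j) y)"
            by simp
          also have "\<dots> = tr (sh (- m) (\<lambda>y. \<Prod>j\<le>k. sh (int (Suc j) * m) (G j) y))"
            by (intro tr_sh[symmetric] ballD(1) ball_multi G)
          finally show ?thesis unfolding sh_prod_eq by (simp add: algebra_simps)
        qed
        then show ?thesis using IH[OF G] by (simp add: ell_def)
      qed
      then show ?thesis by simp
    qed
    finally show ?thesis by simp
  qed
  ultimately show ?thesis by (simp add: n_def a_def g_def)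
qed

text \<open>Test the vanishing form against the conjugate of a translation-stable average, placed at
  position \<open>0\<close>: the form is then close to the squared norm of that average.\<close>

lemma prog_small:
  assumes \<zeta>: "character \<zeta>" and f: "\<And>j. f j \<in> ball"
    and zero: "\<And>g. (\<And>j. g j \<in> ball) \<Longrightarrow> ell \<zeta> k g = 0" and \<epsilon>: "\<epsilon> > 0"
  shows "\<exists>W. W \<noteq> [] \<and> (\<forall>g. nrm (mav (\<lambda>p. \<zeta> (coeff p 0)) (prog_fs k f) (map ((+) g) W)) \<le> \<epsilon>)"
proof -
  define \<delta> where "\<delta> = min (\<epsilon> / 2) ((\<epsilon> / 2)\<^sup>2)"
  have \<delta>: "\<delta> > 0" "\<delta> \<le> \<epsilon> / 2" "\<delta> \<le> (\<epsilon> / 2)\<^sup>2" using \<epsilon> by (auto simp: \<delta>_def)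
  let ?a = "mav (\<lambda>p. \<zeta> (coeff p 0)) (prog_fs k f)"
  have v: "valid A (prog_fs k f)" by (intro valid_prog_fs ballD(1) f)
  obtain W where W: "W \<noteq> []" "\<And>g. nrm (\<lambda>y. ?a (map ((+) g) W) y - ?a W y) \<le> \<delta>"
    using ex_translation_stable[OF character_int_poly[OF \<zeta>] v \<delta>(1)] by blast
  have aA: "?a V \<in> A" for V by (rule mav_A[OF v])
  have a: "?a W \<in> ball" by (rule norm_mav_prog_le[OF \<zeta> f W(1)])
  define g where "g = (\<lambda>j. if j = 0 then (\<lambda>y. cnj (?a W y)) else f j)"
  have g: "g j \<in> ball" for j unfolding g_def using ball_cnj[OF a] f by auto
  have pg: "prog k g = prog k f" unfolding prog_def g_def by (intro HOL.ext prod.cong) auto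
  have "fejer (\<lambda>m. \<zeta> m * tr (\<lambda>y. cnj (?a W y) * prog k f m y)) = 0"
    using zero[of g, OF g] unfolding ell_eq_prog pg by (simp add: g_def)
  then have "cmod (tr (\<lambda>y. cnj (?a W y) * ?a W y)) \<le> \<delta>"
    using fejer_near_mav[OF \<zeta> f ball_cnj[OF a] W] by simp
  then have "(nrm (?a W))\<^sup>2 \<le> (\<epsilon> / 2)\<^sup>2"
    using complex_Re_le_cmod[of "ip (?a W) (?a W)"] \<delta>(3) nrm_power2[OF aA, of W]
    by (simp add: ip_def mult.commute)
  then have n: "nrm (?a W) \<le> \<epsilon> / 2" by (rule power2_le_imp_le) (use \<epsilon> in simp)
  have "nrm (?a (map ((+) g) W)) \<le> \<epsilon>" for g
  proof -
    have "nrm (?a (map ((+) g) W)) \<le> nrm (\<lambda>y. ?a (map ((+) g) W) y - ?a W y) + nrm (?a W)"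
      using nrm_triangle[OF A_diff[OF aA aA] aA, of "map ((+) g) W" W W] by simp
    then show ?thesis using n W(2)[of g] \<delta>(2) by linarith
  qed
  then show ?thesis using W(1) by blast
qed

text \<open>Translating \<open>W\<close> by \<open>g\<close> changes the twisted average
  \<open>a\<close> only by a shift and a factor of modulus \<open>1\<close>, so all translated
  averages of the correlation are bounded by the norm of \<open>a\<close>.\<close>

lemma ell_zero_1:
  assumes \<zeta>: "character \<zeta>" and f: "\<And>j. f j \<in> ball"
    and no_eigen: "\<And>f \<epsilon>. f \<in> A \<Longrightarrow> \<epsilon> > 0 \<Longrightarrow>
      \<exists>W :: int list. W \<noteq> [] \<and> nrm (\<lambda>y. avg W (\<lambda>w. \<zeta> w * sh w f y)) \<le> \<epsilon>"
  shows "ell \<zeta> 1 f = 0"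
proof -
  interpret L: inv_mean fejer by (rule inv_mean_fejer)
  let ?c = "\<lambda>m. \<zeta> m * tr (\<lambda>y. f 0 y * sh m (f 1) y)"
  have b: "bdf ?c"
    by (intro bdfI[of _ 1]) (simp add: norm_mult norm_character[OF \<zeta>] cmod_tr_ball ball_mult ball_sh f)
  have "cmod (fejer ?c) \<le> 0 + \<epsilon>" if \<epsilon>: "\<epsilon> > 0" for \<epsilon>
  proof -
    obtain W :: "int list" where W: "W \<noteq> []" "nrm (\<lambda>y. avg W (\<lambda>w. \<zeta> w * sh w (f 1) y)) \<le> \<epsilon>"
      using no_eigen[OF ballD(1)[OF f] \<epsilon>] by blast
    define a where "a = (\<lambda>y. avg W (\<lambda>w. \<zeta> w * sh w (f 1) y))"
    have an: "nrm a \<le> \<epsilon>" using W(2) by (simp only: a_def)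
    have aA: "a \<in> A" unfolding a_def by (intro A_avg A_mult A_const A_sh ballD(1) f)
    have "cmod (avg W (\<lambda>w. ?c (g + w)) - 0) \<le> \<epsilon>" for g
    proof -
      have "avg W (\<lambda>w. ?c (g + w)) = avg W (\<lambda>w. tr (\<lambda>y. f 0 y * (\<zeta> g * (\<zeta> w * sh (g + w) (f 1) y))))"
      proof (rule avg_cong)
        fix w
        have "?c (g + w) = tr (\<lambda>y. (\<zeta> (g + w)) * (f 0 y * sh (g + w) (f 1) y))"
          by (intro tr_cmult[symmetric] A_mult A_sh ballD(1) f)
        then show "?c (g + w) = tr (\<lambda>y. f 0 y * (\<zeta> g * (\<zeta> w * sh (g + w) (f 1) y)))"
          by (simp add: character_add[OF \<zeta>] mult_ac)
      qed
      also have "\<dots> = tr (\<lambda>y. avg W (\<lambda>w. f 0 y * (\<zeta> g * (\<zeta> w * sh (g + w) (f 1) y))))"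
        by (intro tr_avg[symmetric] A_mult A_const A_sh ballD(1) f)
      also have "\<dots> = tr (\<lambda>y. f 0 y * (\<zeta> g * sh g a y))"
        unfolding avg_cmult a_def sh_avg by (simp add: sh_mult sh_const)
      also have "cmod \<dots> \<le> nrm (f 0) * nrm (\<lambda>y. \<zeta> g * sh g a y)"
        by (intro cmod_tr_mult_le A_mult A_const A_sh aA ballD(1) f)
      also have "nrm (\<lambda>y. \<zeta> g * sh g a y) = nrm a"
        by (simp add: nrm_cmult A_sh aA norm_character[OF \<zeta>] nrm_sh)
      also have "nrm (f 0) * nrm a \<le> 1 * \<epsilon>"
        using nrm_nonneg[OF aA] by (intro mult_mono nrm_ball f an) auto
      finally show ?thesis by simp
    qed
    from L.near_avg[OF b W(1) this] show ?thesis by simp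
  qed
  then have "cmod (fejer ?c) \<le> 0" by (rule field_le_epsilon)
  then show ?thesis by (simp add: ell_def)
qed

text \<open>If the form had modulus \<open>x > 0\<close>, then \<open>ell_bound\<close> and
  \<open>U_small\<close> would make the form with the conjugate average at position \<open>0\<close>
  small, hence also the squared norm of the average. But the original form is nearly
  \<open>tr\<close> of \<open>f 0\<close> against that average.\<close>

theorem ell_zero:
  assumes "k \<ge> 1" and \<zeta>: "character \<zeta>" and f: "\<And>j. f j \<in> ball"
    and no_eigen: "\<And>f \<epsilon>. f \<in> A \<Longrightarrow> \<epsilon> > 0 \<Longrightarrow>
      \<exists>W :: int list. W \<noteq> [] \<and> nrm (\<lambda>y. avg W (\<lambda>w. \<zeta> w * sh w f y)) \<le> \<epsilon>"
  shows "ell \<zeta> k f = 0"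
  using assms(1) f
proof (induction k arbitrary: f rule: nat_induct_at_least)
  case base
  then show ?case using ell_zero_1[OF \<zeta> _ no_eigen] by simp
next
  case (Suc k)
  define x where "x = cmod (ell \<zeta> (Suc k) f)"
  have "x \<le> 0"
  proof (rule ccontr)
    assume "\<not> x \<le> 0"
    then have x: "x > 0" by simp
    obtain C where C: "C \<ge> 0" "\<And>f. (\<And>j. f j \<in> ball) \<Longrightarrow> cmod (ell \<zeta> (Suc k) f) \<le> x\<^sup>2 / 32 + C * Re (U (Suc k) (f 0))"
      using ell_bound[of "Suc k" \<zeta> "x\<^sup>2 / 32"] \<zeta> Suc.hyps x by auto
    \<comment> \<open>The squared norm of the average is at most \<open>\<epsilon> + x\<^sup>2 / 32
      + C * \<epsilon> \<le> x\<^sup>2 / 16\<close>, and the contradiction is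
      \<open>x \<le> \<epsilon> + x / 4 \<le> x / 2\<close>.\<close>
    define \<epsilon> where "\<epsilon> = min (x / 4) (x\<^sup>2 / 32 / (C + 1))"
    have "(C + 1) * \<epsilon> \<le> (C + 1) * (x\<^sup>2 / 32 / (C + 1))"
      unfolding \<epsilon>_def by (rule mult_left_mono[OF min.cobounded2]) (use C(1) in simp)
    also have "\<dots> = x\<^sup>2 / 32"
      using C(1) nonzero_mult_div_cancel_left[of "C + 1" "x\<^sup>2 / 32"] by simp
    finally have "(C + 1) * \<epsilon> \<le> x\<^sup>2 / 32" .
    moreover have "\<epsilon> > 0" using x C(1) by (simp add: \<epsilon>_def)
    moreover have "\<epsilon> \<le> x / 4" unfolding \<epsilon>_def by (rule min.cobounded1)
    ultimately have \<epsilon>: "\<epsilon> > 0" "\<epsilon> \<le> x / 4" "(C + 1) * \<epsilon> \<le> x\<^sup>2 / 32" by auto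
    let ?a = "mav (\<lambda>p. \<zeta> (coeff p 0)) (prog_fs (Suc k) f)"
    have v: "valid A (prog_fs (Suc k) f)" by (intro valid_prog_fs ballD(1) Suc.prems)
    obtain W where W: "W \<noteq> []" "\<And>g. nrm (\<lambda>y. ?a (map ((+) g) W) y - ?a W y) \<le> \<epsilon>"
      using ex_translation_stable[OF character_int_poly[OF \<zeta>] v \<epsilon>(1)] by blast
    have a: "?a W \<in> ball" by (rule norm_mav_prog_le[OF \<zeta> Suc.prems W(1)])
    have U: "cmod (U (Suc k) (\<lambda>y. cnj (?a W y))) \<le> \<epsilon>"
      by (rule U_small[OF \<zeta> Suc.prems W Suc.IH])
    define g where "g = (\<lambda>j. if j = 0 then (\<lambda>y. cnj (?a W y)) else f j)"
    have g: "g j \<in> ball" for j unfolding g_def using ball_cnj[OF a] Suc.prems by auto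
    have pg: "prog (Suc k) g = prog (Suc k) f" unfolding prog_def g_def by (intro HOL.ext prod.cong) auto
    have "cmod (ell \<zeta> (Suc k) g) \<le> x\<^sup>2 / 32 + C * Re (U (Suc k) (g 0))" by (rule C(2)[OF g])
    also have "\<dots> \<le> x\<^sup>2 / 32 + C * \<epsilon>"
      using U C(1) complex_Re_le_cmod[of "U (Suc k) (g 0)"]
      by (intro add_left_mono mult_left_mono) (auto simp: g_def intro: order_trans)
    finally have eg: "cmod (ell \<zeta> (Suc k) g) \<le> x\<^sup>2 / 32 + C * \<epsilon>" .
    have near: "cmod (ell \<zeta> (Suc k) h - tr (\<lambda>y. h 0 y * ?a W y)) \<le> \<epsilon>"
      if "prog (Suc k) h = prog (Suc k) f" "h 0 \<in> ball" for h
      using fejer_near_mav[OF \<zeta> Suc.prems that(2) W] by (simp add: ell_eq_prog that(1))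
    have "cmod (tr (\<lambda>y. cnj (?a W y) * ?a W y)) \<le> x\<^sup>2 / 16"
      using near[OF pg g] eg \<epsilon>(3) norm_triangle_sub[of "tr (\<lambda>y. g 0 y * ?a W y)" "ell \<zeta> (Suc k) g"]
      by (simp add: g_def norm_minus_commute algebra_simps)
    then have "(nrm (?a W))\<^sup>2 \<le> (x / 4)\<^sup>2"
      using complex_Re_le_cmod[of "ip (?a W) (?a W)"] nrm_power2[OF ballD(1)[OF a]]
      by (simp add: ip_def mult.commute power_divide)
    then have n: "nrm (?a W) \<le> x / 4" by (rule power2_le_imp_le) (use x in simp)
    have "cmod (tr (\<lambda>y. f 0 y * ?a W y)) \<le> nrm (f 0) * nrm (?a W)"
      by (intro cmod_tr_mult_le ballD(1) Suc.prems a)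
    also have "\<dots> \<le> 1 * (x / 4)"
      using n by (intro mult_mono nrm_ball Suc.prems) (auto intro: nrm_nonneg ballD(1) a)
    finally have "x \<le> \<epsilon> + x / 4"
      using near[OF refl Suc.prems] norm_triangle_sub[of "ell \<zeta> (Suc k) f" "tr (\<lambda>y. f 0 y * ?a W y)"]
      by (simp add: x_def)
    then show False using \<epsilon>(2) x by simp
  qed
  then show ?case by (simp add: x_def)
qed

end

section \<open>The invertible extension of a measure preserving system\<close>

lemma borel_measurable_cnj [measurable]: "cnj \<in> borel_measurable borel"
  by (intro borel_measurable_continuous_onI continuous_intros)

context measure_preserving_system
begin

lemma measurable_funpow: "(T ^^ n) \<in> measurable M M"
  by (induction n) (auto intro: measurable_compose[OF _ measurable_T])

lemma integral_T:
  fixes f :: "'a \<Rightarrow> 'b::{banach, second_countable_topology}"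
  assumes "f \<in> borel_measurable M"
  shows "(\<integral>x. f (T x) \<partial>M) = (\<integral>x. f x \<partial>M)"
  using integral_distr[OF measurable_T assms] by (simp add: preserves)

lemma integral_funpow:
  fixes f :: "'a \<Rightarrow> 'b::{banach, second_countable_topology}"
  assumes "f \<in> borel_measurable M"
  shows "(\<integral>x. f ((T ^^ n) x) \<partial>M) = (\<integral>x. f x \<partial>M)"
proof (induction n)
  case (Suc n)
  have "(\<integral>x. f ((T ^^ n) (T x)) \<partial>M) = (\<integral>x. f ((T ^^ n) x) \<partial>M)"
    by (rule integral_T) (rule measurable_compose[OF measurable_funpow assms])
  then show ?case using Suc by (simp add: funpow_swap1)
qed simp

text \<open>Compatibility with \<open>T\<close> is only demanded at large times and the trace is the limit for time
  tending to infinity, so shifts by negative times make sense although \<open>T\<close> need not be invertible.\<close>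

definition hat_algebra :: "((int poly, 'a) pt \<Rightarrow> complex) set" where
  "hat_algebra = {F. (\<exists>C. \<forall>y. cmod (F y) \<le> C) \<and> (\<forall>n. (\<lambda>x. F ([], n, x)) \<in> borel_measurable M) \<and>
     (\<exists>n0. \<forall>n\<ge>n0. \<forall>x\<in>space M. F ([], n + 1, x) = F ([], n, T x))}"

definition hat_trace :: "((int poly, 'a) pt \<Rightarrow> complex) \<Rightarrow> complex" where
  "hat_trace F = Ulim (\<lambda>N. \<integral>x. F ([], int N, x) \<partial>M)"

lemma hat_algebraI:
  assumes "\<And>y. cmod (F y) \<le> C" "\<And>n. (\<lambda>x. F ([], n, x)) \<in> borel_measurable M"
    "\<And>n x. n \<ge> n0 \<Longrightarrow> x \<in> space M \<Longrightarrow> F ([], n + 1, x) = F ([], n, T x)"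
  shows "F \<in> hat_algebra"
  unfolding hat_algebra_def using assms by blast

lemma hat_algebraE:
  assumes "F \<in> hat_algebra"
  obtains C n0 where "\<And>y. cmod (F y) \<le> C" "\<And>n. (\<lambda>x. F ([], n, x)) \<in> borel_measurable M"
    "\<And>n x. n \<ge> n0 \<Longrightarrow> x \<in> space M \<Longrightarrow> F ([], n + 1, x) = F ([], n, T x)"
  using assms unfolding hat_algebra_def by blast

lemma hat_algebra_funpow:
  assumes "\<And>n x. n \<ge> n0 \<Longrightarrow> x \<in> space M \<Longrightarrow> F ([], n + 1, x) = F ([], n, T x)"
    and "n \<ge> n0" "x \<in> space M"
  shows "F ([], n + int k, x) = F ([], n, (T ^^ k) x)"
  using assms(3)
proof (induction k arbitrary: x)
  case (Suc k)
  have "F ([], n + int (Suc k), x) = F ([], n + int k, T x)"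
    using assms(1)[of "n + int k" x] assms(2) Suc.prems by (simp add: algebra_simps)
  also have "\<dots> = F ([], n, (T ^^ k) (T x))"
    using Suc.IH measurable_space[OF measurable_T] Suc.prems by blast
  finally show ?case by (simp add: funpow_swap1)
qed simp

text \<open>From time \<open>n0\<close> on the integrals are constant by invariance of the measure,
  so the limit along \<open>ultra\<close> is attained.\<close>

lemma hat_trace_eq:
  assumes "\<And>n. (\<lambda>x. F ([], n, x)) \<in> borel_measurable M"
    "\<And>n x. n \<ge> n0 \<Longrightarrow> x \<in> space M \<Longrightarrow> F ([], n + 1, x) = F ([], n, T x)" "n \<ge> n0"
  shows "hat_trace F = (\<integral>x. F ([], n, x) \<partial>M)"
proof -
  have "(\<integral>x. F ([], int N, x) \<partial>M) = (\<integral>x. F ([], n, x) \<partial>M)" if N: "nat n \<le> N" for N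
  proof -
    define k where "k = nat (int N - n)"
    have k: "int N = n + int k" using N by (simp add: k_def)
    have "(\<integral>x. F ([], int N, x) \<partial>M) = (\<integral>x. F ([], n, (T ^^ k) x) \<partial>M)"
      unfolding k
    proof (rule Bochner_Integration.integral_cong)
      show "F ([], n + int k, x) = F ([], n, (T ^^ k) x)" if "x \<in> space M" for x
        using hat_algebra_funpow[of n0 F n x k] assms that by blast
    qed simp
    also have "\<dots> = (\<integral>x. F ([], n, x) \<partial>M)" by (rule integral_funpow[OF assms(1)])
    finally show ?thesis .
  qed
  then have "eventually (\<lambda>N. (\<integral>x. F ([], int N, x) \<partial>M) = (\<integral>x. F ([], n, x) \<partial>M)) ultra"
    using eventually_ultra_ge[of "nat n"] by (auto elim: eventually_mono)
  then show ?thesis unfolding hat_trace_def by (intro Ulim_eqI tendsto_eventually)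
qed

lemma integrable_bounded:
  fixes f :: "'a \<Rightarrow> complex"
  assumes "f \<in> borel_measurable M" "\<And>x. cmod (f x) \<le> C"
  shows "integrable M f"
  using assms by (intro integrable_const_bound[of _ C]) auto

lemma poly_algebra_hat: "poly_algebra hat_algebra hat_trace"
proof (unfold poly_algebra_def, standard)
  show "(\<lambda>_. c) \<in> hat_algebra" for c by (rule hat_algebraI[of _ "cmod c" 0]) auto
  show "(\<lambda>y. F y + G y) \<in> hat_algebra" if FG: "F \<in> hat_algebra" "G \<in> hat_algebra" for F G
  proof -
    obtain C n where F: "\<And>y. cmod (F y) \<le> C" "\<And>n. (\<lambda>x. F ([], n, x)) \<in> borel_measurable M"
        "\<And>i x. i \<ge> n \<Longrightarrow> x \<in> space M \<Longrightarrow> F ([], i + 1, x) = F ([], i, T x)"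
      using FG(1) unfolding hat_algebra_def by blast
    obtain D m where G: "\<And>y. cmod (G y) \<le> D" "\<And>n. (\<lambda>x. G ([], n, x)) \<in> borel_measurable M"
        "\<And>i x. i \<ge> m \<Longrightarrow> x \<in> space M \<Longrightarrow> G ([], i + 1, x) = G ([], i, T x)"
      using FG(2) unfolding hat_algebra_def by blast
    show ?thesis
      by (rule hat_algebraI[of _ "C + D" "max n m"])
        (auto intro!: norm_triangle_le add_mono F(1) G(1) borel_measurable_add F(2) G(2) simp: F(3) G(3) simp del: split_paired_All)
  qed
  show "(\<lambda>y. F y * G y) \<in> hat_algebra" if FG: "F \<in> hat_algebra" "G \<in> hat_algebra" for F G
  proof -
    obtain C n where F: "\<And>y. cmod (F y) \<le> C" "\<And>n. (\<lambda>x. F ([], n, x)) \<in> borel_measurable M"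
        "\<And>i x. i \<ge> n \<Longrightarrow> x \<in> space M \<Longrightarrow> F ([], i + 1, x) = F ([], i, T x)"
      using FG(1) unfolding hat_algebra_def by blast
    obtain D m where G: "\<And>y. cmod (G y) \<le> D" "\<And>n. (\<lambda>x. G ([], n, x)) \<in> borel_measurable M"
        "\<And>i x. i \<ge> m \<Longrightarrow> x \<in> space M \<Longrightarrow> G ([], i + 1, x) = G ([], i, T x)"
      using FG(2) unfolding hat_algebra_def by blast
    have "0 \<le> C" using F(1) norm_ge_zero order_trans by blast
    then have "cmod (F y * G y) \<le> C * D" for y
      unfolding norm_mult by (intro mult_mono F(1) G(1)) auto
    then show ?thesis
      by (rule hat_algebraI[of _ _ "max n m"])
        (auto intro!: borel_measurable_times F(2) G(2) simp: F(3) G(3))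
  qed
  show "(\<lambda>y. cnj (F y)) \<in> hat_algebra" if "F \<in> hat_algebra" for F
    using that by (elim hat_algebraE, intro hat_algebraI) (auto intro: measurable_compose[OF _ borel_measurable_cnj])
  show "sh k F \<in> hat_algebra" if FG: "F \<in> hat_algebra" for k F
  proof -
    obtain C n where F: "\<And>y. cmod (F y) \<le> C" "\<And>n. (\<lambda>x. F ([], n, x)) \<in> borel_measurable M"
        "\<And>i x. i \<ge> n \<Longrightarrow> x \<in> space M \<Longrightarrow> F ([], i + 1, x) = F ([], i, T x)"
      using FG unfolding hat_algebra_def by blast
    show ?thesis
    proof (rule hat_algebraI[of _ C "n - k"])
      show "cmod (sh k F y) \<le> C" for y by (rule norm_sh_le[OF F(1)])
      show "(\<lambda>x. sh k F ([], i, x)) \<in> borel_measurable M" for i by (simp add: sh_def F(2))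
      show "sh k F ([], i + 1, x) = sh k F ([], i, T x)" if "n - k \<le> i" "x \<in> space M" for i x
        using F(3)[of "i + k" x] that by (simp add: sh_def algebra_simps)
    qed
  qed
  show "\<exists>C. \<forall>y. cmod (F y) \<le> C" if "F \<in> hat_algebra" for F
    using that by (auto simp: hat_algebra_def)
  show "hat_trace (\<lambda>y. F y + G y) = hat_trace F + hat_trace G" if FG: "F \<in> hat_algebra" "G \<in> hat_algebra" for F G
  proof -
    obtain C n where F: "\<And>y. cmod (F y) \<le> C" "\<And>n. (\<lambda>x. F ([], n, x)) \<in> borel_measurable M"
        "\<And>i x. i \<ge> n \<Longrightarrow> x \<in> space M \<Longrightarrow> F ([], i + 1, x) = F ([], i, T x)"
      using FG(1) unfolding hat_algebra_def by blast
    obtain D m where G: "\<And>y. cmod (G y) \<le> D" "\<And>n. (\<lambda>x. G ([], n, x)) \<in> borel_measurable M"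
        "\<And>i x. i \<ge> m \<Longrightarrow> x \<in> space M \<Longrightarrow> G ([], i + 1, x) = G ([], i, T x)"
      using FG(2) unfolding hat_algebra_def by blast
    have "hat_trace (\<lambda>y. F y + G y) = (\<integral>x. F ([], max n m, x) + G ([], max n m, x) \<partial>M)"
      by (rule hat_trace_eq[of _ "max n m"]) (auto simp: F G intro!: borel_measurable_add)
    also have "\<dots> = (\<integral>x. F ([], max n m, x) \<partial>M) + (\<integral>x. G ([], max n m, x) \<partial>M)"
      using F G by (intro Bochner_Integration.integral_add integrable_bounded)
    also have "(\<integral>x. F ([], max n m, x) \<partial>M) = hat_trace F"
      by (rule hat_trace_eq[of _ n, symmetric]) (auto simp: F)
    also have "(\<integral>x. G ([], max n m, x) \<partial>M) = hat_trace G"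
      by (rule hat_trace_eq[of _ m, symmetric]) (auto simp: G)
    finally show ?thesis .
  qed
  show "hat_trace (\<lambda>y. c * F y) = c * hat_trace F" if FG: "F \<in> hat_algebra" for F c
  proof -
    obtain C n where F: "\<And>y. cmod (F y) \<le> C" "\<And>n. (\<lambda>x. F ([], n, x)) \<in> borel_measurable M"
        "\<And>i x. i \<ge> n \<Longrightarrow> x \<in> space M \<Longrightarrow> F ([], i + 1, x) = F ([], i, T x)"
      using FG unfolding hat_algebra_def by blast
    have "hat_trace (\<lambda>y. c * F y) = (\<integral>x. c * F ([], n, x) \<partial>M)"
      by (rule hat_trace_eq[of _ n]) (auto simp: F intro!: borel_measurable_times)
    also have "\<dots> = c * hat_trace F"
      using hat_trace_eq[of F n n] F by simp
    finally show ?thesis .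
  qed
  show "hat_trace (\<lambda>y. cnj (F y)) = cnj (hat_trace F)" if FG: "F \<in> hat_algebra" for F
  proof -
    obtain C n where F: "\<And>y. cmod (F y) \<le> C" "\<And>n. (\<lambda>x. F ([], n, x)) \<in> borel_measurable M"
        "\<And>i x. i \<ge> n \<Longrightarrow> x \<in> space M \<Longrightarrow> F ([], i + 1, x) = F ([], i, T x)"
      using FG unfolding hat_algebra_def by blast
    have "hat_trace (\<lambda>y. cnj (F y)) = (\<integral>x. cnj (F ([], n, x)) \<partial>M)"
      by (rule hat_trace_eq[of _ n]) (auto simp: F intro!: measurable_compose[OF _ borel_measurable_cnj])
    also have "\<dots> = cnj (hat_trace F)"
      using hat_trace_eq[of F n n] F by simp
    finally show ?thesis .
  qed
  show "hat_trace (sh k F) = hat_trace F" if FG: "F \<in> hat_algebra" for F k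
  proof -
    obtain C n where F: "\<And>y. cmod (F y) \<le> C" "\<And>n. (\<lambda>x. F ([], n, x)) \<in> borel_measurable M"
        "\<And>i x. i \<ge> n \<Longrightarrow> x \<in> space M \<Longrightarrow> F ([], i + 1, x) = F ([], i, T x)"
      using FG unfolding hat_algebra_def by blast
    have "hat_trace (sh k F) = (\<integral>x. sh k F ([], n - k, x) \<partial>M)"
    proof (rule hat_trace_eq[of _ "n - k"])
      show "(\<lambda>x. sh k F ([], i, x)) \<in> borel_measurable M" for i by (simp add: sh_def F(2))
      show "sh k F ([], i + 1, x) = sh k F ([], i, T x)" if "n - k \<le> i" "x \<in> space M" for i x
        using F(3)[of "i + k" x] that by (simp add: sh_def algebra_simps)
    qed simp
    also have "\<dots> = hat_trace F"
      using hat_trace_eq[of F n n] F by (simp add: sh_def)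
    finally show ?thesis .
  qed
  show "0 \<le> Re (hat_trace F)" if FG: "F \<in> hat_algebra" and pos: "\<And>y. Im (F y) = 0 \<and> 0 \<le> Re (F y)" for F
  proof -
    obtain C n where F: "\<And>y. cmod (F y) \<le> C" "\<And>n. (\<lambda>x. F ([], n, x)) \<in> borel_measurable M"
        "\<And>i x. i \<ge> n \<Longrightarrow> x \<in> space M \<Longrightarrow> F ([], i + 1, x) = F ([], i, T x)"
      using FG unfolding hat_algebra_def by blast
    have "hat_trace F = (\<integral>x. F ([], n, x) \<partial>M)" using hat_trace_eq[of F n n] F by simp
    then have "Re (hat_trace F) = (\<integral>x. Re (F ([], n, x)) \<partial>M)"
      using integral_Re[OF integrable_bounded[OF F(2) F(1)]] by simp
    also have "\<dots> \<ge> 0" using pos by (intro integral_nonneg_AE) auto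
    finally show ?thesis .
  qed
  show "hat_trace (\<lambda>_. 1) = 1"
    by (subst hat_trace_eq[of _ 0 0]) (auto simp: prob_space)
qed

section \<open>Transfer of functions and norms between the system and its extension\<close>

definition emb :: "('a \<Rightarrow> complex) \<Rightarrow> (int poly, 'a) pt \<Rightarrow> complex" where
  "emb f = (\<lambda>(l, n, x). if l = [] \<and> n \<ge> 0 then f ((T ^^ nat n) x) else 0)"

definition L2n :: "('a \<Rightarrow> complex) \<Rightarrow> real" where
  "L2n f = sqrt (\<integral>x. (cmod (f x))\<^sup>2 \<partial>M)"

text \<open>Bounds are required everywhere and not almost everywhere, because the elements of a
  traced algebra are functions, not classes.\<close>

definition bmf :: "('a \<Rightarrow> complex) set" where
  "bmf = {f \<in> borel_measurable M. \<exists>C. \<forall>x. cmod (f x) \<le> C}"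

text \<open>Compatibility with \<open>T\<close> holds from time \<open>0\<close> on, so the filler
  value at negative times does no harm.\<close>

lemma emb_hat:
  assumes "f \<in> bmf" shows "emb f \<in> hat_algebra"
proof -
  obtain C where f: "f \<in> borel_measurable M" and C: "\<And>x. cmod (f x) \<le> C"
    using assms by (auto simp: bmf_def)
  have "0 \<le> C" using C norm_ge_zero order_trans by blast
  then have "cmod (emb f y) \<le> C" for y using C by (auto simp: emb_def split: prod.splits)
  then show ?thesis
  proof (rule hat_algebraI[of _ _ 0])
    show "(\<lambda>x. emb f ([], n, x)) \<in> borel_measurable M" for n
      using measurable_compose[OF measurable_funpow f, of "nat n"] by (cases "n \<ge> 0") (auto simp: emb_def)
    show "emb f ([], n + 1, x) = emb f ([], n, T x)" if "n \<ge> 0" for n x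
      using that by (simp add: emb_def nat_add_distrib funpow_swap1)
  qed
qed

interpretation H: poly_algebra hat_algebra hat_trace by (rule poly_algebra_hat)

text \<open>At large times \<open>F\<close> is \<open>f\<close> after a power of \<open>T\<close>,
  which does not change the integral. The offset \<open>k\<close> allows \<open>f\<close> to be read
  off at a late time instead of time \<open>0\<close>.\<close>

lemma nrm_eq_L2n:
  assumes F: "F \<in> hat_algebra" and f: "f \<in> borel_measurable M"
    and eq: "\<And>n x. n \<ge> n0 \<Longrightarrow> x \<in> space M \<Longrightarrow> F ([], int n, x) = f ((T ^^ (n - k)) x)"
  shows "H.nrm F = L2n f"
proof -
  have FF: "(\<lambda>y. F y * cnj (F y)) \<in> hat_algebra" by (rule H.A_ip[OF F F])
  then obtain C m where G: "\<And>y. cmod (F y * cnj (F y)) \<le> C"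
      "\<And>n. (\<lambda>x. F ([], n, x) * cnj (F ([], n, x))) \<in> borel_measurable M"
      "\<And>n x. n \<ge> m \<Longrightarrow> x \<in> space M \<Longrightarrow> F ([], n + 1, x) * cnj (F ([], n + 1, x)) = F ([], n, T x) * cnj (F ([], n, T x))"
    unfolding hat_algebra_def by blast
  define n where "n = max n0 (nat m)"
  have "H.ip F F = (\<integral>x. F ([], int n, x) * cnj (F ([], int n, x)) \<partial>M)"
    unfolding H.ip_def by (rule hat_trace_eq[of _ m]) (use G in \<open>auto simp: n_def\<close>)
  also have "\<dots> = (\<integral>x. of_real ((cmod (f ((T ^^ (n - k)) x)))\<^sup>2) \<partial>M)"
    unfolding complex_norm_square by (intro Bochner_Integration.integral_cong) (auto simp: eq n_def)
  also have "\<dots> = of_real (\<integral>x. (cmod (f ((T ^^ (n - k)) x)))\<^sup>2 \<partial>M)" by (rule integral_complex_of_real)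
  also have "(\<integral>x. (cmod (f ((T ^^ (n - k)) x)))\<^sup>2 \<partial>M) = (\<integral>x. (cmod (f x))\<^sup>2 \<partial>M)"
    by (rule integral_funpow) (use f in measurable)
  finally show ?thesis by (simp add: H.nrm_def L2n_def)
qed

lemma nrm_emb: "f \<in> bmf \<Longrightarrow> H.nrm (emb f) = L2n f"
  by (rule nrm_eq_L2n[OF emb_hat, of _ _ 0 0]) (auto simp: bmf_def emb_def)

lemma bmfI: "f \<in> borel_measurable M \<Longrightarrow> (\<And>x. cmod (f x) \<le> C) \<Longrightarrow> f \<in> bmf"
  by (auto simp: bmf_def)

lemma bmf_measurable: "f \<in> bmf \<Longrightarrow> f \<in> borel_measurable M"
  by (simp add: bmf_def)

lemma bmf_bdd: "f \<in> bmf \<Longrightarrow> \<exists>C. \<forall>x. cmod (f x) \<le> C"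
  by (simp add: bmf_def)

lemma bmf_const: "(\<lambda>_. c) \<in> bmf"
  by (rule bmfI[of _ "cmod c"]) auto

lemma bmf_add: "f \<in> bmf \<Longrightarrow> g \<in> bmf \<Longrightarrow> (\<lambda>x. f x + g x) \<in> bmf"
  using bdf_add[of f g] unfolding bmf_def bdf_def by auto

lemma bmf_mult: "f \<in> bmf \<Longrightarrow> g \<in> bmf \<Longrightarrow> (\<lambda>x. f x * g x) \<in> bmf"
  using bdf_mult[of f g] unfolding bmf_def bdf_def by auto

lemma bmf_diff: "f \<in> bmf \<Longrightarrow> g \<in> bmf \<Longrightarrow> (\<lambda>x. f x - g x) \<in> bmf"
  using bmf_add[OF _ bmf_mult[OF bmf_const[of "-1"]]] by simp

lemma bmf_sum_list: "(\<And>w. w \<in> set W \<Longrightarrow> F w \<in> bmf) \<Longrightarrow> (\<lambda>x. \<Sum>w\<leftarrow>W. F w x) \<in> bmf"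
  by (induction W) (auto intro: bmf_const bmf_add)

lemma bmf_avg: "(\<And>w. w \<in> set W \<Longrightarrow> F w \<in> bmf) \<Longrightarrow> (\<lambda>x. avg W (\<lambda>w. F w x)) \<in> bmf"
  unfolding avg_def divide_inverse by (intro bmf_mult bmf_sum_list bmf_const)

lemma bmf_prod: "(\<And>i. i \<in> I \<Longrightarrow> F i \<in> bmf) \<Longrightarrow> (\<lambda>x. \<Prod>i\<in>I. F i x) \<in> bmf"
  by (induction I rule: infinite_finite_induct) (auto intro: bmf_const bmf_mult)

lemma bmf_funpow: "f \<in> bmf \<Longrightarrow> (\<lambda>x. f ((T ^^ n) x)) \<in> bmf"
  unfolding bmf_def by (auto intro: measurable_compose[OF measurable_funpow])

lemma emb_add: "emb (\<lambda>x. f x + g x) = (\<lambda>y. emb f y + emb g y)"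
  and emb_cmult: "emb (\<lambda>x. c * f x) = (\<lambda>y. c * emb f y)"
  by (auto simp: emb_def)

lemma emb_avg: "emb (\<lambda>x. avg W (\<lambda>w. F w x)) = (\<lambda>y. avg W (\<lambda>w. emb (F w) y))"
  by (auto simp: emb_def avg_def split: prod.splits intro!: HOL.ext)

lemma norm_emb_le: "(\<And>x. cmod (f x) \<le> C) \<Longrightarrow> C \<ge> 0 \<Longrightarrow> cmod (emb f y) \<le> C"
  by (auto simp: emb_def split: prod.splits)

lemma L2n_triangle: "f \<in> bmf \<Longrightarrow> g \<in> bmf \<Longrightarrow> L2n (\<lambda>x. f x + g x) \<le> L2n f + L2n g"
  using H.nrm_triangle[OF emb_hat emb_hat] by (simp add: nrm_emb[symmetric] bmf_add emb_add)

lemma L2n_cmult: "f \<in> bmf \<Longrightarrow> L2n (\<lambda>x. c * f x) = cmod c * L2n f"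
  using H.nrm_cmult[OF emb_hat] by (simp add: nrm_emb[symmetric] bmf_mult bmf_const emb_cmult)

lemma L2n_minus_commute: "L2n (\<lambda>x. f x - g x) = L2n (\<lambda>x. g x - f x)"
  by (simp add: L2n_def norm_minus_commute)

lemma L2n_triangle_diff:
  "f \<in> bmf \<Longrightarrow> g \<in> bmf \<Longrightarrow> h \<in> bmf \<Longrightarrow> L2n (\<lambda>x. f x - h x) \<le> L2n (\<lambda>x. f x - g x) + L2n (\<lambda>x. g x - h x)"
  using L2n_triangle[OF bmf_diff bmf_diff, of f g g h] by simp

lemma L2n_nonneg [simp]: "L2n f \<ge> 0"
  by (simp add: L2n_def)

lemma L2n_avg_le:
  assumes "W \<noteq> []" "\<And>w. w \<in> set W \<Longrightarrow> F w \<in> bmf" "\<And>w. w \<in> set W \<Longrightarrow> L2n (F w) \<le> C"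
  shows "L2n (\<lambda>x. avg W (\<lambda>w. F w x)) \<le> C"
  using H.nrm_avg_le[of W "\<lambda>w. emb (F w)" C] assms
  by (simp add: nrm_emb[symmetric] bmf_avg emb_avg emb_hat)

lemma L2n_bound:
  assumes "f \<in> borel_measurable M" "\<And>x. cmod (f x) \<le> C"
  shows "L2n f \<le> C"
proof -
  have "C \<ge> 0" using assms(2) norm_ge_zero order_trans by blast
  then show ?thesis
    using H.nrm_le_const[OF emb_hat norm_emb_le] assms bmfI[OF assms] by (simp add: nrm_emb)
qed

lemma L2n_funpow: "f \<in> borel_measurable M \<Longrightarrow> L2n (\<lambda>x. f ((T ^^ n) x)) = L2n f"
  unfolding L2n_def using integral_funpow[of "\<lambda>x. (cmod (f x))\<^sup>2" n] by simp

definition mprod :: "nat \<Rightarrow> (nat \<Rightarrow> 'a \<Rightarrow> complex) \<Rightarrow> nat \<Rightarrow> 'a \<Rightarrow> complex" where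
  "mprod k f n x = (\<Prod>j\<in>{1..k}. f j ((T ^^ (j * n)) x))"

lemma bmf_mprod: "(\<And>j. j \<in> {1..k} \<Longrightarrow> f j \<in> bmf) \<Longrightarrow> mprod k f n \<in> bmf"
  using bmf_prod[of "{1..k}" "\<lambda>j x. f j ((T ^^ (j * n)) x)"] bmf_funpow by (simp add: mprod_def[abs_def])

lemma prog_emb:
  assumes "N \<ge> 0" "n \<ge> 0"
  shows "H.prog k (\<lambda>j. emb (f j)) n ([], N, x) = mprod k f (nat n) ((T ^^ nat N) x)"
proof -
  have "nat (N + int j * n) = j * nat n + nat N" for j :: nat
    using assms by (simp add: nat_add_distrib nat_mult_distrib)
  then show ?thesis
    using assms by (simp add: H.prog_def mprod_def sh_def emb_def funpow_add)
qed

lemma nrm_avg_prog: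
  assumes f: "\<And>j. j \<in> {1..k} \<Longrightarrow> f j \<in> bmf" and W: "\<And>w. w \<in> set W \<Longrightarrow> w \<ge> 0" and V: "\<And>w. w \<in> set V \<Longrightarrow> w \<ge> 0"
  shows "H.nrm (\<lambda>y. avg W (\<lambda>w. \<zeta> w * H.prog k (\<lambda>j. emb (f j)) w y) - avg V (\<lambda>w. \<zeta> w * H.prog k (\<lambda>j. emb (f j)) w y)) =
    L2n (\<lambda>x. avg W (\<lambda>w. \<zeta> w * mprod k f (nat w) x) - avg V (\<lambda>w. \<zeta> w * mprod k f (nat w) x))"
proof (rule nrm_eq_L2n[of _ _ 0 0])
  have "H.prog k (\<lambda>j. emb (f j)) w \<in> hat_algebra" for w
    unfolding H.prog_def by (intro H.A_prod H.A_sh emb_hat f)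
  then show "(\<lambda>y. avg W (\<lambda>w. \<zeta> w * H.prog k (\<lambda>j. emb (f j)) w y) - avg V (\<lambda>w. \<zeta> w * H.prog k (\<lambda>j. emb (f j)) w y)) \<in> hat_algebra"
    by (intro H.A_diff H.A_avg H.A_mult H.A_const)
  show "(\<lambda>x. avg W (\<lambda>w. \<zeta> w * mprod k f (nat w) x) - avg V (\<lambda>w. \<zeta> w * mprod k f (nat w) x)) \<in> borel_measurable M"
    by (intro bmf_measurable bmf_diff bmf_avg bmf_mult bmf_const bmf_mprod f)
  show "avg W (\<lambda>w. \<zeta> w * H.prog k (\<lambda>j. emb (f j)) w ([], int n, x)) - avg V (\<lambda>w. \<zeta> w * H.prog k (\<lambda>j. emb (f j)) w ([], int n, x)) =
      avg W (\<lambda>w. \<zeta> w * mprod k f (nat w) ((T ^^ (n - 0)) x)) - avg V (\<lambda>w. \<zeta> w * mprod k f (nat w) ((T ^^ (n - 0)) x))" for n x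
    using W V by (intro arg_cong2[of _ _ _ _ minus] avg_cong) (auto simp: prog_emb)
qed

text \<open>Only forward iterates of \<open>T\<close> are at hand, so the list over
  \<open>int poly\<close> is first translated until all coefficients \<open>0\<close> are
  non-negative; stability under translations pays for this.\<close>

lemma mprod_stable:
  assumes \<zeta>: "character \<zeta>" and f: "\<And>j. j \<in> {1..k} \<Longrightarrow> f j \<in> bmf" and \<epsilon>: "\<epsilon> > 0"
  shows "\<exists>V :: nat list. V \<noteq> [] \<and> (\<forall>m. L2n (\<lambda>x. avg V (\<lambda>w. \<zeta> (int (m + w)) * mprod k f (m + w) x) -
     avg V (\<lambda>w. \<zeta> (int w) * mprod k f w x)) \<le> \<epsilon>)"
proof -
  let ?a = "\<lambda>W. mav (\<lambda>p. \<zeta> (coeff p 0)) (H.prog_fs k (\<lambda>j. emb (f j))) W"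
  let ?p = "H.prog k (\<lambda>j. emb (f j))"
  have v: "valid hat_algebra (H.prog_fs k (\<lambda>j. emb (f j)))"
    by (intro H.valid_prog_fs emb_hat f)
  obtain W where W: "W \<noteq> []" "\<And>g. H.nrm (\<lambda>y. ?a (map ((+) g) W) y - ?a W y) \<le> \<epsilon> / 2"
    using H.ex_translation_stable[OF character_int_poly[OF \<zeta>] v, of "\<epsilon> / 2"] \<epsilon> by auto
  have aA: "?a X \<in> hat_algebra" for X by (rule H.mav_A[OF v])
  define c where "c = (\<Sum>w\<leftarrow>W. \<bar>coeff w 0\<bar>)"
  have c: "\<bar>coeff w 0\<bar> \<le> c" if "w \<in> set W" for w
    unfolding c_def using that by (intro member_le_sum_list) auto
  define V where "V = map (\<lambda>w. nat (c + coeff w 0)) W"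
  have shift: "L2n (\<lambda>x. avg V (\<lambda>w. \<zeta> (int (m + w)) * mprod k f (m + w) x) - avg V (\<lambda>w. \<zeta> (int w) * mprod k f w x)) =
     H.nrm (\<lambda>y. ?a (map ((+) [:int m + c:]) W) y - ?a (map ((+) [:c:]) W) y)" for m
  proof -
    let ?X = "map (\<lambda>w. int m + c + coeff w 0) W" and ?Y = "map (\<lambda>w. c + coeff w 0) W"
    have pos: "0 \<le> c + coeff w 0" if "w \<in> set W" for w using c[OF that] by linarith
    have "H.nrm (\<lambda>y. ?a (map ((+) [:int m + c:]) W) y - ?a (map ((+) [:c:]) W) y) =
       H.nrm (\<lambda>y. avg ?X (\<lambda>w. \<zeta> w * ?p w y) - avg ?Y (\<lambda>w. \<zeta> w * ?p w y))"
      by (simp add: mav_def avg_map H.lp_prog_fs)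
    also have "\<dots> = L2n (\<lambda>x. avg ?X (\<lambda>w. \<zeta> w * mprod k f (nat w) x) - avg ?Y (\<lambda>w. \<zeta> w * mprod k f (nat w) x))"
      using pos by (intro nrm_avg_prog f) (auto simp: add.assoc)
    also have "(\<lambda>x. avg ?X (\<lambda>w. \<zeta> w * mprod k f (nat w) x) - avg ?Y (\<lambda>w. \<zeta> w * mprod k f (nat w) x)) =
       (\<lambda>x. avg V (\<lambda>w. \<zeta> (int (m + w)) * mprod k f (m + w) x) - avg V (\<lambda>w. \<zeta> (int w) * mprod k f w x))"
      unfolding V_def avg_map using pos
      by (intro HOL.ext arg_cong2[of _ _ _ _ minus] avg_cong) (auto simp: nat_add_distrib add.assoc)
    finally show ?thesis by simp
  qed
  have "H.nrm (\<lambda>y. ?a (map ((+) [:int m + c:]) W) y - ?a (map ((+) [:c:]) W) y) \<le> \<epsilon>" for m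
  proof -
    have "H.nrm (\<lambda>y. ?a (map ((+) [:int m + c:]) W) y - ?a (map ((+) [:c:]) W) y) \<le>
      H.nrm (\<lambda>y. ?a (map ((+) [:int m + c:]) W) y - ?a W y) + H.nrm (\<lambda>y. ?a W y - ?a (map ((+) [:c:]) W) y)"
      by (intro H.nrm_triangle_diff aA)
    also have "\<dots> \<le> \<epsilon> / 2 + \<epsilon> / 2"
      using W(2) by (intro add_mono) (simp_all add: H.nrm_minus_commute[OF aA aA, of W])
    finally show ?thesis by simp
  qed
  then show ?thesis using W(1) shift by (intro exI[of _ V]) (auto simp: V_def)
qed

text \<open>Two reductions precede \<open>prog_small\<close>: the functions are scaled into
  \<open>ball\<close>, at the price of the factor \<open>D\<close>, and the hypothesis is carried
  over to \<open>hat_algebra\<close> by reading an element at a late time as a function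
  \<open>h\<close> on the space.\<close>

lemma mprod_twisted_small:
  assumes "k \<ge> 1" and \<zeta>: "character \<zeta>" and f: "\<And>j. j \<in> {1..k} \<Longrightarrow> f j \<in> bmf" and \<epsilon>: "\<epsilon> > 0"
    and no_eigen: "\<And>g \<epsilon>. g \<in> bmf \<Longrightarrow> \<epsilon> > 0 \<Longrightarrow>
      \<exists>V :: nat list. V \<noteq> [] \<and> L2n (\<lambda>x. avg V (\<lambda>w. \<zeta> (int w) * g ((T ^^ w) x))) \<le> \<epsilon>"
  shows "\<exists>V :: nat list. V \<noteq> [] \<and> (\<forall>m. L2n (\<lambda>x. avg V (\<lambda>w. \<zeta> (int (m + w)) * mprod k f (m + w) x)) \<le> \<epsilon>)"
proof -
  have "\<exists>C>0. \<forall>x. cmod (f j x) \<le> C" if "j \<in> {1..k}" for j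
    using bmf_bdd[OF f[OF that]] by (meson less_le_trans linorder_le_less_linear order_trans zero_less_one less_imp_le)
  then obtain C where C: "\<And>j. j \<in> {1..k} \<Longrightarrow> C j > 0 \<and> (\<forall>x. cmod (f j x) \<le> C j)" by metis
  define D where "D = (\<Prod>j\<in>{1..k}. C j)"
  have D: "D > 0" unfolding D_def using C by (intro prod_pos) auto
  define g where "g = (\<lambda>j. if j \<in> {1..k} then (\<lambda>x. of_real (1 / C j) * f j x) else (\<lambda>_. 1))"
  have g: "g j \<in> bmf" for j unfolding g_def by (cases "j \<in> {1..k}") (simp_all only: if_True if_False bmf_mult[OF bmf_const f] bmf_const)
  have g1: "cmod (g j x) \<le> 1" for j x
    unfolding g_def using C[of j] by (auto simp: norm_mult norm_divide field_simps)
  have gb: "emb (g j) \<in> H.ball" for j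
    by (intro H.ballI emb_hat g norm_emb_le g1) simp
  have fg: "mprod k f n x = of_real D * mprod k g n x" for n x
  proof -
    have "mprod k f n x = (\<Prod>j\<in>{1..k}. of_real (C j) * g j ((T ^^ (j * n)) x))"
      unfolding mprod_def
    proof (rule prod.cong)
      fix j assume "j \<in> {1..k}"
      then show "f j ((T ^^ (j * n)) x) = of_real (C j) * g j ((T ^^ (j * n)) x)"
        using C[of j] by (simp add: g_def)
    qed simp
    then show ?thesis by (simp add: prod.distrib mprod_def D_def)
  qed
  have no_eigen': "\<exists>W :: int list. W \<noteq> [] \<and> H.nrm (\<lambda>y. avg W (\<lambda>w. \<zeta> w * sh w F y)) \<le> \<epsilon>"
    if F: "F \<in> hat_algebra" and "\<epsilon> > 0" for F \<epsilon>
  proof -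
    obtain K n0 where F': "\<And>y. cmod (F y) \<le> K" "\<And>n. (\<lambda>x. F ([], n, x)) \<in> borel_measurable M"
        "\<And>n x. n \<ge> n0 \<Longrightarrow> x \<in> space M \<Longrightarrow> F ([], n + 1, x) = F ([], n, T x)"
      using F unfolding hat_algebra_def by blast
    define n where "n = nat n0"
    have n: "int n \<ge> n0" by (simp add: n_def)
    define h where "h = (\<lambda>x. F ([], int n, x))"
    have h: "h \<in> bmf" unfolding h_def by (rule bmfI[OF F'(2) F'(1)])
    obtain V :: "nat list" where V: "V \<noteq> []" "L2n (\<lambda>x. avg V (\<lambda>w. \<zeta> (int w) * h ((T ^^ w) x))) \<le> \<epsilon>"
      using no_eigen[OF h \<open>\<epsilon> > 0\<close>] by blast
    have "H.nrm (\<lambda>y. avg (map int V) (\<lambda>w. \<zeta> w * sh w F y)) = L2n (\<lambda>x. avg V (\<lambda>w. \<zeta> (int w) * h ((T ^^ w) x)))"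
    proof (rule nrm_eq_L2n[of _ _ n n])
      show "(\<lambda>y. avg (map int V) (\<lambda>w. \<zeta> w * sh w F y)) \<in> hat_algebra"
        by (intro H.A_avg H.A_mult H.A_const H.A_sh F)
      show "(\<lambda>x. avg V (\<lambda>w. \<zeta> (int w) * h ((T ^^ w) x))) \<in> borel_measurable M"
        by (intro bmf_measurable bmf_avg bmf_mult bmf_const bmf_funpow h)
      fix i x assume i: "n \<le> i" and x: "x \<in> space M"
      have "F ([], int i + int w, x) = h ((T ^^ w) ((T ^^ (i - n)) x))" for w
      proof -
        have "int i + int w = int n + int (w + (i - n))" using i by simp
        then show ?thesis
          using hat_algebra_funpow[OF F'(3) n x, of "w + (i - n)"] by (simp only: h_def funpow_add o_apply)
      qed
      then show "avg (map int V) (\<lambda>w. \<zeta> w * sh w F ([], int i, x)) =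
          avg V (\<lambda>w. \<zeta> (int w) * h ((T ^^ w) ((T ^^ (i - n)) x)))"
        by (simp add: avg_map sh_def)
    qed
    then show ?thesis using V by (intro exI[of _ "map int V"]) auto
  qed
  let ?a = "\<lambda>W. mav (\<lambda>p. \<zeta> (coeff p 0)) (H.prog_fs k (\<lambda>j. emb (g j))) W"
  let ?p = "H.prog k (\<lambda>j. emb (g j))"
  obtain W where W: "W \<noteq> []" "\<And>q. H.nrm (?a (map ((+) q) W)) \<le> \<epsilon> / D"
    using H.prog_small[OF \<zeta>, where f = "\<lambda>j. emb (g j)" and k = k and \<epsilon> = "\<epsilon> / D",
        OF gb H.ell_zero[OF \<open>k \<ge> 1\<close> \<zeta> _ no_eigen']] \<epsilon> D by auto
  define c where "c = (\<Sum>w\<leftarrow>W. \<bar>coeff w 0\<bar>)"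
  have c: "\<bar>coeff w 0\<bar> \<le> c" if "w \<in> set W" for w
    unfolding c_def using that by (intro member_le_sum_list) auto
  have pos: "0 \<le> c + coeff w 0" if "w \<in> set W" for w using c[OF that] by linarith
  define V where "V = map (\<lambda>w. nat (c + coeff w 0)) W"
  have "L2n (\<lambda>x. avg V (\<lambda>w. \<zeta> (int (m + w)) * mprod k f (m + w) x)) \<le> \<epsilon>" for m
  proof -
    let ?X = "map (\<lambda>w. int m + c + coeff w 0) W"
    \<comment> \<open>The average over \<open>[]\<close> is \<open>0\<close>, which makes
      \<open>nrm_avg_prog\<close> applicable to a single average.\<close>
    have "H.nrm (?a (map ((+) [:int m + c:]) W)) = H.nrm (\<lambda>y. avg ?X (\<lambda>w. \<zeta> w * ?p w y) - avg [] (\<lambda>w. \<zeta> w * ?p w y))"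
      by (rule arg_cong[of _ _ H.nrm]) (auto simp: mav_def avg_map H.lp_prog_fs avg_def[of "[]"])
    also have "\<dots> = L2n (\<lambda>x. avg ?X (\<lambda>w. \<zeta> w * mprod k g (nat w) x) - avg [] (\<lambda>w. \<zeta> w * mprod k g (nat w) x))"
      using pos by (intro nrm_avg_prog g) (auto simp: add.assoc)
    also have "(\<lambda>x. avg ?X (\<lambda>w. \<zeta> w * mprod k g (nat w) x) - avg [] (\<lambda>w. \<zeta> w * mprod k g (nat w) x)) =
       (\<lambda>x. avg V (\<lambda>w. \<zeta> (int (m + w)) * mprod k g (m + w) x))"
    proof
      fix x
      have "avg ?X (\<lambda>w. \<zeta> w * mprod k g (nat w) x) = avg V (\<lambda>w. \<zeta> (int (m + w)) * mprod k g (m + w) x)"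
        unfolding V_def avg_map using pos
        by (intro avg_cong) (auto simp: nat_add_distrib add.assoc)
      then show "avg ?X (\<lambda>w. \<zeta> w * mprod k g (nat w) x) - avg [] (\<lambda>w. \<zeta> w * mprod k g (nat w) x) =
         avg V (\<lambda>w. \<zeta> (int (m + w)) * mprod k g (m + w) x)" by (simp add: avg_def[of "[]"])
    qed
    finally have le: "L2n (\<lambda>x. avg V (\<lambda>w. \<zeta> (int (m + w)) * mprod k g (m + w) x)) \<le> \<epsilon> / D"
      using W(2)[of "[:int m + c:]"] by simp
    have "(\<lambda>x. avg V (\<lambda>w. \<zeta> (int (m + w)) * mprod k f (m + w) x)) =
        (\<lambda>x. of_real D * avg V (\<lambda>w. \<zeta> (int (m + w)) * mprod k g (m + w) x))"
      unfolding avg_cmult[symmetric] by (simp add: fg mult_ac)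
    then have "L2n (\<lambda>x. avg V (\<lambda>w. \<zeta> (int (m + w)) * mprod k f (m + w) x)) =
       D * L2n (\<lambda>x. avg V (\<lambda>w. \<zeta> (int (m + w)) * mprod k g (m + w) x))"
      using D by (simp add: L2n_cmult bmf_avg bmf_mult bmf_const bmf_mprod g)
    also have "\<dots> \<le> \<epsilon>" using le D by (simp add: field_simps)
    finally show ?thesis .
  qed
  then show ?thesis using W(1) by (intro exI[of _ V]) (auto simp: V_def)
qed

section \<open>Limits in the \<open>L2\<close> norm of averages of bounded functions\<close>

lemma integrable_cmod_power2:
  assumes "f \<in> bmf"
  shows "integrable M (\<lambda>x. (cmod (f x))\<^sup>2)"
proof -
  obtain C where C: "\<And>x. cmod (f x) \<le> C" using bmf_bdd[OF assms] by blast
  have [measurable]: "f \<in> borel_measurable M" using assms by (rule bmf_measurable)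
  have "norm ((cmod (f x))\<^sup>2) \<le> C\<^sup>2" for x using power_mono[OF C, of x 2] by simp
  then show ?thesis by (intro integrable_const_bound[of _ "C\<^sup>2"]) auto
qed

lemma L2n_eq_0_AE:
  assumes "f \<in> bmf" "L2n f = 0"
  shows "AE x in M. f x = 0"
proof -
  have "(\<integral>x. (cmod (f x))\<^sup>2 \<partial>M) = 0" using assms(2) by (simp add: L2n_def)
  then have "AE x in M. (cmod (f x))\<^sup>2 = 0"
    using integral_nonneg_eq_0_iff_AE[OF integrable_cmod_power2[OF assms(1)]] by simp
  then show ?thesis by simp
qed

text \<open>The variance of \<open>cmod (f x)\<close> is non-negative.\<close>

lemma L1_le_L2n:
  assumes "f \<in> bmf"
  shows "(\<integral>x. cmod (f x) \<partial>M) \<le> L2n f"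
proof -
  have [measurable]: "f \<in> borel_measurable M" using assms by (rule bmf_measurable)
  obtain C where C: "\<And>x. cmod (f x) \<le> C" using bmf_bdd[OF assms] by blast
  have "integrable M (\<lambda>x. cmod (f x))" using C by (intro integrable_const_bound[of _ C]) auto
  then have "0 \<le> (\<integral>x. (cmod (f x))\<^sup>2 \<partial>M) - (\<integral>x. cmod (f x) \<partial>M)\<^sup>2"
    using variance_positive[of "\<lambda>x. cmod (f x)"] variance_eq[OF _ integrable_cmod_power2[OF assms]] by simp
  then show ?thesis unfolding L2n_def by (intro real_le_rsqrt) simp
qed

text \<open>The increments are summable in the \<open>L1\<close> norm, which forces convergence
  almost everywhere; dominated convergence leads back to \<open>L2\<close>.\<close>

lemma L2n_complete:
  assumes a: "\<And>n. a n \<in> borel_measurable M" "\<And>n x. cmod (a n x) \<le> C"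
    and Cauchy: "\<And>n. L2n (\<lambda>x. a (Suc n) x - a n x) \<le> 2 * (1/2) ^ n"
  shows "\<exists>g. g \<in> borel_measurable M \<and> (\<forall>x. cmod (g x) \<le> C) \<and> (\<lambda>n. L2n (\<lambda>x. a n x - g x)) \<longlonglongrightarrow> 0"
proof -
  have C: "C \<ge> 0" using a(2) norm_ge_zero order_trans by blast
  note [measurable] = a(1)
  define d where "d = (\<lambda>n x. cmod (a (Suc n) x - a n x))"
  have [measurable]: "d n \<in> borel_measurable M" for n unfolding d_def by measurable
  have di: "integrable M (d n)" for n
  proof (rule integrable_const_bound[of _ "2 * C"])
    have "d n x \<le> C + C" for x unfolding d_def by (intro order_trans[OF norm_triangle_ineq4] add_mono a)
    then show "AE x in M. norm (d n x) \<le> 2 * C" by (simp add: d_def)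
  qed measurable
  have "(\<integral>x. d n x \<partial>M) \<le> 2 * (1/2) ^ n" for n
    unfolding d_def using a by (intro order_trans[OF L1_le_L2n Cauchy] bmf_diff bmfI)
  then have "(\<integral>\<^sup>+x. ennreal (d n x) \<partial>M) \<le> ennreal (2 * (1/2) ^ n)" for n
    using nn_integral_eq_integral[OF di, of n] by (simp add: d_def ennreal_leI)
  then have "(\<integral>\<^sup>+x. (\<Sum>n. ennreal (d n x)) \<partial>M) \<le> (\<Sum>n. ennreal (2 * (1/2) ^ n))"
    by (subst nn_integral_suminf) (auto intro!: suminf_le)
  also have "\<dots> < \<infinity>"
    by (subst suminf_ennreal2) (auto intro!: summable_mult summable_geometric)
  finally have "AE x in M. (\<Sum>n. ennreal (d n x)) \<noteq> \<infinity>"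
    by (intro nn_integral_PInf_AE) auto
  then have conv: "AE x in M. (\<lambda>n. a n x) \<longlonglongrightarrow> lim (\<lambda>n. a n x)"
  proof eventually_elim
    case (elim x)
    then have "summable (\<lambda>n. d n x)" by (intro summable_suminf_not_top) (auto simp: d_def)
    then have "summable (\<lambda>n. a (Suc n) x - a n x)" unfolding d_def by (rule summable_norm_cancel)
    then have "convergent (\<lambda>n. \<Sum>k<n. a (Suc k) x - a k x)" by (simp add: summable_iff_convergent)
    then have "convergent (\<lambda>n. (a n x - a 0 x) + a 0 x)"
      by (subst (asm) sum_lessThan_telescope) (intro convergent_add convergent_const)
    then show ?case by (simp add: convergent_LIMSEQ_iff)
  qed
  \<comment> \<open>The cut-off keeps the bound \<open>C\<close> at every point, also on the null
    set where the sequence may diverge.\<close>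
  define g where "g = (\<lambda>x. if cmod (lim (\<lambda>n. a n x)) \<le> C then lim (\<lambda>n. a n x) else 0)"
  have [measurable]: "(\<lambda>x. lim (\<lambda>n. a n x)) \<in> borel_measurable M" by measurable
  have g [measurable]: "g \<in> borel_measurable M" unfolding g_def by measurable
  have gC: "cmod (g x) \<le> C" for x using C by (simp add: g_def)
  have lim_g: "AE x in M. (\<lambda>n. a n x) \<longlonglongrightarrow> g x"
    using conv
  proof eventually_elim
    case (elim x)
    then have "cmod (lim (\<lambda>n. a n x)) \<le> C" using a(2) by (intro Lim_norm_ubound[OF _ elim]) auto
    then show ?case using elim by (simp add: g_def)
  qed
  have "(\<lambda>n. \<integral>x. (cmod (a n x - g x))\<^sup>2 \<partial>M) \<longlonglongrightarrow> (\<integral>x. 0 \<partial>M)"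
  proof (rule integral_dominated_convergence[where w = "\<lambda>_. (2 * C)\<^sup>2"])
    show "AE x in M. (\<lambda>n. (cmod (a n x - g x))\<^sup>2) \<longlonglongrightarrow> 0"
      using lim_g
    proof eventually_elim
      case (elim x)
      then have "(\<lambda>n. (cmod (a n x - g x))\<^sup>2) \<longlonglongrightarrow> (cmod (g x - g x))\<^sup>2"
        by (intro tendsto_intros)
      then show ?case by simp
    qed
    fix n
    have "cmod (a n x - g x) \<le> 2 * C" for x
      using norm_triangle_ineq4[of "a n x" "g x"] a(2)[of n x] gC[of x] by linarith
    then have "(cmod (a n x - g x))\<^sup>2 \<le> (2 * C)\<^sup>2" for x by (rule power_mono) simp
    then show "AE x in M. norm ((cmod (a n x - g x))\<^sup>2) \<le> (2 * C)\<^sup>2" by simp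
  qed auto
  then have "(\<lambda>n. L2n (\<lambda>x. a n x - g x)) \<longlonglongrightarrow> 0"
    unfolding L2n_def using tendsto_real_sqrt by fastforce
  then show ?thesis using g gC by blast
qed

text \<open>Two stable averages are compared through the average over both lists. It is close to
  each of them, because the order of averaging can be exchanged.\<close>

lemma stable_limit:
  fixes v :: "nat \<Rightarrow> 'a \<Rightarrow> complex"
  assumes v: "\<And>n. v n \<in> borel_measurable M" "\<And>n x. cmod (v n x) \<le> C"
    and stable: "\<And>\<epsilon>. \<epsilon> > 0 \<Longrightarrow> \<exists>V. V \<noteq> [] \<and> (\<forall>m. L2n (\<lambda>x. avg V (\<lambda>w. v (m + w) x) - avg V (\<lambda>w. v w x)) \<le> \<epsilon>)"
  shows "\<exists>g. g \<in> borel_measurable M \<and> (\<forall>x. cmod (g x) \<le> C) \<and>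
    (\<forall>\<epsilon>>0. \<exists>V. V \<noteq> [] \<and> (\<forall>m. L2n (\<lambda>x. avg V (\<lambda>w. v (m + w) x) - g x) \<le> \<epsilon>))"
proof -
  have vb: "v n \<in> bmf" for n using v by (rule bmfI)
  obtain V where V: "\<And>n :: nat. V n \<noteq> []"
    "\<And>n m. L2n (\<lambda>x. avg (V n) (\<lambda>w. v (m + w) x) - avg (V n) (\<lambda>w. v w x)) \<le> (1/2) ^ n"
    using stable[of "(1/2) ^ n" for n] by (metis zero_less_power half_gt_zero_iff zero_less_one)
  define a where "a = (\<lambda>n x. avg (V n) (\<lambda>w. v w x))"
  have ab: "a n \<in> bmf" for n unfolding a_def by (intro bmf_avg vb)
  have aC: "cmod (a n x) \<le> C" for n x unfolding a_def by (intro norm_avg_le V v)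
  have shift: "L2n (\<lambda>x. avg (V i) (\<lambda>w. avg (V n) (\<lambda>u. v (w + u) x)) - a n x) \<le> (1/2) ^ n" for n i
  proof -
    have "(\<lambda>x. avg (V i) (\<lambda>w. avg (V n) (\<lambda>u. v (w + u) x)) - a n x) =
       (\<lambda>x. avg (V i) (\<lambda>w. avg (V n) (\<lambda>u. v (w + u) x) - a n x))"
      using V(1) by (simp add: avg_diff)
    then show ?thesis
      using V by (simp only:) (intro L2n_avg_le bmf_diff bmf_avg vb ab, simp_all add: a_def)
  qed
  have Cauchy: "L2n (\<lambda>x. a i x - a n x) \<le> (1/2) ^ i + (1/2) ^ n" for i n
  proof -
    define b where "b = (\<lambda>x. avg (V i) (\<lambda>w. avg (V n) (\<lambda>u. v (w + u) x)))"
    have b: "b \<in> bmf" unfolding b_def by (intro bmf_avg vb)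
    have "b = (\<lambda>x. avg (V n) (\<lambda>u. avg (V i) (\<lambda>w. v (u + w) x)))"
      unfolding b_def by (subst avg_swap) (simp add: add.commute)
    then have "L2n (\<lambda>x. b x - a i x) \<le> (1/2) ^ i" using shift[of n i] by simp
    moreover have "L2n (\<lambda>x. b x - a n x) \<le> (1/2) ^ n" using shift[of i n] by (simp add: b_def)
    moreover have "L2n (\<lambda>x. a i x - a n x) \<le> L2n (\<lambda>x. a i x - b x) + L2n (\<lambda>x. b x - a n x)"
      by (intro L2n_triangle_diff ab b)
    ultimately show ?thesis by (simp add: L2n_minus_commute[of "a i"])
  qed
  have step: "L2n (\<lambda>x. a (Suc n) x - a n x) \<le> 2 * (1/2) ^ n" for n
    using Cauchy[of "Suc n" n] by (simp add: field_simps)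
  obtain g where g: "g \<in> borel_measurable M" "\<And>x. cmod (g x) \<le> C" "(\<lambda>n. L2n (\<lambda>x. a n x - g x)) \<longlonglongrightarrow> 0"
    using L2n_complete[OF bmf_measurable[OF ab] aC step] by blast
  have gb: "g \<in> bmf" using g by (intro bmfI)
  have "\<exists>V. V \<noteq> [] \<and> (\<forall>m. L2n (\<lambda>x. avg V (\<lambda>w. v (m + w) x) - g x) \<le> \<epsilon>)" if \<epsilon>: "\<epsilon> > 0" for \<epsilon>
  proof -
    have "(\<lambda>n. L2n (\<lambda>x. a n x - g x) + (1/2) ^ n) \<longlonglongrightarrow> 0 + 0"
      by (intro tendsto_add g(3) LIMSEQ_realpow_zero) auto
    then have "eventually (\<lambda>n. L2n (\<lambda>x. a n x - g x) + (1/2) ^ n < \<epsilon>) sequentially"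
      by (rule order_tendstoD(2)) (use \<epsilon> in simp)
    then obtain n where n: "L2n (\<lambda>x. a n x - g x) + (1/2) ^ n < \<epsilon>"
      by (auto simp: eventually_sequentially)
    have "L2n (\<lambda>x. avg (V n) (\<lambda>w. v (m + w) x) - g x) \<le> \<epsilon>" for m
    proof -
      have "L2n (\<lambda>x. avg (V n) (\<lambda>w. v (m + w) x) - g x) \<le>
        L2n (\<lambda>x. avg (V n) (\<lambda>w. v (m + w) x) - a n x) + L2n (\<lambda>x. a n x - g x)"
        by (intro L2n_triangle_diff bmf_avg vb ab gb)
      then show ?thesis using V(2)[of n m] n unfolding a_def by linarith
    qed
    then show ?thesis using V(1) by blast
  qed
  then show ?thesis using g by blast
qed

text \<open>A long interval is almost invariant under the finitely many translations in
  \<open>V\<close>, so its average is close to a mean of translated \<open>V\<close>-averages, each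
  of which is close to \<open>g\<close>.\<close>

lemma window_limit:
  fixes v :: "nat \<Rightarrow> 'a \<Rightarrow> complex"
  assumes v: "\<And>n. v n \<in> borel_measurable M" "\<And>n x. cmod (v n x) \<le> C" and g: "g \<in> bmf"
    and lim: "\<And>\<epsilon>. \<epsilon> > 0 \<Longrightarrow> \<exists>V. V \<noteq> [] \<and> (\<forall>m. L2n (\<lambda>x. avg V (\<lambda>w. v (m + w) x) - g x) \<le> \<epsilon>)"
    and \<epsilon>: "\<epsilon> > 0"
  shows "\<exists>L. \<forall>a b. a + L \<le> b \<longrightarrow> L2n (\<lambda>x. avg [a..<b] (\<lambda>n. v n x) - g x) \<le> \<epsilon>"
proof -
  have C: "C \<ge> 0" using v(2) norm_ge_zero order_trans by blast
  have vb: "v n \<in> bmf" for n using v by (rule bmfI)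
  obtain V where V: "V \<noteq> []" "\<And>m. L2n (\<lambda>x. avg V (\<lambda>w. v (m + w) x) - g x) \<le> \<epsilon> / 2"
    using lim[of "\<epsilon> / 2"] \<epsilon> by auto
  define K where "K = sum_list V"
  have K: "w \<le> K" if "w \<in> set V" for w unfolding K_def using that by (rule member_le_sum_list) simp
  obtain L where L: "2 * C * real K / (real L + 1) \<le> \<epsilon> / 2"
    using ex_div_Suc_le[of "\<epsilon> / 2"] \<epsilon> by (metis half_gt_zero)
  have shift1: "cmod (avg [a..<b] (\<lambda>n. v (n + w) x) - avg [a..<b] (\<lambda>n. v n x)) \<le> 2 * C * real w / real (b - a)"
    if ab: "a < b" for a b w x
  proof -
    have one: "cmod ((\<Sum>n\<leftarrow>[a..<b]. v (n + w) x) - (\<Sum>n\<leftarrow>[a..<b]. v n x)) \<le> 2 * C * real w"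
    proof (induction w)
      case (Suc w)
      have "(\<Sum>n\<in>{a..<b}. v (n + Suc w) x) - (\<Sum>n\<in>{a..<b}. v (n + w) x) = v (b + w) x - v (a + w) x"
        using sum_Suc_diff'[of a b "\<lambda>n. v (n + w) x"] ab by (simp add: sum_subtractf)
      then have st: "cmod ((\<Sum>n\<leftarrow>[a..<b]. v (n + Suc w) x) - (\<Sum>n\<leftarrow>[a..<b]. v (n + w) x)) \<le> C + C"
        by (simp only: interv_sum_list_conv_sum_set_nat set_upt) (intro order_trans[OF norm_triangle_ineq4] add_mono v)
      show ?case
        using norm_triangle_le[OF add_mono[OF st Suc.IH]] by (simp add: algebra_simps)
    qed simp
    have "avg [a..<b] (\<lambda>n. v (n + w) x) - avg [a..<b] (\<lambda>n. v n x) =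
       ((\<Sum>n\<leftarrow>[a..<b]. v (n + w) x) - (\<Sum>n\<leftarrow>[a..<b]. v n x)) / of_nat (b - a)"
      by (simp add: avg_def diff_divide_distrib)
    then show ?thesis using one by (simp add: norm_divide divide_right_mono)
  qed
  \<comment> \<open>\<open>Suc L\<close> keeps the window non-empty and matches the denominator
    \<open>real L + 1\<close>.\<close>
  have "L2n (\<lambda>x. avg [a..<b] (\<lambda>n. v n x) - g x) \<le> \<epsilon>" if ab: "a + Suc L \<le> b" for a b
  proof -
    have lt: "a < b" using ab by simp
    define h where "h = (\<lambda>x. avg [a..<b] (\<lambda>n. avg V (\<lambda>w. v (n + w) x)))"
    have h: "h \<in> bmf" unfolding h_def by (intro bmf_avg vb)
    have "cmod (avg [a..<b] (\<lambda>n. v n x) - h x) \<le> \<epsilon> / 2" for x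
    proof -
      have "h x = avg V (\<lambda>w. avg [a..<b] (\<lambda>n. v (n + w) x))" unfolding h_def by (rule avg_swap)
      then have "h x - avg [a..<b] (\<lambda>n. v n x) = avg V (\<lambda>w. avg [a..<b] (\<lambda>n. v (n + w) x) - avg [a..<b] (\<lambda>n. v n x))"
        using V(1) by (simp add: avg_diff)
      also have "cmod \<dots> \<le> \<epsilon> / 2"
      proof (rule norm_avg_le[OF V(1)])
        fix w assume "w \<in> set V"
        then have le: "2 * C * real w / real (b - a) \<le> 2 * C * real K / (real L + 1)"
          using K[of w] C ab by (intro frac_le mult_left_mono mult_nonneg_nonneg) auto
        show "cmod (avg [a..<b] (\<lambda>n. v (n + w) x) - avg [a..<b] (\<lambda>n. v n x)) \<le> \<epsilon> / 2"
          by (rule order_trans[OF shift1[OF lt] order_trans[OF le L]])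
      qed
      finally show ?thesis by (simp add: norm_minus_commute)
    qed
    then have "L2n (\<lambda>x. avg [a..<b] (\<lambda>n. v n x) - h x) \<le> \<epsilon> / 2"
      by (intro L2n_bound bmf_measurable bmf_diff bmf_avg vb h)
    moreover have "L2n (\<lambda>x. h x - g x) \<le> \<epsilon> / 2"
    proof -
      have "(\<lambda>x. h x - g x) = (\<lambda>x. avg [a..<b] (\<lambda>n. avg V (\<lambda>w. v (n + w) x) - g x))"
        using lt by (simp add: h_def avg_diff)
      then show ?thesis
        using lt V(2) by (simp only:) (intro L2n_avg_le bmf_diff bmf_avg vb g, auto)
    qed
    moreover have "L2n (\<lambda>x. avg [a..<b] (\<lambda>n. v n x) - g x) \<le>
        L2n (\<lambda>x. avg [a..<b] (\<lambda>n. v n x) - h x) + L2n (\<lambda>x. h x - g x)"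
      by (intro L2n_triangle_diff bmf_avg vb h g)
    ultimately show ?thesis by simp
  qed
  then show ?thesis by blast
qed

text \<open>The limit \<open>h\<close> of the twisted averages satisfies
  \<open>\<zeta> 1 * h (T x) = h x\<close>, as moving the list by one step shows, and so vanishes by
  hypothesis.\<close>

lemma no_eigenfunction_small:
  assumes \<zeta>: "character \<zeta>" and f: "f \<in> bmf" and \<epsilon>: "\<epsilon> > 0"
    and no: "\<And>h. h \<in> bmf \<Longrightarrow> AE x in M. \<zeta> 1 * h (T x) = h x \<Longrightarrow> AE x in M. h x = 0"
  shows "\<exists>V :: nat list. V \<noteq> [] \<and> L2n (\<lambda>x. avg V (\<lambda>w. \<zeta> (int w) * f ((T ^^ w) x))) \<le> \<epsilon>"
proof -
  define v where "v = (\<lambda>n x. \<zeta> (int n) * f ((T ^^ n) x))"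
  obtain C where C: "\<And>x. cmod (f x) \<le> C" using bmf_bdd[OF f] by blast
  have vb: "v n \<in> bmf" for n unfolding v_def by (intro bmf_mult bmf_const bmf_funpow f)
  have vC: "cmod (v n x) \<le> C" for n x by (simp add: v_def norm_mult norm_character[OF \<zeta>] C)
  have "\<exists>V. V \<noteq> [] \<and> (\<forall>m. L2n (\<lambda>x. avg V (\<lambda>w. v (m + w) x) - avg V (\<lambda>w. v w x)) \<le> \<epsilon>)" if "\<epsilon> > 0" for \<epsilon>
    using mprod_stable[OF \<zeta>, of 1 "\<lambda>_. f" \<epsilon>] f that by (simp add: mprod_def v_def)
  from stable_limit[OF bmf_measurable[OF vb] vC this]
  obtain h where h: "h \<in> borel_measurable M" "\<And>x. cmod (h x) \<le> C"
    "\<And>\<epsilon>. \<epsilon> > 0 \<Longrightarrow> \<exists>V. V \<noteq> [] \<and> (\<forall>m. L2n (\<lambda>x. avg V (\<lambda>w. v (m + w) x) - h x) \<le> \<epsilon>)" by blast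
  have hb: "h \<in> bmf" using h(1,2) by (rule bmfI)
  have hT: "(\<lambda>x. h (T x)) \<in> bmf" using bmf_funpow[OF hb, of 1] by simp
  have "L2n (\<lambda>x. \<zeta> 1 * h (T x) - h x) \<le> 0 + e" if e: "e > 0" for e
  proof -
    obtain V where V: "V \<noteq> []" "\<And>m. L2n (\<lambda>x. avg V (\<lambda>w. v (m + w) x) - h x) \<le> e / 2"
      using h(3)[of "e / 2"] e by auto
    define a where "a = (\<lambda>m x. avg V (\<lambda>w. v (m + w) x))"
    have ab: "a m \<in> bmf" for m unfolding a_def by (intro bmf_avg vb)
    have aT: "(\<lambda>x. a 0 (T x)) \<in> bmf" using bmf_funpow[OF ab, of 0 1] by simp
    have a1: "a 1 = (\<lambda>x. \<zeta> 1 * a 0 (T x))"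
      unfolding a_def avg_cmult[symmetric]
      by (simp add: v_def character_add[OF \<zeta>] funpow_swap1 mult_ac)
    have "L2n (\<lambda>x. \<zeta> 1 * h (T x) - a 1 x) = L2n (\<lambda>x. h x - a 0 x)"
    proof -
      have "L2n (\<lambda>x. \<zeta> 1 * (h (T x) - a 0 (T x))) = cmod (\<zeta> 1) * L2n (\<lambda>x. h (T x) - a 0 (T x))"
        by (intro L2n_cmult bmf_diff hT aT)
      also have "\<dots> = L2n (\<lambda>x. h x - a 0 x)"
        using L2n_funpow[OF bmf_measurable[OF bmf_diff[OF hb ab]], of 1 0] by (simp add: norm_character[OF \<zeta>])
      finally show ?thesis unfolding a1 by (simp add: right_diff_distrib)
    qed
    also have "\<dots> \<le> e / 2" using V(2)[of 0] by (simp add: a_def L2n_minus_commute[of h])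
    finally have "L2n (\<lambda>x. \<zeta> 1 * h (T x) - a 1 x) \<le> e / 2" .
    moreover have "L2n (\<lambda>x. a 1 x - h x) \<le> e / 2" using V(2)[of 1] by (simp add: a_def)
    moreover have "L2n (\<lambda>x. \<zeta> 1 * h (T x) - h x) \<le> L2n (\<lambda>x. \<zeta> 1 * h (T x) - a 1 x) + L2n (\<lambda>x. a 1 x - h x)"
      by (intro L2n_triangle_diff bmf_mult bmf_const hT ab hb)
    ultimately show ?thesis by simp
  qed
  then have "L2n (\<lambda>x. \<zeta> 1 * h (T x) - h x) \<le> 0" by (rule field_le_epsilon)
  then have "L2n (\<lambda>x. \<zeta> 1 * h (T x) - h x) = 0" using L2n_nonneg order_antisym by blast
  then have "AE x in M. \<zeta> 1 * h (T x) - h x = 0"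
    by (intro L2n_eq_0_AE bmf_diff bmf_mult bmf_const hT hb)
  then have h0: "AE x in M. h x = 0" by (intro no hb) auto
  obtain V where V: "V \<noteq> []" "\<And>m. L2n (\<lambda>x. avg V (\<lambda>w. v (m + w) x) - h x) \<le> \<epsilon>"
    using h(3)[OF \<epsilon>] by blast
  have [measurable]: "(\<lambda>x. avg V (\<lambda>w. v w x)) \<in> borel_measurable M" "h \<in> borel_measurable M"
    by (intro bmf_measurable bmf_avg vb hb)+
  have "L2n (\<lambda>x. avg V (\<lambda>w. v w x)) = L2n (\<lambda>x. avg V (\<lambda>w. v w x) - h x)"
    unfolding L2n_def
    by (intro arg_cong[of _ _ sqrt] integral_cong_AE) (measurable, use h0 in auto)
  then show ?thesis using V(1) V(2)[of 0] by (intro exI[of _ V]) (simp add: v_def)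
qed

end

section \<open>Trigonometric approximation of the fractional part\<close>

text \<open>Trigonometric polynomials, generated so that \<open>trig_window_small\<close> can treat
  one wave at a time by rule induction.\<close>

inductive trig :: "(real \<Rightarrow> complex) \<Rightarrow> bool" where
  wave: "trig (\<lambda>x. c * cis (2 * pi * of_int h * x))"
| add: "trig p \<Longrightarrow> trig q \<Longrightarrow> trig (\<lambda>x. p x + q x)"

lemma trig_const: "trig (\<lambda>_. c)"
  using trig.wave[of c 0] by simp

lemma trig_cmult: "trig p \<Longrightarrow> trig (\<lambda>x. c * p x)"
proof (induction rule: trig.induct)
  case (wave d h)
  show ?case using trig.wave[of "c * d" h] by (simp add: mult.assoc)
qed (simp add: trig.add algebra_simps)

lemma trig_sum: "(\<And>i. i \<in> I \<Longrightarrow> trig (F i)) \<Longrightarrow> trig (\<lambda>x. \<Sum>i\<in>I. F i x)"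
  by (induction I rule: infinite_finite_induct) (auto intro: trig_const trig.add)

lemma trig_shift: "trig p \<Longrightarrow> trig (\<lambda>x. p (x + y))"
proof (induction rule: trig.induct)
  case (wave c h)
  show ?case
    using trig.wave[of "c * cis (2 * pi * of_int h * y)" h]
    by (simp add: cis_mult algebra_simps)
qed (rule trig.add)

text \<open>\<open>1 - cis (2 * pi * y)\<close> has modulus \<open>2 * sin (pi * y)\<close> and
  argument \<open>pi * y - pi / 2\<close>. So, up to scaling, the sawtooth is the boundary value of
  \<open>Im (Ln (1 - z))\<close> on the unit circle.\<close>

lemma Im_Ln_sawtooth:
  assumes "0 < y" "y < 1"
  shows "Im (Ln (1 - cis (2 * pi * y))) = pi * y - pi / 2"
proof -
  have py: "0 < pi * y" "pi * y < pi" using assms by auto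
  then have s: "sin (pi * y) > 0" by (intro sin_gt_zero)
  have "exp (Complex (ln (2 * sin (pi * y))) (pi * y - pi / 2)) =
      of_real (2 * sin (pi * y)) * cis (pi * y - pi / 2)"
    using s by (simp add: exp_eq_polar)
  also have "\<dots> = 1 - cis (2 * pi * y)"
    using sin_double[of "pi * y"] cos_double_sin[of "pi * y"]
    by (auto simp: complex_eq_iff cos_diff sin_diff power2_eq_square mult.assoc)
  finally have "Ln (1 - cis (2 * pi * y)) = Complex (ln (2 * sin (pi * y))) (pi * y - pi / 2)"
  proof (rule Ln_unique)
    show "- pi < Im (Complex (ln (2 * sin (pi * y))) (pi * y - pi / 2))"
      "Im (Complex (ln (2 * sin (pi * y))) (pi * y - pi / 2)) \<le> pi"
      unfolding complex.sel using py by linarith+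
  qed
  then show ?thesis by simp
qed

text \<open>Abel summation: uniform continuity away from the jump permits a radius
  \<open>\<rho> < 1\<close>, where the logarithm series converges uniformly and can be truncated.
  The bound valid for all \<open>x\<close> holds because \<open>1 - w x\<close> lies in the right
  half-plane, where the argument stays below \<open>pi / 2\<close>.\<close>

lemma sawtooth_trig_approx:
  assumes \<eta>: "0 < \<eta>" "\<eta> < 1/4" and \<epsilon>: "\<epsilon> > 0" "\<epsilon> \<le> 1"
  shows "\<exists>p. trig p \<and> (\<forall>x. cmod (p x) \<le> 2) \<and>
    (\<forall>x. \<eta> \<le> frac x \<and> frac x \<le> 1 - \<eta> \<longrightarrow> cmod (of_real (frac x) - p x) \<le> \<epsilon>)"
proof -
  define F where "F = (\<lambda>(\<rho>, y). Im (Ln (1 - complex_of_real \<rho> * cis (2 * pi * y))))"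
  define K where "K = {0..1::real} \<times> {\<eta>..1 - \<eta>}"
  have pos: "Re (1 - complex_of_real \<rho> * cis (2 * pi * y)) > 0" if "0 \<le> \<rho>" "\<rho> \<le> 1" "0 < y" "y < 1" for \<rho> y
  proof -
    have "sin (pi * y) > 0" using that by (intro sin_gt_zero) auto
    then have c: "cos (2 * pi * y) < 1"
      using cos_double_sin[of "pi * y"] by (simp add: mult.assoc)
    have "\<rho> * cos (2 * pi * y) < 1"
    proof (cases "cos (2 * pi * y) \<le> 0")
      case True
      then show ?thesis using that mult_nonneg_nonpos[of \<rho> "cos (2 * pi * y)"] by linarith
    next
      case False
      then show ?thesis using that c mult_right_mono[of \<rho> 1 "cos (2 * pi * y)"] by linarith
    qed
    then show ?thesis by simp
  qed
  have "continuous_on K F"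
    unfolding F_def K_def split_beta
  proof (intro continuous_intros)
    fix z assume z: "z \<in> {0..1::real} \<times> {\<eta>..1 - \<eta>}"
    then have "Re (1 - complex_of_real (fst z) * cis (2 * pi * snd z)) > 0"
      using \<eta> by (intro pos) auto
    then show "1 - complex_of_real (fst z) * cis (2 * pi * snd z) \<notin> \<real>\<^sub>\<le>\<^sub>0"
      by (auto simp: complex_nonpos_Reals_iff)
  qed
  moreover have "compact K" unfolding K_def by (intro compact_Times) auto
  ultimately have "uniformly_continuous_on K F" by (rule compact_uniformly_continuous)
  then obtain \<delta> where \<delta>: "\<delta> > 0" "\<And>z z'. z \<in> K \<Longrightarrow> z' \<in> K \<Longrightarrow> dist z' z < \<delta> \<Longrightarrow> dist (F z') (F z) < \<epsilon>"
    unfolding uniformly_continuous_on_def using \<epsilon> by metis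
  \<comment> \<open>Within \<open>\<delta>\<close> of the unit circle; the \<open>1/2\<close> keeps
    the radius positive.\<close>
  define \<rho> where "\<rho> = max (1/2) (1 - \<delta> / 2)"
  have \<rho>: "0 < \<rho>" "\<rho> < 1" "1 - \<rho> < \<delta>" using \<delta>(1) by (auto simp: \<rho>_def)
  define w where "w = (\<lambda>y. complex_of_real \<rho> * cis (2 * pi * y))"
  have nw: "cmod (w y) = \<rho>" for y using \<rho> by (simp add: w_def norm_mult)
  have "uniform_limit UNIV (\<lambda>n y. \<Sum>i<n. - (w y ^ i) / of_nat i) (\<lambda>y. suminf (\<lambda>i. - (w y ^ i) / of_nat i)) sequentially"
  proof (rule Weierstrass_m_test)
    show "summable (\<lambda>n. \<rho> ^ n)" using \<rho> by (intro summable_geometric) simp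
    show "norm (- (w y ^ n) / of_nat n) \<le> \<rho> ^ n" for n y
      using \<rho> by (cases "n = 0") (auto simp: norm_divide norm_power nw divide_le_eq mult_left_le)
  qed
  then have "eventually (\<lambda>n. \<forall>y\<in>UNIV. dist (\<Sum>i<n. - (w y ^ i) / of_nat i) (suminf (\<lambda>i. - (w y ^ i) / of_nat i)) < \<epsilon>) sequentially"
    using \<epsilon>(1) unfolding uniform_limit_iff by blast
  then obtain N where N: "\<And>y. dist (\<Sum>i<N. - (w y ^ i) / of_nat i) (suminf (\<lambda>i. - (w y ^ i) / of_nat i)) < \<epsilon>"
    by (auto simp: eventually_sequentially)
  define s where "s = (\<lambda>y. \<Sum>i<N. - (w y ^ i) / of_nat i)"
  have s: "cmod (s y - Ln (1 - w y)) \<le> \<epsilon>" for y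
  proof -
    have "(\<lambda>n. - ((- (- w y)) ^ n) / of_nat n) sums ln (1 + (- w y))"
      using nw \<rho> by (intro Ln_series') simp
    then have "suminf (\<lambda>i. - (w y ^ i) / of_nat i) = Ln (1 - w y)" by (simp add: sums_iff)
    then show ?thesis using N[of y] by (simp add: s_def dist_norm)
  qed
  define p where "p = (\<lambda>y. 1/2 + complex_of_real (Im (s y) / pi))"
  have trig_p: "trig p"
  proof -
    have pw: "cis (2 * pi * y) ^ i = cis (2 * pi * of_int (int i) * y)" for i y
      unfolding Complex.DeMoivre by (rule arg_cong[of _ _ cis]) simp
    have s_eq: "s = (\<lambda>y. \<Sum>i<N. (- (of_real \<rho> ^ i) / of_nat i) * cis (2 * pi * of_int (int i) * y))"
      unfolding s_def w_def power_mult_distrib pw by (intro HOL.ext sum.cong) simp_all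
    have cs_eq: "(\<lambda>y. cnj (s y)) = (\<lambda>y. \<Sum>i<N. (- (of_real \<rho> ^ i) / of_nat i) * cis (2 * pi * of_int (- int i) * y))"
      unfolding s_eq by (simp add: cis_cnj)
    define k where "k = 1 / (2 * \<i>)"
    have k: "complex_of_real (Im z) = k * z + (- k) * cnj z" for z
      by (simp add: k_def complex_eq_iff Re_divide Im_divide)
    have "p = (\<lambda>y. 1/2 + ((k / of_real pi) * s y + (- k / of_real pi) * cnj (s y)))"
      unfolding p_def of_real_divide k by (simp add: diff_divide_distrib)
    moreover have "trig s" unfolding s_eq by (intro trig_sum trig.wave)
    moreover have "trig (\<lambda>y. cnj (s y))" unfolding cs_eq by (intro trig_sum trig.wave)
    ultimately show ?thesis by (simp only:) (intro trig.add trig_const trig_cmult)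
  qed
  have near: "\<bar>Im (s y) - Im (Ln (1 - w y))\<bar> \<le> \<epsilon>" for y
    using abs_Im_le_cmod[of "s y - Ln (1 - w y)"] s[of y] by simp
  have "cmod (p x) \<le> 2" for x
  proof -
    have "Re (w x) < 1" using complex_Re_le_cmod[of "w x"] nw[of x] \<rho> by linarith
    then have "0 < Re (1 - w x)" by simp
    then have "\<bar>Im (Ln (1 - w x))\<bar> < pi / 2" by (subst Re_Ln_pos_lt) (auto simp: complex_eq_iff)
    then have "\<bar>Im (s x)\<bar> \<le> pi / 2 + 1" using near[of x] \<epsilon>(2) by linarith
    also have "\<dots> \<le> pi" using pi_gt3 by simp
    finally have "\<bar>Im (s x) / pi\<bar> \<le> 1" by (simp add: abs_divide)
    moreover have "cmod (p x) \<le> 1/2 + \<bar>Im (s x) / pi\<bar>"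
      unfolding p_def by (rule order_trans[OF norm_triangle_ineq]) (simp only: norm_of_real, simp add: norm_divide)
    ultimately show ?thesis by linarith
  qed
  moreover have "cmod (of_real (frac x) - p x) \<le> \<epsilon>" if x: "\<eta> \<le> frac x" "frac x \<le> 1 - \<eta>" for x
  proof -
    define y where "y = frac x"
    have y: "0 < y" "y < 1" using x \<eta> unfolding y_def by linarith+
    have "cis (2 * pi * x) = cis (2 * pi * y) * cis (2 * pi * of_int \<lfloor>x\<rfloor>)"
      by (simp add: y_def frac_def cis_mult algebra_simps)
    also have "cis (2 * pi * of_int \<lfloor>x\<rfloor>) = 1" by (rule cis_multiple_2pi) simp
    finally have wx: "w x = complex_of_real \<rho> * cis (2 * pi * y)" by (simp add: w_def)
    have "dist (F (\<rho>, y)) (F (1, y)) < \<epsilon>"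
      using \<rho> \<eta> x by (intro \<delta>) (auto simp: K_def dist_Pair_Pair dist_real_def y_def)
    then have "\<bar>Im (Ln (1 - w x)) - (pi * y - pi / 2)\<bar> \<le> \<epsilon>"
      using Im_Ln_sawtooth[OF y] by (simp add: F_def wx dist_real_def)
    then have "\<bar>Im (s x) - (pi * y - pi / 2)\<bar> \<le> 2 * \<epsilon>" using near[of x] by linarith
    then have "\<bar>(Im (s x) - (pi * y - pi / 2)) / pi\<bar> \<le> 2 * \<epsilon> / pi"
      by (simp add: abs_divide divide_right_mono)
    also have "\<dots> \<le> \<epsilon>" using \<epsilon> pi_gt3 by (simp add: field_simps)
    finally have "\<bar>y - (1/2 + Im (s x) / pi)\<bar> \<le> \<epsilon>" by (simp add: field_simps abs_minus_commute)
    moreover have "complex_of_real y - p x = of_real (y - (1/2 + Im (s x) / pi))" by (simp add: p_def)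
    ultimately show ?thesis unfolding y_def[symmetric] by (simp only: norm_of_real)
  qed
  ultimately show ?thesis using trig_p by blast
qed

text \<open>A one-sided exceptional set is what makes the case of rational slopes work: there it is empty
  for small \<open>\<eta>\<close>, even if the orbit passes through the discontinuity.\<close>

lemma frac_trig_approx:
  assumes \<eta>: "0 < \<eta>" "\<eta> < 1/4" and \<epsilon>: "\<epsilon> > 0" "\<epsilon> \<le> 1"
  shows "\<exists>p. trig p \<and> (\<forall>x. cmod (p x) \<le> 3) \<and>
    (\<forall>x. frac x < 1 - 2 * \<eta> \<longrightarrow> cmod (of_real (frac x) - p x) \<le> \<epsilon>)"
proof -
  obtain p where p: "trig p" "\<And>x. cmod (p x) \<le> 2"
    "\<And>x. \<eta> \<le> frac x \<Longrightarrow> frac x \<le> 1 - \<eta> \<Longrightarrow> cmod (of_real (frac x) - p x) \<le> \<epsilon>"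
    using sawtooth_trig_approx[OF assms] by blast
  define q where "q = (\<lambda>x. p (x + \<eta>) + of_real (- \<eta>))"
  have "trig q" unfolding q_def by (rule trig.add[OF trig_shift[OF p(1)] trig_const])
  moreover have "cmod (q x) \<le> 3" for x
    using norm_triangle_ineq[of "p (x + \<eta>)" "of_real (- \<eta>)"] p(2)[of "x + \<eta>"] \<eta> by (simp add: q_def)
  moreover have "cmod (of_real (frac x) - q x) \<le> \<epsilon>" if x: "frac x < 1 - 2 * \<eta>" for x
  proof -
    have f: "frac (x + \<eta>) = frac x + \<eta>"
      using x \<eta> by (simp add: frac_add frac_eq)
    then have eq: "of_real (frac x) - q x = of_real (frac (x + \<eta>)) - p (x + \<eta>)" by (simp add: q_def)
    have "0 \<le> frac x" by simp
    then show ?thesis unfolding eq using x \<eta> f by (intro p(3)) linarith+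
  qed
  ultimately show ?thesis by blast
qed

lemma frac_eqI:
  assumes "x - y \<in> \<int>"
  shows "frac x = frac y"
proof -
  obtain k where "x = y + of_int k" using assms by (metis Ints_cases add.commute diff_add_cancel)
  then show ?thesis by (simp add: frac_def)
qed

text \<open>An elementary substitute for equidistribution. If a positive multiple of
  \<open>\<beta>\<close> is an integer, the orbit is finite and stays below some
  \<open>m < 1\<close>, so no \<open>r\<close> is exceptional. Otherwise two exceptional
  \<open>r\<close> are more than \<open>D\<close> apart, because \<open>d * \<beta>\<close> keeps a
  distance \<open>\<mu>\<close> from the integers for \<open>1 \<le> d \<le> D\<close>.\<close>

lemma orbit_density:
  fixes \<beta> x0 \<epsilon> :: real
  assumes \<epsilon>: "\<epsilon> > 0"
  shows "\<exists>\<eta> L. 0 < \<eta> \<and> \<eta> < 1/4 \<and> (\<forall>a b. a + L \<le> b \<longrightarrow>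
    real (card {r \<in> {a..<b :: nat}. frac (x0 - real r * \<beta>) \<ge> 1 - 2 * \<eta>}) \<le> \<epsilon> * real (b - a))"
proof (cases "\<exists>q::nat. q > 0 \<and> real q * \<beta> \<in> \<int>")
  case True
  then obtain q :: nat where q: "q > 0" "real q * \<beta> \<in> \<int>" by blast
  define m where "m = Max ((\<lambda>r. frac (x0 - real r * \<beta>)) ` {..<q})"
  have "m \<in> (\<lambda>r. frac (x0 - real r * \<beta>)) ` {..<q}" unfolding m_def using q by (intro Max_in) auto
  then have m: "m < 1" using frac_lt_1 by auto
  have le_m: "frac (x0 - real r * \<beta>) \<le> m" for r
  proof -
    have "r = q * (r div q) + r mod q" by simp
    then have "real r = real q * real (r div q) + real (r mod q)" by (metis of_nat_add of_nat_mult)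
    then have "x0 - real r * \<beta> - (x0 - real (r mod q) * \<beta>) = - (real (r div q) * (real q * \<beta>))"
      by (simp add: algebra_simps)
    also have "\<dots> \<in> \<int>" by (rule Ints_minus[OF Ints_mult[OF Ints_of_nat q(2)]])
    finally have "frac (x0 - real r * \<beta>) = frac (x0 - real (r mod q) * \<beta>)" by (rule frac_eqI)
    also have "\<dots> \<le> m" unfolding m_def using q by (intro Max_ge) auto
    finally show ?thesis .
  qed
  define \<eta> where "\<eta> = min (1/8) ((1 - m) / 4)"
  have "2 * \<eta> \<le> (1 - m) / 2" unfolding \<eta>_def by linarith
  then have "m < 1 - 2 * \<eta>" using m by (simp add: field_simps)
  then have less: "frac (x0 - real r * \<beta>) < 1 - 2 * \<eta>" for r using le_m[of r] by (rule le_less_trans[rotated])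
  have "0 < \<eta>" "\<eta> < 1/4" using m by (auto simp: \<eta>_def)
  moreover have "{r \<in> {a..<b :: nat}. frac (x0 - real r * \<beta>) \<ge> 1 - 2 * \<eta>} = {}" for a b
    using less by (auto simp: not_le)
  ultimately show ?thesis using \<epsilon> by (intro exI[of _ \<eta>] exI[of _ 0]) (simp del: Collect_empty_eq)
next
  case False
  \<comment> \<open>At most one exceptional \<open>r\<close> in each block of length
    \<open>D\<close> means density \<open>1 / D \<le> \<epsilon> / 2\<close>; incomplete blocks add
    at most \<open>2\<close>, which \<open>L\<close> absorbs.\<close>
  define D where "D = nat \<lceil>2 / \<epsilon>\<rceil> + 1"
  have D: "D > 0" "2 / \<epsilon> \<le> real D" unfolding D_def by (auto intro: order_trans[OF real_nat_ceiling_ge])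
  define \<mu> where "\<mu> = Min ((\<lambda>d. min (frac (real d * \<beta>)) (1 - frac (real d * \<beta>))) ` {1..D})"
  have "\<mu> \<in> (\<lambda>d. min (frac (real d * \<beta>)) (1 - frac (real d * \<beta>))) ` {1..D}"
    unfolding \<mu>_def using D by (intro Min_in) auto
  then obtain d where d: "d \<in> {1..D}" "\<mu> = min (frac (real d * \<beta>)) (1 - frac (real d * \<beta>))" by blast
  have "real d * \<beta> \<notin> \<int>" using False d(1) by (auto dest: spec[of _ d])
  then have "frac (real d * \<beta>) > 0" by (simp add: frac_gt_0_iff)
  then have \<mu>: "\<mu> > 0" using d(2) frac_lt_1[of "real d * \<beta>"] by simp
  have \<mu>_le: "\<mu> \<le> frac (real d * \<beta>)" "\<mu> \<le> 1 - frac (real d * \<beta>)" if "d \<in> {1..D}" for d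
  proof -
    have "\<mu> \<le> min (frac (real d * \<beta>)) (1 - frac (real d * \<beta>))"
      unfolding \<mu>_def using that by (intro Min_le) auto
    then show "\<mu> \<le> frac (real d * \<beta>)" "\<mu> \<le> 1 - frac (real d * \<beta>)" by auto
  qed
  define \<eta> where "\<eta> = min (1/8) (\<mu> / 4)"
  have \<eta>: "0 < \<eta>" "\<eta> < 1/4" "2 * \<eta> < \<mu>" using \<mu> by (auto simp: \<eta>_def)
  let ?S = "\<lambda>a b. {r \<in> {a..<b :: nat}. frac (x0 - real r * \<beta>) \<ge> 1 - 2 * \<eta>}"
  have gap: "False" if "frac (x0 - real r * \<beta>) \<ge> 1 - 2 * \<eta>" "frac (x0 - real (r + d) * \<beta>) \<ge> 1 - 2 * \<eta>" "d \<in> {1..D}" for r d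
  proof -
    define y1 y2 where "y1 = frac (x0 - real r * \<beta>)" and "y2 = frac (x0 - real (r + d) * \<beta>)"
    have y: "\<bar>y1 - y2\<bar> < 2 * \<eta>"
      using that frac_lt_1[of "x0 - real r * \<beta>"] frac_lt_1[of "x0 - real (r + d) * \<beta>"] unfolding y1_def y2_def by linarith
    have "real d * \<beta> - (y1 - y2) \<in> \<int>"
    proof -
      have "real d * \<beta> - (y1 - y2) = of_int (\<lfloor>x0 - real r * \<beta>\<rfloor> - \<lfloor>x0 - real (r + d) * \<beta>\<rfloor>)"
        by (simp add: y1_def y2_def frac_def algebra_simps)
      then show ?thesis by (metis Ints_of_int)
    qed
    \<comment> \<open>So \<open>d * \<beta>\<close> is within \<open>2 * \<eta> < \<mu>\<close> of
      an integer, against the choice of \<open>\<mu>\<close>.\<close>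
    then have f: "frac (real d * \<beta>) = frac (y1 - y2)" by (rule frac_eqI)
    show False
    proof (cases "y1 - y2 \<ge> 0")
      case True
      then have "frac (y1 - y2) = y1 - y2" using y \<eta> by (simp add: frac_eq)
      then show False using f y \<eta> \<mu>_le[OF that(3)] by linarith
    next
      case neg: False
      have "frac (y1 - y2) = frac (y1 - y2 + 1)" by (rule frac_eqI) simp
      also have "\<dots> = y1 - y2 + 1" using y \<eta> neg by (simp add: frac_eq)
      finally show False using f y \<eta> \<mu>_le[OF that(3)] by linarith
    qed
  qed
  have inj: "inj_on (\<lambda>r. r div D) (?S a b)" for a b
  proof (rule linorder_inj_onI)
    fix r s assume r: "r \<in> ?S a b" and s: "s \<in> ?S a b" and "r < s"
    show "r div D \<noteq> s div D"
    proof
      assume eq: "r div D = s div D"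
      define d where "d = s - r"
      have "r = D * (r div D) + r mod D" "s = D * (s div D) + s mod D" by simp_all
      moreover have "s mod D < D" using D by simp
      ultimately have "s - r < D" using eq \<open>r < s\<close> by (metis add_diff_cancel_left diff_le_self le_less_trans)
      then have "d \<in> {1..D}" using \<open>r < s\<close> by (auto simp: d_def)
      moreover have "s = r + d" using \<open>r < s\<close> by (simp add: d_def)
      ultimately show False using gap[of r d] r s by auto
    qed
  qed auto
  define L where "L = nat \<lceil>4 / \<epsilon>\<rceil>"
  have "real (card (?S a b)) \<le> \<epsilon> * real (b - a)" if ab: "a + L \<le> b" for a b
  proof -
    have "card (?S a b) = card ((\<lambda>r. r div D) ` ?S a b)" by (rule card_image[OF inj, symmetric])
    also have "\<dots> \<le> card {a div D..b div D}"
      by (intro card_mono) (auto simp: div_le_mono)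
    also have "\<dots> = Suc (b div D) - a div D" by simp
    finally have "real (card (?S a b)) \<le> real (b div D) - real (a div D) + 1"
      using div_le_mono[of a b D] ab by linarith
    also have "\<dots> \<le> real b / real D - (real a / real D - 1) + 1"
    proof -
      have "real (b div D) \<le> real b / real D" by (rule of_nat_div_le_of_nat)
      moreover have "real a / real D - 1 \<le> real (a div D)"
      proof -
        have "real a = real D * real (a div D) + real (a mod D)" by (metis mult_div_mod_eq of_nat_add of_nat_mult)
        moreover have "real (a mod D) \<le> real D" using D by (simp add: less_imp_le)
        ultimately have "real a \<le> real D * (real (a div D) + 1)" by (simp add: algebra_simps)
        then show ?thesis using D by (simp add: field_simps)
      qed
      ultimately show ?thesis by linarith
    qed
    also have "\<dots> = real (b - a) / real D + 2" using ab by (simp add: of_nat_diff diff_divide_distrib)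
    also have "\<dots> \<le> \<epsilon> / 2 * real (b - a) + \<epsilon> / 2 * real (b - a)"
    proof (rule add_mono)
      have "1 / real D \<le> \<epsilon> / 2" using D \<epsilon> by (simp add: field_simps)
      then show "real (b - a) / real D \<le> \<epsilon> / 2 * real (b - a)"
        using mult_right_mono[of "1 / real D" "\<epsilon> / 2" "real (b - a)"] by simp
      have "4 / \<epsilon> \<le> real L" unfolding L_def by (rule real_nat_ceiling_ge)
      also have "\<dots> \<le> real (b - a)" using ab by simp
      finally have "4 \<le> \<epsilon> * real (b - a)" using \<epsilon> by (simp add: divide_le_eq mult.commute del: of_nat_diff)
      then show "2 \<le> \<epsilon> / 2 * real (b - a)" by linarith
    qed
    finally show ?thesis by simp
  qed
  then show ?thesis using \<eta> by blast
qed

section \<open>Averages along Beatty sequences\<close>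

text \<open>The first index at which the Beatty sequence reaches a value of at least
  \<open>r\<close>.\<close>

definition entry :: "real \<Rightarrow> real \<Rightarrow> int \<Rightarrow> int" where
  "entry \<theta> \<gamma> r = \<lceil>(of_int r - \<gamma>) / \<theta>\<rceil>"

lemma floor_eq_iff_entry:
  assumes "\<theta> > 0"
  shows "\<lfloor>\<theta> * of_int i + \<gamma>\<rfloor> = r \<longleftrightarrow> entry \<theta> \<gamma> r \<le> i \<and> i < entry \<theta> \<gamma> (r + 1)"
proof -
  have "entry \<theta> \<gamma> r \<le> i \<longleftrightarrow> of_int r \<le> \<theta> * of_int i + \<gamma>" for r
    using assms by (simp add: entry_def ceiling_le_iff divide_le_eq algebra_simps)
  then show ?thesis by (simp add: floor_eq_iff not_le[symmetric])
qed

text \<open>A ceiling is the number itself plus the fractional part of its negative.\<close>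

lemma entry_diff:
  assumes "\<theta> > 0"
  shows "real_of_int (entry \<theta> \<gamma> (r + 1) - entry \<theta> \<gamma> r) =
    1 / \<theta> + (frac ((\<gamma> - of_int (r + 1)) / \<theta>) - frac ((\<gamma> - of_int r) / \<theta>))"
proof -
  have "real_of_int (entry \<theta> \<gamma> r) = (of_int r - \<gamma>) / \<theta> + frac ((\<gamma> - of_int r) / \<theta>)" for r
  proof -
    have "(\<gamma> - of_int r) / \<theta> = - ((of_int r - \<gamma>) / \<theta>)" by (simp add: minus_divide_left)
    then show ?thesis by (simp add: entry_def frac_def ceiling_def)
  qed
  then show ?thesis by (simp add: add_divide_distrib diff_divide_distrib)
qed

lemma entry_mono: "\<theta> > 0 \<Longrightarrow> r \<le> s \<Longrightarrow> entry \<theta> \<gamma> r \<le> entry \<theta> \<gamma> s"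
  unfolding entry_def by (intro ceiling_mono divide_right_mono) auto

lemma entry_diff_le:
  assumes "\<theta> > 0"
  shows "real_of_int (entry \<theta> \<gamma> (r + 1) - entry \<theta> \<gamma> r) \<le> 1 / \<theta> + 1"
  unfolding entry_diff[OF assms]
  using frac_lt_1[of "(\<gamma> - of_int (r + 1)) / \<theta>"] frac_ge_0[of "(\<gamma> - of_int r) / \<theta>"] by linarith

lemma sum_floor_entry:
  fixes G :: "int \<Rightarrow> complex"
  assumes "\<theta> > 0" "A \<le> B"
  shows "(\<Sum>i\<in>{entry \<theta> \<gamma> A..<entry \<theta> \<gamma> B}. G \<lfloor>\<theta> * of_int i + \<gamma>\<rfloor>) =
    (\<Sum>r\<in>{A..<B}. of_int (entry \<theta> \<gamma> (r + 1) - entry \<theta> \<gamma> r) * G r)"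
  using assms(2)
proof (induction B rule: int_ge_induct)
  case (step B)
  let ?t = "entry \<theta> \<gamma>"
  have t: "?t A \<le> ?t B" "?t B \<le> ?t (B + 1)" using step.hyps assms(1) by (auto intro: entry_mono)
  have "{?t A..<?t (B + 1)} = {?t A..<?t B} \<union> {?t B..<?t (B + 1)}" using t by auto
  then have "(\<Sum>i\<in>{?t A..<?t (B + 1)}. G \<lfloor>\<theta> * of_int i + \<gamma>\<rfloor>) =
     (\<Sum>i\<in>{?t A..<?t B}. G \<lfloor>\<theta> * of_int i + \<gamma>\<rfloor>) + (\<Sum>i\<in>{?t B..<?t (B + 1)}. G \<lfloor>\<theta> * of_int i + \<gamma>\<rfloor>)"
    by (simp only:) (rule sum.union_disjoint, auto)
  also have "(\<Sum>i\<in>{?t B..<?t (B + 1)}. G \<lfloor>\<theta> * of_int i + \<gamma>\<rfloor>) = (\<Sum>i\<in>{?t B..<?t (B + 1)}. G B)"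
  proof (rule sum.cong)
    fix i assume "i \<in> {?t B..<?t (B + 1)}"
    then have "\<lfloor>\<theta> * of_int i + \<gamma>\<rfloor> = B" using floor_eq_iff_entry[OF assms(1)] by simp
    then show "G \<lfloor>\<theta> * of_int i + \<gamma>\<rfloor> = G B" by simp
  qed simp
  also have "\<dots> = of_int (?t (B + 1) - ?t B) * G B" using t by simp
  finally have 1: "(\<Sum>i\<in>{?t A..<?t (B + 1)}. G \<lfloor>\<theta> * of_int i + \<gamma>\<rfloor>) =
    (\<Sum>i\<in>{?t A..<?t B}. G \<lfloor>\<theta> * of_int i + \<gamma>\<rfloor>) + of_int (?t (B + 1) - ?t B) * G B" .
  have 2: "{A..<B + 1} = insert B {A..<B}" using step.hyps by auto
  show ?case unfolding 1 2 using step.IH by simp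
qed simp

text \<open>The range \<open>{a..<b}\<close> differs from a union of full blocks by an incomplete
  block at each end, and a block has at most \<open>1 / \<theta> + 1\<close> elements.\<close>

lemma beatty_sum_rearrange:
  fixes G :: "nat \<Rightarrow> complex"
  assumes \<theta>: "\<theta> > 0" and G: "\<And>r. cmod (G r) \<le> C" and ab: "a \<le> b" and nn: "\<lfloor>\<theta> * real a + \<gamma>\<rfloor> \<ge> 0"
  shows "cmod ((\<Sum>n\<in>{a..<b}. G (nat \<lfloor>\<theta> * real n + \<gamma>\<rfloor>)) -
     (\<Sum>r\<in>{nat \<lfloor>\<theta> * real a + \<gamma>\<rfloor>..<nat \<lfloor>\<theta> * real b + \<gamma>\<rfloor>}.
        of_int (entry \<theta> \<gamma> (int r + 1) - entry \<theta> \<gamma> (int r)) * G r)) \<le> 2 * (C * (1 / \<theta> + 1))"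
proof -
  let ?t = "entry \<theta> \<gamma>"
  define A B where "A = \<lfloor>\<theta> * real a + \<gamma>\<rfloor>" and "B = \<lfloor>\<theta> * real b + \<gamma>\<rfloor>"
  have AB: "0 \<le> A" "A \<le> B" using \<theta> ab nn by (auto simp: A_def B_def intro!: floor_mono)
  have C: "C \<ge> 0" using G norm_ge_zero order_trans by blast
  have tA: "?t A \<le> int a" "int a < ?t (A + 1)" and tB: "?t B \<le> int b" "int b < ?t (B + 1)"
    using floor_eq_iff_entry[OF \<theta>, of "int a" \<gamma> A] floor_eq_iff_entry[OF \<theta>, of "int b" \<gamma> B]
    by (auto simp: A_def B_def)
  have tAB: "?t A \<le> ?t B" by (rule entry_mono[OF \<theta> AB(2)])
  let ?g = "\<lambda>i :: int. G (nat \<lfloor>\<theta> * of_int i + \<gamma>\<rfloor>)"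
  have split: "sum ?g {i..<k} = sum ?g {i..<j} + sum ?g {j..<k}" if "i \<le> j" "j \<le> k" for i j k
  proof -
    have "{i..<k} = {i..<j} \<union> {j..<k}" using that by auto
    then show ?thesis by (simp only:) (rule sum.union_disjoint, auto)
  qed
  have "(\<Sum>n\<in>{a..<b}. G (nat \<lfloor>\<theta> * real n + \<gamma>\<rfloor>)) = sum ?g {int a..<int b}"
    by (simp add: sum.reindex flip: image_int_atLeastLessThan)
  moreover have "(\<Sum>r\<in>{nat A..<nat B}. of_int (?t (int r + 1) - ?t (int r)) * G r) = sum ?g {?t A..<?t B}"
  proof -
    have "sum ?g {?t A..<?t B} = (\<Sum>r\<in>{A..<B}. of_int (?t (r + 1) - ?t r) * G (nat r))"
      by (rule sum_floor_entry[OF \<theta> AB(2), of "\<lambda>r. G (nat r)" \<gamma>])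
    also have "{A..<B} = int ` {nat A..<nat B}" using AB by (simp add: image_int_atLeastLessThan)
    finally show ?thesis by (simp add: sum.reindex)
  qed
  moreover have "sum ?g {?t A..<int a} + sum ?g {int a..<int b} = sum ?g {?t A..<?t B} + sum ?g {?t B..<int b}"
    using split[OF tA(1), of "int b"] split[OF tAB tB(1)] ab by simp
  ultimately have diff: "(\<Sum>n\<in>{a..<b}. G (nat \<lfloor>\<theta> * real n + \<gamma>\<rfloor>)) -
     (\<Sum>r\<in>{nat A..<nat B}. of_int (?t (int r + 1) - ?t (int r)) * G r) =
     sum ?g {?t B..<int b} - sum ?g {?t A..<int a}"
    by (simp add: algebra_simps)
  have edge: "cmod (sum ?g {?t R..<k}) \<le> C * (1 / \<theta> + 1)" if "?t R \<le> k" "k < ?t (R + 1)" for R k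
  proof -
    have "cmod (sum ?g {?t R..<k}) \<le> (\<Sum>i\<in>{?t R..<k}. C)" by (intro sum_norm_le G)
    also have "\<dots> = C * real_of_int (k - ?t R)" using that by simp
    also have "\<dots> \<le> C * (1 / \<theta> + 1)"
      using C entry_diff_le[OF \<theta>, of \<gamma> R] that by (intro mult_left_mono) (auto intro: order_trans[rotated])
    finally show ?thesis .
  qed
  have "cmod (sum ?g {?t B..<int b} - sum ?g {?t A..<int a}) \<le> C * (1 / \<theta> + 1) + C * (1 / \<theta> + 1)"
    by (intro order_trans[OF norm_triangle_ineq4] add_mono edge tA tB)
  then show ?thesis unfolding diff[symmetric] unfolding A_def B_def by simp
qed

section \<open>Averages with Beatty weights over long windows\<close>

context measure_preserving_system
begin

lemma trig_window_small:
  fixes v :: "nat \<Rightarrow> 'a \<Rightarrow> complex"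
  assumes v: "\<And>n. v n \<in> bmf"
    and tw: "\<And>(h :: int) \<epsilon>. of_int h / \<theta> \<notin> \<int> \<Longrightarrow> \<epsilon> > 0 \<Longrightarrow>
      \<exists>L. \<forall>a b. a + L \<le> b \<longrightarrow> L2n (\<lambda>x. avg [a..<b] (\<lambda>n. cis (2 * pi * (of_int h / \<theta>) * real n) * v n x)) \<le> \<epsilon>"
    and "trig p" "\<epsilon> > 0"
  shows "\<exists>L. \<forall>a b. a + L \<le> b \<longrightarrow>
    L2n (\<lambda>x. avg [a..<b] (\<lambda>r. (p ((\<gamma> - real (r + 1)) / \<theta>) - p ((\<gamma> - real r) / \<theta>)) * v r x)) \<le> \<epsilon>"
  using assms(3,4)
proof (induction arbitrary: \<epsilon> rule: trig.induct)
  case (wave c h)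
  \<comment> \<open>The difference of consecutive values of a wave is again a wave in
    \<open>r\<close>, with amplitude \<open>K\<close>. Its last factor vanishes when
    \<open>h / \<theta>\<close> is an integer, precisely the case that \<open>tw\<close> does not
    cover.\<close>
  define K where "K = c * cis (2 * pi * of_int h * (\<gamma> / \<theta>)) * (cis (- (2 * pi * (of_int h / \<theta>))) - 1)"
  have eq: "c * cis (2 * pi * of_int h * ((\<gamma> - real (r + 1)) / \<theta>)) - c * cis (2 * pi * of_int h * ((\<gamma> - real r) / \<theta>)) =
     K * cis (2 * pi * (of_int (- h) / \<theta>) * real r)" for r
  proof -
    have 1: "cis (2 * pi * of_int h * ((\<gamma> - real r) / \<theta>)) =
        cis (2 * pi * of_int h * (\<gamma> / \<theta>)) * cis (2 * pi * (of_int (- h) / \<theta>) * real r)"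
      unfolding cis_mult by (rule arg_cong[of _ _ cis]) (simp add: diff_divide_distrib algebra_simps)
    have 2: "cis (2 * pi * of_int h * ((\<gamma> - real (r + 1)) / \<theta>)) =
        cis (2 * pi * of_int h * ((\<gamma> - real r) / \<theta>)) * cis (- (2 * pi * (of_int h / \<theta>)))"
      unfolding cis_mult by (rule arg_cong[of _ _ cis]) (simp add: diff_divide_distrib add_divide_distrib algebra_simps)
    show ?thesis unfolding 2 unfolding 1 by (simp add: K_def algebra_simps)
  qed
  have eqL: "L2n (\<lambda>x. avg [a..<b] (\<lambda>r. (c * cis (2 * pi * of_int h * ((\<gamma> - real (r + 1)) / \<theta>)) - c * cis (2 * pi * of_int h * ((\<gamma> - real r) / \<theta>))) * v r x)) =
     cmod K * L2n (\<lambda>x. avg [a..<b] (\<lambda>n. cis (2 * pi * (of_int (- h) / \<theta>) * real n) * v n x))" for a b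
  proof -
    have "(\<lambda>x. avg [a..<b] (\<lambda>r. (K * cis (2 * pi * (of_int (- h) / \<theta>) * real r)) * v r x)) =
      (\<lambda>x. K * avg [a..<b] (\<lambda>r. cis (2 * pi * (of_int (- h) / \<theta>) * real r) * v r x))"
      by (simp only: avg_cmult[symmetric] mult.assoc)
    then show ?thesis unfolding eq by (simp only:) (intro L2n_cmult bmf_avg bmf_mult bmf_const v)
  qed
  show ?case
  proof (cases "of_int h / \<theta> \<in> \<int>")
    case True
    then have "cis (2 * pi * - (of_int h / \<theta>)) = 1" by (intro cis_multiple_2pi) simp
    then have "K = 0" by (simp add: K_def)
    then show ?thesis unfolding eqL using wave by simp
  next
    case False
    have e: "\<epsilon> / (cmod K + 1) > 0" using wave by (intro divide_pos_pos) (auto simp: add_nonneg_pos)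
    have "of_int (- h) / \<theta> \<notin> \<int>" using False by (simp add: minus_in_Ints_iff)
    from tw[OF this e] obtain L where L: "\<And>a b. a + L \<le> b \<Longrightarrow>
        L2n (\<lambda>x. avg [a..<b] (\<lambda>n. cis (2 * pi * (of_int (- h) / \<theta>) * real n) * v n x)) \<le> \<epsilon> / (cmod K + 1)" by blast
    have "cmod K * L2n (\<lambda>x. avg [a..<b] (\<lambda>n. cis (2 * pi * (of_int (- h) / \<theta>) * real n) * v n x)) \<le> \<epsilon>"
      if "a + L \<le> b" for a b
    proof -
      have "cmod K * L2n (\<lambda>x. avg [a..<b] (\<lambda>n. cis (2 * pi * (of_int (- h) / \<theta>) * real n) * v n x)) \<le>
        (cmod K + 1) * (\<epsilon> / (cmod K + 1))"
        using L[OF that] by (intro mult_mono) auto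
      also have "\<dots> = \<epsilon>" using norm_ge_zero[of K] by (simp add: add_nonneg_eq_0_iff)
      finally show ?thesis .
    qed
    then show ?thesis unfolding eqL by blast
  qed
next
  case (add p q)
  obtain L1 where L1: "\<And>a b. a + L1 \<le> b \<Longrightarrow>
    L2n (\<lambda>x. avg [a..<b] (\<lambda>r. (p ((\<gamma> - real (r + 1)) / \<theta>) - p ((\<gamma> - real r) / \<theta>)) * v r x)) \<le> \<epsilon> / 2"
    using add.IH(1)[of "\<epsilon> / 2"] add.prems by auto
  obtain L2 where L2: "\<And>a b. a + L2 \<le> b \<Longrightarrow>
    L2n (\<lambda>x. avg [a..<b] (\<lambda>r. (q ((\<gamma> - real (r + 1)) / \<theta>) - q ((\<gamma> - real r) / \<theta>)) * v r x)) \<le> \<epsilon> / 2"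
    using add.IH(2)[of "\<epsilon> / 2"] add.prems by auto
  have "L2n (\<lambda>x. avg [a..<b] (\<lambda>r. (p ((\<gamma> - real (r + 1)) / \<theta>) + q ((\<gamma> - real (r + 1)) / \<theta>) -
      (p ((\<gamma> - real r) / \<theta>) + q ((\<gamma> - real r) / \<theta>))) * v r x)) \<le> \<epsilon>" if ab: "a + max L1 L2 \<le> b" for a b
  proof -
    have "(\<lambda>x. avg [a..<b] (\<lambda>r. (p ((\<gamma> - real (r + 1)) / \<theta>) + q ((\<gamma> - real (r + 1)) / \<theta>) -
      (p ((\<gamma> - real r) / \<theta>) + q ((\<gamma> - real r) / \<theta>))) * v r x)) =
      (\<lambda>x. avg [a..<b] (\<lambda>r. (p ((\<gamma> - real (r + 1)) / \<theta>) - p ((\<gamma> - real r) / \<theta>)) * v r x) +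
        avg [a..<b] (\<lambda>r. (q ((\<gamma> - real (r + 1)) / \<theta>) - q ((\<gamma> - real r) / \<theta>)) * v r x))"
      unfolding avg_add[symmetric] by (simp add: algebra_simps)
    then have "L2n (\<lambda>x. avg [a..<b] (\<lambda>r. (p ((\<gamma> - real (r + 1)) / \<theta>) + q ((\<gamma> - real (r + 1)) / \<theta>) -
      (p ((\<gamma> - real r) / \<theta>) + q ((\<gamma> - real r) / \<theta>))) * v r x)) \<le>
      L2n (\<lambda>x. avg [a..<b] (\<lambda>r. (p ((\<gamma> - real (r + 1)) / \<theta>) - p ((\<gamma> - real r) / \<theta>)) * v r x)) +
      L2n (\<lambda>x. avg [a..<b] (\<lambda>r. (q ((\<gamma> - real (r + 1)) / \<theta>) - q ((\<gamma> - real r) / \<theta>)) * v r x))"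
      by (simp only:) (intro L2n_triangle bmf_avg bmf_mult bmf_const v)
    also have "\<dots> \<le> \<epsilon> / 2 + \<epsilon> / 2" using ab by (intro add_mono L1 L2) auto
    finally show ?thesis by simp
  qed
  then show ?case by blast
qed

text \<open>Replace each fractional part by a trigonometric polynomial: the error is at most
  \<open>e\<close> off the exceptional set and at most \<open>4\<close> on it, and that set is
  sparse by \<open>orbit_density\<close>.\<close>

lemma weight_window_small:
  fixes v :: "nat \<Rightarrow> 'a \<Rightarrow> complex"
  assumes v: "\<And>n. v n \<in> borel_measurable M" "\<And>n x. cmod (v n x) \<le> C" and \<theta>: "\<theta> > 0" and \<epsilon>: "\<epsilon> > 0"
    and tw: "\<And>(h :: int) \<epsilon>. of_int h / \<theta> \<notin> \<int> \<Longrightarrow> \<epsilon> > 0 \<Longrightarrow>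
      \<exists>L. \<forall>a b. a + L \<le> b \<longrightarrow> L2n (\<lambda>x. avg [a..<b] (\<lambda>n. cis (2 * pi * (of_int h / \<theta>) * real n) * v n x)) \<le> \<epsilon>"
  shows "\<exists>L. \<forall>a b. a + L \<le> b \<longrightarrow> L2n (\<lambda>x. avg [a..<b] (\<lambda>r.
     of_real (frac ((\<gamma> - real (r + 1)) / \<theta>) - frac ((\<gamma> - real r) / \<theta>)) * v r x)) \<le> \<epsilon>"
proof -
  have C: "C \<ge> 0" using v(2) norm_ge_zero order_trans by blast
  have vb: "v n \<in> bmf" for n using v by (rule bmfI)
  \<comment> \<open>The errors average to at most \<open>2 * e + 4 * e + 8 * e = 14 * e\<close>, and
    \<open>14 * e * C\<close> has to stay below \<open>\<epsilon> / 2\<close>.\<close>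
  define e where "e = min 1 (\<epsilon> / (28 * (C + 1)))"
  have e: "e > 0" "e \<le> 1" "14 * e * C \<le> \<epsilon> / 2"
  proof -
    show "e > 0" "e \<le> 1" using \<epsilon> C by (auto simp: e_def)
    have "14 * e * C \<le> 14 * (\<epsilon> / (28 * (C + 1))) * (C + 1)"
      using C \<epsilon> by (intro mult_mono) (auto simp: e_def)
    also have "\<dots> = \<epsilon> / 2" using C by (simp add: field_simps)
    finally show "14 * e * C \<le> \<epsilon> / 2" .
  qed
  define X where "X = (\<lambda>r :: nat. (\<gamma> - real r) / \<theta>)"
  have X: "X r = \<gamma> / \<theta> - real r * (1 / \<theta>)" for r by (simp add: X_def diff_divide_distrib)
  obtain \<eta> L1 where \<eta>: "0 < \<eta>" "\<eta> < 1/4" and L1: "\<And>a b. a + L1 \<le> b \<Longrightarrow>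
     real (card {r \<in> {a..<b :: nat}. frac (X r) \<ge> 1 - 2 * \<eta>}) \<le> e * real (b - a)"
    using orbit_density[OF e(1), of "\<gamma> / \<theta>" "1 / \<theta>"] unfolding X by blast
  obtain p where p: "trig p" "\<And>x. cmod (p x) \<le> 3" "\<And>x. frac x < 1 - 2 * \<eta> \<Longrightarrow> cmod (of_real (frac x) - p x) \<le> e"
    using frac_trig_approx[OF \<eta> e(1,2)] by blast
  obtain L2 where L2: "\<And>a b. a + L2 \<le> b \<Longrightarrow>
     L2n (\<lambda>x. avg [a..<b] (\<lambda>r. (p (X (r + 1)) - p (X r)) * v r x)) \<le> \<epsilon> / 2"
    using trig_window_small[OF vb tw p(1), of "\<epsilon> / 2" \<gamma>] \<epsilon> unfolding X_def by auto
  have L2n_eq: "L2n (\<lambda>x. avg [a..<b] (\<lambda>r. of_real (frac (X (r + 1)) - frac (X r)) * v r x)) \<le> \<epsilon>"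
    if ab: "a + max (max L1 L2) 1 \<le> b" for a b
  proof -
    let ?bad = "\<lambda>r. if frac (X r) \<ge> 1 - 2 * \<eta> then 1 else (0 :: real)"
    have err: "cmod (of_real (frac (X r)) - p (X r)) \<le> e + 4 * ?bad r" for r
    proof (cases "frac (X r) \<ge> 1 - 2 * \<eta>")
      case True
      have "cmod (of_real (frac (X r)) - p (X r)) \<le> 1 + 3"
        using frac_lt_1[of "X r"] frac_ge_0[of "X r"]
        by (intro order_trans[OF norm_triangle_ineq4] add_mono p(2)) (simp add: less_imp_le)
      then show ?thesis using True e by simp
    next
      case False
      then show ?thesis using p(3)[of "X r"] by simp
    qed
    have bad: "(\<Sum>r\<leftarrow>[a..<b]. ?bad r) \<le> e * real (b - a)" "(\<Sum>r\<leftarrow>[a..<b]. ?bad (r + 1)) \<le> 2 * e * real (b - a)"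
    proof -
      have cnt: "(\<Sum>r\<in>{a..<b}. ?bad r) = real (card {r \<in> {a..<b}. frac (X r) \<ge> 1 - 2 * \<eta>})" for a b
        by (simp add: sum.If_cases Int_def)
      show "(\<Sum>r\<leftarrow>[a..<b]. ?bad r) \<le> e * real (b - a)"
        using L1[of a b] ab unfolding interv_sum_list_conv_sum_set_nat set_upt cnt by simp
      \<comment> \<open>The shifted count runs over \<open>{Suc a..<Suc b}\<close>; enlarging the
        window by one element at most doubles its length.\<close>
      have "(\<Sum>r\<in>{a..<b}. ?bad (r + 1)) = (\<Sum>r\<in>{Suc a..<Suc b}. ?bad r)"
        by (subst sum.shift_bounds_Suc_ivl) simp
      also have "\<dots> \<le> (\<Sum>r\<in>{a..<Suc b}. ?bad r)" by (intro sum_mono2) auto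
      also have "\<dots> \<le> e * real (Suc b - a)" unfolding cnt using ab by (intro L1) simp
      also have "\<dots> \<le> e * (2 * real (b - a))" using e ab by (intro mult_left_mono) auto
      finally show "(\<Sum>r\<leftarrow>[a..<b]. ?bad (r + 1)) \<le> 2 * e * real (b - a)"
        unfolding interv_sum_list_conv_sum_set_nat set_upt by (simp add: mult_ac)
    qed
    let ?D = "\<lambda>r. of_real (frac (X (r + 1)) - frac (X r)) - (p (X (r + 1)) - p (X r))"
    have pos: "real (b - a) > 0" using ab by simp
    have "cmod (avg [a..<b] (\<lambda>r. ?D r * v r x)) \<le> \<epsilon> / 2" for x
    proof -
      have "cmod (avg [a..<b] (\<lambda>r. ?D r * v r x)) \<le> avg [a..<b] (\<lambda>r. cmod (?D r * v r x))"
        by (rule norm_avg_le_avg)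
      also have "\<dots> \<le> avg [a..<b] (\<lambda>r. (2 * e + 4 * ?bad r + 4 * ?bad (r + 1)) * C)"
      proof (rule avg_mono)
        fix r
        have "?D r = (of_real (frac (X (r + 1))) - p (X (r + 1))) - (of_real (frac (X r)) - p (X r))" by simp
        also have "cmod \<dots> \<le> (e + 4 * ?bad (r + 1)) + (e + 4 * ?bad r)"
          by (intro order_trans[OF norm_triangle_ineq4] add_mono err)
        finally have d: "cmod (?D r) \<le> 2 * e + 4 * ?bad r + 4 * ?bad (r + 1)" by simp
        show "cmod (?D r * v r x) \<le> (2 * e + 4 * ?bad r + 4 * ?bad (r + 1)) * C"
          unfolding norm_mult using order_trans[OF norm_ge_zero d] by (intro mult_mono v(2) d norm_ge_zero)
      qed
      also have "\<dots> = (2 * e + 4 * ((\<Sum>r\<leftarrow>[a..<b]. ?bad r) / real (b - a)) + 4 * ((\<Sum>r\<leftarrow>[a..<b]. ?bad (r + 1)) / real (b - a))) * C"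
        using pos by (simp add: avg_multc avg_add avg_cmult) (simp add: avg_def)
      also have "\<dots> \<le> (2 * e + 4 * e + 4 * (2 * e)) * C"
        using bad pos C by (intro mult_right_mono add_mono mult_left_mono) (auto simp: divide_le_eq)
      also have "\<dots> \<le> \<epsilon> / 2" using e(3) by simp
      finally show ?thesis .
    qed
    then have "L2n (\<lambda>x. avg [a..<b] (\<lambda>r. ?D r * v r x)) \<le> \<epsilon> / 2"
      by (intro L2n_bound bmf_measurable bmf_avg bmf_mult bmf_const vb)
    moreover have "L2n (\<lambda>x. avg [a..<b] (\<lambda>r. (p (X (r + 1)) - p (X r)) * v r x)) \<le> \<epsilon> / 2"
      using ab by (intro L2) simp
    moreover have "(\<lambda>x. avg [a..<b] (\<lambda>r. of_real (frac (X (r + 1)) - frac (X r)) * v r x)) =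
      (\<lambda>x. avg [a..<b] (\<lambda>r. ?D r * v r x) + avg [a..<b] (\<lambda>r. (p (X (r + 1)) - p (X r)) * v r x))"
      unfolding avg_add[symmetric] distrib_right[symmetric] by simp
    moreover have "L2n (\<lambda>x. avg [a..<b] (\<lambda>r. ?D r * v r x) + avg [a..<b] (\<lambda>r. (p (X (r + 1)) - p (X r)) * v r x)) \<le>
      L2n (\<lambda>x. avg [a..<b] (\<lambda>r. ?D r * v r x)) + L2n (\<lambda>x. avg [a..<b] (\<lambda>r. (p (X (r + 1)) - p (X r)) * v r x))"
      by (intro L2n_triangle bmf_avg bmf_mult bmf_const vb)
    ultimately show ?thesis by simp
  qed
  show ?thesis using L2n_eq unfolding X_def by blast
qed

lemma bmf_sum: "(\<And>i. i \<in> I \<Longrightarrow> F i \<in> bmf) \<Longrightarrow> (\<lambda>x. \<Sum>i\<in>I. F i x) \<in> bmf"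
  by (induction I rule: infinite_finite_induct) (auto intro: bmf_const bmf_add)

text \<open>With \<open>q\<close> the number of values \<open>r\<close> and \<open>l\<close> the
  divisor \<open>N - m\<close>, \<open>S / l - g\<close> splits into the regrouping error
  \<open>(S - P) / l\<close>, the small function \<open>(q / l) D\<close>, and the error from
  \<open>q / \<theta>\<close> differing from \<open>l\<close>. Indices below \<open>n1\<close>,
  where the floor may be negative, are only bounded.\<close>

lemma beatty_window:
  fixes u v :: "nat \<Rightarrow> 'a \<Rightarrow> complex"
  assumes \<theta>: "\<theta> > 0" and v: "\<And>n. v n \<in> bmf" "\<And>n x. cmod (v n x) \<le> C"
    and u: "\<And>n. u n \<in> bmf" "\<And>n x. cmod (u n x) \<le> C"
    and uv: "\<And>n x. \<lfloor>\<theta> * real n + \<gamma>\<rfloor> \<ge> 0 \<Longrightarrow> u n x = v (nat \<lfloor>\<theta> * real n + \<gamma>\<rfloor>) x"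
    and g: "g \<in> bmf" "\<And>x. cmod (g x) \<le> C"
    and n1: "\<And>n. n \<ge> n1 \<Longrightarrow> \<lfloor>\<theta> * real n + \<gamma>\<rfloor> \<ge> 0"
    and mN: "m + n1 < N" and \<epsilon>: "\<epsilon> \<ge> 0"
    and A: "A = nat \<lfloor>\<theta> * real (max m n1) + \<gamma>\<rfloor>" and B: "B = nat \<lfloor>\<theta> * real (Suc N) + \<gamma>\<rfloor>"
    and lim: "L2n (\<lambda>x. avg [A..<B] (\<lambda>n. v n x) - g x) \<le> \<epsilon>"
    and wt: "L2n (\<lambda>x. avg [A..<B] (\<lambda>r. of_real (frac ((\<gamma> - real (r + 1)) / \<theta>) - frac ((\<gamma> - real r) / \<theta>)) * v r x)) \<le> \<epsilon>"
  defines "K1 \<equiv> C * real n1 + 2 * (C * (1 / \<theta> + 1))" and "K2 \<equiv> 1 / \<theta> + 1 + real n1"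
  shows "L2n (\<lambda>x. (\<Sum>n=m..N. u n x) / of_real (real N - real m) - g x) \<le>
     (K1 + C * K2) / (real N - real m) + (1 + K2) * (1 + \<theta>) * \<epsilon>"
proof -
  have C: "C \<ge> 0" using v(2) norm_ge_zero order_trans by blast
  define a where "a = max m n1"
  define l where "l = real N - real m"
  have a: "m \<le> a" "n1 \<le> a" "a \<le> N" "a - m \<le> n1" using mN by (auto simp: a_def)
  have l: "l \<ge> 1" using mN by (simp add: l_def)
  define q where "q = real B - real A"
  have nn: "\<lfloor>\<theta> * real n + \<gamma>\<rfloor> \<ge> 0" if "a \<le> n" for n using n1[of n] that a by simp
  have AB: "A \<le> B" using \<theta> a unfolding A B a_def[symmetric] by (intro nat_mono floor_mono) simp
  have q0: "q \<ge> 0" using AB by (simp add: q_def)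
  have q: "\<bar>q / \<theta> - l\<bar> \<le> K2"
  proof -
    have "real A = of_int \<lfloor>\<theta> * real a + \<gamma>\<rfloor>" "real B = of_int \<lfloor>\<theta> * real (Suc N) + \<gamma>\<rfloor>"
      using nn[of a] nn[of "Suc N"] a by (auto simp: A B a_def)
    then have "\<bar>q - \<theta> * (real (Suc N) - real a)\<bar> \<le> 1"
      unfolding q_def abs_le_iff right_diff_distrib by linarith
    then have "\<bar>q - \<theta> * (real (Suc N) - real a)\<bar> / \<theta> \<le> 1 / \<theta>"
      using \<theta> by (intro divide_right_mono) auto
    moreover have "\<bar>q - \<theta> * (real (Suc N) - real a)\<bar> / \<theta> = \<bar>q / \<theta> - (real (Suc N) - real a)\<bar>"
    proof -
      have "q / \<theta> - (real (Suc N) - real a) = (q - \<theta> * (real (Suc N) - real a)) / \<theta>"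
        using \<theta> by (simp add: diff_divide_distrib)
      then show ?thesis using \<theta> by (simp add: abs_divide)
    qed
    moreover have "real a - real m \<le> real n1" "real a \<ge> real m" using a by linarith+
    ultimately show ?thesis unfolding K2_def l_def by (simp add: abs_le_iff)
  qed
  let ?w = "\<lambda>r :: nat. frac ((\<gamma> - real (r + 1)) / \<theta>) - frac ((\<gamma> - real r) / \<theta>)"
  define P where "P = (\<lambda>x. \<Sum>r\<in>{A..<B}. of_int (entry \<theta> \<gamma> (int r + 1) - entry \<theta> \<gamma> (int r)) * v r x)"
  define S where "S = (\<lambda>x. \<Sum>n=m..N. u n x)"
  have Sb: "S \<in> bmf" "P \<in> bmf" unfolding S_def P_def by (intro bmf_sum bmf_mult bmf_const u v)+
  have SP: "cmod (S x - P x) \<le> K1" for x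
  proof -
    have "{m..N} = {m..<a} \<union> {a..<Suc N}" using a by auto
    then have "S x = (\<Sum>n\<in>{m..<a}. u n x) + (\<Sum>n\<in>{a..<Suc N}. u n x)"
      unfolding S_def by (simp only:) (rule sum.union_disjoint, auto)
    also have "(\<Sum>n\<in>{a..<Suc N}. u n x) = (\<Sum>n\<in>{a..<Suc N}. v (nat \<lfloor>\<theta> * real n + \<gamma>\<rfloor>) x)"
      by (intro sum.cong uv nn) auto
    finally have "S x - P x = (\<Sum>n\<in>{m..<a}. u n x) + ((\<Sum>n\<in>{a..<Suc N}. v (nat \<lfloor>\<theta> * real n + \<gamma>\<rfloor>) x) - P x)"
      by simp
    moreover have "cmod (\<Sum>n\<in>{m..<a}. u n x) \<le> C * real n1"
    proof -
      have "cmod (\<Sum>n\<in>{m..<a}. u n x) \<le> (\<Sum>n\<in>{m..<a}. C)" by (intro sum_norm_le u)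
      also have "\<dots> = C * real (a - m)" by simp
      also have "\<dots> \<le> C * real n1" using C a by (intro mult_left_mono) auto
      finally show ?thesis .
    qed
    moreover have "cmod ((\<Sum>n\<in>{a..<Suc N}. v (nat \<lfloor>\<theta> * real n + \<gamma>\<rfloor>) x) - P x) \<le> 2 * (C * (1 / \<theta> + 1))"
      unfolding P_def A B a_def[symmetric] using a by (intro beatty_sum_rearrange \<theta> v(2) nn) auto
    ultimately show ?thesis unfolding K1_def by (metis norm_triangle_le add_mono)
  qed
  define D where "D = (\<lambda>x. of_real (1 / \<theta>) * (avg [A..<B] (\<lambda>n. v n x) - g x) + avg [A..<B] (\<lambda>r. of_real (?w r) * v r x))"
  have Db: "D \<in> bmf" unfolding D_def by (intro bmf_add bmf_diff bmf_mult bmf_const bmf_avg v g)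
  have PD: "P x = of_real q * D x + of_real (q / \<theta>) * g x" for x
  proof -
    have "P x = (\<Sum>r\<in>{A..<B}. of_real (1 / \<theta> + ?w r) * v r x)"
      unfolding P_def
    proof (rule sum.cong)
      fix r
      have "(of_int (entry \<theta> \<gamma> (int r + 1) - entry \<theta> \<gamma> (int r)) :: complex) =
          of_real (real_of_int (entry \<theta> \<gamma> (int r + 1) - entry \<theta> \<gamma> (int r)))" by simp
      also have "\<dots> = of_real (1 / \<theta> + ?w r)" unfolding entry_diff[OF \<theta>] by (simp add: add.commute)
      finally show "of_int (entry \<theta> \<gamma> (int r + 1) - entry \<theta> \<gamma> (int r)) * v r x = of_real (1 / \<theta> + ?w r) * v r x" by simp
    qed simp
    also have "\<dots> = (\<Sum>r\<leftarrow>[A..<B]. of_real (1 / \<theta>) * v r x + of_real (?w r) * v r x)"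
      by (simp add: interv_sum_list_conv_sum_set_nat distrib_right del: of_real_divide)
    also have "\<dots> = of_real q * avg [A..<B] (\<lambda>r. of_real (1 / \<theta>) * v r x + of_real (?w r) * v r x)"
      using AB by (cases "A = B") (auto simp: avg_def q_def of_nat_diff)
    also have "avg [A..<B] (\<lambda>r. of_real (1 / \<theta>) * v r x + of_real (?w r) * v r x) =
       D x + of_real (1 / \<theta>) * g x"
      unfolding avg_add avg_cmult D_def by (simp add: algebra_simps)
    finally show ?thesis by (simp add: algebra_simps)
  qed
  have "L2n D \<le> (1 / \<theta>) * \<epsilon> + \<epsilon>"
  proof -
    have "L2n D \<le> L2n (\<lambda>x. of_real (1 / \<theta>) * (avg [A..<B] (\<lambda>n. v n x) - g x)) + L2n (\<lambda>x. avg [A..<B] (\<lambda>r. of_real (?w r) * v r x))"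
      unfolding D_def by (intro L2n_triangle bmf_diff bmf_mult bmf_const bmf_avg v g)
    also have "L2n (\<lambda>x. of_real (1 / \<theta>) * (avg [A..<B] (\<lambda>n. v n x) - g x)) = cmod (of_real (1 / \<theta>)) * L2n (\<lambda>x. avg [A..<B] (\<lambda>n. v n x) - g x)"
      by (intro L2n_cmult bmf_diff bmf_avg v g)
    also have "\<dots> \<le> (1 / \<theta>) * \<epsilon>" using \<theta> lim by (simp add: norm_divide divide_right_mono)
    finally show ?thesis using wt by simp
  qed
  then have "(q / l) * L2n D \<le> ((1 + K2) * \<theta>) * ((1 / \<theta>) * \<epsilon> + \<epsilon>)"
  proof (intro mult_mono)
    have "K2 \<ge> 0" using \<theta> by (simp add: K2_def)
    have "q \<le> (l + K2) * \<theta>" using q \<theta> by (simp add: abs_le_iff divide_le_eq algebra_simps)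
    also have "\<dots> \<le> ((1 + K2) * l) * \<theta>"
      using \<theta> l \<open>K2 \<ge> 0\<close> mult_left_mono[OF l \<open>K2 \<ge> 0\<close>] by (intro mult_right_mono) (auto simp: distrib_right)
    finally show "q / l \<le> (1 + K2) * \<theta>" using l by (simp add: divide_le_eq mult_ac)
    show "0 \<le> (1 + K2) * \<theta>" using \<open>K2 \<ge> 0\<close> \<theta> by simp
  qed auto
  moreover have "((1 + K2) * \<theta>) * ((1 / \<theta>) * \<epsilon> + \<epsilon>) = (1 + K2) * (1 + \<theta>) * \<epsilon>"
    using \<theta> by (simp add: field_simps)
  moreover have "cmod (of_real (q / l)) = q / l" unfolding norm_of_real using q0 l by simp
  ultimately have 2: "L2n (\<lambda>x. of_real (q / l) * D x) \<le> (1 + K2) * (1 + \<theta>) * \<epsilon>"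
    unfolding L2n_cmult[OF Db] by (simp only:)
  have 1: "L2n (\<lambda>x. (S x - P x) / of_real l) \<le> K1 / l"
  proof (rule L2n_bound)
    show "(\<lambda>x. (S x - P x) / of_real l) \<in> borel_measurable M"
      using bmf_measurable[OF Sb(1)] bmf_measurable[OF Sb(2)] by measurable
    show "cmod ((S x - P x) / of_real l) \<le> K1 / l" for x
      using SP[of x] l by (simp add: norm_divide divide_right_mono)
  qed
  have 3: "L2n (\<lambda>x. of_real ((q / \<theta> - l) / l) * g x) \<le> C * K2 / l"
  proof -
    have "L2n (\<lambda>x. of_real ((q / \<theta> - l) / l) * g x) = cmod (of_real ((q / \<theta> - l) / l)) * L2n g"
      by (intro L2n_cmult g)
    also have "cmod (of_real ((q / \<theta> - l) / l)) = \<bar>q / \<theta> - l\<bar> / l"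
      unfolding norm_of_real using l by simp
    also have "\<bar>q / \<theta> - l\<bar> / l * L2n g \<le> K2 / l * C"
      using q l by (intro mult_mono L2n_bound bmf_measurable g divide_right_mono) (auto simp: K2_def \<theta> less_imp_le)
    finally show ?thesis by (simp add: mult_ac)
  qed
  have b1: "(\<lambda>x. (S x - P x) / of_real l) \<in> bmf"
    unfolding divide_inverse by (intro bmf_mult bmf_diff bmf_const Sb)
  have eq: "S x / of_real l - g x = ((S x - P x) / of_real l + of_real (q / l) * D x) + of_real ((q / \<theta> - l) / l) * g x" for x
  proof -
    have "of_real l \<noteq> (0 :: complex)" using l by simp
    then show ?thesis unfolding PD by (simp add: field_simps)
  qed
  have "L2n (\<lambda>x. S x / of_real l - g x) \<le> L2n (\<lambda>x. (S x - P x) / of_real l + of_real (q / l) * D x) + L2n (\<lambda>x. of_real ((q / \<theta> - l) / l) * g x)"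
    unfolding eq by (intro L2n_triangle bmf_add bmf_mult bmf_const b1 Db g)
  also have "L2n (\<lambda>x. (S x - P x) / of_real l + of_real (q / l) * D x) \<le> L2n (\<lambda>x. (S x - P x) / of_real l) + L2n (\<lambda>x. of_real (q / l) * D x)"
    by (intro L2n_triangle bmf_add bmf_mult bmf_const b1 Db)
  finally have "L2n (\<lambda>x. S x / of_real l - g x) \<le> (K1 / l + (1 + K2) * (1 + \<theta>) * \<epsilon>) + C * K2 / l"
    using 1 2 3 by linarith
  then show ?thesis by (simp add: S_def l_def add_divide_distrib algebra_simps)
qed

lemma beatty_limit:
  fixes u v :: "nat \<Rightarrow> 'a \<Rightarrow> complex"
  assumes \<theta>: "\<theta> > 0" and v: "\<And>n. v n \<in> borel_measurable M" "\<And>n x. cmod (v n x) \<le> C"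
    and u: "\<And>n. u n \<in> borel_measurable M" "\<And>n x. cmod (u n x) \<le> C"
    and uv: "\<And>n x. \<lfloor>\<theta> * real n + \<gamma>\<rfloor> \<ge> 0 \<Longrightarrow> u n x = v (nat \<lfloor>\<theta> * real n + \<gamma>\<rfloor>) x"
    and g: "g \<in> borel_measurable M" "\<And>x. cmod (g x) \<le> C"
    and lim: "\<And>\<epsilon>. \<epsilon> > 0 \<Longrightarrow> \<exists>L. \<forall>a b. a + L \<le> b \<longrightarrow> L2n (\<lambda>x. avg [a..<b] (\<lambda>n. v n x) - g x) \<le> \<epsilon>"
    and tw: "\<And>(h :: int) \<epsilon>. of_int h / \<theta> \<notin> \<int> \<Longrightarrow> \<epsilon> > 0 \<Longrightarrow>
      \<exists>L. \<forall>a b. a + L \<le> b \<longrightarrow> L2n (\<lambda>x. avg [a..<b] (\<lambda>n. cis (2 * pi * (of_int h / \<theta>) * real n) * v n x)) \<le> \<epsilon>"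
    and \<epsilon>: "\<epsilon> > 0"
  shows "\<exists>L. \<forall>m N. m + L \<le> N \<longrightarrow> L2n (\<lambda>x. (\<Sum>n=m..N. u n x) / of_real (real N - real m) - g x) \<le> \<epsilon>"
proof -
  have C: "C \<ge> 0" using v(2) norm_ge_zero order_trans by blast
  define n1 where "n1 = nat \<lceil>- \<gamma> / \<theta>\<rceil>"
  define K1 where "K1 = C * real n1 + 2 * (C * (1 / \<theta> + 1))"
  define K2 where "K2 = 1 / \<theta> + 1 + real n1"
  have K: "K1 \<ge> 0" "K2 \<ge> 0" using C \<theta> by (auto simp: K1_def K2_def)
  have n1: "\<lfloor>\<theta> * real n + \<gamma>\<rfloor> \<ge> 0" if "n \<ge> n1" for n
  proof -
    have "- \<gamma> / \<theta> \<le> real n" using that unfolding n1_def by linarith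
    then have "- \<gamma> \<le> real n * \<theta>" using \<theta> by (subst (asm) pos_divide_le_eq)
    then show ?thesis by (simp add: mult.commute)
  qed
  define d where "d = \<epsilon> / (2 * ((1 + K2) * (1 + \<theta>)))"
  have pos: "(1 + K2) * (1 + \<theta>) > 0" using K \<theta> by (intro mult_pos_pos) auto
  then have d: "d > 0" using \<epsilon> unfolding d_def by (intro divide_pos_pos) auto
  have d2: "(1 + K2) * (1 + \<theta>) * d = \<epsilon> / 2"
  proof -
    have "z * (\<epsilon> / (2 * z)) = \<epsilon> / 2" if "z > 0" for z :: real using that by simp
    from this[OF pos] show ?thesis by (simp add: d_def)
  qed
  obtain L1 where L1: "\<And>a b. a + L1 \<le> b \<Longrightarrow> L2n (\<lambda>x. avg [a..<b] (\<lambda>n. v n x) - g x) \<le> d"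
    using lim[OF d] by blast
  obtain L2 where L2: "\<And>a b. a + L2 \<le> b \<Longrightarrow> L2n (\<lambda>x. avg [a..<b] (\<lambda>r.
     of_real (frac ((\<gamma> - real (r + 1)) / \<theta>) - frac ((\<gamma> - real r) / \<theta>)) * v r x)) \<le> d"
    using weight_window_small[OF v \<theta> d tw, of \<gamma>] by blast
  \<comment> \<open>The summands, in this order, push the boundary terms below
    \<open>\<epsilon> / 2\<close>, carry the window beyond the initial \<open>n1\<close> indices,
    and make the range of values \<open>r\<close> long enough for \<open>L1\<close> and
    \<open>L2\<close>.\<close>
  define L where "L = nat \<lceil>2 * (K1 + C * K2) / \<epsilon>\<rceil> + n1 + 1 + nat \<lceil>(real (max L1 L2) + 1) / \<theta>\<rceil>"
  have "L2n (\<lambda>x. (\<Sum>n=m..N. u n x) / of_real (real N - real m) - g x) \<le> \<epsilon>" if mN: "m + L \<le> N" for m N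
  proof -
    define A B where "A = nat \<lfloor>\<theta> * real (max m n1) + \<gamma>\<rfloor>" and "B = nat \<lfloor>\<theta> * real (Suc N) + \<gamma>\<rfloor>"
    have N: "m + n1 < N" using mN by (simp add: L_def)
    have "A + max L1 L2 \<le> B"
    proof -
      have "(real (max L1 L2) + 1) / \<theta> \<le> real (nat \<lceil>(real (max L1 L2) + 1) / \<theta>\<rceil>)" by linarith
      also have "\<dots> \<le> real (Suc N) - real (max m n1)" using mN unfolding L_def by linarith
      finally have "real (max L1 L2) + 1 \<le> \<theta> * real (Suc N) - \<theta> * real (max m n1)"
        using \<theta> by (simp add: divide_le_eq right_diff_distrib mult.commute del: of_nat_Suc)
      then have "\<lfloor>\<theta> * real (max m n1) + \<gamma>\<rfloor> + int (max L1 L2) \<le> \<lfloor>\<theta> * real (Suc N) + \<gamma>\<rfloor>"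
        by linarith
      moreover have "\<lfloor>\<theta> * real (max m n1) + \<gamma>\<rfloor> \<ge> 0" by (rule n1) simp
      ultimately show ?thesis unfolding A_def B_def by linarith
    qed
    then have L12: "A + L1 \<le> B" "A + L2 \<le> B" by auto
    have "L2n (\<lambda>x. (\<Sum>n=m..N. u n x) / of_real (real N - real m) - g x) \<le>
       (K1 + C * K2) / (real N - real m) + (1 + K2) * (1 + \<theta>) * d"
      unfolding K1_def K2_def
      by (rule beatty_window[OF \<theta> bmfI[OF v] v(2) bmfI[OF u] u(2) uv bmfI[OF g] g(2) n1 N less_imp_le[OF d]
        A_def B_def L1[OF L12(1)] L2[OF L12(2)]])
    also have "(K1 + C * K2) / (real N - real m) \<le> \<epsilon> / 2"
    proof -
      have "2 * (K1 + C * K2) / \<epsilon> \<le> real N - real m" using mN unfolding L_def by linarith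
      then have "2 * (K1 + C * K2) \<le> \<epsilon> * (real N - real m)" using \<epsilon> by (simp add: divide_le_eq mult.commute)
      moreover have "real N - real m > 0" using N by simp
      ultimately show ?thesis by (simp add: divide_le_eq)
    qed
    finally show ?thesis unfolding d2 by simp
  qed
  then show ?thesis by blast
qed

section \<open>Choice of representatives, negative iterates, and the two limits\<close>

lemma funpow_system: "measure_preserving_system M (T ^^ n)"
proof -
  have "distr M M (T ^^ n) = M"
  proof (induction n)
    case 0
    show ?case by (simp add: id_def distr_id2)
  next
    case (Suc n)
    have "distr M M (T ^^ Suc n) = distr (distr M M (T ^^ n)) M T"
      by (simp add: distr_distr measurable_T measurable_funpow)
    then show ?case by (simp only: Suc preserves)
  qed
  then show ?thesis by unfold_locales (rule measurable_funpow)
qed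

lemma AE_compose:
  assumes "AE x in M. P x"
  shows "AE x in M. P (T x)"
  using AE_distrD[OF measurable_T, of P] assms unfolding preserves by blast

lemma inverse_system:
  assumes "invertible_system M T"
  shows "measure_preserving_system M (the_inv_into (space M) T)"
proof
  let ?S = "the_inv_into (space M) T"
  have inv: "bij_betw T (space M) (space M)" and S: "?S \<in> measurable M M"
    using assms by (auto simp: invertible_system_def)
  show "?S \<in> measurable M M" by (rule S)
  have "distr M M ?S = distr (distr M M T) M ?S" by (simp add: preserves)
  also have "\<dots> = distr M M (?S \<circ> T)" by (rule distr_distr[OF S measurable_T])
  also have "\<dots> = distr M M (\<lambda>x. x)"
    using the_inv_into_f_f[OF bij_betw_imp_inj_on[OF inv]] by (intro distr_cong) auto
  finally show "distr M M ?S = M" by (simp add: distr_id2)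
qed

text \<open>Null sets can thus be pulled back along negative powers too, so in every term the
  functions may be replaced by versions bounded everywhere.\<close>

lemma iterate_system:
  assumes "r \<ge> 0 \<or> invertible_system M T"
  shows "measure_preserving_system M (iterate M T r)"
  using assms funpow_system measure_preserving_system.funpow_system[OF inverse_system]
  by (auto simp: iterate_def)

lemma Linf_bounded_version:
  assumes "f \<in> Linf_space M"
  shows "\<exists>g\<in>bmf. AE x in M. f x = g x"
proof -
  obtain C where f: "f \<in> borel_measurable M" and C: "AE x in M. cmod (f x) \<le> C"
    using assms by (auto simp: Linf_space_def)
  note [measurable] = f
  let ?g = "\<lambda>x. if cmod (f x) \<le> C then f x else 0"
  have "?g \<in> borel_measurable M" by measurable
  moreover have "cmod (?g x) \<le> max C 0" for x by auto
  ultimately have "?g \<in> bmf" by (rule bmfI)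
  then show ?thesis by (rule bexI[rotated]) (use C in auto)
qed

lemma product_term_measurable:
  assumes "\<And>j. j \<in> {1..k} \<Longrightarrow> f j \<in> borel_measurable M"
  shows "product_term M T k f r \<in> borel_measurable M"
proof (cases "r \<ge> 0 \<or> invertible_system M T")
  case True
  have "(\<lambda>x. f j (iterate M T (int j * r) x)) \<in> borel_measurable M" if "j \<in> {1..k}" for j
  proof -
    have "int j * r \<ge> 0 \<or> invertible_system M T" using True by auto
    from measure_preserving_system.measurable_T[OF iterate_system[OF this]]
    show ?thesis using assms[OF that] by (rule measurable_compose)
  qed
  then have "(\<lambda>x. \<Prod>j=1..k. f j (iterate M T (int j * r) x)) \<in> borel_measurable M"
    by (rule borel_measurable_prod)
  then show ?thesis using True by (simp add: product_term_def[abs_def])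
next
  case False
  then show ?thesis by (simp add: product_term_def[abs_def])
qed

lemma product_term_AE:
  assumes "\<And>j. j \<in> {1..k} \<Longrightarrow> AE x in M. f j x = g j x"
  shows "AE x in M. product_term M T k f r x = product_term M T k g r x"
proof (cases "r \<ge> 0 \<or> invertible_system M T")
  case True
  have "AE x in M. f j (iterate M T (int j * r) x) = g j (iterate M T (int j * r) x)" if "j \<in> {1..k}" for j
  proof -
    have "int j * r \<ge> 0 \<or> invertible_system M T" using True by auto
    from measure_preserving_system.AE_compose[OF iterate_system[OF this] assms[OF that]]
    show ?thesis .
  qed
  then have "AE x in M. \<forall>j\<in>{1..k}. f j (iterate M T (int j * r) x) = g j (iterate M T (int j * r) x)"
    by (intro AE_finite_allI) auto
  then show ?thesis
  proof (rule eventually_mono)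
    fix x assume "\<forall>j\<in>{1..k}. f j (iterate M T (int j * r) x) = g j (iterate M T (int j * r) x)"
    then show "product_term M T k f r x = product_term M T k g r x"
      unfolding product_term_def by (intro if_cong prod.cong) auto
  qed
next
  case False
  then show ?thesis by (simp add: product_term_def)
qed

lemma product_term_nonneg:
  assumes "r \<ge> 0"
  shows "product_term M T k f r x = mprod k f (nat r) x"
proof -
  have "iterate M T (int j * r) = T ^^ (j * nat r)" for j
    using assms by (simp add: iterate_def nat_mult_distrib)
  then show ?thesis using assms by (simp add: product_term_def mprod_def)
qed

lemma L2_tendsto_AE:
  assumes w: "\<And>i. w i \<in> borel_measurable M" and wu: "\<And>i. AE x in M. w i x = u i x"
    and u: "\<And>i. u i \<in> bmf" and g: "g \<in> bmf"
    and lim: "\<And>\<epsilon>. \<epsilon> > 0 \<Longrightarrow> \<forall>\<^sub>F i in F. L2n (\<lambda>x. u i x - g x) \<le> \<epsilon>"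
  shows "L2_tendsto M w g F"
proof -
  note [measurable] = w bmf_measurable[OF u] bmf_measurable[OF g]
  have "w i \<in> L2_space M" for i
  proof -
    have "integrable M (\<lambda>x. (cmod (w i x))\<^sup>2) \<longleftrightarrow> integrable M (\<lambda>x. (cmod (u i x))\<^sup>2)"
      using wu[of i] by (intro integrable_cong_AE) auto
    then show ?thesis using integrable_cmod_power2[OF u] w by (simp add: L2_space_def)
  qed
  moreover have "g \<in> L2_space M"
    using integrable_cmod_power2[OF g] bmf_measurable[OF g] by (simp add: L2_space_def)
  moreover have "L2_dist M (w i) g = L2n (\<lambda>x. u i x - g x)" for i
    unfolding L2_dist_def L2n_def using wu[of i] by (intro arg_cong[of _ _ sqrt] integral_cong_AE) auto
  moreover have "((\<lambda>i. L2n (\<lambda>x. u i x - g x)) \<longlongrightarrow> 0) F"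
  proof (rule tendstoI)
    fix e :: real assume "e > 0"
    with lim[of "e / 2"] show "\<forall>\<^sub>F i in F. dist (L2n (\<lambda>x. u i x - g x)) 0 < e"
      by (auto elim!: eventually_mono)
  qed
  ultimately show ?thesis by (simp add: L2_tendsto_def)
qed

lemma window_filterI:
  assumes "\<forall>m N. m + L \<le> N \<longrightarrow> P (m, N)"
  shows "eventually P window_filter"
  unfolding window_filter_def eventually_filtercomap
proof (intro exI[of _ "\<lambda>x. x \<ge> real L"] conjI allI impI)
  fix p :: "nat \<times> nat" assume "real L \<le> (case p of (m, n) \<Rightarrow> real n - real m)"
  then show "P p" using assms by (cases p) auto
qed (rule eventually_ge_at_top)

lemma character_cis: "character (\<lambda>m :: int. cis (2 * pi * \<alpha> * of_int m))"
  by (simp add: character_def cis_mult distrib_left)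

text \<open>\<open>q\<close> satisfies the eigenvalue equation for \<open>- h / \<theta>\<close>
  modulo \<open>1\<close>, a non-zero element of the span of \<open>1 / \<theta>\<close>.\<close>

lemma eigenfunction_zero:
  assumes spec: "discrete_spectrum M T \<inter> circle_span {1 / \<theta>} = {0}" and h: "of_int h / \<theta> \<notin> \<int>"
    and q: "q \<in> bmf" "AE x in M. cis (2 * pi * (of_int h / \<theta>)) * q (T x) = q x"
  shows "AE x in M. q x = 0"
proof -
  define t where "t = frac (- (of_int h / \<theta>))"
  have "t = frac (of_int (- h) * (1 / \<theta>))" by (simp add: t_def)
  then have "t \<in> circle_span {1 / \<theta>}" unfolding circle_span_singleton by blast
  moreover have "t \<noteq> 0" using h by (simp add: t_def frac_eq_0_iff minus_in_Ints_iff)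
  ultimately have t: "t \<notin> discrete_spectrum M T" using spec by blast
  have tc: "t \<in> carrier circle_group" by (simp add: t_def circle_group_def frac_lt_1)
  have cis: "cis (2 * pi * t) * cis (2 * pi * (of_int h / \<theta>)) = 1"
  proof -
    have "t + of_int h / \<theta> \<in> \<int>" by (simp add: t_def frac_def)
    then have "cis (2 * pi * (t + of_int h / \<theta>)) = 1" by (rule cis_multiple_2pi)
    then show ?thesis by (simp add: cis_mult distrib_left)
  qed
  have "q (T x) = cis (2 * pi * t) * q x" if "cis (2 * pi * (of_int h / \<theta>)) * q (T x) = q x" for x
    using cis by (simp add: that[symmetric] mult.assoc[symmetric])
  with q(2) have "AE x in M. q (T x) = cis (2 * pi * t) * q x" by auto
  moreover have "q \<in> L2_space M"
    using integrable_cmod_power2[OF q(1)] bmf_measurable[OF q(1)] by (simp add: L2_space_def)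
  ultimately show ?thesis using t tc unfolding discrete_spectrum_def by blast
qed

lemma mprod_bounded:
  assumes "\<And>j. j \<in> {1..k} \<Longrightarrow> f j \<in> bmf"
  shows "\<exists>C. \<forall>y. cmod (\<Prod>j=1..k. f j (y j)) \<le> C"
proof -
  obtain C where "\<forall>j\<in>{1..k}. \<forall>x. cmod (f j x) \<le> C j" using bmf_bdd[OF assms] by metis
  then have "cmod (\<Prod>j=1..k. f j (y j)) \<le> (\<Prod>j=1..k. C j)" for y
    unfolding prod_norm[symmetric] by (intro prod_mono) auto
  then show ?thesis by blast
qed

text \<open>The extra function \<open>1\<close> at position \<open>Suc k\<close> covers
  \<open>k = 0\<close>, whereas \<open>mprod_twisted_small\<close> asks for at least one
  function.\<close>

lemma mprod_twisted_window:
  assumes spec: "discrete_spectrum M T \<inter> circle_span {1 / \<theta>} = {0}" and h: "of_int h / \<theta> \<notin> \<int>"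
    and f: "\<And>j. f j \<in> bmf" "f (Suc k) = (\<lambda>_. 1)" and \<epsilon>: "\<epsilon> > 0"
  shows "\<exists>L. \<forall>a b. a + L \<le> b \<longrightarrow> L2n (\<lambda>x. avg [a..<b] (\<lambda>n. cis (2 * pi * (of_int h / \<theta>) * real n) * mprod k f n x)) \<le> \<epsilon>"
proof -
  let ?\<zeta> = "\<lambda>m :: int. cis (2 * pi * (of_int h / \<theta>) * of_int m)"
  have eq: "mprod (Suc k) f = mprod k f" by (intro HOL.ext) (simp add: mprod_def f(2))
  have small: "\<exists>V :: nat list. V \<noteq> [] \<and> L2n (\<lambda>x. avg V (\<lambda>w. ?\<zeta> (int w) * q ((T ^^ w) x))) \<le> e" if "q \<in> bmf" "e > 0" for q e
    using that eigenfunction_zero[OF spec h] by (intro no_eigenfunction_small character_cis) auto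
  obtain C where C: "\<And>y. cmod (\<Prod>j=1..k. f j (y j)) \<le> C" using mprod_bounded[of k f, OF f(1)] by blast
  have "\<exists>L. \<forall>a b. a + L \<le> b \<longrightarrow> L2n (\<lambda>x. avg [a..<b] (\<lambda>n. ?\<zeta> (int n) * mprod k f n x) - 0) \<le> \<epsilon>"
  proof (rule window_limit[OF _ _ bmf_const _ \<epsilon>])
    show "(\<lambda>x. ?\<zeta> (int n) * mprod k f n x) \<in> borel_measurable M" for n
      by (intro bmf_measurable bmf_mult bmf_const bmf_mprod f)
    show "cmod (?\<zeta> (int n) * mprod k f n x) \<le> C" for n x
      using C by (simp add: norm_mult mprod_def)
    show "\<exists>V. V \<noteq> [] \<and> (\<forall>m. L2n (\<lambda>x. avg V (\<lambda>w. ?\<zeta> (int (m + w)) * mprod k f (m + w) x) - 0) \<le> e)" if "e > 0" for e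
      using mprod_twisted_small[of "Suc k" ?\<zeta> f e, OF _ character_cis f(1) that small] by (simp add: eq)
  qed
  then show ?thesis by simp
qed

lemma beatty_limit_equationI:
  assumes \<theta>: "\<theta> > 0" and spec: "discrete_spectrum M T \<inter> circle_span {1 / \<theta>} = {0}"
    and f: "\<And>j. j \<in> {1..k} \<Longrightarrow> f j \<in> Linf_space M"
  shows "beatty_limit_equation M T \<theta> \<gamma> k f"
proof -
  have "\<exists>F. F \<in> bmf \<and> (j \<in> {1..k} \<longrightarrow> (AE x in M. f j x = F x)) \<and> (j = Suc k \<longrightarrow> F = (\<lambda>_. 1))" for j
    using Linf_bounded_version[OF f[of j]] bmf_const[of 1] by (cases "j \<in> {1..k}") auto
  then obtain F where F: "\<And>j. F j \<in> bmf" "\<And>j. j \<in> {1..k} \<Longrightarrow> AE x in M. f j x = F j x" "F (Suc k) = (\<lambda>_. 1)"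
    by metis
  have fm: "f j \<in> borel_measurable M" if "j \<in> {1..k}" for j using f[OF that] by (simp add: Linf_space_def)
  define v where "v = mprod k F"
  define u where "u = (\<lambda>n :: nat. product_term M T k F \<lfloor>\<theta> * real n + \<gamma>\<rfloor>)"
  obtain C where C: "\<And>y. cmod (\<Prod>j=1..k. F j (y j)) \<le> C" using mprod_bounded[of k F, OF F(1)] by blast
  have v: "v n \<in> borel_measurable M" "cmod (v n x) \<le> C" for n x
    using C by (auto simp: v_def mprod_def[abs_def] intro!: bmf_measurable bmf_prod bmf_funpow F)
  have u: "u n \<in> borel_measurable M" "cmod (u n x) \<le> C" for n x
  proof -
    show "u n \<in> borel_measurable M" unfolding u_def by (intro product_term_measurable bmf_measurable F)
    have "C \<ge> 0" using C norm_ge_zero order_trans by blast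
    then show "cmod (u n x) \<le> C" using C by (simp add: u_def product_term_def)
  qed
  have one: "character (\<lambda>_ :: int. 1)" by (simp add: character_def)
  \<comment> \<open>The common limit of both sides, built from the plain averages only;
    \<open>lim\<close> below extends it to all long windows.\<close>
  obtain g where g: "g \<in> borel_measurable M" "\<And>x. cmod (g x) \<le> C"
    and V: "\<And>\<epsilon>. \<epsilon> > 0 \<Longrightarrow> \<exists>V. V \<noteq> [] \<and> (\<forall>m. L2n (\<lambda>x. avg V (\<lambda>w. v (m + w) x) - g x) \<le> \<epsilon>)"
  proof -
    have "\<exists>V. V \<noteq> [] \<and> (\<forall>m. L2n (\<lambda>x. avg V (\<lambda>w. v (m + w) x) - avg V (\<lambda>w. v w x)) \<le> \<epsilon>)" if "\<epsilon> > 0" for \<epsilon>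
      using mprod_stable[of "\<lambda>_. 1" k F \<epsilon>, OF one F(1) that] by (simp add: v_def)
    from stable_limit[OF v this] show ?thesis using that by blast
  qed
  have gb: "g \<in> bmf" using g by (rule bmfI)
  have lim: "\<exists>L. \<forall>a b. a + L \<le> b \<longrightarrow> L2n (\<lambda>x. avg [a..<b] (\<lambda>n. v n x) - g x) \<le> \<epsilon>" if "\<epsilon> > 0" for \<epsilon>
    by (rule window_limit[OF v gb V that])
  have "L2_tendsto M (beatty_average M T \<theta> \<gamma> k f) g window_filter"
  proof (rule L2_tendsto_AE[where u = "\<lambda>p x. (\<Sum>n=fst p..snd p. u n x) / of_real (real (snd p) - real (fst p))"])
    show "beatty_average M T \<theta> \<gamma> k f p \<in> borel_measurable M" for p
      unfolding beatty_average_def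
      by (cases p) (simp, intro borel_measurable_divide borel_measurable_sum product_term_measurable fm borel_measurable_const)
    show "AE x in M. beatty_average M T \<theta> \<gamma> k f p x = (\<Sum>n=fst p..snd p. u n x) / of_real (real (snd p) - real (fst p))" for p
    proof -
      have "AE x in M. \<forall>n\<in>{fst p..snd p}. product_term M T k f \<lfloor>\<theta> * real n + \<gamma>\<rfloor> x = u n x"
        unfolding u_def by (intro AE_finite_allI product_term_AE F) auto
      then show ?thesis by (rule eventually_mono) (auto simp: beatty_average_def split: prod.splits)
    qed
    show "(\<lambda>x. (\<Sum>n=fst p..snd p. u n x) / of_real (real (snd p) - real (fst p))) \<in> bmf" for p
      unfolding divide_inverse by (intro bmf_mult bmf_sum bmf_const bmfI[OF u])
    show "g \<in> bmf" by (rule gb)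
    show "\<forall>\<^sub>F p in window_filter. L2n (\<lambda>x. (\<Sum>n=fst p..snd p. u n x) / of_real (real (snd p) - real (fst p)) - g x) \<le> \<epsilon>"
      if "\<epsilon> > 0" for \<epsilon>
    proof -
      have "\<exists>L. \<forall>m N. m + L \<le> N \<longrightarrow> L2n (\<lambda>x. (\<Sum>n=m..N. u n x) / of_real (real N - real m) - g x) \<le> \<epsilon>"
      proof (rule beatty_limit[OF \<theta> v u _ g lim _ that])
        show "u n x = v (nat \<lfloor>\<theta> * real n + \<gamma>\<rfloor>) x" if "\<lfloor>\<theta> * real n + \<gamma>\<rfloor> \<ge> 0" for n x
          unfolding u_def v_def by (rule product_term_nonneg[OF that])
        show "\<exists>L. \<forall>a b. a + L \<le> b \<longrightarrow> L2n (\<lambda>x. avg [a..<b] (\<lambda>n. cis (2 * pi * (of_int h / \<theta>) * real n) * v n x)) \<le> e"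
          if "of_int h / \<theta> \<notin> \<int>" "e > 0" for h :: int and e
          unfolding v_def by (rule mprod_twisted_window[of \<theta> h F k e, OF spec that(1) F(1,3) that(2)])
      qed
      then show ?thesis by (elim exE) (rule window_filterI, simp)
    qed
  qed
  moreover have "L2_tendsto M (multiple_average M T k f) g sequentially"
  proof (rule L2_tendsto_AE[where u = "\<lambda>N x. avg [1..<Suc N] (\<lambda>n. v n x)"])
    have eq: "multiple_average M T k f = (\<lambda>N x. (\<Sum>n=1..N. product_term M T k f (int n) x) / of_nat N)" for f
      by (simp add: multiple_average_def product_term_nonneg mprod_def)
    show "multiple_average M T k f N \<in> borel_measurable M" for N
      unfolding eq by (intro borel_measurable_divide borel_measurable_sum product_term_measurable fm borel_measurable_const)
    show "AE x in M. multiple_average M T k f N x = avg [1..<Suc N] (\<lambda>n. v n x)" for N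
    proof -
      have "AE x in M. \<forall>n\<in>{1..N}. product_term M T k f (int n) x = product_term M T k F (int n) x"
        by (intro AE_finite_allI product_term_AE F) auto
      then show ?thesis
      proof (rule eventually_mono)
        fix x assume "\<forall>n\<in>{1..N}. product_term M T k f (int n) x = product_term M T k F (int n) x"
        then have "(\<Sum>n=1..N. product_term M T k f (int n) x) = (\<Sum>n=1..N. v n x)"
          by (simp add: product_term_nonneg v_def)
        then show "multiple_average M T k f N x = avg [1..<Suc N] (\<lambda>n. v n x)"
          unfolding eq avg_def by (simp add: interv_sum_list_conv_sum_set_nat atLeastLessThanSuc_atLeastAtMost del: upt_Suc)
      qed
    qed
    show "(\<lambda>x. avg [1..<Suc N] (\<lambda>n. v n x)) \<in> bmf" for N
      by (intro bmf_avg bmfI[OF v])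
    show "g \<in> bmf" by (rule gb)
    show "\<forall>\<^sub>F N in sequentially. L2n (\<lambda>x. avg [1..<Suc N] (\<lambda>n. v n x) - g x) \<le> \<epsilon>" if "\<epsilon> > 0" for \<epsilon>
    proof -
      obtain L where L: "\<And>a b. a + L \<le> b \<Longrightarrow> L2n (\<lambda>x. avg [a..<b] (\<lambda>n. v n x) - g x) \<le> \<epsilon>"
        using lim[OF \<open>\<epsilon> > 0\<close>] by blast
      show ?thesis unfolding eventually_sequentially by (intro exI[of _ L] allI impI L) simp
    qed
  qed
  ultimately show ?thesis unfolding beatty_limit_equation_def by blast
qed

end

section \<open>Countability of the discrete spectrum\<close>

context measure_preserving_system
begin

lemma L2_prod_integrable:
  assumes "f \<in> L2_space M" "g \<in> L2_space M"
  shows "integrable M (\<lambda>x. f x * cnj (g x))"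
proof (rule Bochner_Integration.integrable_bound)
  show "integrable M (\<lambda>x. (cmod (f x))\<^sup>2 + (cmod (g x))\<^sup>2)"
    using assms by (simp add: L2_space_def)
  show "(\<lambda>x. f x * cnj (g x)) \<in> borel_measurable M"
    using assms unfolding L2_space_def by (auto intro!: borel_measurable_times measurable_compose[OF _ borel_measurable_cnj])
  show "AE x in M. cmod (f x * cnj (g x)) \<le> norm ((cmod (f x))\<^sup>2 + (cmod (g x))\<^sup>2)"
  proof (rule AE_I2)
    fix x
    show "cmod (f x * cnj (g x)) \<le> norm ((cmod (f x))\<^sup>2 + (cmod (g x))\<^sup>2)"
    proof -
      have "0 \<le> cmod (f x) * cmod (g x)" by simp
      then have "cmod (f x) * cmod (g x) \<le> (cmod (f x))\<^sup>2 + (cmod (g x))\<^sup>2"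
        using sum_squares_bound[of "cmod (f x)" "cmod (g x)"] by linarith
      then show ?thesis by (simp add: norm_mult)
    qed
  qed
qed

lemma cmod_diff_power2: "(cmod (a - b))\<^sup>2 = (cmod a)\<^sup>2 + (cmod b)\<^sup>2 - 2 * Re (a * cnj b)"
  by (simp add: cmod_power2 power2_diff)

lemma L2_diff:
  assumes "f \<in> L2_space M" "g \<in> L2_space M"
  shows "(\<lambda>x. f x - g x) \<in> L2_space M"
proof -
  have "integrable M (\<lambda>x. (cmod (f x - g x))\<^sup>2)"
    unfolding cmod_diff_power2 using assms L2_prod_integrable[OF assms]
    by (intro Bochner_Integration.integrable_diff Bochner_Integration.integrable_add integrable_mult_right integrable_Re)
      (auto simp: L2_space_def)
  then show ?thesis using assms by (auto simp: L2_space_def)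
qed

text \<open>Invariance of the measure multiplies the inner product by
  \<open>cis (2 * pi * (s - t))\<close>, which is not \<open>1\<close> for distinct points of
  \<open>[0,1)\<close>.\<close>

lemma eigenfunctions_orthogonal:
  assumes f: "f \<in> L2_space M" "AE x in M. f (T x) = cis (2 * pi * s) * f x"
    and g: "g \<in> L2_space M" "AE x in M. g (T x) = cis (2 * pi * t) * g x"
    and st: "s \<in> {0..<1}" "t \<in> {0..<1}" "s \<noteq> t"
  shows "(\<integral>x. f x * cnj (g x) \<partial>M) = 0"
proof -
  have meas: "(\<lambda>x. f x * cnj (g x)) \<in> borel_measurable M"
    using L2_prod_integrable[OF f(1) g(1)] by auto
  let ?I = "\<integral>x. f x * cnj (g x) \<partial>M"
  have "?I = (\<integral>x. f (T x) * cnj (g (T x)) \<partial>M)" using integral_T[OF meas] by simp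
  also have "\<dots> = (\<integral>x. cis (2 * pi * (s - t)) * (f x * cnj (g x)) \<partial>M)"
  proof (rule integral_cong_AE)
    show "(\<lambda>x. f (T x) * cnj (g (T x))) \<in> borel_measurable M"
      using measurable_compose[OF measurable_T meas] .
    show "(\<lambda>x. cis (2 * pi * (s - t)) * (f x * cnj (g x))) \<in> borel_measurable M"
      by (intro borel_measurable_times meas borel_measurable_const)
    have c: "cis (2 * pi * (s - t)) = cis (2 * pi * s) * cnj (cis (2 * pi * t))"
      by (simp add: cis_cnj cis_mult right_diff_distrib)
    show "AE x in M. f (T x) * cnj (g (T x)) = cis (2 * pi * (s - t)) * (f x * cnj (g x))"
      using f(2) g(2) by eventually_elim (simp add: c)
  qed
  also have "\<dots> = cis (2 * pi * (s - t)) * ?I" by simp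
  finally have "(1 - cis (2 * pi * (s - t))) * ?I = 0" by (simp add: algebra_simps)
  moreover have "cis (2 * pi * (s - t)) \<noteq> 1"
  proof
    assume "cis (2 * pi * (s - t)) = 1"
    then have "cos (2 * pi * (s - t)) = 1" by (simp add: complex_eq_iff)
    then obtain k :: int where "2 * pi * (s - t) = of_int k * 2 * pi" by (auto simp: cos_one_2pi_int)
    then have "s - t = of_int k" by simp
    moreover from this have "k = 0" using st by simp
    ultimately show False using st by simp
  qed
  ultimately show ?thesis by simp
qed

lemma L2_normalize:
  assumes "f \<in> L2_space M" "\<not> (AE x in M. f x = 0)"
  shows "\<exists>c. c \<noteq> 0 \<and> (\<lambda>x. c * f x) \<in> L2_space M \<and> (\<integral>x. (cmod (c * f x))\<^sup>2 \<partial>M) = 1"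
proof -
  let ?I = "\<integral>x. (cmod (f x))\<^sup>2 \<partial>M"
  have int: "integrable M (\<lambda>x. (cmod (f x))\<^sup>2)" using assms(1) by (simp add: L2_space_def)
  have "?I \<noteq> 0" using integral_nonneg_eq_0_iff_AE[OF int] assms(2) by simp
  moreover have "?I \<ge> 0" by simp
  ultimately have I: "?I > 0" by linarith
  let ?c = "of_real (1 / sqrt ?I) :: complex"
  have "(cmod (?c * f x))\<^sup>2 = (1 / ?I) * (cmod (f x))\<^sup>2" for x
    unfolding norm_mult norm_of_real power_mult_distrib using I by (simp add: power_divide)
  then have "(\<lambda>x. ?c * f x) \<in> L2_space M" "(\<integral>x. (cmod (?c * f x))\<^sup>2 \<partial>M) = 1"
    using assms(1) I int by (auto simp: L2_space_def intro!: borel_measurable_times)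
  moreover have "?c \<noteq> 0" using I by simp
  ultimately show ?thesis by blast
qed

text \<open>Normalised eigenfunctions for distinct eigenvalues are at distance
  \<open>sqrt 2\<close>, so no point of the dense set is within \<open>1 / 2\<close> of two of them;
  choosing a near point is injective.\<close>

lemma countable_discrete_spectrum:
  assumes "L2_separable M"
  shows "countable (discrete_spectrum M T)"
proof -
  obtain D where D: "countable D" "D \<subseteq> L2_space M" "\<And>f \<epsilon>. f \<in> L2_space M \<Longrightarrow> \<epsilon> > 0 \<Longrightarrow> \<exists>d\<in>D. L2_dist M f d < \<epsilon>"
    using assms unfolding L2_separable_def by metis
  define R where "R = (\<lambda>t f d. f \<in> L2_space M \<and> (\<integral>x. (cmod (f x))\<^sup>2 \<partial>M) = 1 \<and>
      (AE x in M. f (T x) = cis (2 * pi * t) * f x) \<and> d \<in> D \<and> L2_dist M f d < 1 / 2)"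
  have "\<exists>f d. R t f d" if t: "t \<in> discrete_spectrum M T" for t
  proof -
    obtain f where f: "f \<in> L2_space M" "\<not> (AE x in M. f x = 0)" "AE x in M. f (T x) = cis (2 * pi * t) * f x"
      using t unfolding discrete_spectrum_def by blast
    obtain c where c: "(\<lambda>x. c * f x) \<in> L2_space M" "(\<integral>x. (cmod (c * f x))\<^sup>2 \<partial>M) = 1"
      using L2_normalize[OF f(1,2)] by blast
    obtain d where d: "d \<in> D" "L2_dist M (\<lambda>x. c * f x) d < 1 / 2" using D(3)[OF c(1), of "1 / 2"] by auto
    have e: "AE x in M. c * f (T x) = cis (2 * pi * t) * (c * f x)" using f(3) by eventually_elim simp
    show ?thesis unfolding R_def
      by (rule exI[of _ "\<lambda>x. c * f x"], rule exI[of _ d]) (intro conjI c d e)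
  qed
  then obtain f d where "\<And>t. t \<in> discrete_spectrum M T \<Longrightarrow> R t (f t) (d t)" by metis
  note fd = this[unfolded R_def]
  have "inj_on d (discrete_spectrum M T)"
  proof (rule inj_onI, rule ccontr)
    fix s t assume s: "s \<in> discrete_spectrum M T" and t: "t \<in> discrete_spectrum M T" and "d s = d t" "s \<noteq> t"
    have st: "s \<in> {0..<1}" "t \<in> {0..<1}" using s t by (auto simp: discrete_spectrum_def circle_group_def)
    let ?f = "f s" and ?g = "f t" and ?d = "d s"
    have L2: "?f \<in> L2_space M" "?g \<in> L2_space M" "?d \<in> L2_space M" using fd[OF s] fd[OF t] D(2) by auto
    have int: "integrable M (\<lambda>x. (cmod (?f x))\<^sup>2)" "integrable M (\<lambda>x. (cmod (?g x))\<^sup>2)"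
      using L2 by (auto simp: L2_space_def)
    have int2: "integrable M (\<lambda>x. (cmod (h x - k x))\<^sup>2)" if "h \<in> L2_space M" "k \<in> L2_space M" for h k
      using L2_diff[OF that] by (simp add: L2_space_def)
    have close: "(\<integral>x. (cmod (f r x - ?d x))\<^sup>2 \<partial>M) < 1 / 4" if "r \<in> discrete_spectrum M T" "d r = ?d" for r
    proof -
      have "sqrt (\<integral>x. (cmod (f r x - ?d x))\<^sup>2 \<partial>M) < sqrt (1 / 4)"
        using fd[OF that(1)] that(2) by (simp add: L2_dist_def real_sqrt_divide)
      then show ?thesis by (simp only: real_sqrt_less_iff)
    qed
    have two: "(\<integral>x. (cmod (?f x - ?g x))\<^sup>2 \<partial>M) = 2"
    proof -
      have "(\<integral>x. ?f x * cnj (?g x) \<partial>M) = 0"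
        using fd[OF s] fd[OF t] st \<open>s \<noteq> t\<close> by (intro eigenfunctions_orthogonal[of _ s _ t]) auto
      then have "(\<integral>x. Re (?f x * cnj (?g x)) \<partial>M) = 0"
        using integral_Re[OF L2_prod_integrable[OF L2(1,2)]] by simp
      moreover have "integrable M (\<lambda>x. Re (?f x * cnj (?g x)))"
        by (intro integrable_Re L2_prod_integrable L2)
      moreover have "(\<integral>x. a x + b x - 2 * c x \<partial>M) = (\<integral>x. a x \<partial>M) + (\<integral>x. b x \<partial>M) - 2 * (\<integral>x. c x \<partial>M)"
        if "integrable M a" "integrable M b" "integrable M c" for a b c :: "'a \<Rightarrow> real"
        using that by simp
      ultimately show ?thesis
        unfolding cmod_diff_power2 using int fd[OF s] fd[OF t] by (simp del: times_complex.sel)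
    qed
    have "(\<integral>x. (cmod (?f x - ?g x))\<^sup>2 \<partial>M) \<le> (\<integral>x. 2 * (cmod (?f x - ?d x))\<^sup>2 + 2 * (cmod (?g x - ?d x))\<^sup>2 \<partial>M)"
    proof (rule integral_mono)
      fix x
      have "cmod (?f x - ?g x) \<le> cmod (?f x - ?d x) + cmod (?g x - ?d x)"
        using norm_triangle_ineq4[of "?f x - ?d x" "?g x - ?d x"] by simp
      then have "(cmod (?f x - ?g x))\<^sup>2 \<le> (cmod (?f x - ?d x) + cmod (?g x - ?d x))\<^sup>2" by (rule power_mono) simp
      also have "\<dots> \<le> 2 * (cmod (?f x - ?d x))\<^sup>2 + 2 * (cmod (?g x - ?d x))\<^sup>2"
        using sum_squares_bound[of "cmod (?f x - ?d x)" "cmod (?g x - ?d x)"] by (simp add: power2_sum)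
      finally show "(cmod (?f x - ?g x))\<^sup>2 \<le> 2 * (cmod (?f x - ?d x))\<^sup>2 + 2 * (cmod (?g x - ?d x))\<^sup>2" .
    qed (use int2 L2 in auto)
    also have "\<dots> = 2 * (\<integral>x. (cmod (?f x - ?d x))\<^sup>2 \<partial>M) + 2 * (\<integral>x. (cmod (?g x - ?d x))\<^sup>2 \<partial>M)"
      using int2 L2 by (subst Bochner_Integration.integral_add) auto
    also have "\<dots> < 2" using close[OF s] close[OF t] \<open>d s = d t\<close> by simp
    finally show False unfolding two by simp
  qed
  moreover have "d ` discrete_spectrum M T \<subseteq> D" using fd by blast
  ultimately show ?thesis using D(1) by (meson countable_image_inj_on countable_subset)
qed

lemma AE_spectrum_disjoint:
  assumes "L2_separable M"
  shows "AE \<theta> in lebesgue. \<theta> > 0 \<longrightarrow> discrete_spectrum M T \<inter> circle_span {1 / \<theta>} = {0}"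
proof -
  \<comment> \<open>The solutions of \<open>m / \<theta> = t + l\<close>, with \<open>l\<close> the
    integer part lost in the projection to the circle. Triples with \<open>t + l = 0\<close> only
    add the point \<open>0\<close>.\<close>
  define B where "B = (\<lambda>(t, m, l). real_of_int m / (t + real_of_int l)) ` (discrete_spectrum M T \<times> (UNIV :: (int \<times> int) set))"
  have "countable B"
    unfolding B_def by (intro countable_image countable_SIGMA countable_discrete_spectrum assms) auto
  then have "B \<in> null_sets lebesgue"
    by (intro null_sets_completionI countable_imp_null_set_lborel)
  then have "AE \<theta> in lebesgue. \<theta> \<notin> B" by (rule AE_not_in)
  then show ?thesis
  proof (rule eventually_mono, intro impI equalityI subsetI)
    fix \<theta> t :: real assume \<theta>: "\<theta> \<notin> B" "\<theta> > 0" and t: "t \<in> discrete_spectrum M T \<inter> circle_span {1 / \<theta>}"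
    obtain m where m: "t = frac (of_int m * (1 / \<theta>))" using t unfolding circle_span_singleton by blast
    define l where "l = \<lfloor>of_int m * (1 / \<theta>)\<rfloor>"
    have eq: "of_int m / \<theta> = t + of_int l" by (simp add: m l_def frac_def)
    show "t \<in> {0}"
    proof (rule ccontr)
      assume "t \<notin> {0}"
      then have "t \<notin> \<int>" using t unfolding m by (auto simp: frac_eq_0_iff frac_in_Ints_iff)
      then have "t + of_int l \<noteq> 0" by (metis add.inverse_inverse add_eq_0_iff Ints_minus Ints_of_int)
      then have "\<theta> = of_int m / (t + of_int l)" using eq \<theta> by (auto simp: field_simps)
      then have "\<theta> \<in> B" using t unfolding B_def by (intro image_eqI[of _ _ "(t, m, l)"]) auto
      then show False using \<theta> by simp
    qed
  next
    fix \<theta> t :: real assume "t \<in> {0}"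
    have "(\<lambda>_. 1) \<in> L2_space M" by (simp add: L2_space_def)
    then have "0 \<in> discrete_spectrum M T"
      unfolding discrete_spectrum_def by (auto simp: circle_group_def intro!: bexI[of _ "\<lambda>_. 1"])
    moreover have "0 \<in> circle_span {1 / \<theta>}"
      unfolding circle_span_singleton by (auto intro!: exI[of _ 0])
    ultimately show "t \<in> discrete_spectrum M T \<inter> circle_span {1 / \<theta>}" using \<open>t \<in> {0}\<close> by simp
  qed
qed

end

theorem theorem2p5:
  fixes M :: "'a measure" and T :: "'a \<Rightarrow> 'a"
  assumes "ergodic_system M T"
  shows "(\<forall>\<theta> \<gamma> :: real. \<theta> > 0 \<longrightarrow>
            discrete_spectrum M T \<inter> circle_span {1 / \<theta>} = {0} \<longrightarrow>
            (\<forall>(k :: nat) f. (\<forall>j\<in>{1..k}. f j \<in> Linf_space M) \<longrightarrow>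
               beatty_limit_equation M T \<theta> \<gamma> k f)) \<and>
         (L2_separable M \<longrightarrow>
            (AE \<theta> in lebesgue. \<theta> > 0 \<longrightarrow>
              (\<forall>(\<gamma> :: real) (k :: nat) f. (\<forall>j\<in>{1..k}. f j \<in> Linf_space M) \<longrightarrow>
                 beatty_limit_equation M T \<theta> \<gamma> k f)))"
proof -
  interpret ergodic_system M T by (rule assms)
  show ?thesis
  proof (intro conjI allI impI)
    assume "L2_separable M"
    from AE_spectrum_disjoint[OF this]
    show "AE \<theta> in lebesgue. \<theta> > 0 \<longrightarrow>
              (\<forall>(\<gamma> :: real) (k :: nat) f. (\<forall>j\<in>{1..k}. f j \<in> Linf_space M) \<longrightarrow>
                 beatty_limit_equation M T \<theta> \<gamma> k f)"
      by (rule eventually_mono) (blast intro: beatty_limit_equationI)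
  qed (rule beatty_limit_equationI, auto)
qed

end
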